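(* $\operatorname{HH}^{\bullet}(S_{\mathbf q}(V))$ is the graded vector subspace of $S_{\mathbf q}(V)\otimes\bigwedge_{\mathbf q^{-1}}(V^* )$ given by $$\operatorname{HH}^m(S_{\mathbf q}(V))\cong\bigoplus_{\substack{\beta\in\{0,1\}^N\\|\beta|=m}}\ \bigoplus_{\substack{\alpha\in\mathbb N^N\\\alpha-\beta\in C}}\operatorname{span}_{\Bbbk}\{x^\alpha\otimes(x^* )^{\wedge\beta}\}$$ for all $m\in\mathbb N$.
   Context: Let $\Bbbk$ be a field of characteristic $0$; all tensor products are over $\Bbbk$, algebras are associative and unital, and $\mathbb N=\{0,1,2,\dots\}$. Let $N$ be a positive integer and, for $1\le i,j\le N$, let $q_{i,j}\in\Bbbk$ be nonzero scalars with $q_{i,i}=1$ and $q_{j,i}=q_{i,j}^{-1}$; write $\mathbf q=(q_{i,j})$ and $\mathbf q^{-1}=(q_{i,j}^{-1})$. Let $V$ be a vector space with basis $x_1,\dots,x_N$ and dual basis $x_1^*,\dots,x_N^*$ of $V^*$. Put $A=S_{\mathbf q}(V)=\Bbbk\langle x_1,\dots,x_N\mid x_ix_j=q_{i,j}x_jx_i,\ 1\le i,j\le N\rangle$ and $\bigwedge_{\mathbf q^{-1}}(V^* )=T(V^* )/(x_i^*x_j^*+q_{i,j}^{-1}x_j^*x_i^*\mid 1\le i,j\le N)$. For $\alpha\in\mathbb N^N$, $x^\alpha=x_1^{\alpha_1}\cdots x_N^{\alpha_N}$. For $\beta\in\{0,1\}^N$, $|\beta|=\sum_i\beta_i$, and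 $(x^* )^{\wedge\beta}=x_{j_1}^*\wedge\cdots\wedge x_{j_m}^*$ where $m=|\beta|$ and $j_1<\dots<j_m$ are the indices with $\beta_{j_k}=1$; these with $|\beta|=m$ form a basis of $\bigwedge^m(V^* )$ and of the degree $m$ part of $\bigwedge_{\mathbf q^{-1}}(V^* )$, which are identified as vector spaces. Let $[i]\in\mathbb N^N$ be the $i$-th unit vector. Define $$C=\Big\{\gamma\in(\mathbb N\cup\{-1\})^N\ \Big|\ \text{for each }i\in\{1,\dots,N\},\ \prod_{s=1}^Nq_{i,s}^{\gamma_s}=1\ \text{or}\ \gamma_i=-1\Big\}.$$ Hochschild cohomology is $\operatorname{HH}^{\bullet}(A)=\operatorname{HH}^{\bullet}(A,A)=\operatorname{Ext}^{\bullet}_{A\otimes A^{\mathrm{op}}}(A,A)$. It is the cohomology of the complex with degree $m$ term $A\otimes\bigwedge^m(V^* )$ (obtained from a twisted Koszul resolution of $A$) and differential, for $a\in A$ and $|\beta|=m-1$, $$d_m^*(a\otimes(x^* )^{\wedge\beta})=\sum_{i=1}^N\delta_{\beta_i,0}(-1)^{\sum_{s=1}^i\beta_s}\Big[\Big(\prod_{s=1}^iq_{s,i}^{\beta_s}\Big)x_ia-\Big(\prod_{s=i}^Nq_{i,s}^{\beta_s}\Big)ax_i\Big]\otimes(x^* )^{\wedge(\beta+[i])},$$ and the elements $x^\alpha\otimes(x^* )^{\wedge\beta}$ in the statement denote the classes of these cochains. *)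

theory Defs
  imports Complex_Main "HOL-Algebra.Module" "HOL-Algebra.QuotRing"
begin

section \<open>Modules, linear maps and quotients\<close>

text \<open>
  The record \<open>('r, 'm) module\<close> of HOL-Algebra serves both for left modules over a (possibly
  noncommutative) ring and for algebras over a field. For plain modules the fields \<open>mult\<close> and
  \<open>one\<close> carry no meaning. (The HOL-Algebra locale \<open>module\<close> only covers commutative rings.)
\<close>

definition scalars :: "'k::field ring" where
  "scalars = \<lparr>carrier = UNIV, monoid.mult = (*), one = 1, zero = 0, add = (+)\<rparr>"

definition left_module :: "('r, 'b) ring_scheme \<Rightarrow> ('r, 'm, 'c) module_scheme \<Rightarrow> bool" where
  "left_module R M \<longleftrightarrow> ring R \<and> abelian_group M \<and>
     (\<forall>r\<in>carrier R. \<forall>x\<in>carrier M. r \<odot>\<^bsub>M\<^esub> x \<in> carrier M) \<and>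
     (\<forall>r\<in>carrier R. \<forall>s\<in>carrier R. \<forall>x\<in>carrier M.
        (r \<oplus>\<^bsub>R\<^esub> s) \<odot>\<^bsub>M\<^esub> x = r \<odot>\<^bsub>M\<^esub> x \<oplus>\<^bsub>M\<^esub> s \<odot>\<^bsub>M\<^esub> x) \<and>
     (\<forall>r\<in>carrier R. \<forall>x\<in>carrier M. \<forall>y\<in>carrier M.
        r \<odot>\<^bsub>M\<^esub> (x \<oplus>\<^bsub>M\<^esub> y) = r \<odot>\<^bsub>M\<^esub> x \<oplus>\<^bsub>M\<^esub> r \<odot>\<^bsub>M\<^esub> y) \<and>
     (\<forall>r\<in>carrier R. \<forall>s\<in>carrier R. \<forall>x\<in>carrier M.
        (r \<otimes>\<^bsub>R\<^esub> s) \<odot>\<^bsub>M\<^esub> x = r \<odot>\<^bsub>M\<^esub> (s \<odot>\<^bsub>M\<^esub> x)) \<and>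
     (\<forall>x\<in>carrier M. \<one>\<^bsub>R\<^esub> \<odot>\<^bsub>M\<^esub> x = x)"

definition is_hom ::
  "('r, 'b) ring_scheme \<Rightarrow> ('r, 'm, 'c) module_scheme \<Rightarrow> ('r, 'n, 'd) module_scheme \<Rightarrow> ('m \<Rightarrow> 'n) \<Rightarrow> bool"
where
  "is_hom R M N f \<longleftrightarrow> f \<in> carrier M \<rightarrow> carrier N \<and>
     (\<forall>x\<in>carrier M. \<forall>y\<in>carrier M. f (x \<oplus>\<^bsub>M\<^esub> y) = f x \<oplus>\<^bsub>N\<^esub> f y) \<and>
     (\<forall>r\<in>carrier R. \<forall>x\<in>carrier M. f (r \<odot>\<^bsub>M\<^esub> x) = r \<odot>\<^bsub>N\<^esub> f x)"

definition lin_iso :: "('k::field, 'm) module \<Rightarrow> ('k, 'n) module \<Rightarrow> ('m \<Rightarrow> 'n) \<Rightarrow> bool" where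
  "lin_iso V W f \<longleftrightarrow> is_hom scalars V W f \<and> bij_betw f (carrier V) (carrier W)"

definition lin_span :: "('k::field, 'm) module \<Rightarrow> 'm set \<Rightarrow> 'm set" where
  "lin_span V S = \<Inter>{W. submodule W (scalars :: 'k ring) V \<and> S \<subseteq> W}"

definition lin_indep_family :: "('k::field, 'm) module \<Rightarrow> 'i set \<Rightarrow> ('i \<Rightarrow> 'm) \<Rightarrow> bool" where
  "lin_indep_family V J v \<longleftrightarrow> v \<in> J \<rightarrow> carrier V \<and>
     (\<forall>F c. finite F \<and> F \<subseteq> J \<and> (\<Oplus>\<^bsub>V\<^esub>j\<in>F. c j \<odot>\<^bsub>V\<^esub> v j) = \<zero>\<^bsub>V\<^esub> \<longrightarrow> (\<forall>j\<in>F. c j = 0))"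

text \<open>
  The quotient by a submodule, or by a two-sided ideal: \<^const>\<open>FactRing\<close> with the induced
  scalar multiplication.
\<close>

definition quotient :: "('k, 'm) module \<Rightarrow> 'm set \<Rightarrow> ('k, 'm set) module" where
  "quotient M W =
     \<lparr>carrier = carrier (M Quot W), monoid.mult = monoid.mult (M Quot W), one = one (M Quot W),
      zero = zero (M Quot W), add = add (M Quot W),
      smult = (\<lambda>c X. \<Union>x\<in>X. W +>\<^bsub>M\<^esub> (c \<odot>\<^bsub>M\<^esub> x))\<rparr>"


section \<open>Presented algebras and tensor products\<close>

definition single :: "'m \<Rightarrow> 'm \<Rightarrow> 'k::field" where
  "single x = (\<lambda>y. if y = x then 1 else 0)"

definition monoid_alg :: "('m, 'b) monoid_scheme \<Rightarrow> ('k::field, 'm \<Rightarrow> 'k) module" where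
  "monoid_alg M =
     \<lparr>carrier = {f. finite {x. f x \<noteq> 0} \<and> {x. f x \<noteq> 0} \<subseteq> carrier M},
      monoid.mult = (\<lambda>f g z. \<Sum>(x, y) \<in> {(x, y). f x \<noteq> 0 \<and> g y \<noteq> 0 \<and> x \<otimes>\<^bsub>M\<^esub> y = z}. f x * g y),
      one = single \<one>\<^bsub>M\<^esub>, zero = (\<lambda>_. 0), add = (\<lambda>f g x. f x + g x),
      smult = (\<lambda>c f x. c * f x)\<rparr>"

definition free_alg :: "nat \<Rightarrow> ('k::field, nat list \<Rightarrow> 'k) module" where
  "free_alg N = monoid_alg \<lparr>carrier = lists {1..N}, monoid.mult = (@), one = []\<rparr>"

definition presented_alg ::
  "nat \<Rightarrow> (nat list \<Rightarrow> 'k::field) set \<Rightarrow> ('k, (nat list \<Rightarrow> 'k) set) module" where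
  "presented_alg N S = quotient (free_alg N) (Idl\<^bsub>free_alg N\<^esub> S)"

definition presented_gen :: "nat \<Rightarrow> (nat list \<Rightarrow> 'k::field) set \<Rightarrow> nat \<Rightarrow> (nat list \<Rightarrow> 'k) set" where
  "presented_gen N S i =
     (let F = (free_alg N :: ('k, nat list \<Rightarrow> 'k) module) in (Idl\<^bsub>F\<^esub> S) +>\<^bsub>F\<^esub> single [i])"

definition ordered_monomial ::
  "('k, 'a) module \<Rightarrow> (nat \<Rightarrow> 'a) \<Rightarrow> nat \<Rightarrow> (nat \<Rightarrow> nat) \<Rightarrow> 'a" where
  "ordered_monomial R g N \<alpha> =
     foldr (\<lambda>i y. (g i [^]\<^bsub>R\<^esub> \<alpha> i) \<otimes>\<^bsub>R\<^esub> y) [1..<Suc N] \<one>\<^bsub>R\<^esub>"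

text \<open>
  \<open>A \<otimes> B\<close> is the vector space with basis \<open>A \<times> B\<close> modulo the subspace spanned by the
  bilinearity relators. This subspace is a two-sided ideal of the monoid algebra of the
  multiplicative monoid \<open>A \<times> B\<close>, so that the quotient carries the product
  \<open>(a \<otimes> b) (a' \<otimes> b') = a a' \<otimes> b b'\<close>.
\<close>

definition bilin_relators ::
  "('k::field, 'a) module \<Rightarrow> ('k, 'b) module \<Rightarrow> ('a \<times> 'b \<Rightarrow> 'k) set" where
  "bilin_relators A B =
     {\<lambda>p. single (a \<oplus>\<^bsub>A\<^esub> a', b) p - single (a, b) p - single (a', b) p | a a' b.
        a \<in> carrier A \<and> a' \<in> carrier A \<and> b \<in> carrier B} \<union>
     {\<lambda>p. single (a, b \<oplus>\<^bsub>B\<^esub> b') p - single (a, b) p - single (a, b') p | a b b'.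
        a \<in> carrier A \<and> b \<in> carrier B \<and> b' \<in> carrier B} \<union>
     {\<lambda>p. single (c \<odot>\<^bsub>A\<^esub> a, b) p - c * single (a, b) p | c a b.
        a \<in> carrier A \<and> b \<in> carrier B} \<union>
     {\<lambda>p. single (a, c \<odot>\<^bsub>B\<^esub> b) p - c * single (a, b) p | c a b.
        a \<in> carrier A \<and> b \<in> carrier B}"

definition tensor_rel ::
  "('k::field, 'a) module \<Rightarrow> ('k, 'b) module \<Rightarrow> ('a \<times> 'b \<Rightarrow> 'k) set" where
  "tensor_rel A B = lin_span (monoid_alg (A \<times>\<times> B)) (bilin_relators A B)"

definition tensor ::
  "('k::field, 'a) module \<Rightarrow> ('k, 'b) module \<Rightarrow> ('k, ('a \<times> 'b \<Rightarrow> 'k) set) module" where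
  "tensor A B = quotient (monoid_alg (A \<times>\<times> B)) (tensor_rel A B)"

definition pure_tensor ::
  "('k::field, 'a) module \<Rightarrow> ('k, 'b) module \<Rightarrow> 'a \<Rightarrow> 'b \<Rightarrow> ('a \<times> 'b \<Rightarrow> 'k) set" where
  "pure_tensor A B a b =
     tensor_rel A B +>\<^bsub>(monoid_alg (A \<times>\<times> B) :: ('k, 'a \<times> 'b \<Rightarrow> 'k) module)\<^esub> single (a, b)"

definition op_alg :: "('k::field, 'a) module \<Rightarrow> ('k, 'a) module" where
  "op_alg A = A\<lparr>monoid.mult := (\<lambda>x y. y \<otimes>\<^bsub>A\<^esub> x)\<rparr>"

definition env_alg :: "('k::field, 'a) module \<Rightarrow> ('k, ('a \<times> 'a \<Rightarrow> 'k) set) module" where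
  "env_alg A = tensor A (op_alg A)"

text \<open>
  \<open>A\<close> as a left module over \<open>A \<otimes> A\<^sup>o\<^sup>p\<close>, with \<open>(a \<otimes> b) \<cdot> x = a x b\<close>. The action is evaluated on
  representatives and does not depend on their choice, so \<^const>\<open>the_elem\<close> is applied to a singleton.
\<close>

definition regular_bimodule ::
  "('k::field, 'a) module \<Rightarrow> (('a \<times> 'a \<Rightarrow> 'k) set, 'a) module" where
  "regular_bimodule A =
     \<lparr>carrier = carrier A, monoid.mult = monoid.mult A, one = one A, zero = zero A, add = add A,
      smult = (\<lambda>z x. the_elem
        ((\<lambda>f. \<Oplus>\<^bsub>A\<^esub>p\<in>{p. f p \<noteq> 0}. f p \<odot>\<^bsub>A\<^esub> (fst p \<otimes>\<^bsub>A\<^esub> x \<otimes>\<^bsub>A\<^esub> snd p)) ` z))\<rparr>"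


section \<open>Cochain complexes, projective resolutions and Ext\<close>

definition cocycles :: "(nat \<Rightarrow> ('k, 'c) module) \<Rightarrow> (nat \<Rightarrow> 'c \<Rightarrow> 'c) \<Rightarrow> nat \<Rightarrow> 'c set" where
  "cocycles C d m = {x \<in> carrier (C m). d m x = \<zero>\<^bsub>C (Suc m)\<^esub>}"

definition coboundaries :: "(nat \<Rightarrow> ('k, 'c) module) \<Rightarrow> (nat \<Rightarrow> 'c \<Rightarrow> 'c) \<Rightarrow> nat \<Rightarrow> 'c set" where
  "coboundaries C d m = (case m of 0 \<Rightarrow> {\<zero>\<^bsub>C 0\<^esub>} | Suc n \<Rightarrow> d n ` carrier (C n))"

definition cohomology ::
  "(nat \<Rightarrow> ('k, 'c) module) \<Rightarrow> (nat \<Rightarrow> 'c \<Rightarrow> 'c) \<Rightarrow> nat \<Rightarrow> ('k, 'c set) module" where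
  "cohomology C d m = quotient ((C m)\<lparr>carrier := cocycles C d m\<rparr>) (coboundaries C d m)"

definition coh_class ::
  "(nat \<Rightarrow> ('k, 'c) module) \<Rightarrow> (nat \<Rightarrow> 'c \<Rightarrow> 'c) \<Rightarrow> nat \<Rightarrow> 'c \<Rightarrow> 'c set" where
  "coh_class C d m z = coboundaries C d m +>\<^bsub>C m\<^esub> z"

definition cochain_map ::
  "(nat \<Rightarrow> ('k::field, 'c) module) \<Rightarrow> (nat \<Rightarrow> 'c \<Rightarrow> 'c) \<Rightarrow>
   (nat \<Rightarrow> ('k, 'e) module) \<Rightarrow> (nat \<Rightarrow> 'e \<Rightarrow> 'e) \<Rightarrow> (nat \<Rightarrow> 'c \<Rightarrow> 'e) \<Rightarrow> bool" where
  "cochain_map C d D e \<Theta> \<longleftrightarrow>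
     (\<forall>m. is_hom scalars (C m) (D m) (\<Theta> m) \<and>
          (\<forall>x\<in>carrier (C m). \<Theta> (Suc m) (d m x) = e m (\<Theta> m x)))"

definition free_module :: "('r, 'b) ring_scheme \<Rightarrow> 'i set \<Rightarrow> ('r, 'i \<Rightarrow> 'r) module" where
  "free_module R I =
     \<lparr>carrier = {f. (\<forall>i\<in>I. f i \<in> carrier R) \<and> (\<forall>i. i \<notin> I \<longrightarrow> f i = \<zero>\<^bsub>R\<^esub>) \<and> finite {i. f i \<noteq> \<zero>\<^bsub>R\<^esub>}},
      monoid.mult = undefined, one = undefined, zero = (\<lambda>_. \<zero>\<^bsub>R\<^esub>),
      add = (\<lambda>f g i. f i \<oplus>\<^bsub>R\<^esub> g i), smult = (\<lambda>r f i. r \<otimes>\<^bsub>R\<^esub> f i)\<rparr>"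

text \<open>
  Projective modules as direct summands of free modules. Taking the index set of the free module
  inside the type of elements of \<open>P\<close> is no restriction, since the canonical surjection from the
  free module on \<open>carrier P\<close> onto a projective \<open>P\<close> splits.
\<close>

definition projective_module :: "('r, 'b) ring_scheme \<Rightarrow> ('r, 'p) module \<Rightarrow> bool" where
  "projective_module R P \<longleftrightarrow> left_module R P \<and>
     (\<exists>(I :: 'p set) s r. is_hom R P (free_module R I) s \<and> is_hom R (free_module R I) P r \<and>
        (\<forall>x\<in>carrier P. r (s x) = x))"

definition projective_resolution ::
  "('r, 'b) ring_scheme \<Rightarrow> ('r, 'm) module \<Rightarrow> (nat \<Rightarrow> ('r, 'p) module) \<Rightarrow> (nat \<Rightarrow> 'p \<Rightarrow> 'p) \<Rightarrow>
   ('p \<Rightarrow> 'm) \<Rightarrow> bool" where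
  "projective_resolution R M P d e \<longleftrightarrow>
     (\<forall>n. projective_module R (P n)) \<and>
     (\<forall>n. is_hom R (P (Suc n)) (P n) (d n)) \<and>
     is_hom R (P 0) M e \<and> e ` carrier (P 0) = carrier M \<and>
     d 0 ` carrier (P 1) = {x \<in> carrier (P 0). e x = \<zero>\<^bsub>M\<^esub>} \<and>
     (\<forall>n. d (Suc n) ` carrier (P (Suc (Suc n))) =
        {x \<in> carrier (P (Suc n)). d n x = \<zero>\<^bsub>P n\<^esub>})"

text \<open>
  For an algebra \<open>R\<close> over the field of scalars, \<open>Hom\<^sub>R(M, N)\<close> is a vector space; a scalar \<open>c\<close> acts
  through the element \<open>c 1\<close> of \<open>R\<close>.
\<close>

definition Hom_space ::
  "('k::field, 'r) module \<Rightarrow> ('r, 'm) module \<Rightarrow> ('r, 'n) module \<Rightarrow> ('k, 'm \<Rightarrow> 'n) module" where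
  "Hom_space R M N =
     \<lparr>carrier = {f \<in> extensional (carrier M). is_hom R M N f},
      monoid.mult = undefined, one = undefined, zero = (\<lambda>x\<in>carrier M. \<zero>\<^bsub>N\<^esub>),
      add = (\<lambda>f g. \<lambda>x\<in>carrier M. f x \<oplus>\<^bsub>N\<^esub> g x),
      smult = (\<lambda>c f. \<lambda>x\<in>carrier M. (c \<odot>\<^bsub>R\<^esub> \<one>\<^bsub>R\<^esub>) \<odot>\<^bsub>N\<^esub> f x)\<rparr>"

definition Hom_diff ::
  "(nat \<Rightarrow> ('r, 'p) module) \<Rightarrow> (nat \<Rightarrow> 'p \<Rightarrow> 'p) \<Rightarrow> nat \<Rightarrow> ('p \<Rightarrow> 'n) \<Rightarrow> ('p \<Rightarrow> 'n)" where
  "Hom_diff P d n f = (\<lambda>x\<in>carrier (P (Suc n)). f (d n x))"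

text \<open>
  \<open>Ext\<^sub>R\<^sup>m(M, N)\<close>, computed from a projective resolution \<open>(P, d)\<close> of \<open>M\<close>. It depends on the resolution
  up to canonical isomorphism only, so assertions about it are made for every projective resolution,
  with elements in an arbitrary type.
\<close>

definition Ext ::
  "('k::field, 'r) module \<Rightarrow> (nat \<Rightarrow> ('r, 'p) module) \<Rightarrow> (nat \<Rightarrow> 'p \<Rightarrow> 'p) \<Rightarrow> ('r, 'n) module \<Rightarrow>
   nat \<Rightarrow> ('k, ('p \<Rightarrow> 'n) set) module" where
  "Ext R P d N m = cohomology (\<lambda>n. Hom_space R (P n) N) (Hom_diff P d) m"

text \<open>
  Hochschild cohomology \<open>HH\<^sup>m(A) = Ext\<^sup>m(A, A)\<close> over \<open>A \<otimes> A\<^sup>o\<^sup>p\<close>, computed from a projective resolution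
  \<open>(P, d)\<close> of \<open>A\<close>.
\<close>

definition bimodule_resolution ::
  "('k::field, 'a) module \<Rightarrow> (nat \<Rightarrow> (('a \<times> 'a \<Rightarrow> 'k) set, 'p) module) \<Rightarrow> (nat \<Rightarrow> 'p \<Rightarrow> 'p) \<Rightarrow>
   ('p \<Rightarrow> 'a) \<Rightarrow> bool" where
  "bimodule_resolution A P d e \<longleftrightarrow>
     projective_resolution (env_alg A) (regular_bimodule A) P d e"

definition HH_complex ::
  "('k::field, 'a) module \<Rightarrow> (nat \<Rightarrow> (('a \<times> 'a \<Rightarrow> 'k) set, 'p) module) \<Rightarrow>
   nat \<Rightarrow> ('k, 'p \<Rightarrow> 'a) module" where
  "HH_complex A P n = Hom_space (env_alg A) (P n) (regular_bimodule A)"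

definition HH ::
  "('k::field, 'a) module \<Rightarrow> (nat \<Rightarrow> (('a \<times> 'a \<Rightarrow> 'k) set, 'p) module) \<Rightarrow> (nat \<Rightarrow> 'p \<Rightarrow> 'p) \<Rightarrow>
   nat \<Rightarrow> ('k, ('p \<Rightarrow> 'a) set) module" where
  "HH A P d m = Ext (env_alg A) P d (regular_bimodule A) m"


section \<open>Quantum symmetric and quantum exterior algebras\<close>

definition quantum_params :: "nat \<Rightarrow> (nat \<Rightarrow> nat \<Rightarrow> 'k::field) \<Rightarrow> bool" where
  "quantum_params N q \<longleftrightarrow>
     (\<forall>i\<in>{1..N}. q i i = 1 \<and> (\<forall>j\<in>{1..N}. q i j \<noteq> 0 \<and> q j i = inverse (q i j)))"

definition S_relators :: "nat \<Rightarrow> (nat \<Rightarrow> nat \<Rightarrow> 'k::field) \<Rightarrow> (nat list \<Rightarrow> 'k) set" where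
  "S_relators N q =
     {\<lambda>w. single [i, j] w - q i j * single [j, i] w | i j. i \<in> {1..N} \<and> j \<in> {1..N}}"

definition S_alg ::
  "nat \<Rightarrow> (nat \<Rightarrow> nat \<Rightarrow> 'k::field) \<Rightarrow> ('k, (nat list \<Rightarrow> 'k) set) module" where
  "S_alg N q = presented_alg N (S_relators N q)"

definition S_gen :: "nat \<Rightarrow> (nat \<Rightarrow> nat \<Rightarrow> 'k::field) \<Rightarrow> nat \<Rightarrow> (nat list \<Rightarrow> 'k) set" where
  "S_gen N q = presented_gen N (S_relators N q)"

definition S_monomial ::
  "nat \<Rightarrow> (nat \<Rightarrow> nat \<Rightarrow> 'k::field) \<Rightarrow> (nat \<Rightarrow> nat) \<Rightarrow> (nat list \<Rightarrow> 'k) set" where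
  "S_monomial N q \<alpha> = ordered_monomial (S_alg N q) (S_gen N q) N \<alpha>"

text \<open>
  The quantum exterior algebra on the dual basis for the parameters \<open>q\<^sup>-\<^sup>1\<close>; the letter \<open>i\<close> of the
  free algebra now stands for \<open>x\<^sub>i\<^sup>*\<close>.
\<close>

definition wedge_relators :: "nat \<Rightarrow> (nat \<Rightarrow> nat \<Rightarrow> 'k::field) \<Rightarrow> (nat list \<Rightarrow> 'k) set" where
  "wedge_relators N q =
     {\<lambda>w. single [i, j] w + inverse (q i j) * single [j, i] w | i j. i \<in> {1..N} \<and> j \<in> {1..N}}"

definition wedge_alg ::
  "nat \<Rightarrow> (nat \<Rightarrow> nat \<Rightarrow> 'k::field) \<Rightarrow> ('k, (nat list \<Rightarrow> 'k) set) module" where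
  "wedge_alg N q = presented_alg N (wedge_relators N q)"

definition wedge_gen :: "nat \<Rightarrow> (nat \<Rightarrow> nat \<Rightarrow> 'k::field) \<Rightarrow> nat \<Rightarrow> (nat list \<Rightarrow> 'k) set" where
  "wedge_gen N q = presented_gen N (wedge_relators N q)"

definition wedge_monomial ::
  "nat \<Rightarrow> (nat \<Rightarrow> nat \<Rightarrow> 'k::field) \<Rightarrow> (nat \<Rightarrow> nat) \<Rightarrow> (nat list \<Rightarrow> 'k) set" where
  "wedge_monomial N q \<beta> = ordered_monomial (wedge_alg N q) (wedge_gen N q) N \<beta>"

text \<open>Exponent vectors are functions on \<^typ>\<open>nat\<close> that vanish outside \<open>{1..N}\<close>.\<close>

definition exponents :: "nat \<Rightarrow> (nat \<Rightarrow> nat) set" where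
  "exponents N = {\<alpha>. \<forall>i. i \<notin> {1..N} \<longrightarrow> \<alpha> i = 0}"

definition binary_exponents :: "nat \<Rightarrow> nat \<Rightarrow> (nat \<Rightarrow> nat) set" where
  "binary_exponents N m =
     {\<beta> \<in> exponents N. (\<forall>i. \<beta> i \<in> {0, 1}) \<and> (\<Sum>i\<in>{1..N}. \<beta> i) = m}"

definition C_set :: "nat \<Rightarrow> (nat \<Rightarrow> nat \<Rightarrow> 'k::field) \<Rightarrow> (nat \<Rightarrow> int) set" where
  "C_set N q =
     {\<gamma>. (\<forall>i. i \<notin> {1..N} \<longrightarrow> \<gamma> i = 0) \<and> (\<forall>i\<in>{1..N}. \<gamma> i \<ge> -1) \<and>
          (\<forall>i\<in>{1..N}. (\<Prod>s\<in>{1..N}. q i s powi \<gamma> s) = 1 \<or> \<gamma> i = -1)}"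


section \<open>The Koszul cochain complex\<close>

type_synonym 'k SW = "((nat list \<Rightarrow> 'k) set \<times> (nat list \<Rightarrow> 'k) set \<Rightarrow> 'k) set"

definition S_wedge :: "nat \<Rightarrow> (nat \<Rightarrow> nat \<Rightarrow> 'k::field) \<Rightarrow> ('k, 'k SW) module" where
  "S_wedge N q = tensor (S_alg N q) (wedge_alg N q)"

definition sw :: "nat \<Rightarrow> (nat \<Rightarrow> nat \<Rightarrow> 'k::field) \<Rightarrow> (nat list \<Rightarrow> 'k) set \<Rightarrow> (nat \<Rightarrow> nat) \<Rightarrow> 'k SW" where
  "sw N q a \<beta> = pure_tensor (S_alg N q) (wedge_alg N q) a (wedge_monomial N q \<beta>)"

definition koszul :: "nat \<Rightarrow> (nat \<Rightarrow> nat \<Rightarrow> 'k::field) \<Rightarrow> nat \<Rightarrow> ('k, 'k SW) module" where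
  "koszul N q m = (S_wedge N q)\<lparr>carrier := lin_span (S_wedge N q)
     {sw N q a \<beta> | a \<beta>. a \<in> carrier (S_alg N q) \<and> \<beta> \<in> binary_exponents N m}\<rparr>"

definition koszul_diff_on_tensor ::
  "nat \<Rightarrow> (nat \<Rightarrow> nat \<Rightarrow> 'k::field) \<Rightarrow> (nat list \<Rightarrow> 'k) set \<Rightarrow> (nat \<Rightarrow> nat) \<Rightarrow> 'k SW" where
  "koszul_diff_on_tensor N q a \<beta> =
     (let A = S_alg N q; T = S_wedge N q; x = S_gen N q in
      \<Oplus>\<^bsub>T\<^esub>i\<in>{i \<in> {1..N}. \<beta> i = 0}.
        ((-1) ^ (\<Sum>s\<in>{1..i}. \<beta> s)) \<odot>\<^bsub>T\<^esub>
        sw N q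
          (((\<Prod>s\<in>{1..i}. q s i ^ \<beta> s) \<odot>\<^bsub>A\<^esub> (x i \<otimes>\<^bsub>A\<^esub> a)) \<ominus>\<^bsub>A\<^esub>
           ((\<Prod>s\<in>{i..N}. q i s ^ \<beta> s) \<odot>\<^bsub>A\<^esub> (a \<otimes>\<^bsub>A\<^esub> x i)))
          (\<beta>(i := \<beta> i + 1)))"

text \<open>
  The unique linear map with the prescribed values on the tensors \<open>a \<otimes> (x\<^sup>*)\<^sup>\<beta>\<close>; it exists and is
  unique because the \<open>(x\<^sup>*)\<^sup>\<beta>\<close> form a basis of the quantum exterior algebra. One map covers all degrees.
\<close>

definition koszul_diff :: "nat \<Rightarrow> (nat \<Rightarrow> nat \<Rightarrow> 'k::field) \<Rightarrow> 'k SW \<Rightarrow> 'k SW" where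
  "koszul_diff N q = (THE d. d \<in> extensional (carrier (S_wedge N q)) \<and>
     is_hom scalars (S_wedge N q) (S_wedge N q) d \<and>
     (\<forall>a\<in>carrier (S_alg N q). \<forall>m. \<forall>\<beta>\<in>binary_exponents N m.
        d (sw N q a \<beta>) = koszul_diff_on_tensor N q a \<beta>))"

definition HH_index :: "nat \<Rightarrow> (nat \<Rightarrow> nat \<Rightarrow> 'k::field) \<Rightarrow> nat \<Rightarrow> ((nat \<Rightarrow> nat) \<times> (nat \<Rightarrow> nat)) set" where
  "HH_index N q m = {(\<alpha>, \<beta>). \<alpha> \<in> exponents N \<and> \<beta> \<in> binary_exponents N m \<and>
     (\<lambda>i. int (\<alpha> i) - int (\<beta> i)) \<in> C_set N q}"

definition HH_monomial ::
  "nat \<Rightarrow> (nat \<Rightarrow> nat \<Rightarrow> 'k::field) \<Rightarrow> (nat \<Rightarrow> nat) \<times> (nat \<Rightarrow> nat) \<Rightarrow> 'k SW" where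
  "HH_monomial N q = (\<lambda>(\<alpha>, \<beta>). sw N q (S_monomial N q \<alpha>) \<beta>)"

text \<open>
  The sum of the lines spanned by the \<open>x\<^sup>\<alpha> \<otimes> (x\<^sup>*)\<^sup>\<beta>\<close>, as a subspace of the tensor product. That the sum is
  direct is the linear independence of the family \<^term>\<open>HH_monomial N q\<close> on \<^term>\<open>HH_index N q m\<close>.
\<close>

definition HH_span :: "nat \<Rightarrow> (nat \<Rightarrow> nat \<Rightarrow> 'k::field) \<Rightarrow> nat \<Rightarrow> ('k, 'k SW) module" where
  "HH_span N q m = (S_wedge N q)\<lparr>carrier :=
     lin_span (S_wedge N q) (HH_monomial N q ` HH_index N q m)\<rparr>"

end

(* The proof runs in coordinates. Ordered monomials form bases of S_q(V) and of the quantum exterior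
   algebra, and x^alpha x^gamma = chi(alpha, gamma) x^(alpha + gamma) for a bicharacter chi.

   Cohomology of the Koszul cochains: the coefficient with which d raises the i-th entries of alpha and
   beta depends on alpha - beta only, and it vanishes exactly when prod_s q_(i,s)^(alpha_s - beta_s) = 1.
   So d vanishes on the part with alpha - beta in C, while outside of C dividing by the coefficient in
   the first direction where it does not vanish gives a contracting homotopy.

   Relation to HH: the twisted Koszul bimodule complex K becomes the untwisted one after rescaling its
   basis by chi(alpha, beta) chi(alpha, gamma) chi(beta, gamma), and contracting one variable after the
   other shows that it resolves S_q(V). The comparison map P -> K of resolutions is a homotopy
   equivalence, and Hom(K, S_q(V)) is the complex of Koszul cochains. *)

theory Submission
  imports Defs "HOL-Library.Multiset"
begin

text \<open>The differential preserves \<alpha> - \<beta>, so the cochains split over the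
  differences \<gamma>. For fixed \<gamma> the basis elements are the vertices of a cube: a
  direction i with \<gamma>_i \<ge> 0 may be chosen or not, while \<gamma>_i = -1 forces \<alpha>_i
  = 0 and \<beta>_i = 1, so that no edge runs in direction i; this is the origin of the second
  alternative in C. Up to sign all edges of one direction carry the same scalar, so a single nonzero
  one makes the cube contractible. The obstacle is that algebras and tensor products are given as
  quotients, where independence of monomials is invisible; sorting words shows only that they span.
  Independence comes from a scalar defined on all words, multiplicative up to the bicharacter, so
  that the kernel of the resulting linear map is an ideal containing the relations. Comparison with
  an arbitrary projective resolution takes chain maps both ways and a homotopy for each composite,
  one for injectivity on cohomology and one for surjectivity.\<close>

lemma scalars_simps [simp]:
  "carrier scalars = UNIV" "\<one>\<^bsub>scalars\<^esub> = 1" "\<zero>\<^bsub>scalars\<^esub> = 0"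
  "x \<otimes>\<^bsub>scalars\<^esub> y = x * y" "x \<oplus>\<^bsub>scalars\<^esub> y = x + y"
  by (simp_all add: scalars_def)

section \<open>Finitely supported functions\<close>

definition finsupp :: "'i set \<Rightarrow> ('i \<Rightarrow> 'k::field) set" where
  "finsupp I = {f. finite {i. f i \<noteq> 0} \<and> {i. f i \<noteq> 0} \<subseteq> I}"

lemma finsuppI: "finite F \<Longrightarrow> {i. f i \<noteq> 0} \<subseteq> F \<Longrightarrow> {i. f i \<noteq> 0} \<subseteq> I \<Longrightarrow> f \<in> finsupp I"
  by (auto simp: finsupp_def intro: finite_subset)

lemma finsuppD: "f \<in> finsupp I \<Longrightarrow> finite {i. f i \<noteq> 0}" "f \<in> finsupp I \<Longrightarrow> f i \<noteq> 0 \<Longrightarrow> i \<in> I"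
  "f \<in> finsupp I \<Longrightarrow> i \<notin> I \<Longrightarrow> f i = 0"
  by (auto simp: finsupp_def)

lemma finsupp_zero [simp]: "(\<lambda>_. 0) \<in> finsupp I"
  by (simp add: finsupp_def)

lemma finsupp_add: "f \<in> finsupp I \<Longrightarrow> g \<in> finsupp I \<Longrightarrow> (\<lambda>i. f i + g i) \<in> finsupp I"
  by (rule finsuppI[of "{i. f i \<noteq> 0} \<union> {i. g i \<noteq> 0}"])
    (force simp: finsupp_def)+

lemma finsupp_smult: "f \<in> finsupp I \<Longrightarrow> (\<lambda>i. c * f i) \<in> finsupp I"
  by (rule finsuppI[of "{i. f i \<noteq> 0}"]) (auto simp: finsupp_def)

lemma finsupp_diff: "f \<in> finsupp I \<Longrightarrow> g \<in> finsupp I \<Longrightarrow> (\<lambda>i. f i - g i) \<in> finsupp I"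
  using finsupp_add[OF _ finsupp_smult, of f I g "-1"] by simp

lemma finsupp_single [simp]: "single i \<in> finsupp I \<longleftrightarrow> i \<in> I"
  by (auto simp: finsupp_def single_def)

lemma finsupp_mono: "f \<in> finsupp J \<Longrightarrow> J \<subseteq> I \<Longrightarrow> f \<in> finsupp I"
  by (auto simp: finsupp_def)

lemma finsupp_induct [consumes 1, case_names zero add]:
  assumes "f \<in> finsupp I" and "P (\<lambda>_. 0)"
    and "\<And>f c i. f \<in> finsupp I \<Longrightarrow> P f \<Longrightarrow> i \<in> I \<Longrightarrow> P (\<lambda>j. f j + c * single i j)"
  shows "P f"
proof -
  have "finite F \<Longrightarrow> F \<subseteq> I \<Longrightarrow> {i. f i \<noteq> 0} \<subseteq> F \<Longrightarrow> P f" for F f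
  proof (induction F arbitrary: f rule: finite_induct)
    case empty
    then have "f = (\<lambda>_. 0)" by auto
    then show ?case using assms(2) by simp
  next
    case (insert i F)
    let ?g = "\<lambda>j. if j = i then 0 else f j"
    have "P ?g" using insert by (intro insert.IH) auto
    moreover have "?g \<in> finsupp I"
      using insert by (intro finsuppI[of F]) auto
    ultimately have "P (\<lambda>j. ?g j + f i * single i j)"
      using insert.prems(1) by (intro assms(3)) auto
    moreover have "(\<lambda>j. ?g j + f i * single i j) = f"
      by (auto simp: single_def)
    ultimately show ?case by simp
  qed
  from this[of "{i. f i \<noteq> 0}" f] assms(1) show ?thesis by (auto simp: finsupp_def)
qed


section \<open>Vector spaces with coordinates\<close>

locale vsp = abelian_group V for V :: "('k::field, 'v) module" (structure) +
  assumes smult_closed [simp]: "x \<in> carrier V \<Longrightarrow> c \<odot> x \<in> carrier V"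
    and smult_add_left: "x \<in> carrier V \<Longrightarrow> (c + d) \<odot> x = c \<odot> x \<oplus> d \<odot> x"
    and smult_add_right: "x \<in> carrier V \<Longrightarrow> y \<in> carrier V \<Longrightarrow> c \<odot> (x \<oplus> y) = c \<odot> x \<oplus> c \<odot> y"
    and smult_smult: "x \<in> carrier V \<Longrightarrow> (c * d) \<odot> x = c \<odot> (d \<odot> x)"
    and smult_one [simp]: "x \<in> carrier V \<Longrightarrow> 1 \<odot> x = x"
begin

lemma smult_zero_left [simp]: "x \<in> carrier V \<Longrightarrow> 0 \<odot> x = \<zero>"
  using smult_add_left[of x 0 0] by (simp add: add.l_cancel_one')

lemma smult_zero_right [simp]: "c \<odot> \<zero> = \<zero>"
  using smult_add_right[of \<zero> \<zero> c] by (simp add: add.l_cancel_one')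

lemma minus_add_cancel: "x \<in> carrier V \<Longrightarrow> y \<in> carrier V \<Longrightarrow> (x \<ominus> y) \<oplus> y = x"
  by (simp add: minus_eq a_assoc l_neg)

lemma minus_chain:
  "x \<in> carrier V \<Longrightarrow> y \<in> carrier V \<Longrightarrow> z \<in> carrier V \<Longrightarrow> (x \<ominus> y) \<oplus> (y \<ominus> z) = x \<ominus> z"
  by (simp add: minus_eq a_assoc r_neg1)

lemma smult_minus_one: "x \<in> carrier V \<Longrightarrow> (-1) \<odot> x = \<ominus> x"
  using smult_add_left[of x "-1" 1] by (intro minus_equality[symmetric]) auto

text \<open>The negative of x is its multiple by -1, so the closure under negation that
  \<open>submodule\<close> demands follows from closure under scalars.\<close>

lemma submodule_iff:
  "submodule W (scalars :: 'k ring) V \<longleftrightarrow> W \<subseteq> carrier V \<and> \<zero> \<in> W \<and>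
     (\<forall>x\<in>W. \<forall>y\<in>W. x \<oplus> y \<in> W) \<and> (\<forall>c. \<forall>x\<in>W. c \<odot> x \<in> W)" (is "_ \<longleftrightarrow> ?R")
proof
  assume "submodule W (scalars :: 'k ring) V"
  then interpret submodule W "scalars :: 'k ring" V .
  show ?R using subset one_closed m_closed smult_closed by auto
next
  assume R: ?R
  have inv: "\<ominus> x \<in> W" if "x \<in> W" for x
    using R that smult_minus_one[of x] by (metis subsetD)
  have "subgroup W (add_monoid V)"
  proof (rule subgroup.intro)
    show "inv\<^bsub>add_monoid V\<^esub> x \<in> W" if "x \<in> W" for x
      using inv[OF that] by (simp add: a_inv_def)
  qed (use R in auto)
  then show "submodule W (scalars :: 'k ring) V"
    using R by (intro submodule.intro) (auto simp: submodule_axioms_def)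
qed

lemmas submoduleI = submodule_iff[THEN iffD2]

lemma
  assumes "submodule W (scalars :: 'k ring) V"
  shows submodule_subset: "W \<subseteq> carrier V"
    and submodule_zero: "\<zero> \<in> W"
    and submodule_add: "x \<in> W \<Longrightarrow> y \<in> W \<Longrightarrow> x \<oplus> y \<in> W"
    and submodule_smult: "x \<in> W \<Longrightarrow> c \<odot> x \<in> W"
    and submodule_uminus: "x \<in> W \<Longrightarrow> \<ominus> x \<in> W"
    and submodule_minus: "x \<in> W \<Longrightarrow> y \<in> W \<Longrightarrow> x \<ominus> y \<in> W"
  using assms smult_minus_one[symmetric] unfolding submodule_iff minus_eq by (auto simp: subset_iff)

lemma submodule_carrier: "submodule (carrier V) (scalars :: 'k ring) V"
  by (rule submoduleI) auto

lemma lin_span_submodule: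
  assumes "S \<subseteq> carrier V"
  shows "submodule (lin_span V S) (scalars :: 'k ring) V"
proof -
  have "lin_span V S \<subseteq> carrier V"
    using assms submodule_carrier unfolding lin_span_def by blast
  then show ?thesis
    unfolding lin_span_def submodule_iff by (intro conjI) (assumption, auto)
qed

lemma lin_span_superset: "S \<subseteq> lin_span V S"
  unfolding lin_span_def by blast

lemma lin_span_least: "submodule W (scalars :: 'k ring) V \<Longrightarrow> S \<subseteq> W \<Longrightarrow> lin_span V S \<subseteq> W"
  unfolding lin_span_def by blast

lemma restrict_vsp:
  assumes "submodule Z (scalars :: 'k ring) V"
  shows "vsp (V\<lparr>carrier := Z\<rparr>)"
proof -
  note Z = submodule_subset[OF assms, THEN subsetD] submodule_zero[OF assms] submodule_add[OF assms]
    submodule_smult[OF assms] submodule_uminus[OF assms]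
  have "abelian_group (V\<lparr>carrier := Z\<rparr>)"
  proof (rule abelian_groupI)
    show "\<exists>y\<in>carrier (V\<lparr>carrier := Z\<rparr>). y \<oplus>\<^bsub>V\<lparr>carrier := Z\<rparr>\<^esub> x = \<zero>\<^bsub>V\<lparr>carrier := Z\<rparr>\<^esub>"
      if "x \<in> carrier (V\<lparr>carrier := Z\<rparr>)" for x
      using that Z(5)[of x] l_neg[of x] Z(1) by auto
  qed (use Z in \<open>auto simp: a_ac\<close>)
  then show ?thesis
    using Z by (auto simp: vsp_def vsp_axioms_def smult_add_left smult_add_right smult_smult)
qed

lemma submodule_restrict:
  assumes "submodule Z (scalars :: 'k ring) V" "submodule W (scalars :: 'k ring) V" "W \<subseteq> Z"
  shows "submodule W (scalars :: 'k ring) (V\<lparr>carrier := Z\<rparr>)"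
proof -
  interpret Z: vsp "V\<lparr>carrier := Z\<rparr>" by (rule restrict_vsp) fact
  show ?thesis using assms unfolding submodule_iff Z.submodule_iff by simp
qed

end

section \<open>Cosets and quotient spaces\<close>

lemma a_r_coset_iff: "y \<in> W +>\<^bsub>G\<^esub> x \<longleftrightarrow> (\<exists>w\<in>W. y = w \<oplus>\<^bsub>G\<^esub> x)"
  by (auto simp: a_r_coset_def')

context vsp
begin

context
  fixes W
  assumes W: "submodule W (scalars :: 'k ring) V"
begin

lemma coset_mem_iff: "x \<in> carrier V \<Longrightarrow> y \<in> W +> x \<longleftrightarrow> y \<in> carrier V \<and> y \<ominus> x \<in> W"
proof
  assume x: "x \<in> carrier V" and "y \<in> W +> x"
  then obtain w where w: "w \<in> W" "y = w \<oplus> x" by (auto simp: a_r_coset_iff)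
  have wc: "w \<in> carrier V" using submodule_subset[OF W] w by auto
  have "y \<ominus> x = w" using wc x w(2) by (simp add: minus_eq a_assoc r_neg)
  then show "y \<in> carrier V \<and> y \<ominus> x \<in> W" using wc x w by simp
next
  assume x: "x \<in> carrier V" and y: "y \<in> carrier V \<and> y \<ominus> x \<in> W"
  have "y = (y \<ominus> x) \<oplus> x" using x y by (simp add: minus_eq a_assoc l_neg)
  then show "y \<in> W +> x" using y by (auto simp: a_r_coset_iff)
qed

lemma coset_self: "x \<in> carrier V \<Longrightarrow> x \<in> W +> x"
  using submodule_zero[OF W] by (simp add: coset_mem_iff minus_eq r_neg)

lemma coset_eq_iff:
  assumes x: "x \<in> carrier V" and y: "y \<in> carrier V"
  shows "W +> x = W +> y \<longleftrightarrow> x \<ominus> y \<in> W"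
proof
  assume "W +> x = W +> y"
  then have "x \<in> W +> y" using coset_self x by auto
  then show "x \<ominus> y \<in> W" using y coset_mem_iff by blast
next
  assume d: "x \<ominus> y \<in> W"
  have "z \<ominus> x \<in> W \<longleftrightarrow> z \<ominus> y \<in> W" if z: "z \<in> carrier V" for z
  proof -
    have "(z \<ominus> x) \<oplus> (x \<ominus> y) = z \<ominus> y"
      using minus_chain[OF z x y] .
    moreover have "(z \<ominus> y) \<ominus> (x \<ominus> y) = z \<ominus> x"
    proof -
      have "\<ominus> (x \<ominus> y) = y \<ominus> x"
        using x y by (simp add: minus_eq minus_add a_ac)
      then show ?thesis
        using x y z minus_chain[of z y x] by (simp add: minus_eq[of "z \<ominus> y"])
    qed
    ultimately show ?thesis using submodule_add[OF W] submodule_minus[OF W] d by metis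
  qed
  then show "W +> x = W +> y"
    using x y by (auto simp: coset_mem_iff)
qed

lemma quotient_carrier: "carrier (quotient V W) = (\<lambda>x. W +> x) ` carrier V"
  by (auto simp: quotient_def FactRing_def A_RCOSETS_def')

lemma coset_add:
  assumes "x \<in> carrier V" "y \<in> carrier V"
  shows "(W +> x) \<oplus>\<^bsub>quotient V W\<^esub> (W +> y) = W +> (x \<oplus> y)"
proof -
  have "z \<in> (W +> x) <+> (W +> y) \<longleftrightarrow> z \<in> W +> (x \<oplus> y)" for z
  proof
    assume "z \<in> (W +> x) <+> (W +> y)"
    then obtain v w where vw: "v \<in> W" "w \<in> W" "z = (v \<oplus> x) \<oplus> (w \<oplus> y)"
      unfolding set_add_def' by (auto simp: a_r_coset_iff)
    then have "z = (v \<oplus> w) \<oplus> (x \<oplus> y)"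
      using submodule_subset[OF W] assms by (simp add: a_ac subset_iff)
    then show "z \<in> W +> (x \<oplus> y)"
      using vw submodule_add[OF W] by (auto simp: a_r_coset_iff)
  next
    assume "z \<in> W +> (x \<oplus> y)"
    then obtain w where w: "w \<in> W" "z = w \<oplus> (x \<oplus> y)" by (auto simp: a_r_coset_iff)
    then have "z = (w \<oplus> x) \<oplus> (\<zero> \<oplus> y)"
      using submodule_subset[OF W] assms by (simp add: a_ac subset_iff)
    moreover have "w \<oplus> x \<in> W +> x" "\<zero> \<oplus> y \<in> W +> y"
      using w submodule_zero[OF W] by (auto simp: a_r_coset_iff)
    ultimately show "z \<in> (W +> x) <+> (W +> y)"
      unfolding set_add_def' by blast
  qed
  then show ?thesis by (auto simp: quotient_def FactRing_def)
qed

text \<open>\<open>quotient\<close> defines the scalar multiple as a union over all representatives,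
  so that none has to be chosen. Any two of them differ by an element of W, hence the union runs
  over a nonempty family of equal cosets.\<close>

lemma coset_smult:
  assumes x: "x \<in> carrier V"
  shows "c \<odot>\<^bsub>quotient V W\<^esub> (W +> x) = W +> (c \<odot> x)"
proof -
  have "W +> (c \<odot> y) = W +> (c \<odot> x)" if y: "y \<in> W +> x" for y
  proof -
    have *: "y \<in> carrier V" "y \<ominus> x \<in> W" using y x coset_mem_iff by auto
    have "c \<odot> y \<ominus> c \<odot> x = c \<odot> (y \<ominus> x)"
      using * x smult_smult[of x "-1" c] smult_smult[of x c "-1"]
      by (simp add: minus_eq smult_add_right flip: smult_minus_one)
    then show ?thesis using * x submodule_smult[OF W] by (subst coset_eq_iff) auto
  qed
  moreover have "(\<Union>y\<in>W +> x. W +> (c \<odot> y)) = c \<odot>\<^bsub>quotient V W\<^esub> (W +> x)"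
    by (simp add: quotient_def)
  moreover have "W +> x \<noteq> {}" using coset_self[OF x] by blast
  ultimately show ?thesis by (simp add: SUP_eq_const)
qed

lemma quotient_zero: "\<zero>\<^bsub>quotient V W\<^esub> = W +> \<zero>"
proof -
  have "W = W +> \<zero>" using submodule_subset[OF W] by (auto simp: a_r_coset_iff subset_iff)
  then show ?thesis by (simp add: quotient_def FactRing_def)
qed

lemma quotient_vsp: "vsp (quotient V W)"
proof -
  have "abelian_group (quotient V W)"
  proof (rule abelian_groupI)
    show "\<exists>y\<in>carrier (quotient V W). y \<oplus>\<^bsub>quotient V W\<^esub> x = \<zero>\<^bsub>quotient V W\<^esub>"
      if "x \<in> carrier (quotient V W)" for x
    proof -
      from that obtain z where z: "z \<in> carrier V" "x = W +> z" by (auto simp: quotient_carrier)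
      then have "(W +> (\<ominus> z)) \<oplus>\<^bsub>quotient V W\<^esub> x = \<zero>\<^bsub>quotient V W\<^esub>"
        by (simp add: coset_add quotient_zero l_neg)
      then show ?thesis using z by (auto simp: quotient_carrier)
    qed
  qed (auto simp: quotient_carrier coset_add quotient_zero a_ac)
  then show ?thesis
    by (auto simp: vsp_def vsp_axioms_def quotient_carrier coset_smult coset_add smult_add_left
        smult_add_right smult_smult)
qed

end

end

section \<open>Linear isomorphisms onto subquotients\<close>

lemma is_hom_scalarsD:
  assumes "is_hom (scalars :: 'k::field ring) V W f"
  shows "x \<in> carrier V \<Longrightarrow> f x \<in> carrier W"
    and "x \<in> carrier V \<Longrightarrow> y \<in> carrier V \<Longrightarrow> f (x \<oplus>\<^bsub>V\<^esub> y) = f x \<oplus>\<^bsub>W\<^esub> f y"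
    and "x \<in> carrier V \<Longrightarrow> f (c \<odot>\<^bsub>V\<^esub> x) = c \<odot>\<^bsub>W\<^esub> f x"
  using assms by (auto simp: is_hom_def)

text \<open>Shaped to fit \<open>cohomology\<close>: Z and W stand for cocycles and coboundaries.
  Injectivity and surjectivity are asked for modulo W, so that the Koszul complex and the Hom
  complex of a resolution are treated by the same argument.\<close>

lemma lin_iso_quotient:
  fixes S :: "('k::field, 's) module" and V :: "('k, 'v) module"
  assumes S: "vsp S" and V: "vsp V"
    and Z: "submodule Z (scalars :: 'k ring) V" and W: "submodule W (scalars :: 'k ring) V" and "W \<subseteq> Z"
    and \<Theta>: "is_hom (scalars :: 'k ring) S V \<Theta>" "\<And>x. x \<in> carrier S \<Longrightarrow> \<Theta> x \<in> Z"
    and inj: "\<And>x. x \<in> carrier S \<Longrightarrow> \<Theta> x \<in> W \<Longrightarrow> x = \<zero>\<^bsub>S\<^esub>"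
    and surj: "\<And>z. z \<in> Z \<Longrightarrow> \<exists>x\<in>carrier S. z \<ominus>\<^bsub>V\<^esub> \<Theta> x \<in> W"
  shows "lin_iso S (quotient (V\<lparr>carrier := Z\<rparr>) W) (\<lambda>x. W +>\<^bsub>V\<^esub> \<Theta> x)"
proof -
  interpret S: vsp S by fact
  interpret V: vsp V by fact
  interpret Z: vsp "V\<lparr>carrier := Z\<rparr>" using V.restrict_vsp[OF Z] .
  have WZ: "submodule W (scalars :: 'k ring) (V\<lparr>carrier := Z\<rparr>)"
    using Z W \<open>W \<subseteq> Z\<close> by (rule V.submodule_restrict)
  have coset: "W +>\<^bsub>V\<lparr>carrier := Z\<rparr>\<^esub> x = W +>\<^bsub>V\<^esub> x" for x
    by (simp add: a_r_coset_def')
  note hom = is_hom_scalarsD[OF \<Theta>(1)]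
  have diff: "\<Theta> (x \<ominus>\<^bsub>S\<^esub> y) = \<Theta> x \<ominus>\<^bsub>V\<^esub> \<Theta> y" if "x \<in> carrier S" "y \<in> carrier S" for x y
    using that by (simp add: S.minus_eq V.minus_eq hom flip: S.smult_minus_one V.smult_minus_one)
  have "is_hom (scalars :: 'k ring) S (quotient (V\<lparr>carrier := Z\<rparr>) W) (\<lambda>x. W +>\<^bsub>V\<^esub> \<Theta> x)"
    using Z.quotient_carrier[OF WZ] Z.coset_add[OF WZ] Z.coset_smult[OF WZ] \<Theta>(2)
    by (auto simp: is_hom_def coset hom)
  moreover have "inj_on (\<lambda>x. W +>\<^bsub>V\<^esub> \<Theta> x) (carrier S)"
  proof (rule inj_onI)
    fix x y assume xy: "x \<in> carrier S" "y \<in> carrier S" "W +>\<^bsub>V\<^esub> \<Theta> x = W +>\<^bsub>V\<^esub> \<Theta> y"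
    then have "\<Theta> (x \<ominus>\<^bsub>S\<^esub> y) \<in> W"
      using V.coset_eq_iff[OF W] hom(1) by (simp add: diff)
    then have "x \<ominus>\<^bsub>S\<^esub> y = \<zero>\<^bsub>S\<^esub>" using xy by (intro inj) auto
    then show "x = y" using xy S.minus_add_cancel[of x y] by simp
  qed
  moreover have "(\<lambda>x. W +>\<^bsub>V\<^esub> \<Theta> x) ` carrier S = carrier (quotient (V\<lparr>carrier := Z\<rparr>) W)"
  proof -
    have "W +>\<^bsub>V\<^esub> z \<in> (\<lambda>x. W +>\<^bsub>V\<^esub> \<Theta> x) ` carrier S" if z: "z \<in> Z" for z
    proof -
      obtain x where x: "x \<in> carrier S" "z \<ominus>\<^bsub>V\<^esub> \<Theta> x \<in> W" using surj[OF z] by auto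
      then have "W +>\<^bsub>V\<^esub> z = W +>\<^bsub>V\<^esub> \<Theta> x"
        using V.submodule_subset[OF Z] z hom(1) by (subst V.coset_eq_iff[OF W]) auto
      then show ?thesis using x by auto
    qed
    then show ?thesis
      using \<Theta>(2) by (auto simp: Z.quotient_carrier[OF WZ] coset)
  qed
  ultimately show ?thesis by (simp add: lin_iso_def bij_betw_def)
qed

lemma
  fixes V :: "('k::field, 'v) module" and W :: "('k, 'w) module"
  assumes V: "vsp V" and W: "vsp W" and d: "is_hom (scalars :: 'k ring) V W d"
  shows kernel_submodule: "submodule {v \<in> carrier V. d v = \<zero>\<^bsub>W\<^esub>} (scalars :: 'k ring) V"
    and image_submodule: "submodule (d ` carrier V) (scalars :: 'k ring) W"
proof -
  interpret V: vsp V by fact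
  interpret W: vsp W by fact
  note h = is_hom_scalarsD[OF d]
  have z: "d \<zero>\<^bsub>V\<^esub> = \<zero>\<^bsub>W\<^esub>" using h(1)[of "\<zero>\<^bsub>V\<^esub>"] h(3)[of "\<zero>\<^bsub>V\<^esub>" 0] by simp
  show "submodule {v \<in> carrier V. d v = \<zero>\<^bsub>W\<^esub>} (scalars :: 'k ring) V"
    by (rule V.submoduleI) (auto simp: h z)
  have "d v \<oplus>\<^bsub>W\<^esub> d w \<in> d ` carrier V" "c \<odot>\<^bsub>W\<^esub> d v \<in> d ` carrier V"
    if "v \<in> carrier V" "w \<in> carrier V" for v w c
    using that by (simp_all flip: h(2,3))
  moreover have "\<zero>\<^bsub>W\<^esub> \<in> d ` carrier V" unfolding z[symmetric] by simp
  ultimately show "submodule (d ` carrier V) (scalars :: 'k ring) W"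
    using h(1) by (intro W.submoduleI) auto
qed

text \<open>A basis is encoded by its coordinate map: \<phi> identifies V with the finitely
  supported functions on I, and the basis vectors are recovered as \<open>vec (single i)\<close>.
  Equations in iterated quotients thereby become equations between scalar-valued functions.\<close>

locale coords = vsp V for V :: "('k::field, 'v) module" (structure) +
  fixes I :: "'i set" and \<phi> :: "'v \<Rightarrow> 'i \<Rightarrow> 'k"
  assumes coords_inj: "inj_on \<phi> (carrier V)"
    and coords_image: "\<phi> ` carrier V = finsupp I"
    and coords_add: "x \<in> carrier V \<Longrightarrow> y \<in> carrier V \<Longrightarrow> \<phi> (x \<oplus> y) = (\<lambda>i. \<phi> x i + \<phi> y i)"
    and coords_smult: "x \<in> carrier V \<Longrightarrow> \<phi> (c \<odot> x) = (\<lambda>i. c * \<phi> x i)"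
begin

lemma coords_eqI: "x \<in> carrier V \<Longrightarrow> y \<in> carrier V \<Longrightarrow> (\<And>i. \<phi> x i = \<phi> y i) \<Longrightarrow> x = y"
  using inj_onD[OF coords_inj] by blast

lemma coords_finsupp: "x \<in> carrier V \<Longrightarrow> \<phi> x \<in> finsupp I"
  using coords_image by auto

lemma coords_outside: "x \<in> carrier V \<Longrightarrow> i \<notin> I \<Longrightarrow> \<phi> x i = 0"
  by (rule finsuppD(3)[OF coords_finsupp])

lemma coords_zero [simp]: "\<phi> \<zero> = (\<lambda>_. 0)"
  using coords_smult[of \<zero> 0] by simp

lemma coords_minus: "x \<in> carrier V \<Longrightarrow> y \<in> carrier V \<Longrightarrow> \<phi> (x \<ominus> y) = (\<lambda>i. \<phi> x i - \<phi> y i)"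
  by (simp add: minus_eq coords_add coords_smult flip: smult_minus_one)

lemma coords_finsum: "f \<in> A \<rightarrow> carrier V \<Longrightarrow> \<phi> (finsum V f A) = (\<lambda>i. \<Sum>a\<in>A. \<phi> (f a) i)"
  by (induction A rule: infinite_finite_induct) (auto simp: finsum_infinite Pi_def coords_add)

definition vec :: "('i \<Rightarrow> 'k) \<Rightarrow> 'v" where "vec f = inv_into (carrier V) \<phi> f"

lemma
  assumes "f \<in> finsupp I"
  shows vec_closed: "vec f \<in> carrier V" and coords_vec: "\<phi> (vec f) = f"
  using assms coords_image unfolding vec_def by (metis inv_into_into, metis f_inv_into_f)

lemma vec_coords: "x \<in> carrier V \<Longrightarrow> vec (\<phi> x) = x"
  by (simp add: coords_inj vec_def)

lemma supported_submodule: "submodule {x \<in> carrier V. \<forall>i. i \<notin> J \<longrightarrow> \<phi> x i = 0} (scalars :: 'k ring) V"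
  by (rule submoduleI) (auto simp: coords_add coords_smult)

lemma carrier_induct [consumes 1, case_names zero add]:
  assumes "x \<in> carrier V" "P \<zero>"
    and "\<And>x c i. x \<in> carrier V \<Longrightarrow> P x \<Longrightarrow> i \<in> I \<Longrightarrow> P (x \<oplus> c \<odot> vec (single i))"
  shows "P x"
proof -
  have z: "vec (\<lambda>_. 0) = \<zero>"
    using vec_coords[of \<zero>] by simp
  have "P (vec f)" if "f \<in> finsupp I" for f
    using that
  proof (induction f rule: finsupp_induct)
    case zero
    show ?case using assms(2) z by simp
  next
    case (add f c i)
    have "\<phi> (vec f \<oplus> c \<odot> vec (single i)) = (\<lambda>j. f j + c * single i j)"
      using add by (simp add: coords_add coords_smult vec_closed coords_vec)
    then have "vec (\<lambda>j. f j + c * single i j) = vec f \<oplus> c \<odot> vec (single i)"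
      using add by (metis a_closed smult_closed vec_closed vec_coords finsupp_single)
    then show ?case using assms(3)[OF vec_closed[OF add(1)] add(3,2)] by simp
  qed
  then show ?thesis using assms(1) coords_finsupp vec_coords by metis
qed

text \<open>Enough to find in S a vector for each unit function on J; S itself may be much larger.
  \<open>koszul\<close> and \<open>HH_span\<close> are defined as spans, and this turns membership
  in them into the vanishing of coordinates.\<close>

lemma lin_span_eq_supported:
  assumes S: "S \<subseteq> carrier V" "\<And>x i. x \<in> S \<Longrightarrow> i \<notin> J \<Longrightarrow> \<phi> x i = 0"
    and J: "J \<subseteq> I" "\<And>j. j \<in> J \<Longrightarrow> \<exists>x\<in>S. \<phi> x = single j"
  shows "lin_span V S = {x \<in> carrier V. \<forall>i. i \<notin> J \<longrightarrow> \<phi> x i = 0}" (is "?L = ?R")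
proof
  show "?L \<subseteq> ?R" using S by (intro lin_span_least supported_submodule) auto
next
  note sub = lin_span_submodule[OF S(1)]
  have "vec f \<in> ?L" if "f \<in> finsupp J" for f
    using that
  proof (induction f rule: finsupp_induct)
    case zero
    then show ?case using vec_coords[of \<zero>] submodule_zero[OF sub] by simp
  next
    case (add f c j)
    have f: "f \<in> finsupp I" using add(1) J(1) by (rule finsupp_mono)
    obtain x where x: "x \<in> S" "\<phi> x = single j" using J(2) add by blast
    have xc: "x \<in> carrier V" using x S by auto
    have "\<phi> (vec f \<oplus> c \<odot> x) = (\<lambda>j'. f j' + c * single j j')"
      using f xc x by (simp add: coords_add coords_smult vec_closed coords_vec)
    then have "vec (\<lambda>j'. f j' + c * single j j') = vec f \<oplus> c \<odot> x"
      using f xc vec_closed[of f] by (metis a_closed smult_closed vec_coords)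
    moreover have "x \<in> lin_span V S" using x lin_span_superset by blast
    ultimately show ?case
      using add(3) submodule_add[OF sub] submodule_smult[OF sub] by simp
  qed
  moreover have "\<phi> x \<in> finsupp J" if "x \<in> ?R" for x
    using that coords_finsupp[of x] by (auto simp: finsupp_def)
  ultimately show "?R \<subseteq> ?L" using vec_coords by (metis (no_types, lifting) mem_Collect_eq subsetI)
qed

lemma lin_indep_familyI:
  assumes "v \<in> J \<rightarrow> carrier V" "\<And>j. j \<in> J \<Longrightarrow> \<phi> (v j) = single j"
  shows "lin_indep_family V J v"
  unfolding lin_indep_family_def
proof (intro conjI allI impI ballI)
  fix F c j
  assume F: "finite F \<and> F \<subseteq> J \<and> (\<Oplus>j\<in>F. c j \<odot> v j) = \<zero>" and j: "j \<in> F"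
  have "\<phi> (\<Oplus>j\<in>F. c j \<odot> v j) j = (\<Sum>i\<in>F. c i * single i j)"
    using F assms(1) by (subst coords_finsum) (auto simp: Pi_def coords_smult assms(2) subset_iff)
  also have "\<dots> = c j" using F j by (simp add: single_def if_distrib cong: if_cong)
  finally show "c j = 0" using F by simp
qed (use assms in auto)

end

section \<open>Monoid algebras and their quotients\<close>

locale kalg = vsp A + ring A for A :: "('k::field, 'a) module" (structure) +
  assumes smult_mult_left: "x \<in> carrier A \<Longrightarrow> y \<in> carrier A \<Longrightarrow> (c \<odot> x) \<otimes> y = c \<odot> (x \<otimes> y)"
    and smult_mult_right: "x \<in> carrier A \<Longrightarrow> y \<in> carrier A \<Longrightarrow> x \<otimes> (c \<odot> y) = c \<odot> (x \<otimes> y)"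

section \<open>Linear extension and monoid algebras\<close>

definition lin_ext :: "('m \<Rightarrow> 'i \<Rightarrow> 'k) \<Rightarrow> ('m \<Rightarrow> 'k::field) \<Rightarrow> 'i \<Rightarrow> 'k" where
  "lin_ext t f = (\<lambda>i. \<Sum>x | f x \<noteq> 0. f x * t x i)"

lemma lin_ext_eq:
  assumes "finite F" "{x. f x \<noteq> 0} \<subseteq> F"
  shows "lin_ext t f i = (\<Sum>x\<in>F. f x * t x i)"
  unfolding lin_ext_def using assms by (intro sum.mono_neutral_left) auto

lemma lin_ext_zero [simp]: "lin_ext t (\<lambda>_. 0) = (\<lambda>_. 0)"
  by (simp add: lin_ext_def)

lemma lin_ext_single [simp]: "lin_ext t (single x) = t x"
  by (rule ext) (simp add: lin_ext_eq[of "{x}"] single_def)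

lemma lin_ext_add:
  assumes "f \<in> finsupp I" "g \<in> finsupp J"
  shows "lin_ext t (\<lambda>x. f x + g x) = (\<lambda>i. lin_ext t f i + lin_ext t g i)"
proof
  fix i
  let ?F = "{x. f x \<noteq> 0} \<union> {x. g x \<noteq> 0}"
  have "finite ?F" using assms by (simp add: finsuppD(1))
  then show "lin_ext t (\<lambda>x. f x + g x) i = lin_ext t f i + lin_ext t g i"
    by (subst (1 2 3) lin_ext_eq[of ?F]) (auto simp: sum.distrib distrib_right)
qed

lemma lin_ext_smult: "lin_ext t (\<lambda>x. c * f x) = (\<lambda>i. c * lin_ext t f i)"
  by (cases "c = 0") (auto simp: lin_ext_def sum_distrib_left mult.assoc)

lemma lin_ext_add_smult:
  "f \<in> finsupp I \<Longrightarrow> g \<in> finsupp I \<Longrightarrow>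
    lin_ext t (\<lambda>x. f x + c * g x) = (\<lambda>i. lin_ext t f i + c * lin_ext t g i)"
  using lin_ext_add[OF _ finsupp_smult, of f I g I t c] by (simp add: lin_ext_smult)

lemma lin_ext_finsupp:
  assumes "f \<in> finsupp X" and t: "\<And>x. x \<in> X \<Longrightarrow> t x \<in> finsupp I"
  shows "lin_ext t f \<in> finsupp I"
  using assms(1)
proof (induction f rule: finsupp_induct)
  case (add f c x)
  have "lin_ext t (\<lambda>j. f j + c * single x j) = (\<lambda>i. lin_ext t f i + c * t x i)"
    using lin_ext_add[OF add(1) finsupp_smult[of "single x" X c]] add(2) by (simp add: lin_ext_smult)
  then show ?case using add t by (simp add: finsupp_add finsupp_smult)
qed simp

lemma monoid_alg_simps [simp]:
  "carrier (monoid_alg M) = finsupp (carrier M)"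
  "\<one>\<^bsub>monoid_alg M\<^esub> = single \<one>\<^bsub>M\<^esub>" "\<zero>\<^bsub>monoid_alg M\<^esub> = (\<lambda>_. 0)"
  "f \<oplus>\<^bsub>monoid_alg M\<^esub> g = (\<lambda>x. f x + g x)" "c \<odot>\<^bsub>monoid_alg M\<^esub> f = (\<lambda>x. c * f x)"
  by (simp_all add: monoid_alg_def finsupp_def)

lemma monoid_alg_vsp: "vsp (monoid_alg M :: ('k::field, 'm \<Rightarrow> 'k) module)"
proof -
  have "abelian_group (monoid_alg M :: ('k, 'm \<Rightarrow> 'k) module)"
  proof (rule abelian_groupI)
    show "\<exists>y\<in>carrier (monoid_alg M). y \<oplus>\<^bsub>monoid_alg M\<^esub> f = \<zero>\<^bsub>monoid_alg M\<^esub>"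
      if "f \<in> carrier (monoid_alg M :: ('k, 'm \<Rightarrow> 'k) module)" for f
      using that finsupp_smult[of f _ "-1"] by (intro bexI[of _ "\<lambda>x. -1 * f x"]) auto
  qed (auto simp: finsupp_add algebra_simps)
  then show ?thesis
    by (auto simp: vsp_def vsp_axioms_def finsupp_smult algebra_simps)
qed

lemma monoid_alg_minus:
  fixes f g :: "'m \<Rightarrow> 'k::field"
  assumes "f \<in> finsupp (carrier M)" "g \<in> finsupp (carrier M)"
  shows "f \<ominus>\<^bsub>(monoid_alg M :: ('k, 'm \<Rightarrow> 'k) module)\<^esub> g = (\<lambda>x. f x - g x)"
proof -
  interpret vsp "monoid_alg M :: ('k, 'm \<Rightarrow> 'k) module" by (rule monoid_alg_vsp)
  show ?thesis using assms by (simp add: minus_eq flip: smult_minus_one)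
qed

lemma monoid_alg_mult:
  fixes f g :: "'m \<Rightarrow> 'k::field"
  assumes "finite F" "finite G" "{x. f x \<noteq> 0} \<subseteq> F" "{x. g x \<noteq> 0} \<subseteq> G"
  shows "(f \<otimes>\<^bsub>monoid_alg M\<^esub> g) z = (\<Sum>x\<in>F. \<Sum>y\<in>G. if x \<otimes>\<^bsub>M\<^esub> y = z then f x * g y else 0)"
proof -
  have "(f \<otimes>\<^bsub>monoid_alg M\<^esub> g) z =
      (\<Sum>p\<in>{(x, y). f x \<noteq> 0 \<and> g y \<noteq> 0 \<and> x \<otimes>\<^bsub>M\<^esub> y = z}. case p of (x, y) \<Rightarrow> f x * g y)"
    by (simp add: monoid_alg_def)
  also have "\<dots> = (\<Sum>p\<in>F \<times> G. case p of (x, y) \<Rightarrow> if x \<otimes>\<^bsub>M\<^esub> y = z then f x * g y else 0)"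
    using assms by (intro sum.mono_neutral_cong_left) (auto split: if_splits)
  also have "\<dots> = (\<Sum>x\<in>F. \<Sum>y\<in>G. if x \<otimes>\<^bsub>M\<^esub> y = z then f x * g y else 0)"
    by (simp add: sum.cartesian_product)
  finally show ?thesis .
qed

lemma monoid_alg_mult_zero:
  "(\<lambda>_. 0) \<otimes>\<^bsub>monoid_alg M\<^esub> g = (\<lambda>_. 0)" "f \<otimes>\<^bsub>monoid_alg M\<^esub> (\<lambda>_. 0) = (\<lambda>_. 0)"
  by (auto simp: monoid_alg_def)

lemma monoid_alg_mult_single: "single x \<otimes>\<^bsub>monoid_alg M\<^esub> single y = single (x \<otimes>\<^bsub>M\<^esub> y)"
  by (rule ext) (subst monoid_alg_mult[of "{x}" "{y}"], auto simp: single_def)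

lemma monoid_alg_mult_linear:
  fixes f f' g :: "'m \<Rightarrow> 'k::field"
  assumes "f \<in> finsupp X" "f' \<in> finsupp X" "g \<in> finsupp X"
  shows "(\<lambda>x. f x + c * f' x) \<otimes>\<^bsub>monoid_alg M\<^esub> g =
      (\<lambda>x. (f \<otimes>\<^bsub>monoid_alg M\<^esub> g) x + c * (f' \<otimes>\<^bsub>monoid_alg M\<^esub> g) x)" (is ?A)
    and "g \<otimes>\<^bsub>monoid_alg M\<^esub> (\<lambda>x. f x + c * f' x) =
      (\<lambda>x. (g \<otimes>\<^bsub>monoid_alg M\<^esub> f) x + c * (g \<otimes>\<^bsub>monoid_alg M\<^esub> f') x)" (is ?B)
proof -
  let ?F = "{x. f x \<noteq> 0} \<union> {x. f' x \<noteq> 0}"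
  let ?G = "{x. g x \<noteq> 0}"
  have fin: "finite ?F" "finite ?G" using assms by (simp_all add: finsuppD(1))
  have supp: "{x. f x + c * f' x \<noteq> 0} \<subseteq> ?F" "{x. f x \<noteq> 0} \<subseteq> ?F" "{x. f' x \<noteq> 0} \<subseteq> ?F"
    by auto
  show ?A
  proof
    fix z
    have "(\<Sum>x\<in>?F. \<Sum>y\<in>?G. if x \<otimes>\<^bsub>M\<^esub> y = z then (f x + c * f' x) * g y else 0) =
      (\<Sum>x\<in>?F. \<Sum>y\<in>?G. if x \<otimes>\<^bsub>M\<^esub> y = z then f x * g y else 0) +
      c * (\<Sum>x\<in>?F. \<Sum>y\<in>?G. if x \<otimes>\<^bsub>M\<^esub> y = z then f' x * g y else 0)"
      unfolding sum_distrib_left sum.distrib[symmetric]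
      by (intro sum.cong refl) (simp add: algebra_simps)
    then show "((\<lambda>x. f x + c * f' x) \<otimes>\<^bsub>monoid_alg M\<^esub> g) z =
        (f \<otimes>\<^bsub>monoid_alg M\<^esub> g) z + c * (f' \<otimes>\<^bsub>monoid_alg M\<^esub> g) z"
      by (simp only: monoid_alg_mult[OF fin supp(1) order_refl]
          monoid_alg_mult[OF fin supp(2) order_refl] monoid_alg_mult[OF fin supp(3) order_refl])
  qed
  show ?B
  proof
    fix z
    have "(\<Sum>x\<in>?G. \<Sum>y\<in>?F. if x \<otimes>\<^bsub>M\<^esub> y = z then g x * (f y + c * f' y) else 0) =
      (\<Sum>x\<in>?G. \<Sum>y\<in>?F. if x \<otimes>\<^bsub>M\<^esub> y = z then g x * f y else 0) +
      c * (\<Sum>x\<in>?G. \<Sum>y\<in>?F. if x \<otimes>\<^bsub>M\<^esub> y = z then g x * f' y else 0)"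
      unfolding sum_distrib_left sum.distrib[symmetric]
      by (intro sum.cong refl) (simp add: algebra_simps)
    then show "(g \<otimes>\<^bsub>monoid_alg M\<^esub> (\<lambda>x. f x + c * f' x)) z =
        (g \<otimes>\<^bsub>monoid_alg M\<^esub> f) z + c * (g \<otimes>\<^bsub>monoid_alg M\<^esub> f') z"
      by (simp only: monoid_alg_mult[OF fin(2,1) order_refl supp(1)]
          monoid_alg_mult[OF fin(2,1) order_refl supp(2)] monoid_alg_mult[OF fin(2,1) order_refl supp(3)])
  qed
qed

lemma monoid_alg_kalg:
  fixes M :: "('m, 'b) monoid_scheme"
  assumes "monoid M"
  shows "kalg (monoid_alg M :: ('k::field, 'm \<Rightarrow> 'k) module)" (is "kalg ?A")
proof -
  interpret M: monoid M by fact
  interpret A: vsp ?A by (rule monoid_alg_vsp)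
  note lin = monoid_alg_mult_linear[of _ "carrier M"]
  note S = finsupp_single[THEN iffD2]
  have closed: "f \<otimes>\<^bsub>?A\<^esub> g \<in> finsupp (carrier M)"
    if "f \<in> finsupp (carrier M)" "g \<in> finsupp (carrier M)" for f g :: "'m \<Rightarrow> 'k"
    using that(1)
  proof (induction f rule: finsupp_induct)
    case (add f c x)
    have "single x \<otimes>\<^bsub>?A\<^esub> g \<in> finsupp (carrier M)"
      using that(2) add(2)
      by (induction g rule: finsupp_induct)
        (auto simp: monoid_alg_mult_zero monoid_alg_mult_single lin finsupp_add finsupp_smult S)
    then show ?case using add that(2) by (simp add: lin finsupp_add finsupp_smult)
  qed (simp add: monoid_alg_mult_zero)
  \<comment> \<open>By linearity the three factors are replaced by basis elements one after the
    other, and for these associativity is that of M.\<close>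
  have assoc: "(f \<otimes>\<^bsub>?A\<^esub> g) \<otimes>\<^bsub>?A\<^esub> h = f \<otimes>\<^bsub>?A\<^esub> (g \<otimes>\<^bsub>?A\<^esub> h)"
    if f: "f \<in> finsupp (carrier M)" and g: "g \<in> finsupp (carrier M)" and h: "h \<in> finsupp (carrier M)"
    for f g h :: "'m \<Rightarrow> 'k"
    using f
  proof (induction f rule: finsupp_induct)
    case (add f c x)
    have "(single x \<otimes>\<^bsub>?A\<^esub> g) \<otimes>\<^bsub>?A\<^esub> h = single x \<otimes>\<^bsub>?A\<^esub> (g \<otimes>\<^bsub>?A\<^esub> h)"
      using g
    proof (induction g rule: finsupp_induct)
      case (add g d y)
      have "(single x \<otimes>\<^bsub>?A\<^esub> single y) \<otimes>\<^bsub>?A\<^esub> h = single x \<otimes>\<^bsub>?A\<^esub> (single y \<otimes>\<^bsub>?A\<^esub> h)"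
        using h
      proof (induction h rule: finsupp_induct)
        case (add h e z)
        then show ?case using \<open>x \<in> carrier M\<close> \<open>y \<in> carrier M\<close>
          by (simp add: monoid_alg_mult_single lin closed M.m_assoc)
      qed (simp add: monoid_alg_mult_zero)
      then show ?case using add h \<open>x \<in> carrier M\<close> by (simp add: lin closed)
    qed (simp add: monoid_alg_mult_zero)
    then show ?case using add g h by (simp add: lin closed)
  qed (simp add: monoid_alg_mult_zero)
  have one: "single \<one>\<^bsub>M\<^esub> \<otimes>\<^bsub>?A\<^esub> f = f" "f \<otimes>\<^bsub>?A\<^esub> single \<one>\<^bsub>M\<^esub> = f"
    if "f \<in> finsupp (carrier M)" for f :: "'m \<Rightarrow> 'k"
    using that
    by (induction f rule: finsupp_induct)
      (auto simp: monoid_alg_mult_zero monoid_alg_mult_single lin)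
  have "ring ?A"
  proof (rule ringI)
    show "abelian_group ?A" ..
    show "Group.monoid ?A"
      by (rule monoidI) (auto simp: closed assoc one)
  qed (use lin(1,2)[where c = 1] in auto)
  then show ?thesis
    using lin(1,2)[of "\<lambda>_. 0"]
    by (auto simp: kalg_def kalg_axioms_def A.vsp_axioms monoid_alg_mult_zero)
qed

text \<open>Evaluates on an arbitrary representative, which is harmless once the submodule lies in
  the kernel of \<open>lin_ext t\<close>.\<close>

definition quotient_coord :: "('m \<Rightarrow> 'i \<Rightarrow> 'k::field) \<Rightarrow> ('m \<Rightarrow> 'k) set \<Rightarrow> 'i \<Rightarrow> 'k" where
  "quotient_coord t X = lin_ext t (SOME f. f \<in> X)"

text \<open>The hypothesis on \<^term>\<open>s\<close> makes the span of its values a complement of the kernel of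
  \<^term>\<open>lin_ext t\<close>, and the last one says that \<^term>\<open>W\<close> together with this complement is everything;
  hence \<^term>\<open>W\<close> is the whole kernel.\<close>

lemma monoid_alg_quotient_coords:
  fixes M :: "('m, 'b) monoid_scheme" and t :: "'m \<Rightarrow> 'i \<Rightarrow> 'k::field"
  assumes W: "submodule W (scalars :: 'k ring) (monoid_alg M :: ('k, 'm \<Rightarrow> 'k) module)"
    and t: "\<And>x. x \<in> carrier M \<Longrightarrow> t x \<in> finsupp I"
    and ker: "\<And>f. f \<in> W \<Longrightarrow> lin_ext t f = (\<lambda>_. 0)"
    and s: "\<And>i. i \<in> I \<Longrightarrow> s i \<in> carrier M" "\<And>i. i \<in> I \<Longrightarrow> t (s i) = single i"
    and span: "\<And>x. x \<in> carrier M \<Longrightarrow> \<exists>y\<in>finsupp (s ` I). (\<lambda>z. single x z - y z) \<in> W"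
  shows "coords (quotient (monoid_alg M) W) I (quotient_coord t)"
    and "\<And>f. f \<in> finsupp (carrier M) \<Longrightarrow>
      quotient_coord t (W +>\<^bsub>(monoid_alg M :: ('k, 'm \<Rightarrow> 'k) module)\<^esub> f) = lin_ext t f"
proof -
  let ?A = "monoid_alg M :: ('k, 'm \<Rightarrow> 'k) module"
  interpret A: vsp ?A by (rule monoid_alg_vsp)
  have sI: "s ` I \<subseteq> carrier M" using s by auto
  have ex: "\<exists>y\<in>finsupp (s ` I). (\<lambda>z. f z - y z) \<in> W" if "f \<in> finsupp (carrier M)" for f :: "'m \<Rightarrow> 'k"
    using that
  proof (induction f rule: finsupp_induct)
    case zero
    show ?case using A.submodule_zero[OF W] by (intro bexI[of _ "\<lambda>_. 0"]) auto
  next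
    case (add f c x)
    then obtain y y' where y: "y \<in> finsupp (s ` I)" "(\<lambda>z. f z - y z) \<in> W"
      and y': "y' \<in> finsupp (s ` I)" "(\<lambda>z. single x z - y' z) \<in> W"
      using span by blast
    have "(\<lambda>z. (f z + c * single x z) - (y z + c * y' z)) =
        (\<lambda>z. f z - y z) \<oplus>\<^bsub>?A\<^esub> c \<odot>\<^bsub>?A\<^esub> (\<lambda>z. single x z - y' z)"
      by (auto simp: algebra_simps)
    also have "\<dots> \<in> W"
      using A.submodule_add[OF W] A.submodule_smult[OF W] y y' by blast
    finally show ?case
      using y y' by (intro bexI[of _ "\<lambda>z. y z + c * y' z"]) (auto intro: finsupp_add finsupp_smult)
  qed
  have diff: "lin_ext t (\<lambda>z. f z - g z) = (\<lambda>i. lin_ext t f i - lin_ext t g i)"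
    if "f \<in> finsupp (carrier M)" "g \<in> finsupp (carrier M)" for f g
    using lin_ext_add[OF that(1) finsupp_smult[OF that(2), of "-1"], of t] lin_ext_smult[of t "-1" g]
    by simp
  have s_inj: "s i = s j \<longleftrightarrow> i = j" if "i \<in> I" "j \<in> I" for i j
    using s(2)[OF that(1)] s(2)[OF that(2)] by (metis single_def zero_neq_one)
  \<comment> \<open>On combinations of the \<open>s i\<close> the map reads off coefficients,
    because \<open>t (s i)\<close> is the i-th unit function and \<open>s\<close> is injective on
    I.\<close>
  have comp: "lin_ext t y i = y (s i)" if y: "y \<in> finsupp (s ` I)" and i: "i \<in> I" for y i
  proof -
    have "y x * t x i = (if x = s i then y x else 0)" if "x \<in> s ` I" for x
      using that i s(2) s_inj by (auto simp: single_def)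
    then have "lin_ext t y i = (\<Sum>x | y x \<noteq> 0. if x = s i then y x else 0)"
      unfolding lin_ext_def using y finsuppD(2)[OF y] by (intro sum.cong) auto
    also have "\<dots> = y (s i)" using finsuppD(1)[OF y] by simp
    finally show ?thesis .
  qed
  \<comment> \<open>Modulo W, f is a combination y of the \<open>s i\<close>. The coefficients of y
    are its coordinates, which vanish together with those of f, so y = 0.\<close>
  have kernel: "f \<in> W" if f: "f \<in> finsupp (carrier M)" and 0: "lin_ext t f = (\<lambda>_. 0)" for f
  proof -
    obtain y where y: "y \<in> finsupp (s ` I)" "(\<lambda>z. f z - y z) \<in> W" using ex[OF f] by blast
    have "lin_ext t y i = 0" for i
      using ker[OF y(2)] diff[OF f finsupp_mono[OF y(1) sI]] 0 by (metis diff_0 neg_equal_0_iff_equal)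
    then have "y x = 0" for x using comp[OF y(1)] finsuppD(2)[OF y(1), of x] by force
    then show ?thesis using y(2) by simp
  qed
  have W_iff: "f \<in> W \<longleftrightarrow> f \<in> finsupp (carrier M) \<and> lin_ext t f = (\<lambda>_. 0)" for f
    using kernel ker A.submodule_subset[OF W] by auto
  have coset_iff: "g \<in> W +>\<^bsub>?A\<^esub> f \<longleftrightarrow> g \<in> finsupp (carrier M) \<and> lin_ext t g = lin_ext t f"
    if "f \<in> finsupp (carrier M)" for f g
    using A.coset_mem_iff[OF W, of f g] that
    by (auto simp: W_iff monoid_alg_minus finsupp_diff diff fun_eq_iff)
  show qc: "quotient_coord t (W +>\<^bsub>?A\<^esub> f) = lin_ext t f" if "f \<in> finsupp (carrier M)" for f
    unfolding quotient_coord_def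
    using someI_ex[of "\<lambda>g. g \<in> W +>\<^bsub>?A\<^esub> f"] coset_iff[OF that] that by blast
  have lin_ext_onto: "lin_ext t ` finsupp (carrier M) = finsupp I"
  proof
    show "lin_ext t ` finsupp (carrier M) \<subseteq> finsupp I" using t lin_ext_finsupp by blast
    have "f \<in> lin_ext t ` finsupp (carrier M)" if "f \<in> finsupp I" for f
      using that
    proof (induction f rule: finsupp_induct)
      case zero
      show ?case by (intro image_eqI[of _ _ "\<lambda>_. 0"]) auto
    next
      case (add f c i)
      then obtain g where g: "g \<in> finsupp (carrier M)" "f = lin_ext t g" by auto
      have "lin_ext t (\<lambda>x. g x + c * single (s i) x) = (\<lambda>j. f j + c * single i j)"
        using lin_ext_add[OF g(1) finsupp_smult[of "single (s i)" "carrier M" c], of t] add s g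
        by (simp add: lin_ext_smult)
      moreover have "(\<lambda>x. g x + c * single (s i) x) \<in> finsupp (carrier M)"
        using g s add by (intro finsupp_add finsupp_smult) auto
      ultimately show ?case
        by (intro image_eqI[of _ _ "\<lambda>x. g x + c * single (s i) x"]) simp_all
    qed
    then show "finsupp I \<subseteq> lin_ext t ` finsupp (carrier M)" by blast
  qed
  note Q = A.quotient_carrier[OF W]
  show "coords (quotient ?A W) I (quotient_coord t)"
  proof (intro coords.intro A.quotient_vsp W coords_axioms.intro)
    show "inj_on (quotient_coord t) (carrier (quotient ?A W))"
      by (rule inj_onI) (auto simp: Q qc coset_iff)
    show "quotient_coord t ` carrier (quotient ?A W) = finsupp I"
      using lin_ext_onto by (simp add: Q image_image qc cong: image_cong_simp)
    fix X Y c
    assume "X \<in> carrier (quotient ?A W)" "Y \<in> carrier (quotient ?A W)"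
    then obtain f g where fg: "f \<in> finsupp (carrier M)" "X = W +>\<^bsub>?A\<^esub> f"
      "g \<in> finsupp (carrier M)" "Y = W +>\<^bsub>?A\<^esub> g" by (auto simp: Q)
    show "quotient_coord t (X \<oplus>\<^bsub>quotient ?A W\<^esub> Y) =
        (\<lambda>i. quotient_coord t X i + quotient_coord t Y i)"
      using A.coset_add[OF W, of f g] fg
      by (simp add: qc finsupp_add) (rule lin_ext_add)
    show "quotient_coord t (c \<odot>\<^bsub>quotient ?A W\<^esub> X) = (\<lambda>i. c * quotient_coord t X i)"
      using A.coset_smult[OF W, of f c] fg by (simp add: qc finsupp_smult lin_ext_smult)
  qed
qed

text \<open>The scalar c acts as multiplication by the algebra element c 1, so an ideal absorbs
  scalars.\<close>

lemma (in kalg) ideal_submodule: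
  assumes "ideal W A"
  shows "submodule W (scalars :: 'k ring) A"
proof -
  interpret W: ideal W A by fact
  have "c \<odot> x \<in> W" if x: "x \<in> W" for c x
  proof -
    have "(c \<odot> \<one>) \<otimes> x = c \<odot> x" using W.Icarr[OF x] by (simp add: smult_mult_left)
    moreover have "(c \<odot> \<one>) \<otimes> x \<in> W" using x by (intro W.I_l_closed) auto
    ultimately show ?thesis by simp
  qed
  then show ?thesis by (intro submoduleI) auto
qed

lemma (in kalg) quotient_kalg:
  assumes W: "ideal W A"
  shows "kalg (quotient A W)"
    and "\<And>x y. x \<in> carrier A \<Longrightarrow> y \<in> carrier A \<Longrightarrow>
      (W +> x) \<otimes>\<^bsub>quotient A W\<^esub> (W +> y) = W +> (x \<otimes> y)"
    and "\<one>\<^bsub>quotient A W\<^esub> = W +> \<one>"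
proof -
  interpret W: ideal W A by fact
  note sub = ideal_submodule[OF W]
  interpret Q: vsp "quotient A W" using quotient_vsp[OF sub] .
  show mult: "(W +> x) \<otimes>\<^bsub>quotient A W\<^esub> (W +> y) = W +> (x \<otimes> y)"
    if "x \<in> carrier A" "y \<in> carrier A" for x y
    using W.rcoset_mult_add[OF that] by (simp add: quotient_def FactRing_def)
  show one: "\<one>\<^bsub>quotient A W\<^esub> = W +> \<one>"
    by (simp add: quotient_def FactRing_def)
  note Q = quotient_carrier[OF sub] coset_add[OF sub] coset_smult[OF sub]
  have "ring (quotient A W)"
  proof (rule ringI)
    show "abelian_group (quotient A W)" ..
    show "Group.monoid (quotient A W)"
      by (rule monoidI) (auto simp: Q mult one m_assoc)
  qed (auto simp: Q mult l_distr r_distr)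
  then show "kalg (quotient A W)"
    by (auto simp: kalg_def kalg_axioms_def Q.vsp_axioms Q mult smult_mult_left smult_mult_right)
qed

declare One_nat_def [simp del]

section \<open>Skew commuting generators\<close>

lemma exponentsD: "\<alpha> \<in> exponents N \<Longrightarrow> i \<notin> {1..N} \<Longrightarrow> \<alpha> i = 0"
  by (simp add: exponents_def)

lemma finite_exponents_le:
  assumes "\<delta> \<in> exponents N"
  shows "finite {\<alpha>. \<forall>i. \<alpha> i \<le> \<delta> i}"
proof (rule finite_subset)
  show "{\<alpha>. \<forall>i. \<alpha> i \<le> \<delta> i} \<subseteq>
      {\<alpha>. \<forall>i. (i \<in> {1..N} \<longrightarrow> \<alpha> i \<in> {..Max (\<delta> ` {1..N})}) \<and> (i \<notin> {1..N} \<longrightarrow> \<alpha> i = 0)}"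
    using exponentsD[OF assms] by (auto intro: order_trans Max_ge) (metis atLeastAtMost_iff le_zero_eq)+
  show "finite \<dots>" by (rule finite_set_of_finite_funs) auto
qed

text \<open>Index set of the product formula: the ways of obtaining \<open>x\<^sup>\<delta>\<close>,
  up to a scalar, as a product of two ordered monomials.\<close>

definition splits :: "('i \<Rightarrow> nat) \<Rightarrow> (('i \<Rightarrow> nat) \<times> ('i \<Rightarrow> nat)) set" where
  "splits \<delta> = {(\<alpha>, \<gamma>). \<forall>i. \<alpha> i + \<gamma> i = \<delta> i}"

lemma finite_splits:
  assumes "\<delta> \<in> exponents N"
  shows "finite (splits \<delta>)"
proof (rule finite_subset)
  show "splits \<delta> \<subseteq> {\<alpha>. \<forall>i. \<alpha> i \<le> \<delta> i} \<times> {\<alpha>. \<forall>i. \<alpha> i \<le> \<delta> i}"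
    by (auto simp: splits_def) (metis le_add1, metis le_add2)
qed (use finite_exponents_le[OF assms] in blast)

lemma prod_power_update:
  fixes f :: "'i \<Rightarrow> 'k::comm_monoid_mult"
  assumes "finite S" "i \<in> S"
  shows "(\<Prod>j\<in>S. f j ^ (\<gamma>(i := Suc (\<gamma> i))) j) = f i * (\<Prod>j\<in>S. f j ^ \<gamma> j)"
proof -
  have "(\<Prod>j\<in>S - {i}. f j ^ (\<gamma>(i := Suc (\<gamma> i))) j) = (\<Prod>j\<in>S - {i}. f j ^ \<gamma> j)"
    by (intro prod.cong) auto
  then show ?thesis
    using assms by (simp add: prod.remove[of S i] mult.assoc)
qed

locale skew_params =
  fixes N :: nat and l :: "nat \<Rightarrow> nat \<Rightarrow> 'k::field"
  assumes l_inverse: "i \<in> {1..N} \<Longrightarrow> j \<in> {1..N} \<Longrightarrow> i \<noteq> j \<Longrightarrow> l i j * l j i = 1"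
begin

text \<open>In the algebra with relations \<open>x\<^sub>i x\<^sub>j = l i j x\<^sub>j x\<^sub>i\<close>, sorting \<open>x\<^sub>i x\<^sub>j\<close> produces the factor
  \<open>kap i j\<close>; the value \<open>0\<close> on the diagonal encodes \<open>x\<^sub>i\<^sup>2 = 0\<close>, which the relations force when
  \<open>l i i\<close> is not \<open>1\<close>. Both the quantum symmetric and the quantum exterior algebra are of this kind.\<close>

definition kap :: "nat \<Rightarrow> nat \<Rightarrow> 'k" where
  "kap i j = (if i < j then 1 else if j < i then l i j else if l i i = 1 then 1 else 0)"

text \<open>The scalar produced by sorting \<open>x\<^sub>i x\<^sup>\<gamma>\<close>. Likewise
  \<open>col\<close> belongs to \<open>x\<^sup>\<alpha> x\<^sub>j\<close> and \<open>chi\<close> to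
  \<open>x\<^sup>\<alpha> x\<^sup>\<gamma>\<close>; in the exterior case they are 0 when the product
  creates a square.\<close>

definition row :: "nat \<Rightarrow> (nat \<Rightarrow> nat) \<Rightarrow> 'k" where
  "row i \<gamma> = (\<Prod>j\<in>{1..N}. kap i j ^ \<gamma> j)"

definition col :: "(nat \<Rightarrow> nat) \<Rightarrow> nat \<Rightarrow> 'k" where
  "col \<alpha> j = (\<Prod>i\<in>{1..N}. kap i j ^ \<alpha> i)"

definition chi :: "(nat \<Rightarrow> nat) \<Rightarrow> (nat \<Rightarrow> nat) \<Rightarrow> 'k" where
  "chi \<alpha> \<gamma> = (\<Prod>i\<in>{1..N}. \<Prod>j\<in>{1..N}. kap i j ^ (\<alpha> i * \<gamma> j))"

lemma row_inc: "j \<in> {1..N} \<Longrightarrow> row i (\<gamma>(j := Suc (\<gamma> j))) = kap i j * row i \<gamma>"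
  unfolding row_def by (rule prod_power_update) auto

lemma col_inc: "i \<in> {1..N} \<Longrightarrow> col (\<alpha>(i := Suc (\<alpha> i))) j = kap i j * col \<alpha> j"
  unfolding col_def by (rule prod_power_update) auto

lemma chi_alt: "chi \<alpha> \<gamma> = (\<Prod>i\<in>{1..N}. row i \<gamma> ^ \<alpha> i)" "chi \<alpha> \<gamma> = (\<Prod>j\<in>{1..N}. col \<alpha> j ^ \<gamma> j)"
   apply (simp add: chi_def row_def prod_power_distrib mult.commute flip: power_mult)
  apply (unfold chi_def col_def, subst prod.swap)
  apply (simp add: prod_power_distrib power_mult)
  done

lemma chi_inc_left: "i \<in> {1..N} \<Longrightarrow> chi (\<alpha>(i := Suc (\<alpha> i))) \<gamma> = row i \<gamma> * chi \<alpha> \<gamma>"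
  unfolding chi_alt(1) by (rule prod_power_update) auto

lemma chi_inc_right: "j \<in> {1..N} \<Longrightarrow> chi \<alpha> (\<gamma>(j := Suc (\<gamma> j))) = col \<alpha> j * chi \<alpha> \<gamma>"
  unfolding chi_alt(2) by (rule prod_power_update) auto

lemma chi_zero [simp]: "chi (\<lambda>_. 0) \<gamma> = 1" "chi \<alpha> (\<lambda>_. 0) = 1"
  by (simp_all add: chi_def)

lemma chi_unit: "i \<in> {1..N} \<Longrightarrow> chi ((\<lambda>_. 0)(i := Suc 0)) \<gamma> = row i \<gamma>"
  "i \<in> {1..N} \<Longrightarrow> chi \<alpha> ((\<lambda>_. 0)(i := Suc 0)) = col \<alpha> i"
  using chi_inc_left[of i "\<lambda>_. 0"] chi_inc_right[of i _ "\<lambda>_. 0"] by simp_all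

text \<open>The factor by which a word differs from its sorted rearrangement, found by inserting the
  first letter into the already sorted tail. It lives on the free algebra, so nothing about the
  quotient has to be known in order to define it.\<close>

primrec word_coeff :: "nat list \<Rightarrow> 'k" where
  "word_coeff [] = 1"
| "word_coeff (x # w) = row x (count_list w) * word_coeff w"

lemma count_list_Cons: "count_list (x # w) = (count_list w)(x := Suc (count_list w x))"
  by auto

lemma count_list_append': "count_list (u @ v) = (\<lambda>i. count_list u i + count_list v i)"
  by auto

lemma row_add: "row i (\<lambda>j. \<alpha> j + \<gamma> j) = row i \<alpha> * row i \<gamma>"
  by (simp add: row_def power_add prod.distrib)

lemma count_list_exponents: "w \<in> lists {1..N} \<Longrightarrow> count_list w \<in> exponents N"
  by (auto simp: exponents_def count_list_0_iff)

text \<open>Each letter of u contributes \<open>row\<close> of everything to its right, that is of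
  the rest of u together with v, and \<open>row\<close> is multiplicative in the exponents. The
  factors coming from v make up \<open>chi\<close>.\<close>

lemma word_coeff_append:
  "u \<in> lists {1..N} \<Longrightarrow> word_coeff (u @ v) =
     word_coeff u * word_coeff v * chi (count_list u) (count_list v)"
proof (induction u)
  case Nil
  have "count_list [] = (\<lambda>_. 0)" by auto
  then show ?case by simp
next
  case (Cons x u)
  have "chi (count_list (x # u)) (count_list v) = row x (count_list v) * chi (count_list u) (count_list v)"
    unfolding count_list_Cons using Cons.prems by (intro chi_inc_left) simp
  then show ?case
    using Cons by (simp add: count_list_append' row_add mult_ac del: count_list.simps(2))
qed

definition word_vec :: "nat list \<Rightarrow> (nat \<Rightarrow> nat) \<Rightarrow> 'k" where
  "word_vec w \<alpha> = (if \<alpha> = count_list w then word_coeff w else 0)"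

section \<open>The free algebra and the ideal of relations\<close>

abbreviation F :: "('k, nat list \<Rightarrow> 'k) module" where "F \<equiv> free_alg N"

lemma words_monoid: "monoid \<lparr>carrier = lists {1..N}, monoid.mult = (@), one = []\<rparr>"
  by (rule monoidI) auto

sublocale F: kalg F
  unfolding free_alg_def by (rule monoid_alg_kalg[OF words_monoid])

lemma F_simps [simp]:
  "carrier F = finsupp (lists {1..N})" "\<zero>\<^bsub>F\<^esub> = (\<lambda>_. 0)" "\<one>\<^bsub>F\<^esub> = single []"
  "f \<oplus>\<^bsub>F\<^esub> g = (\<lambda>w. f w + g w)" "c \<odot>\<^bsub>F\<^esub> f = (\<lambda>w. c * f w)"
  "single u \<otimes>\<^bsub>F\<^esub> single v = single (u @ v)"
  by (simp_all add: free_alg_def monoid_alg_mult_single)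

lemma F_mult_linear:
  assumes "f \<in> finsupp (lists {1..N})" "f' \<in> finsupp (lists {1..N})" "g \<in> finsupp (lists {1..N})"
  shows "(\<lambda>w. f w + c * f' w) \<otimes>\<^bsub>F\<^esub> g = (\<lambda>w. (f \<otimes>\<^bsub>F\<^esub> g) w + c * (f' \<otimes>\<^bsub>F\<^esub> g) w)"
    and "g \<otimes>\<^bsub>F\<^esub> (\<lambda>w. f w + c * f' w) = (\<lambda>w. (g \<otimes>\<^bsub>F\<^esub> f) w + c * (g \<otimes>\<^bsub>F\<^esub> f') w)"
  unfolding free_alg_def by (rule monoid_alg_mult_linear[OF assms])+

text \<open>Bilinearity reduces the formula to two words. Then a single pair of exponent vectors
  contributes, and the identity becomes \<open>word_coeff_append\<close>. The point is that the
  coordinates of a product depend only on those of its factors.\<close>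

lemma lin_ext_mult:
  assumes f: "f \<in> finsupp (lists {1..N})" and g: "g \<in> finsupp (lists {1..N})"
    and \<delta>: "\<delta> \<in> exponents N"
  shows "lin_ext word_vec (f \<otimes>\<^bsub>F\<^esub> g) \<delta> =
    (\<Sum>(\<alpha>, \<gamma>)\<in>splits \<delta>. chi \<alpha> \<gamma> * lin_ext word_vec f \<alpha> * lin_ext word_vec g \<gamma>)"
  using f
proof (induction f rule: finsupp_induct)
  case zero
  then show ?case using F.l_null[of g] g by simp
next
  case (add f c u)
  have u: "(single u :: nat list \<Rightarrow> 'k) \<in> finsupp (lists {1..N})" using add(2) by simp
  have "lin_ext word_vec (single u \<otimes>\<^bsub>F\<^esub> g) \<delta> =
      (\<Sum>(\<alpha>, \<gamma>)\<in>splits \<delta>. chi \<alpha> \<gamma> * word_vec u \<alpha> * lin_ext word_vec g \<gamma>)"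
    using g
  proof (induction g rule: finsupp_induct)
    case zero
    then show ?case using F.r_null[of "single u"] u by simp
  next
    case (add g d v)
    have v: "(single v :: nat list \<Rightarrow> 'k) \<in> finsupp (lists {1..N})" using add(2) by simp
    have "chi \<alpha> \<gamma> * word_vec u \<alpha> * word_vec v \<gamma> = (if (\<alpha>, \<gamma>) = (count_list u, count_list v)
        then word_coeff (u @ v) else 0)" for \<alpha> \<gamma>
      using word_coeff_append[of u v] \<open>u \<in> lists {1..N}\<close> by (simp add: word_vec_def mult_ac)
    then have "(\<Sum>(\<alpha>, \<gamma>)\<in>splits \<delta>. chi \<alpha> \<gamma> * word_vec u \<alpha> * word_vec v \<gamma>) =
        (\<Sum>p\<in>splits \<delta>. if p = (count_list u, count_list v) then word_coeff (u @ v) else 0)"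
      by (intro sum.cong) (auto split: if_splits)
    also have "\<dots> = word_vec (u @ v) \<delta>"
      using finite_splits[OF \<delta>] by (auto simp: word_vec_def splits_def count_list_append')
    finally have "word_vec (u @ v) \<delta> =
        (\<Sum>(\<alpha>, \<gamma>)\<in>splits \<delta>. chi \<alpha> \<gamma> * word_vec u \<alpha> * word_vec v \<gamma>)" ..
    moreover have "lin_ext word_vec (single u \<otimes>\<^bsub>F\<^esub> (\<lambda>w. g w + d * single v w)) =
        (\<lambda>\<delta>. lin_ext word_vec (single u \<otimes>\<^bsub>F\<^esub> g) \<delta> + d * word_vec (u @ v) \<delta>)"
      using add(1) u v F.m_closed[of "single u" g] \<open>u \<in> lists {1..N}\<close> \<open>v \<in> lists {1..N}\<close>
      by (simp add: F_mult_linear lin_ext_add_smult[of _ "lists {1..N}"])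
    moreover have "lin_ext word_vec (\<lambda>w. g w + d * single v w) =
        (\<lambda>\<delta>. lin_ext word_vec g \<delta> + d * word_vec v \<delta>)"
      using add(1) v by (simp add: lin_ext_add_smult[of _ "lists {1..N}"])
    ultimately show ?case
      using add(3) by (simp add: sum_distrib_left algebra_simps case_prod_unfold sum.distrib)
  qed
  moreover have "lin_ext word_vec ((\<lambda>w. f w + c * single u w) \<otimes>\<^bsub>F\<^esub> g) =
      (\<lambda>\<delta>. lin_ext word_vec (f \<otimes>\<^bsub>F\<^esub> g) \<delta> + c * lin_ext word_vec (single u \<otimes>\<^bsub>F\<^esub> g) \<delta>)"
    using add(1) u g F.m_closed[of f g] F.m_closed[of "single u" g]
    by (simp add: F_mult_linear lin_ext_add_smult[of _ "lists {1..N}"])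
  moreover have "lin_ext word_vec (\<lambda>w. f w + c * single u w) =
      (\<lambda>\<delta>. lin_ext word_vec f \<delta> + c * word_vec u \<delta>)"
    using add(1) u by (simp add: lin_ext_add_smult[of _ "lists {1..N}"])
  ultimately show ?case
    using add(3) by (simp add: sum_distrib_left algebra_simps case_prod_unfold sum.distrib)
qed

definition relators :: "(nat list \<Rightarrow> 'k) set" where
  "relators = {\<lambda>w. single [i, j] w - l i j * single [j, i] w | i j. i \<in> {1..N} \<and> j \<in> {1..N}}"

lemma relator_closed:
  "i \<in> {1..N} \<Longrightarrow> j \<in> {1..N} \<Longrightarrow>
    (\<lambda>w. single [i, j] w - l i j * single [j, i] w) \<in> finsupp (lists {1..N})"
  by (intro finsupp_diff finsupp_smult) auto

lemma relators_closed: "relators \<subseteq> carrier F"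
  using relator_closed by (auto simp: relators_def)

definition W :: "(nat list \<Rightarrow> 'k) set" where "W = Idl\<^bsub>F\<^esub> relators"

lemma W_ideal: "ideal W F"
  unfolding W_def by (rule F.genideal_ideal[OF relators_closed])

lemmas W_submodule = F.ideal_submodule[OF W_ideal]

text \<open>The exponents of the monomials that survive: the square of \<open>x\<^sub>i\<close>
  vanishes whenever \<open>l i i\<close> is not 1.\<close>

definition exps :: "(nat \<Rightarrow> nat) set" where
  "exps = {\<alpha> \<in> exponents N. \<forall>i\<in>{1..N}. l i i = 1 \<or> \<alpha> i \<le> 1}"

text \<open>If the tail has admissible exponents but the whole word has not, the offending letter is
  the first one; it meets itself in the tail, and \<open>kap x x\<close> = 0 makes
  \<open>row\<close> vanish.\<close>

lemma word_coeff_eq_0: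
  "w \<in> lists {1..N} \<Longrightarrow> count_list w \<notin> exps \<Longrightarrow> word_coeff w = 0"
proof (induction w)
  case Nil
  then show ?case by (auto simp: exps_def exponents_def)
next
  case (Cons x w)
  show ?case
  proof (cases "count_list w \<in> exps")
    case True
    obtain i where i: "i \<in> {1..N}" "l i i \<noteq> 1" "count_list (x # w) i > 1"
      using Cons.prems(2) count_list_exponents[OF Cons.prems(1)]
      by (auto simp: exps_def not_le simp del: count_list.simps)
    then have "count_list w i \<le> 1" using True by (auto simp: exps_def)
    with i have "l x x \<noteq> 1" "count_list w x \<noteq> 0" by (auto split: if_splits)
    moreover have "x \<in> {1..N}" using Cons.prems by simp
    ultimately have "row x (count_list w) = 0"
      by (auto simp: row_def kap_def intro!: prod_zero)
    then show ?thesis by simp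
  qed (use Cons in auto)
qed

lemma word_vec_finsupp: "w \<in> lists {1..N} \<Longrightarrow> word_vec w \<in> finsupp exps"
  by (rule finsuppI[of "{count_list w}"]) (use word_coeff_eq_0 in \<open>auto simp: word_vec_def\<close>)

text \<open>The kernel K of the coordinate map is a two-sided ideal, because
  \<open>lin_ext_mult\<close> computes the coordinates of a product from those of the factors. So
  only the relators have to be checked: W is the smallest ideal containing them.\<close>

lemma W_kernel:
  assumes "f \<in> W"
  shows "lin_ext word_vec f = (\<lambda>_. 0)"
proof -
  define K where "K = {f \<in> carrier F. lin_ext word_vec f = (\<lambda>_. 0)}"
  have fs: "lin_ext word_vec f \<in> finsupp exps" if "f \<in> carrier F" for f
    using that by (intro lin_ext_finsupp word_vec_finsupp) auto
  have "submodule K (scalars :: 'k ring) F"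
    by (rule F.submoduleI) (auto simp: K_def lin_ext_add finsupp_add finsupp_smult lin_ext_smult)
  then have "subgroup K (add_monoid F)" by (rule submodule.axioms)
  then have "ideal K F"
  proof (rule idealI[OF F.ring_axioms])
    fix f g assume fg: "f \<in> K" "g \<in> carrier F"
    have f: "f \<in> finsupp (lists {1..N})" "lin_ext word_vec f = (\<lambda>_. 0)"
      and g: "g \<in> finsupp (lists {1..N})" using fg by (auto simp: K_def)
    have "lin_ext word_vec (f \<otimes>\<^bsub>F\<^esub> g) \<delta> = 0 \<and> lin_ext word_vec (g \<otimes>\<^bsub>F\<^esub> f) \<delta> = 0" for \<delta>
    proof (cases "\<delta> \<in> exponents N")
      case True
      then show ?thesis using f g by (simp add: lin_ext_mult case_prod_unfold)
    next
      case False
      then have "\<delta> \<notin> exps" by (auto simp: exps_def)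
      then show ?thesis
        using fs[of "f \<otimes>\<^bsub>F\<^esub> g"] fs[of "g \<otimes>\<^bsub>F\<^esub> f"] f g F.m_closed finsuppD(3) by fastforce
    qed
    then show "g \<otimes>\<^bsub>F\<^esub> f \<in> K" "f \<otimes>\<^bsub>F\<^esub> g \<in> K"
      using f g F.m_closed by (auto simp: K_def)
  qed
  moreover have "relators \<subseteq> K"
  proof
    fix r assume "r \<in> relators"
    then obtain i j where ij: "i \<in> {1..N}" "j \<in> {1..N}"
      "r = (\<lambda>w. single [i, j] w - l i j * single [j, i] w)" by (auto simp: relators_def)
    have "row x (count_list [y]) = kap x y" if "y \<in> {1..N}" for x y
    proof -
      have "count_list [y] = (\<lambda>_. 0)(y := Suc ((\<lambda>_. 0) y))" by auto
      then have "row x (count_list [y]) = kap x y * row x (\<lambda>_. 0)"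
        using row_inc[OF that] by metis
      then show ?thesis by (simp add: row_def)
    qed
    moreover have "row x (count_list []) = 1" for x by (simp add: row_def)
    ultimately have coeff: "word_coeff [x, y] = kap x y" if "y \<in> {1..N}" for x y
      using that by simp
    \<comment> \<open>For i \<noteq> j one of the two \<open>kap\<close> values is 1 and the other
      is given by \<open>l\<close>; on the diagonal either \<open>l i i\<close> = 1 or both sides
      are 0.\<close>
    have "kap i j = l i j * kap j i"
      using l_inverse[OF ij(1,2)] by (auto simp: kap_def mult.commute)
    then have "word_vec [i, j] = (\<lambda>\<alpha>. l i j * word_vec [j, i] \<alpha>)"
      unfolding word_vec_def coeff[OF ij(1)] coeff[OF ij(2)] by (auto simp: fun_eq_iff)
    moreover have "lin_ext word_vec (\<lambda>w. single [i, j] w + (- l i j) * single [j, i] w) =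
        (\<lambda>\<alpha>. word_vec [i, j] \<alpha> + (- l i j) * word_vec [j, i] \<alpha>)"
      by (subst lin_ext_add[of _ UNIV _ UNIV]) (auto intro!: finsupp_smult simp: lin_ext_smult simp del: mult_minus_left)
    ultimately show "r \<in> K"
      using relator_closed ij by (simp add: K_def)
  qed
  ultimately have "W \<subseteq> K" unfolding W_def by (rule F.genideal_minimal)
  then show ?thesis using assms by (auto simp: K_def)
qed

definition sorted_word :: "(nat \<Rightarrow> nat) \<Rightarrow> nat list" where
  "sorted_word \<alpha> = concat (map (\<lambda>i. replicate (\<alpha> i) i) [1..<Suc N])"

lemma sorted_word_closed: "sorted_word \<alpha> \<in> lists {1..N}"
  by (auto simp: sorted_word_def)

lemma count_sorted_word: "\<alpha> \<in> exponents N \<Longrightarrow> count_list (sorted_word \<alpha>) = \<alpha>"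
proof
  fix i :: nat assume \<alpha>: "\<alpha> \<in> exponents N"
  have rep: "count_list (replicate n k) i = (if k = i then n else 0)" for n and k :: nat
    by (induction n) auto
  have "count_list (concat (map (\<lambda>i. replicate (\<alpha> i) i) [1..<m])) i = (if 1 \<le> i \<and> i < m then \<alpha> i else 0)" for m
    by (induction m) (auto simp: rep)
  then show "count_list (sorted_word \<alpha>) i = \<alpha> i"
    using exponentsD[OF \<alpha>, of i] by (auto simp: sorted_word_def simp del: upt_Suc)
qed

lemma sorted_sorted_word: "sorted (sorted_word \<alpha>)"
proof -
  have "sorted (concat (map (\<lambda>i. replicate (\<alpha> i) i) [1..<m]))" for m
    by (induction m) (auto simp: sorted_append)
  then show ?thesis unfolding sorted_word_def by blast
qed

lemma sort_eq_sorted_word: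
  assumes "w \<in> lists {1..N}"
  shows "sort w = sorted_word (count_list w)"
proof (rule properties_for_sort)
  show "mset (sorted_word (count_list w)) = mset w"
    using count_sorted_word[OF count_list_exponents[OF assms]]
    by (intro multiset_eqI) (metis count_mset)
qed (rule sorted_sorted_word)

text \<open>In a sorted word no smaller letter follows x, a repeated x is admissible only if
  \<open>l x x\<close> = 1, and passing larger letters costs nothing, so every factor is 1.\<close>

lemma word_coeff_sorted:
  "sorted w \<Longrightarrow> w \<in> lists {1..N} \<Longrightarrow> count_list w \<in> exps \<Longrightarrow> word_coeff w = 1"
proof (induction w)
  case (Cons x w)
  have le: "count_list w i \<le> count_list (x # w) i" for i by simp
  have "count_list w \<in> exps"
    using Cons.prems count_list_exponents[of w] le unfolding exps_def
    by (auto simp: exps_def simp del: count_list.simps(2) intro: order_trans[OF le])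
  then have "word_coeff w = 1" using Cons by auto
  moreover have "kap x j ^ count_list w j = 1" if "j \<in> {1..N}" for j
  proof (cases j x rule: linorder_cases)
    case less
    then have "j \<notin> set w" using Cons.prems by auto
    then show ?thesis by (simp add: count_list_0_iff)
  next
    case equal
    then have "l x x = 1 \<or> count_list w x = 0" using Cons.prems(3) that by (auto simp: exps_def)
    then show ?thesis using equal by (auto simp: kap_def)
  qed (simp add: kap_def)
  ultimately show ?case by (simp add: row_def)
qed simp

lemma word_vec_sorted_word:
  assumes "\<alpha> \<in> exps"
  shows "word_vec (sorted_word \<alpha>) = single \<alpha>"
proof -
  have "count_list (sorted_word \<alpha>) = \<alpha>" using assms by (intro count_sorted_word) (auto simp: exps_def)
  moreover have "word_coeff (sorted_word \<alpha>) = 1"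
    by (rule word_coeff_sorted) (use assms calculation sorted_sorted_word sorted_word_closed in auto)
  ultimately show ?thesis by (auto simp: word_vec_def single_def)
qed

lemma W_mult:
  "f \<in> W \<Longrightarrow> g \<in> finsupp (lists {1..N}) \<Longrightarrow> f \<otimes>\<^bsub>F\<^esub> g \<in> W"
  "f \<in> W \<Longrightarrow> g \<in> finsupp (lists {1..N}) \<Longrightarrow> g \<otimes>\<^bsub>F\<^esub> f \<in> W"
  using ideal.I_r_closed[OF W_ideal] ideal.I_l_closed[OF W_ideal] by auto

lemma W_combine:
  "f \<in> W \<Longrightarrow> g \<in> W \<Longrightarrow> (\<And>w. f w + c * g w = h w) \<Longrightarrow> h \<in> W"
  using F.submodule_add[OF W_submodule, of f "\<lambda>w. c * g w"] F.submodule_smult[OF W_submodule, of g c]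
  by simp

lemma W_mult_single:
  assumes "(\<lambda>w. single u w - c * single v w) \<in> W" "u \<in> lists {1..N}" "v \<in> lists {1..N}"
    "a \<in> lists {1..N}" "b \<in> lists {1..N}"
  shows "(\<lambda>w. single (a @ u @ b) w - c * single (a @ v @ b) w) \<in> W"
proof -
  have S: "single x \<in> finsupp (lists {1..N})" if "x \<in> lists {1..N}" for x using that by simp
  have "(\<lambda>w. single u w + (- c) * single v w) \<otimes>\<^bsub>F\<^esub> single b =
      (\<lambda>w. single (u @ b) w + (- c) * single (v @ b) w)"
    using assms by (subst F_mult_linear) (auto simp del: mult_minus_left)
  moreover have "single a \<otimes>\<^bsub>F\<^esub> (\<lambda>w. single (u @ b) w + (- c) * single (v @ b) w) =
      (\<lambda>w. single (a @ u @ b) w + (- c) * single (a @ v @ b) w)"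
    using assms by (subst F_mult_linear) (auto simp del: mult_minus_left)
  ultimately show ?thesis
    using W_mult(2)[OF W_mult(1)[OF assms(1) S[OF assms(5)]] S[OF assms(4)]] by simp
qed

lemma relator_in_W:
  "i \<in> {1..N} \<Longrightarrow> j \<in> {1..N} \<Longrightarrow> (\<lambda>w. single [i, j] w - l i j * single [j, i] w) \<in> W"
  using F.genideal_self[OF relators_closed] unfolding W_def relators_def by blast

lemma W_zero: "(\<lambda>_. 0) \<in> W"
  using F.submodule_zero[OF W_submodule] by simp

text \<open>One pass of insertion sort modulo W, with a relator for each letter that x overtakes.
  The scalar is left unspecified, since spanning does not ask for its value.\<close>

lemma single_Cons_insort:
  "x \<in> {1..N} \<Longrightarrow> w \<in> lists {1..N} \<Longrightarrow> \<exists>c. (\<lambda>v. single (x # w) v - c * single (insort x w) v) \<in> W"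
proof (induction w)
  case Nil
  show ?case using W_zero by (intro exI[of _ 1]) simp
next
  case (Cons y w)
  show ?case
  proof (cases "x \<le> y")
    case True
    then show ?thesis using W_zero by (intro exI[of _ 1]) simp
  next
    case False
    obtain c where c: "(\<lambda>v. single (x # w) v - c * single (insort x w) v) \<in> W"
      using Cons by auto
    have 1: "(\<lambda>v. single (y # x # w) v - c * single (y # insort x w) v) \<in> W"
      using W_mult_single[OF c, of "[y]" "[]"] Cons.prems by (auto simp: set_insort_key in_lists_conv_set)
    have 2: "(\<lambda>v. single (x # y # w) v - l x y * single (y # x # w) v) \<in> W"
      using W_mult_single[OF relator_in_W[of x y], of "[]" w] Cons.prems by auto
    have "(\<lambda>v. single (x # y # w) v - l x y * c * single (y # insort x w) v) \<in> W"
      by (rule W_combine[OF 2 1, where c = "l x y"]) (simp add: algebra_simps)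
    then show ?thesis using False by auto
  qed
qed

lemma single_sort: "w \<in> lists {1..N} \<Longrightarrow> \<exists>c. (\<lambda>v. single w v - c * single (sort w) v) \<in> W"
proof (induction w)
  case Nil
  show ?case using W_zero by (intro exI[of _ 1]) simp
next
  case (Cons x w)
  then obtain c where c: "(\<lambda>v. single w v - c * single (sort w) v) \<in> W" by auto
  have sw: "sort w \<in> lists {1..N}" using Cons.prems by (auto simp: in_lists_conv_set)
  obtain d where d: "(\<lambda>v. single (x # sort w) v - d * single (insort x (sort w)) v) \<in> W"
    using single_Cons_insort[OF _ sw] Cons.prems by auto
  have "(\<lambda>v. single (x # w) v - c * single (x # sort w) v) \<in> W"
    using W_mult_single[OF c _ sw, of "[x]" "[]"] Cons.prems by auto
  then have "(\<lambda>v. single (x # w) v - c * d * single (insort x (sort w)) v) \<in> W"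
    by (rule W_combine[where c = c]) (use d in \<open>auto simp: algebra_simps\<close>)
  then show ?case by auto
qed

text \<open>Equal letters are adjacent in a sorted word, and for \<open>l i i\<close> different from
  1 the relator of i with itself is a nonzero multiple of the square of
  \<open>x\<^sub>i\<close>.\<close>

lemma sorted_word_in_W:
  assumes "\<alpha> \<in> exponents N" "\<alpha> \<notin> exps"
  shows "single (sorted_word \<alpha>) \<in> W"
proof -
  obtain i where i: "i \<in> {1..N}" "l i i \<noteq> 1" "\<alpha> i \<ge> 2" using assms by (force simp: exps_def)
  have "i \<in> set [1..<Suc N]" using i by auto
  then obtain ys zs where "[1..<Suc N] = ys @ i # zs" by (meson split_list)
  moreover obtain k where "\<alpha> i = 2 + k" using le_Suc_ex[OF i(3)] by auto
  ultimately have uv: "\<exists>u v. sorted_word \<alpha> = u @ [i, i] @ v"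
    unfolding sorted_word_def
    by (intro exI[of _ "concat (map (\<lambda>i. replicate (\<alpha> i) i) ys)"]
        exI[of _ "replicate k i @ concat (map (\<lambda>i. replicate (\<alpha> i) i) zs)"]) (simp del: upt_Suc)
  then obtain u v where uv: "sorted_word \<alpha> = u @ [i, i] @ v" by blast
  \<comment> \<open>The relator for (i, i) is (1 - \<open>l i i\<close>) times
    \<open>[i, i]\<close>, which explains the constant; the void second term gives the statement the
    form that \<open>W_mult_single\<close> expects.\<close>
  have "(\<lambda>w. single [i, i] w - 0 * single [] w) \<in> W"
    by (rule W_combine[OF W_zero relator_in_W[OF i(1) i(1)], where c = "1 / (1 - l i i)"])
      (use i(2) in \<open>simp add: field_simps\<close>)
  from W_mult_single[OF this, of u v] show ?thesis
    using sorted_word_closed[of \<alpha>] uv by auto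
qed

lemma word_span:
  assumes w: "w \<in> lists {1..N}"
  shows "\<exists>y\<in>finsupp (sorted_word ` exps). (\<lambda>z. single w z - y z) \<in> W"
proof -
  obtain c where c: "(\<lambda>v. single w v - c * single (sorted_word (count_list w)) v) \<in> W"
    using single_sort[OF w] sort_eq_sorted_word[OF w] by metis
  show ?thesis
  proof (cases "count_list w \<in> exps")
    case True
    then show ?thesis
      using c by (intro bexI[of _ "\<lambda>v. c * single (sorted_word (count_list w)) v"] finsupp_smult) auto
  next
    case False
    have "(\<lambda>v. single w v - 0) \<in> W"
      using sorted_word_in_W[OF count_list_exponents[OF w] False]
      by (rule W_combine[OF c, where c = c]) simp
    then show ?thesis by (intro bexI[of _ "\<lambda>_. 0"]) auto
  qed
qed

section \<open>The presented algebra in coordinates\<close>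

definition alg :: "('k, (nat list \<Rightarrow> 'k) set) module" where "alg = presented_alg N relators"

definition coord :: "(nat list \<Rightarrow> 'k) set \<Rightarrow> (nat \<Rightarrow> nat) \<Rightarrow> 'k" where
  "coord = quotient_coord word_vec"

lemma alg_eq: "alg = quotient F W"
  by (simp add: alg_def presented_alg_def W_def)

sublocale alg: kalg alg
  unfolding alg_eq by (rule F.quotient_kalg[OF W_ideal])

lemma coord_coset: "f \<in> carrier F \<Longrightarrow> coord (W +>\<^bsub>F\<^esub> f) = lin_ext word_vec f"
  and alg_coords: "coords alg exps coord"
proof -
  let ?M = "\<lparr>carrier = lists {1..N}, monoid.mult = (@), one = []\<rparr>"
  note * = monoid_alg_quotient_coords[where M = ?M and W = W and t = word_vec and I = exps
      and s = sorted_word, folded free_alg_def]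
  show "coord (W +>\<^bsub>F\<^esub> f) = lin_ext word_vec f" if "f \<in> carrier F"
    unfolding coord_def
    using that by (intro *(2)) (auto simp: W_submodule word_vec_finsupp W_kernel sorted_word_closed
        word_vec_sorted_word word_span)
  show "coords alg exps coord"
    unfolding coord_def alg_eq
    by (intro *(1)) (auto simp: W_submodule word_vec_finsupp W_kernel sorted_word_closed
        word_vec_sorted_word word_span)
qed

sublocale alg: coords alg exps coord by (rule alg_coords)

lemma alg_carrier: "carrier alg = (\<lambda>f. W +>\<^bsub>F\<^esub> f) ` carrier F"
  unfolding alg_eq by (rule F.quotient_carrier[OF W_submodule])

lemma coord_mult:
  assumes "a \<in> carrier alg" "b \<in> carrier alg" "\<delta> \<in> exponents N"
  shows "coord (a \<otimes>\<^bsub>alg\<^esub> b) \<delta> = (\<Sum>(\<alpha>, \<gamma>)\<in>splits \<delta>. chi \<alpha> \<gamma> * coord a \<alpha> * coord b \<gamma>)"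
proof -
  obtain f g where fg: "f \<in> carrier F" "a = W +>\<^bsub>F\<^esub> f" "g \<in> carrier F" "b = W +>\<^bsub>F\<^esub> g"
    using assms by (auto simp: alg_carrier)
  then show ?thesis
    using F.quotient_kalg(2)[OF W_ideal fg(1,3)] F.m_closed[OF fg(1,3)] assms(3)
    by (simp add: alg_eq coord_coset lin_ext_mult del: F_simps(1)) (simp add: lin_ext_mult)
qed

definition gen :: "nat \<Rightarrow> (nat list \<Rightarrow> 'k) set" where "gen = presented_gen N relators"

lemma gen_eq: "gen i = W +>\<^bsub>F\<^esub> single [i]"
  by (simp add: gen_def presented_gen_def W_def Let_def)

lemma gen_closed: "i \<in> {1..N} \<Longrightarrow> gen i \<in> carrier alg"
  by (auto simp: gen_eq alg_carrier)

lemma monomial_eq: "ordered_monomial alg gen N \<alpha> = W +>\<^bsub>F\<^esub> single (sorted_word \<alpha>)"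
proof -
  have pow: "gen i [^]\<^bsub>alg\<^esub> (n::nat) = W +>\<^bsub>F\<^esub> single (replicate n i)" if "i \<in> {1..N}" for i n
  proof (induction n)
    case 0
    show ?case using F.quotient_kalg(3)[OF W_ideal] by (simp add: alg_eq)
  next
    case (Suc n)
    have "(W +>\<^bsub>F\<^esub> single (replicate n i)) \<otimes>\<^bsub>alg\<^esub> (W +>\<^bsub>F\<^esub> single [i]) =
        W +>\<^bsub>F\<^esub> single (replicate (Suc n) i)"
      unfolding alg_eq using that F.quotient_kalg(2)[OF W_ideal, of "single (replicate n i)" "single [i]"]
      by (auto simp: replicate_append_same in_lists_conv_set)
    then show ?case using Suc by (simp add: gen_eq)
  qed
  have "foldr (\<lambda>i y. (gen i [^]\<^bsub>alg\<^esub> \<alpha> i) \<otimes>\<^bsub>alg\<^esub> y) xs \<one>\<^bsub>alg\<^esub> =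
      W +>\<^bsub>F\<^esub> single (concat (map (\<lambda>i. replicate (\<alpha> i) i) xs))" if "xs \<in> lists {1..N}" for xs
    using that
  proof (induction xs)
    case Nil
    show ?case using F.quotient_kalg(3)[OF W_ideal] by (simp add: alg_eq)
  next
    case (Cons i xs)
    have *: "single (replicate (\<alpha> i) i) \<in> carrier F"
      "single (concat (map (\<lambda>i. replicate (\<alpha> i) i) xs)) \<in> carrier F"
      using Cons.hyps by (auto simp: in_lists_conv_set)
    have "(W +>\<^bsub>F\<^esub> single (replicate (\<alpha> i) i)) \<otimes>\<^bsub>alg\<^esub>
        (W +>\<^bsub>F\<^esub> single (concat (map (\<lambda>i. replicate (\<alpha> i) i) xs))) =
        W +>\<^bsub>F\<^esub> single (replicate (\<alpha> i) i @ concat (map (\<lambda>i. replicate (\<alpha> i) i) xs))"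
      unfolding alg_eq using F.quotient_kalg(2)[OF W_ideal *] by simp
    then show ?case using Cons by (simp add: pow)
  qed
  then show ?thesis
    unfolding ordered_monomial_def sorted_word_def by (simp add: in_lists_conv_set del: upt_Suc)
qed

lemma monomial_closed: "ordered_monomial alg gen N \<alpha> \<in> carrier alg"
  using sorted_word_closed by (auto simp: monomial_eq alg_carrier)

lemma coord_monomial: "\<alpha> \<in> exps \<Longrightarrow> coord (ordered_monomial alg gen N \<alpha>) = single \<alpha>"
  using sorted_word_closed by (simp add: monomial_eq coord_coset word_vec_sorted_word)

lemma coord_gen: "i \<in> {1..N} \<Longrightarrow> coord (gen i) = single ((\<lambda>_. 0)(i := Suc 0))"
proof -
  assume i: "i \<in> {1..N}"
  have "count_list [i] = (\<lambda>_. 0)(i := Suc 0)" by auto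
  moreover have "word_coeff [i] = 1" by (simp add: row_def)
  ultimately have "word_vec [i] = single ((\<lambda>_. 0)(i := Suc 0))"
    by (auto simp: word_vec_def single_def simp del: word_coeff.simps)
  then show ?thesis using i by (simp add: gen_eq coord_coset)
qed

text \<open>In the product formula only the split of \<delta> with the unit vector [i] as one part
  contributes, and there is none if \<open>\<delta> i\<close> = 0. For \<delta> outside the exponent
  vectors both sides vanish by support.\<close>

lemma coord_gen_mult:
  assumes i: "i \<in> {1..N}" and a: "a \<in> carrier alg"
  shows "coord (gen i \<otimes>\<^bsub>alg\<^esub> a) \<delta> =
      (if \<delta> i = 0 then 0 else row i (\<delta>(i := \<delta> i - 1)) * coord a (\<delta>(i := \<delta> i - 1)))" (is ?A)
    and "coord (a \<otimes>\<^bsub>alg\<^esub> gen i) \<delta> =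
      (if \<delta> i = 0 then 0 else col (\<delta>(i := \<delta> i - 1)) i * coord a (\<delta>(i := \<delta> i - 1)))" (is ?B)
proof -
  let ?e = "(\<lambda>_. 0)(i := Suc 0)" and ?\<delta> = "\<delta>(i := \<delta> i - 1)"
  have g: "gen i \<in> carrier alg" using gen_closed[OF i] .
  show ?A ?B
  proof (atomize (full), cases "\<delta> \<in> exponents N")
    case False
    have "\<delta> \<notin> exps" "?\<delta> \<notin> exps" using False i by (auto simp: exps_def exponents_def)
    then show "?A \<and> ?B" using g a alg.coords_outside by simp
  next
    case True
    have s1: "(?e, \<gamma>) \<in> splits \<delta> \<longleftrightarrow> \<delta> i \<noteq> 0 \<and> \<gamma> = ?\<delta>" for \<gamma>
      by (auto simp: splits_def fun_eq_iff split: if_splits)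
    have s2: "(\<alpha>, ?e) \<in> splits \<delta> \<longleftrightarrow> \<delta> i \<noteq> 0 \<and> \<alpha> = ?\<delta>" for \<alpha>
      by (auto simp: splits_def fun_eq_iff split: if_splits)
    have "coord (gen i \<otimes>\<^bsub>alg\<^esub> a) \<delta> =
        (\<Sum>p\<in>splits \<delta>. if p = (?e, ?\<delta>) then row i ?\<delta> * coord a ?\<delta> else 0)"
      unfolding coord_mult[OF g a True]
      using s1 by (intro sum.cong) (auto simp: coord_gen[OF i] single_def chi_unit[OF i] split: if_splits)
    moreover have "coord (a \<otimes>\<^bsub>alg\<^esub> gen i) \<delta> =
        (\<Sum>p\<in>splits \<delta>. if p = (?\<delta>, ?e) then col ?\<delta> i * coord a ?\<delta> else 0)"
      unfolding coord_mult[OF a g True]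
      using s2 by (intro sum.cong) (auto simp: coord_gen[OF i] single_def chi_unit[OF i] split: if_splits)
    ultimately show "?A \<and> ?B"
      using finite_splits[OF True] s1[of ?\<delta>] s2[of ?\<delta>] by auto
  qed
qed

end

section \<open>Tensor products\<close>

lemma single_Pair: "single (i, j) (a, b) = single i a * single j b"
  by (simp add: single_def)

lemma lin_ext_kernel_submodule:
  fixes M :: "('m, 'b) monoid_scheme" and t :: "'m \<Rightarrow> 'i \<Rightarrow> 'k::field"
  shows "submodule {f \<in> finsupp (carrier M). lin_ext t f = (\<lambda>_. 0)} (scalars :: 'k ring)
     (monoid_alg M :: ('k, 'm \<Rightarrow> 'k) module)"
proof -
  interpret vsp "monoid_alg M :: ('k, 'm \<Rightarrow> 'k) module" by (rule monoid_alg_vsp)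
  show ?thesis
    by (rule submoduleI) (auto simp: lin_ext_add finsupp_add finsupp_smult lin_ext_smult)
qed

lemma lin_ext_relator:
  "lin_ext t (\<lambda>p. single x p - single y p - single z p) = (\<lambda>i. t x i - t y i - t z i)"
    "lin_ext t (\<lambda>p. single x p - c * single y p) = (\<lambda>i. t x i - c * t y i)"
proof -
  have *: "lin_ext t (\<lambda>p. single x p + c * single y p) = (\<lambda>i. t x i + c * t y i)" for x y c
    using lin_ext_add_smult[of "single x" UNIV "single y" t c] by simp
  from *[of x "-c" y] show "lin_ext t (\<lambda>p. single x p - c * single y p) = (\<lambda>i. t x i - c * t y i)"
    by simp
  have "lin_ext t (\<lambda>p. (single x p + (-1) * single y p) + (-1) * single z p) =
      (\<lambda>i. lin_ext t (\<lambda>p. single x p + (-1) * single y p) i + (-1) * t z i)"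
    by (subst lin_ext_add_smult[of _ UNIV])
      (auto intro!: finsupp_add finsupp_diff simp del: mult_minus_left)
  then show "lin_ext t (\<lambda>p. single x p - single y p - single z p) = (\<lambda>i. t x i - t y i - t z i)"
    unfolding * by simp
qed

text \<open>Universal property in coordinates: a bilinear t kills every bilinearity relator and
  hence their span. It makes the coordinates of a tensor, and later the action of the enveloping
  algebra, independent of representatives.\<close>

lemma lin_ext_tensor_rel:
  fixes A :: "('k::field, 'a) module" and B :: "('k, 'b) module" and t :: "'a \<times> 'b \<Rightarrow> 'i \<Rightarrow> 'k"
  assumes A: "vsp A" and B: "vsp B"
    and t: "\<And>a a' b. a \<in> carrier A \<Longrightarrow> a' \<in> carrier A \<Longrightarrow> b \<in> carrier B \<Longrightarrow>
        t (a \<oplus>\<^bsub>A\<^esub> a', b) = (\<lambda>i. t (a, b) i + t (a', b) i)"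
      "\<And>a b b'. a \<in> carrier A \<Longrightarrow> b \<in> carrier B \<Longrightarrow> b' \<in> carrier B \<Longrightarrow>
        t (a, b \<oplus>\<^bsub>B\<^esub> b') = (\<lambda>i. t (a, b) i + t (a, b') i)"
      "\<And>c a b. a \<in> carrier A \<Longrightarrow> b \<in> carrier B \<Longrightarrow> t (c \<odot>\<^bsub>A\<^esub> a, b) = (\<lambda>i. c * t (a, b) i)"
      "\<And>c a b. a \<in> carrier A \<Longrightarrow> b \<in> carrier B \<Longrightarrow> t (a, c \<odot>\<^bsub>B\<^esub> b) = (\<lambda>i. c * t (a, b) i)"
    and f: "f \<in> tensor_rel A B"
  shows "lin_ext t f = (\<lambda>_. 0)"
proof -
  let ?M = "monoid_alg (A \<times>\<times> B) :: ('k, 'a \<times> 'b \<Rightarrow> 'k) module"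
  interpret A: vsp A by fact
  interpret B: vsp B by fact
  interpret M: vsp ?M by (rule monoid_alg_vsp)
  have closed: "bilin_relators A B \<subseteq> finsupp (carrier (A \<times>\<times> B))"
    by (auto simp: bilin_relators_def DirProd_def intro!: finsupp_diff finsupp_smult)
  have "tensor_rel A B \<subseteq> {f \<in> finsupp (carrier (A \<times>\<times> B)). lin_ext t f = (\<lambda>_. 0)}"
    unfolding tensor_rel_def
  proof (intro M.lin_span_least lin_ext_kernel_submodule subsetI CollectI conjI)
    fix r assume r: "r \<in> bilin_relators A B"
    then show "r \<in> finsupp (carrier (A \<times>\<times> B))" using closed by blast
    show "lin_ext t r = (\<lambda>_. 0)"
      using r unfolding bilin_relators_def
      by (auto simp: lin_ext_relator t)
  qed
  then show ?thesis using f by blast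
qed

lemma tensor_rel_submodule:
  fixes A :: "('k::field, 'a) module" and B :: "('k, 'b) module"
  assumes A: "vsp A" and B: "vsp B"
  shows "submodule (tensor_rel A B) (scalars :: 'k ring)
      (monoid_alg (A \<times>\<times> B) :: ('k, 'a \<times> 'b \<Rightarrow> 'k) module)"
    and "bilin_relators A B \<subseteq> tensor_rel A B"
proof -
  let ?M = "monoid_alg (A \<times>\<times> B) :: ('k, 'a \<times> 'b \<Rightarrow> 'k) module"
  interpret A: vsp A by fact
  interpret B: vsp B by fact
  interpret M: vsp ?M by (rule monoid_alg_vsp)
  have "bilin_relators A B \<subseteq> carrier ?M"
    by (auto simp: bilin_relators_def DirProd_def intro!: finsupp_diff finsupp_smult)
  then show "submodule (tensor_rel A B) (scalars :: 'k ring) ?M"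
    unfolding tensor_rel_def by (rule M.lin_span_submodule)
  show "bilin_relators A B \<subseteq> tensor_rel A B"
    unfolding tensor_rel_def by (rule M.lin_span_superset)
qed

definition tensor_coord ::
  "('a \<Rightarrow> 'i \<Rightarrow> 'k) \<Rightarrow> ('b \<Rightarrow> 'j \<Rightarrow> 'k) \<Rightarrow> ('a \<times> 'b \<Rightarrow> 'k::field) set \<Rightarrow> 'i \<times> 'j \<Rightarrow> 'k" where
  "tensor_coord \<phi> \<psi> = quotient_coord (\<lambda>(a, b) (i, j). \<phi> a i * \<psi> b j)"

locale tensor_coords = A: coords A I \<phi> + B: coords B J \<psi>
  for A :: "('k::field, 'a) module" and I :: "'i set" and \<phi>
    and B :: "('k, 'b) module" and J :: "'j set" and \<psi>
begin

abbreviation M :: "('k, 'a \<times> 'b \<Rightarrow> 'k) module" where "M \<equiv> monoid_alg (A \<times>\<times> B)"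

definition pvec :: "'a \<times> 'b \<Rightarrow> 'i \<times> 'j \<Rightarrow> 'k" where
  "pvec = (\<lambda>(a, b) (i, j). \<phi> a i * \<psi> b j)"

sublocale M: vsp M by (rule monoid_alg_vsp)

lemmas rel_submodule = tensor_rel_submodule(1)[OF A.vsp_axioms B.vsp_axioms]
lemmas relators_rel = tensor_rel_submodule(2)[OF A.vsp_axioms B.vsp_axioms]

lemma rel_combine: "f \<in> tensor_rel A B \<Longrightarrow> g \<in> tensor_rel A B \<Longrightarrow>
    (\<And>p. f p + c * g p = h p) \<Longrightarrow> h \<in> tensor_rel A B"
  using M.submodule_add[OF rel_submodule, of f "\<lambda>p. c * g p"] M.submodule_smult[OF rel_submodule, of g c]
  by simp

lemma carrier_prod [simp]: "carrier (A \<times>\<times> B) = carrier A \<times> carrier B"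
  by (simp add: DirProd_def)

definition basis_pair :: "'i \<times> 'j \<Rightarrow> 'a \<times> 'b" where
  "basis_pair = (\<lambda>(i, j). (A.vec (single i), B.vec (single j)))"

text \<open>Congruence, modulo the relations, to a combination of pairs of basis vectors: the
  spanning hypothesis of \<open>monoid_alg_quotient_coords\<close> in a form that passes to linear
  combinations.\<close>

definition reducible :: "('a \<times> 'b \<Rightarrow> 'k) \<Rightarrow> bool" where
  "reducible f \<longleftrightarrow> (\<exists>y\<in>finsupp (basis_pair ` (I \<times> J)). (\<lambda>z. f z - y z) \<in> tensor_rel A B)"

lemma reducible_rel: "f \<in> tensor_rel A B \<Longrightarrow> reducible f"
  unfolding reducible_def by (rule bexI[of _ "\<lambda>_. 0"]) auto

lemma reducible_combine:
  assumes "reducible f" "reducible g" "\<And>p. f p + c * g p = h p"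
  shows "reducible h"
proof -
  obtain y y' where y: "y \<in> finsupp (basis_pair ` (I \<times> J))" "(\<lambda>z. f z - y z) \<in> tensor_rel A B"
    "y' \<in> finsupp (basis_pair ` (I \<times> J))" "(\<lambda>z. g z - y' z) \<in> tensor_rel A B"
    using assms(1,2) unfolding reducible_def by blast
  have "(\<lambda>z. h z - (y z + c * y' z)) \<in> tensor_rel A B"
    by (rule rel_combine[OF y(2,4), of c]) (simp add: algebra_simps flip: assms(3))
  then show ?thesis
    unfolding reducible_def
    by (rule bexI[of _ "\<lambda>z. y z + c * y' z"]) (intro finsupp_add finsupp_smult y)
qed

text \<open>Both arguments are expanded in their bases, at the cost of one additivity and one
  homogeneity relator for each term.\<close>

lemma reducible_single:
  assumes "a \<in> carrier A" "b \<in> carrier B"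
  shows "reducible (single (a, b))"
  using assms(1)
proof (induction a rule: A.carrier_induct)
  case zero
  \<comment> \<open>Homogeneity with scalar 0: this relator is the pair with first entry zero
    itself.\<close>
  have "(\<lambda>p. single (0 \<odot>\<^bsub>A\<^esub> \<zero>\<^bsub>A\<^esub>, b) p - 0 * single (\<zero>\<^bsub>A\<^esub>, b) p) \<in> bilin_relators A B"
    unfolding bilin_relators_def using assms(2) by blast
  then show ?case using relators_rel by (intro reducible_rel) auto
next
  case (add a c i)
  let ?v = "A.vec (single i)"
  have v: "?v \<in> carrier A" using add A.vec_closed by simp
  have "reducible (single (?v, b))"
    using assms(2)
  proof (induction b rule: B.carrier_induct)
    case zero
    have "(\<lambda>p. single (?v, 0 \<odot>\<^bsub>B\<^esub> \<zero>\<^bsub>B\<^esub>) p - 0 * single (?v, \<zero>\<^bsub>B\<^esub>) p) \<in> bilin_relators A B"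
      unfolding bilin_relators_def using v by blast
    then show ?case using relators_rel by (intro reducible_rel) auto
  next
    case (add b d j)
    let ?w = "B.vec (single j)"
    have w: "?w \<in> carrier B" using add B.vec_closed by simp
    have "single (?v, ?w) \<in> finsupp (basis_pair ` (I \<times> J))"
      using add \<open>i \<in> I\<close> by (auto simp: basis_pair_def)
    then have vw: "reducible (single (?v, ?w))"
      unfolding reducible_def using M.submodule_zero[OF rel_submodule]
      by (intro bexI[of _ "single (?v, ?w)"]) auto
    have "(\<lambda>p. single (?v, d \<odot>\<^bsub>B\<^esub> ?w) p - d * single (?v, ?w) p) \<in> bilin_relators A B"
      unfolding bilin_relators_def using v w by blast
    then have "reducible (\<lambda>p. single (?v, d \<odot>\<^bsub>B\<^esub> ?w) p - d * single (?v, ?w) p)"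
      using relators_rel by (intro reducible_rel) auto
    then have dw: "reducible (single (?v, d \<odot>\<^bsub>B\<^esub> ?w))"
      using vw by (rule reducible_combine[where c = d]) simp
    have "(\<lambda>p. single (?v, b \<oplus>\<^bsub>B\<^esub> d \<odot>\<^bsub>B\<^esub> ?w) p - single (?v, b) p - single (?v, d \<odot>\<^bsub>B\<^esub> ?w) p)
        \<in> bilin_relators A B"
      unfolding bilin_relators_def using v w add(1) B.smult_closed[OF w] by blast
    then have "reducible (\<lambda>p. single (?v, b \<oplus>\<^bsub>B\<^esub> d \<odot>\<^bsub>B\<^esub> ?w) p - single (?v, b) p - single (?v, d \<odot>\<^bsub>B\<^esub> ?w) p)"
      using relators_rel by (intro reducible_rel) auto
    then have "reducible (\<lambda>p. single (?v, b \<oplus>\<^bsub>B\<^esub> d \<odot>\<^bsub>B\<^esub> ?w) p - single (?v, d \<odot>\<^bsub>B\<^esub> ?w) p)"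
      using add(3) by (rule reducible_combine[where c = 1]) simp
    then show ?case
      using dw by (rule reducible_combine[where c = 1]) simp
  qed
  note vb = this
  have "(\<lambda>p. single (c \<odot>\<^bsub>A\<^esub> ?v, b) p - c * single (?v, b) p) \<in> bilin_relators A B"
    unfolding bilin_relators_def using v assms(2) by blast
  then have "reducible (\<lambda>p. single (c \<odot>\<^bsub>A\<^esub> ?v, b) p - c * single (?v, b) p)"
    using relators_rel by (intro reducible_rel) auto
  then have cv: "reducible (single (c \<odot>\<^bsub>A\<^esub> ?v, b))"
    using vb by (rule reducible_combine[where c = c]) simp
  have "(\<lambda>p. single (a \<oplus>\<^bsub>A\<^esub> c \<odot>\<^bsub>A\<^esub> ?v, b) p - single (a, b) p - single (c \<odot>\<^bsub>A\<^esub> ?v, b) p)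
      \<in> bilin_relators A B"
    unfolding bilin_relators_def using v assms(2) add(1) A.smult_closed[OF v] by blast
  then have "reducible (\<lambda>p. single (a \<oplus>\<^bsub>A\<^esub> c \<odot>\<^bsub>A\<^esub> ?v, b) p - single (a, b) p - single (c \<odot>\<^bsub>A\<^esub> ?v, b) p)"
    using relators_rel by (intro reducible_rel) auto
  then have "reducible (\<lambda>p. single (a \<oplus>\<^bsub>A\<^esub> c \<odot>\<^bsub>A\<^esub> ?v, b) p - single (c \<odot>\<^bsub>A\<^esub> ?v, b) p)"
    using add(3) by (rule reducible_combine[where c = 1]) simp
  then show ?case
    using cv by (rule reducible_combine[where c = 1]) simp
qed

lemma pvec_finsupp: "x \<in> carrier (A \<times>\<times> B) \<Longrightarrow> pvec x \<in> finsupp (I \<times> J)"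
proof -
  assume "x \<in> carrier (A \<times>\<times> B)"
  then obtain a b where x: "x = (a, b)" "a \<in> carrier A" "b \<in> carrier B" by auto
  show ?thesis
    using A.coords_finsupp[OF x(2)] B.coords_finsupp[OF x(3)]
    by (intro finsuppI[of "{i. \<phi> a i \<noteq> 0} \<times> {j. \<psi> b j \<noteq> 0}"])
      (auto simp: pvec_def x finsupp_def)
qed

lemma pvec_basis_pair: "p \<in> I \<times> J \<Longrightarrow> basis_pair p \<in> carrier (A \<times>\<times> B) \<and> pvec (basis_pair p) = single p"
  by (cases p) (auto simp: basis_pair_def pvec_def A.vec_closed B.vec_closed A.coords_vec B.coords_vec
      single_Pair fun_eq_iff)

lemma tensor_coords: "coords (tensor A B) (I \<times> J) (tensor_coord \<phi> \<psi>)"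
  and tensor_coord_coset: "f \<in> finsupp (carrier A \<times> carrier B) \<Longrightarrow>
    tensor_coord \<phi> \<psi> (tensor_rel A B +>\<^bsub>M\<^esub> f) = lin_ext pvec f"
proof -
  have ker: "lin_ext pvec f = (\<lambda>_. 0)" if "f \<in> tensor_rel A B" for f
    by (rule lin_ext_tensor_rel[OF A.vsp_axioms B.vsp_axioms _ _ _ _ that])
      (auto simp: pvec_def A.coords_add B.coords_add A.coords_smult B.coords_smult algebra_simps)
  have span: "\<exists>y\<in>finsupp (basis_pair ` (I \<times> J)). (\<lambda>z. single x z - y z) \<in> tensor_rel A B"
    if "x \<in> carrier (A \<times>\<times> B)" for x
    using that reducible_single by (auto simp: reducible_def)
  note * = monoid_alg_quotient_coords[OF rel_submodule pvec_finsupp ker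
      conjunct1[OF pvec_basis_pair] conjunct2[OF pvec_basis_pair] span]
  show "coords (tensor A B) (I \<times> J) (tensor_coord \<phi> \<psi>)"
    using *(1) by (simp add: tensor_def tensor_coord_def pvec_def)
  show "tensor_coord \<phi> \<psi> (tensor_rel A B +>\<^bsub>M\<^esub> f) = lin_ext pvec f"
    if "f \<in> finsupp (carrier A \<times> carrier B)"
    using *(2)[of f] that by (simp add: tensor_coord_def pvec_def)
qed

sublocale T: coords "tensor A B" "I \<times> J" "tensor_coord \<phi> \<psi>"
  by (rule tensor_coords)

lemma tensor_carrier: "carrier (tensor A B) = (\<lambda>f. tensor_rel A B +>\<^bsub>M\<^esub> f) ` finsupp (carrier A \<times> carrier B)"
  using M.quotient_carrier[OF rel_submodule] by (simp add: tensor_def)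

lemma pure_closed: "a \<in> carrier A \<Longrightarrow> b \<in> carrier B \<Longrightarrow> pure_tensor A B a b \<in> carrier (tensor A B)"
  by (auto simp: tensor_carrier pure_tensor_def)

lemma coord_pure: "a \<in> carrier A \<Longrightarrow> b \<in> carrier B \<Longrightarrow>
    tensor_coord \<phi> \<psi> (pure_tensor A B a b) (i, j) = \<phi> a i * \<psi> b j"
  by (simp add: pure_tensor_def tensor_coord_coset pvec_def)

text \<open>The scalar in front of a basis vector is absorbed into the left factor, so sums of pure
  tensors are enough.\<close>

lemma tensor_induct [consumes 1, case_names zero add]:
  assumes x: "x \<in> carrier (tensor A B)" and "P \<zero>\<^bsub>tensor A B\<^esub>"
    and step: "\<And>x a b. x \<in> carrier (tensor A B) \<Longrightarrow> P x \<Longrightarrow> a \<in> carrier A \<Longrightarrow> b \<in> carrier B \<Longrightarrow>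
      P (x \<oplus>\<^bsub>tensor A B\<^esub> pure_tensor A B a b)"
  shows "P x"
  using x
proof (induction x rule: T.carrier_induct)
  case (add x c p)
  obtain i j where p: "p = (i, j)" "i \<in> I" "j \<in> J" using add by (cases p) auto
  let ?a = "c \<odot>\<^bsub>A\<^esub> A.vec (single i)" and ?b = "B.vec (single j)"
  have ab: "?a \<in> carrier A" "?b \<in> carrier B" using p by (simp_all add: A.vec_closed B.vec_closed)
  have "c \<odot>\<^bsub>tensor A B\<^esub> T.vec (single p) = pure_tensor A B ?a ?b"
  proof (rule T.coords_eqI)
    fix q show "tensor_coord \<phi> \<psi> (c \<odot>\<^bsub>tensor A B\<^esub> T.vec (single p)) q =
        tensor_coord \<phi> \<psi> (pure_tensor A B ?a ?b) q"
      using p ab by (cases q) (auto simp: coord_pure T.coords_smult T.vec_closed T.coords_vec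
          A.coords_smult A.vec_closed A.coords_vec B.coords_vec single_Pair)
  qed (use p ab in \<open>auto simp: T.vec_closed pure_closed\<close>)
  then show ?case using step[OF add(1,3) ab] by simp
qed fact

end

section \<open>Multiplication on tensor products\<close>

lemma finsupp_subspace_induct:
  assumes "f \<in> finsupp I" "(\<lambda>_. 0) \<in> S" "\<And>f g c. f \<in> S \<Longrightarrow> g \<in> S \<Longrightarrow> (\<lambda>x. f x + c * g x) \<in> S"
    "\<And>i. i \<in> I \<Longrightarrow> single i \<in> S"
  shows "f \<in> S"
  using assms(1) by (induction f rule: finsupp_induct) (auto intro: assms)

text \<open>The product of a relator with a pair (a, b) is again a relator of the same kind. This
  extends to the span in one argument and to all finitely supported functions in the other.\<close>

lemma tensor_rel_ideal:
  fixes A :: "('k::field, 'a) module" and B :: "('k, 'b) module"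
  assumes A: "kalg A" and B: "kalg B"
  shows "ideal (tensor_rel A B) (monoid_alg (A \<times>\<times> B) :: ('k, 'a \<times> 'b \<Rightarrow> 'k) module)"
proof -
  let ?M = "monoid_alg (A \<times>\<times> B) :: ('k, 'a \<times> 'b \<Rightarrow> 'k) module" and ?R = "tensor_rel A B"
  interpret A: kalg A by fact
  interpret B: kalg B by fact
  have C: "carrier (A \<times>\<times> B) = carrier A \<times> carrier B" by (simp add: DirProd_def)
  have mult: "(a, b) \<otimes>\<^bsub>A \<times>\<times> B\<^esub> (a', b') = (a \<otimes>\<^bsub>A\<^esub> a', b \<otimes>\<^bsub>B\<^esub> b')" for a b a' b'
    by (simp add: DirProd_def)
  have "monoid (A \<times>\<times> B)"
    by (rule DirProd_monoid) unfold_locales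
  then interpret M: kalg ?M by (rule monoid_alg_kalg)
  note sub = tensor_rel_submodule[OF A.vsp_axioms B.vsp_axioms]
  note lin = monoid_alg_mult_linear[of _ "carrier A \<times> carrier B", where M = "A \<times>\<times> B"]
  have S: "(single (a, b) :: 'a \<times> 'b \<Rightarrow> 'k) \<in> finsupp (carrier A \<times> carrier B)"
    if "a \<in> carrier A" "b \<in> carrier B" for a b using that by simp
  have Rc: "?R \<subseteq> finsupp (carrier A \<times> carrier B)"
    using M.submodule_subset[OF sub(1)] by (simp add: C)
  have combine: "(\<lambda>x. f x + c * g x) \<in> ?R" if "f \<in> ?R" "g \<in> ?R" for f g c
    using M.submodule_add[OF sub(1) that(1) M.submodule_smult[OF sub(1) that(2), of c]] by simp
  have mlin: "(\<lambda>x. f x - c * g x) \<otimes>\<^bsub>?M\<^esub> h = (\<lambda>x. (f \<otimes>\<^bsub>?M\<^esub> h) x - c * (g \<otimes>\<^bsub>?M\<^esub> h) x)"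
      "h \<otimes>\<^bsub>?M\<^esub> (\<lambda>x. f x - c * g x) = (\<lambda>x. (h \<otimes>\<^bsub>?M\<^esub> f) x - c * (h \<otimes>\<^bsub>?M\<^esub> g) x)"
    if "f \<in> finsupp (carrier A \<times> carrier B)" "g \<in> finsupp (carrier A \<times> carrier B)"
      "h \<in> finsupp (carrier A \<times> carrier B)" for f g h c
    using lin[OF that, of "-c"] by simp_all
  have mlin3: "(\<lambda>x. f x - g x - e x) \<otimes>\<^bsub>?M\<^esub> h = (\<lambda>x. (f \<otimes>\<^bsub>?M\<^esub> h) x - (g \<otimes>\<^bsub>?M\<^esub> h) x - (e \<otimes>\<^bsub>?M\<^esub> h) x)"
      "h \<otimes>\<^bsub>?M\<^esub> (\<lambda>x. f x - g x - e x) = (\<lambda>x. (h \<otimes>\<^bsub>?M\<^esub> f) x - (h \<otimes>\<^bsub>?M\<^esub> g) x - (h \<otimes>\<^bsub>?M\<^esub> e) x)"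
    if "f \<in> finsupp (carrier A \<times> carrier B)" "g \<in> finsupp (carrier A \<times> carrier B)"
      "e \<in> finsupp (carrier A \<times> carrier B)" "h \<in> finsupp (carrier A \<times> carrier B)" for e f g h
    using mlin[OF finsupp_diff[OF that(1,2)] that(3,4), of 1] mlin[OF that(1,2,4), of 1] by simp_all
  have rel: "r \<otimes>\<^bsub>?M\<^esub> single (a, b) \<in> bilin_relators A B" "single (a, b) \<otimes>\<^bsub>?M\<^esub> r \<in> bilin_relators A B"
    if r: "r \<in> bilin_relators A B" and ab: "a \<in> carrier A" "b \<in> carrier B" for r a b
  proof -
    consider (1) x x' y where "r = (\<lambda>p. single (x \<oplus>\<^bsub>A\<^esub> x', y) p - single (x, y) p - single (x', y) p)"
        "x \<in> carrier A" "x' \<in> carrier A" "y \<in> carrier B"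
      | (2) x y y' where "r = (\<lambda>p. single (x, y \<oplus>\<^bsub>B\<^esub> y') p - single (x, y) p - single (x, y') p)"
        "x \<in> carrier A" "y \<in> carrier B" "y' \<in> carrier B"
      | (3) c x y where "r = (\<lambda>p. single (c \<odot>\<^bsub>A\<^esub> x, y) p - c * single (x, y) p)"
        "x \<in> carrier A" "y \<in> carrier B"
      | (4) c x y where "r = (\<lambda>p. single (x, c \<odot>\<^bsub>B\<^esub> y) p - c * single (x, y) p)"
        "x \<in> carrier A" "y \<in> carrier B"
      using r unfolding bilin_relators_def by blast
    then show "r \<otimes>\<^bsub>?M\<^esub> single (a, b) \<in> bilin_relators A B" "single (a, b) \<otimes>\<^bsub>?M\<^esub> r \<in> bilin_relators A B"
    proof (atomize (full), cases)
      case 1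
      have "(x \<otimes>\<^bsub>A\<^esub> a) \<in> carrier A" "(x' \<otimes>\<^bsub>A\<^esub> a) \<in> carrier A" "y \<otimes>\<^bsub>B\<^esub> b \<in> carrier B"
        "(a \<otimes>\<^bsub>A\<^esub> x) \<in> carrier A" "(a \<otimes>\<^bsub>A\<^esub> x') \<in> carrier A" "b \<otimes>\<^bsub>B\<^esub> y \<in> carrier B"
        using 1 ab by auto
      then show "r \<otimes>\<^bsub>?M\<^esub> single (a, b) \<in> bilin_relators A B \<and> single (a, b) \<otimes>\<^bsub>?M\<^esub> r \<in> bilin_relators A B"
        using 1 ab unfolding bilin_relators_def
        by (simp add: mlin3 S monoid_alg_mult_single mult A.l_distr A.r_distr) blast
    next
      case 2
      have "(x \<otimes>\<^bsub>A\<^esub> a) \<in> carrier A" "y' \<otimes>\<^bsub>B\<^esub> b \<in> carrier B" "y \<otimes>\<^bsub>B\<^esub> b \<in> carrier B"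
        "(a \<otimes>\<^bsub>A\<^esub> x) \<in> carrier A" "b \<otimes>\<^bsub>B\<^esub> y' \<in> carrier B" "b \<otimes>\<^bsub>B\<^esub> y \<in> carrier B"
        using 2 ab by auto
      then show "r \<otimes>\<^bsub>?M\<^esub> single (a, b) \<in> bilin_relators A B \<and> single (a, b) \<otimes>\<^bsub>?M\<^esub> r \<in> bilin_relators A B"
        using 2 ab unfolding bilin_relators_def
        by (simp add: mlin3 S monoid_alg_mult_single mult B.l_distr B.r_distr) blast
    next
      case 3
      have "(x \<otimes>\<^bsub>A\<^esub> a) \<in> carrier A" "y \<otimes>\<^bsub>B\<^esub> b \<in> carrier B" "(a \<otimes>\<^bsub>A\<^esub> x) \<in> carrier A" "b \<otimes>\<^bsub>B\<^esub> y \<in> carrier B"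
        using 3 ab by auto
      then show "r \<otimes>\<^bsub>?M\<^esub> single (a, b) \<in> bilin_relators A B \<and> single (a, b) \<otimes>\<^bsub>?M\<^esub> r \<in> bilin_relators A B"
        using 3 ab unfolding bilin_relators_def
        by (simp add: mlin S monoid_alg_mult_single mult A.smult_mult_left A.smult_mult_right) blast
    next
      case 4
      have "(x \<otimes>\<^bsub>A\<^esub> a) \<in> carrier A" "y \<otimes>\<^bsub>B\<^esub> b \<in> carrier B" "(a \<otimes>\<^bsub>A\<^esub> x) \<in> carrier A" "b \<otimes>\<^bsub>B\<^esub> y \<in> carrier B"
        using 4 ab by auto
      then show "r \<otimes>\<^bsub>?M\<^esub> single (a, b) \<in> bilin_relators A B \<and> single (a, b) \<otimes>\<^bsub>?M\<^esub> r \<in> bilin_relators A B"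
        using 4 ab unfolding bilin_relators_def
        by (simp add: mlin S monoid_alg_mult_single mult B.smult_mult_left B.smult_mult_right) blast
    qed
  qed
  have single_mult: "f \<otimes>\<^bsub>?M\<^esub> single (a, b) \<in> ?R \<and> single (a, b) \<otimes>\<^bsub>?M\<^esub> f \<in> ?R"
    if f: "f \<in> ?R" and ab: "a \<in> carrier A" "b \<in> carrier B" for f a b
  proof -
    let ?K = "{f \<in> finsupp (carrier A \<times> carrier B).
        f \<otimes>\<^bsub>?M\<^esub> single (a, b) \<in> ?R \<and> single (a, b) \<otimes>\<^bsub>?M\<^esub> f \<in> ?R}"
    have z: "(\<lambda>_. 0) \<in> ?R" using M.submodule_zero[OF sub(1)] by simp
    have "submodule ?K (scalars :: 'k ring) ?M"
    proof (rule M.submoduleI, intro conjI ballI allI)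
      fix f g c assume *: "f \<in> ?K" "g \<in> ?K"
      show "f \<oplus>\<^bsub>?M\<^esub> g \<in> ?K"
        using lin[of f g "single (a, b)" 1] combine[where c = 1] * ab by (auto simp: finsupp_add)
      show "c \<odot>\<^bsub>?M\<^esub> f \<in> ?K"
        using lin[of "\<lambda>_. 0" f "single (a, b)" c] combine[OF z] * ab
        by (auto simp: finsupp_smult monoid_alg_mult_zero)
    qed (auto simp: C z monoid_alg_mult_zero)
    moreover have "bilin_relators A B \<subseteq> ?K"
      using rel[OF _ ab] sub(2) Rc by blast
    ultimately have "?R \<subseteq> ?K" unfolding tensor_rel_def by (rule M.lin_span_least)
    then show ?thesis using f by blast
  qed
  show ?thesis
  proof (rule idealI[OF M.ring_axioms submodule.axioms(1)[OF sub(1)]])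
    fix f g assume f: "f \<in> ?R" and "g \<in> carrier ?M"
    then have g: "g \<in> finsupp (carrier A \<times> carrier B)" by (simp add: C)
    let ?S = "{g \<in> finsupp (carrier A \<times> carrier B). f \<otimes>\<^bsub>?M\<^esub> g \<in> ?R \<and> g \<otimes>\<^bsub>?M\<^esub> f \<in> ?R}"
    have "g \<in> ?S"
      using g
    proof (rule finsupp_subspace_induct)
      show "(\<lambda>_. 0) \<in> ?S" using M.submodule_zero[OF sub(1)] by (simp add: monoid_alg_mult_zero)
      fix g h c assume "g \<in> ?S" "h \<in> ?S"
      then show "(\<lambda>x. g x + c * h x) \<in> ?S"
        using lin[of g h f c] Rc f combine by (auto intro: finsupp_add finsupp_smult)
    next
      fix p assume "p \<in> carrier A \<times> carrier B"
      then show "single p \<in> ?S" using single_mult[OF f] by auto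
    qed
    then show "g \<otimes>\<^bsub>?M\<^esub> f \<in> ?R" "f \<otimes>\<^bsub>?M\<^esub> g \<in> ?R" by auto
  qed
qed

lemma
  fixes A :: "('k::field, 'a) module" and B :: "('k, 'b) module"
  assumes A: "kalg A" and B: "kalg B"
  shows tensor_kalg: "kalg (tensor A B)"
    and pure_tensor_mult: "\<And>a b a' b'. a \<in> carrier A \<Longrightarrow> b \<in> carrier B \<Longrightarrow> a' \<in> carrier A \<Longrightarrow>
      b' \<in> carrier B \<Longrightarrow> pure_tensor A B a b \<otimes>\<^bsub>tensor A B\<^esub> pure_tensor A B a' b' =
        pure_tensor A B (a \<otimes>\<^bsub>A\<^esub> a') (b \<otimes>\<^bsub>B\<^esub> b')"
    and tensor_one: "\<one>\<^bsub>tensor A B\<^esub> = pure_tensor A B \<one>\<^bsub>A\<^esub> \<one>\<^bsub>B\<^esub>"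
proof -
  let ?M = "monoid_alg (A \<times>\<times> B) :: ('k, 'a \<times> 'b \<Rightarrow> 'k) module"
  interpret A: kalg A by fact
  interpret B: kalg B by fact
  have "monoid (A \<times>\<times> B)"
    by (rule DirProd_monoid) unfold_locales
  then interpret M: kalg ?M by (rule monoid_alg_kalg)
  note Q = M.quotient_kalg[OF tensor_rel_ideal[OF A B]]
  show "kalg (tensor A B)" unfolding tensor_def by (rule Q(1))
  show "pure_tensor A B a b \<otimes>\<^bsub>tensor A B\<^esub> pure_tensor A B a' b' =
      pure_tensor A B (a \<otimes>\<^bsub>A\<^esub> a') (b \<otimes>\<^bsub>B\<^esub> b')"
    if "a \<in> carrier A" "b \<in> carrier B" "a' \<in> carrier A" "b' \<in> carrier B" for a b a' b'
    using Q(2)[of "single (a, b)" "single (a', b')"] that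
    by (simp add: tensor_def pure_tensor_def DirProd_def monoid_alg_mult_single)
  show "\<one>\<^bsub>tensor A B\<^esub> = pure_tensor A B \<one>\<^bsub>A\<^esub> \<one>\<^bsub>B\<^esub>"
    using Q(3) by (simp add: tensor_def pure_tensor_def DirProd_def)
qed

section \<open>The enveloping algebra and the regular bimodule\<close>

lemma op_alg_simps [simp]:
  "carrier (op_alg A) = carrier A" "\<zero>\<^bsub>op_alg A\<^esub> = \<zero>\<^bsub>A\<^esub>" "\<one>\<^bsub>op_alg A\<^esub> = \<one>\<^bsub>A\<^esub>"
  "x \<oplus>\<^bsub>op_alg A\<^esub> y = x \<oplus>\<^bsub>A\<^esub> y" "c \<odot>\<^bsub>op_alg A\<^esub> x = c \<odot>\<^bsub>A\<^esub> x" "x \<otimes>\<^bsub>op_alg A\<^esub> y = y \<otimes>\<^bsub>A\<^esub> x"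
  by (simp_all add: op_alg_def)

lemma regular_bimodule_simps [simp]:
  "carrier (regular_bimodule A) = carrier A" "\<zero>\<^bsub>regular_bimodule A\<^esub> = \<zero>\<^bsub>A\<^esub>"
  "x \<oplus>\<^bsub>regular_bimodule A\<^esub> y = x \<oplus>\<^bsub>A\<^esub> y"
  by (simp_all add: regular_bimodule_def)

lemma finsum_regular_bimodule: "finsum (regular_bimodule A) = finsum A"
  unfolding finsum_def finprod_def by (intro ext) (simp add: regular_bimodule_def cong: if_cong)

locale kalg_coords = A: kalg A + A: coords A I \<phi>
  for A :: "('k::field, 'a) module" and I :: "'i set" and \<phi> :: "'a \<Rightarrow> 'i \<Rightarrow> 'k"
begin

abbreviation R :: "('k, ('a \<times> 'a \<Rightarrow> 'k) set) module" where "R \<equiv> env_alg A"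

abbreviation pure :: "'a \<Rightarrow> 'a \<Rightarrow> ('a \<times> 'a \<Rightarrow> 'k) set" where "pure \<equiv> pure_tensor A (op_alg A)"

abbreviation \<rho> :: "('a \<times> 'a \<Rightarrow> 'k) set \<Rightarrow> 'i \<times> 'i \<Rightarrow> 'k" where "\<rho> \<equiv> tensor_coord \<phi> \<phi>"

abbreviation AM :: "(('a \<times> 'a \<Rightarrow> 'k) set, 'a) module" where "AM \<equiv> regular_bimodule A"

lemma op_vsp: "vsp (op_alg A)"
proof -
  have "abelian_group (op_alg A)"
  proof (rule abelian_groupI)
    show "\<exists>y\<in>carrier (op_alg A). y \<oplus>\<^bsub>op_alg A\<^esub> x = \<zero>\<^bsub>op_alg A\<^esub>" if "x \<in> carrier (op_alg A)" for x
      using that A.l_neg A.a_inv_closed by auto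
  qed (auto simp: A.a_ac)
  then show ?thesis
    by (auto simp: vsp_def vsp_axioms_def A.smult_add_left A.smult_add_right A.smult_smult)
qed

lemma op_kalg: "kalg (op_alg A)"
proof -
  interpret O: vsp "op_alg A" by (rule op_vsp)
  have "ring (op_alg A)"
  proof (rule ringI)
    show "abelian_group (op_alg A)" ..
    show "Group.monoid (op_alg A)"
      by (rule monoidI) (auto simp: A.m_assoc)
  qed (auto simp: A.l_distr A.r_distr)
  then show ?thesis
    by (auto simp: kalg_def kalg_axioms_def O.vsp_axioms A.smult_mult_left A.smult_mult_right)
qed

sublocale O: coords "op_alg A" I \<phi>
proof (rule coords.intro[OF op_vsp])
  show "coords_axioms (op_alg A) I \<phi>"
    by (rule coords_axioms.intro)
      (auto simp: A.coords_inj A.coords_image A.coords_add A.coords_smult)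
qed

sublocale E: tensor_coords A I \<phi> "op_alg A" I \<phi> ..

sublocale R: kalg R
  unfolding env_alg_def by (rule tensor_kalg[OF A.kalg_axioms op_kalg])

sublocale R: coords R "I \<times> I" \<rho>
  unfolding env_alg_def by (rule E.tensor_coords)

lemma R_carrier: "carrier R = (\<lambda>f. tensor_rel A (op_alg A) +>\<^bsub>E.M\<^esub> f) ` finsupp (carrier A \<times> carrier A)"
  using E.tensor_carrier by (simp add: env_alg_def)

lemma pure_closed: "a \<in> carrier A \<Longrightarrow> b \<in> carrier A \<Longrightarrow> pure a b \<in> carrier R"
  using E.pure_closed by (simp add: env_alg_def)

lemma pure_mult:
  "a \<in> carrier A \<Longrightarrow> b \<in> carrier A \<Longrightarrow> a' \<in> carrier A \<Longrightarrow> b' \<in> carrier A \<Longrightarrow>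
    pure a b \<otimes>\<^bsub>R\<^esub> pure a' b' = pure (a \<otimes>\<^bsub>A\<^esub> a') (b' \<otimes>\<^bsub>A\<^esub> b)"
  using pure_tensor_mult[OF A.kalg_axioms op_kalg] by (simp add: env_alg_def)

lemma R_one: "\<one>\<^bsub>R\<^esub> = pure \<one>\<^bsub>A\<^esub> \<one>\<^bsub>A\<^esub>"
  using tensor_one[OF A.kalg_axioms op_kalg] by (simp add: env_alg_def)

lemma coord_pure: "a \<in> carrier A \<Longrightarrow> b \<in> carrier A \<Longrightarrow> \<rho> (pure a b) (i, j) = \<phi> a i * \<phi> b j"
  using E.coord_pure by simp

lemma R_induct [consumes 1, case_names zero add]:
  assumes "r \<in> carrier R" "P \<zero>\<^bsub>R\<^esub>"
    "\<And>r a b. r \<in> carrier R \<Longrightarrow> P r \<Longrightarrow> a \<in> carrier A \<Longrightarrow> b \<in> carrier A \<Longrightarrow> P (r \<oplus>\<^bsub>R\<^esub> pure a b)"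
  shows "P r"
  using assms unfolding env_alg_def by (induction r rule: E.tensor_induct) auto

definition sandwich :: "'a \<Rightarrow> 'a \<times> 'a \<Rightarrow> 'i \<Rightarrow> 'k" where
  "sandwich x = (\<lambda>p. \<phi> (fst p \<otimes>\<^bsub>A\<^esub> x \<otimes>\<^bsub>A\<^esub> snd p))"

text \<open>The sum defining the action is bilinear in the pair (a, b), so it takes the same value
  on all representatives of a coset. The image of the coset is therefore a singleton, from which
  \<open>the_elem\<close> extracts the value.\<close>

lemma
  assumes f: "f \<in> finsupp (carrier A \<times> carrier A)" and x: "x \<in> carrier A"
  shows act_closed': "(tensor_rel A (op_alg A) +>\<^bsub>E.M\<^esub> f) \<odot>\<^bsub>AM\<^esub> x \<in> carrier A"
    and coord_act: "\<phi> ((tensor_rel A (op_alg A) +>\<^bsub>E.M\<^esub> f) \<odot>\<^bsub>AM\<^esub> x) = lin_ext (sandwich x) f"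
proof -
  let ?T = "tensor_rel A (op_alg A)"
  define act where "act f = (\<Oplus>\<^bsub>A\<^esub>p\<in>{p. f p \<noteq> 0}. f p \<odot>\<^bsub>A\<^esub> (fst p \<otimes>\<^bsub>A\<^esub> x \<otimes>\<^bsub>A\<^esub> snd p))" for f
  have act: "act f \<in> carrier A \<and> \<phi> (act f) = lin_ext (sandwich x) f"
    if f: "f \<in> finsupp (carrier A \<times> carrier A)" for f
  proof -
    have c: "fst p \<otimes>\<^bsub>A\<^esub> x \<otimes>\<^bsub>A\<^esub> snd p \<in> carrier A" if "f p \<noteq> 0" for p
      using finsuppD(2)[OF f that] x by (auto simp: mem_Times_iff)
    then have "(\<lambda>p. f p \<odot>\<^bsub>A\<^esub> (fst p \<otimes>\<^bsub>A\<^esub> x \<otimes>\<^bsub>A\<^esub> snd p)) \<in> {p. f p \<noteq> 0} \<rightarrow> carrier A" by auto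
    then show ?thesis
      unfolding act_def using c
      by (auto simp: A.coords_finsum lin_ext_def sandwich_def A.coords_smult intro!: A.finsum_closed)
  qed
  have "act g = act f" if g: "g \<in> ?T +>\<^bsub>E.M\<^esub> f" for g
  proof -
    have fc: "f \<in> carrier E.M" using f by simp
    have g': "g \<in> finsupp (carrier A \<times> carrier A)" "(\<lambda>p. g p - f p) \<in> ?T"
      using E.M.coset_mem_iff[OF E.rel_submodule fc, of g] g f
      by (auto simp: monoid_alg_minus)
    have "lin_ext (sandwich x) (\<lambda>p. g p - f p) = (\<lambda>_. 0)"
      by (rule lin_ext_tensor_rel[OF A.vsp_axioms op_vsp _ _ _ _ g'(2)])
        (auto simp: sandwich_def x A.l_distr A.r_distr A.coords_add A.coords_smult A.smult_mult_left
          A.smult_mult_right)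
    moreover have "lin_ext (sandwich x) (\<lambda>p. g p + (-1) * f p) =
        (\<lambda>i. lin_ext (sandwich x) g i + (-1) * lin_ext (sandwich x) f i)"
      by (rule lin_ext_add_smult[OF g'(1) f])
    ultimately have "\<phi> (act g) = \<phi> (act f)"
      using act[OF f] act[OF g'(1)] by (auto simp: fun_eq_iff)
    then show ?thesis
      using act[OF f] act[OF g'(1)] by (intro A.coords_eqI) auto
  qed
  moreover have "f \<in> ?T +>\<^bsub>E.M\<^esub> f"
    using E.M.coset_self[OF E.rel_submodule] f by simp
  ultimately have "act ` (?T +>\<^bsub>E.M\<^esub> f) = {act f}" by blast
  then have "(?T +>\<^bsub>E.M\<^esub> f) \<odot>\<^bsub>AM\<^esub> x = act f"
    by (simp add: regular_bimodule_def act_def[abs_def])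
  then show "(?T +>\<^bsub>E.M\<^esub> f) \<odot>\<^bsub>AM\<^esub> x \<in> carrier A"
    "\<phi> ((?T +>\<^bsub>E.M\<^esub> f) \<odot>\<^bsub>AM\<^esub> x) = lin_ext (sandwich x) f"
    using act[OF f] by simp_all
qed

lemma act_closed: "r \<in> carrier R \<Longrightarrow> x \<in> carrier A \<Longrightarrow> r \<odot>\<^bsub>AM\<^esub> x \<in> carrier A"
  using act_closed' by (auto simp: R_carrier)

lemma act_pure:
  assumes "a \<in> carrier A" "b \<in> carrier A" "x \<in> carrier A"
  shows "pure a b \<odot>\<^bsub>AM\<^esub> x = a \<otimes>\<^bsub>A\<^esub> x \<otimes>\<^bsub>A\<^esub> b"
proof (rule A.coords_eqI)
  show "\<phi> (pure a b \<odot>\<^bsub>AM\<^esub> x) i = \<phi> (a \<otimes>\<^bsub>A\<^esub> x \<otimes>\<^bsub>A\<^esub> b) i" for i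
    using coord_act[of "single (a, b)" x] assms by (simp add: pure_tensor_def sandwich_def)
qed (use assms pure_closed act_closed in auto)

lemma act_add_left:
  assumes "r \<in> carrier R" "s \<in> carrier R" "x \<in> carrier A"
  shows "(r \<oplus>\<^bsub>R\<^esub> s) \<odot>\<^bsub>AM\<^esub> x = r \<odot>\<^bsub>AM\<^esub> x \<oplus>\<^bsub>A\<^esub> s \<odot>\<^bsub>AM\<^esub> x"
proof -
  let ?T = "tensor_rel A (op_alg A)"
  obtain f g where fg: "f \<in> finsupp (carrier A \<times> carrier A)" "r = ?T +>\<^bsub>E.M\<^esub> f"
    "g \<in> finsupp (carrier A \<times> carrier A)" "s = ?T +>\<^bsub>E.M\<^esub> g"
    using assms by (auto simp: R_carrier)
  have "r \<oplus>\<^bsub>R\<^esub> s = ?T +>\<^bsub>E.M\<^esub> (\<lambda>p. f p + g p)"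
    using E.M.coset_add[OF E.rel_submodule, of f g] fg by (simp add: env_alg_def tensor_def)
  then show ?thesis
    using fg assms by (intro A.coords_eqI)
      (auto simp: coord_act A.coords_add act_closed lin_ext_add finsupp_add act_closed')
qed

lemma act_add_right:
  assumes "r \<in> carrier R" "x \<in> carrier A" "y \<in> carrier A"
  shows "r \<odot>\<^bsub>AM\<^esub> (x \<oplus>\<^bsub>A\<^esub> y) = r \<odot>\<^bsub>AM\<^esub> x \<oplus>\<^bsub>A\<^esub> r \<odot>\<^bsub>AM\<^esub> y"
proof -
  let ?T = "tensor_rel A (op_alg A)"
  obtain f where f: "f \<in> finsupp (carrier A \<times> carrier A)" "r = ?T +>\<^bsub>E.M\<^esub> f"
    using assms by (auto simp: R_carrier)
  have "f p * sandwich (x \<oplus>\<^bsub>A\<^esub> y) p i = f p * sandwich x p i + f p * sandwich y p i" for p i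
  proof (cases "f p = 0")
    case False
    then have "fst p \<in> carrier A" "snd p \<in> carrier A" using finsuppD(2)[OF f(1)] by (auto simp: mem_Times_iff)
    then show ?thesis
      using assms by (simp add: sandwich_def A.l_distr A.r_distr A.coords_add distrib_left)
  qed simp
  then have "lin_ext (sandwich (x \<oplus>\<^bsub>A\<^esub> y)) f = (\<lambda>i. lin_ext (sandwich x) f i + lin_ext (sandwich y) f i)"
    by (simp add: lin_ext_def sum.distrib)
  then show ?thesis
    using f assms by (intro A.coords_eqI) (auto simp: coord_act A.coords_add act_closed act_closed')
qed

lemma act_zero_left: "x \<in> carrier A \<Longrightarrow> \<zero>\<^bsub>R\<^esub> \<odot>\<^bsub>AM\<^esub> x = \<zero>\<^bsub>A\<^esub>"
  using act_add_left[of "\<zero>\<^bsub>R\<^esub>" "\<zero>\<^bsub>R\<^esub>" x] act_closed[of "\<zero>\<^bsub>R\<^esub>" x]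
  by (simp add: A.add.l_cancel_one')

lemma act_zero_right: "r \<in> carrier R \<Longrightarrow> r \<odot>\<^bsub>AM\<^esub> \<zero>\<^bsub>A\<^esub> = \<zero>\<^bsub>A\<^esub>"
  using act_add_right[of r "\<zero>\<^bsub>A\<^esub>" "\<zero>\<^bsub>A\<^esub>"] act_closed[of r "\<zero>\<^bsub>A\<^esub>"]
  by (simp add: A.add.l_cancel_one')

text \<open>On pure tensors both sides are a a' x b' b: multiplication in the second factor is
  reversed, which is the order in which right multiplications are carried out. Additivity in each
  argument does the rest.\<close>

lemma act_assoc:
  assumes r: "r \<in> carrier R" and s: "s \<in> carrier R" and x: "x \<in> carrier A"
  shows "(r \<otimes>\<^bsub>R\<^esub> s) \<odot>\<^bsub>AM\<^esub> x = r \<odot>\<^bsub>AM\<^esub> (s \<odot>\<^bsub>AM\<^esub> x)"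
  using r
proof (induction r rule: R_induct)
  case zero
  show ?case using s x by (simp add: act_zero_left act_closed)
next
  case (add r a b)
  have "(pure a b \<otimes>\<^bsub>R\<^esub> s) \<odot>\<^bsub>AM\<^esub> x = pure a b \<odot>\<^bsub>AM\<^esub> (s \<odot>\<^bsub>AM\<^esub> x)"
    using s
  proof (induction s rule: R_induct)
    case zero
    show ?case using x add(2,3) by (simp add: act_zero_left act_zero_right pure_closed)
  next
    case (add s a' b')
    then show ?case using x \<open>a \<in> carrier A\<close> \<open>b \<in> carrier A\<close>
      by (simp add: R.r_distr pure_closed act_add_left act_add_right act_closed pure_mult act_pure A.m_assoc)
  qed
  then show ?case using add s x
    by (simp add: R.l_distr pure_closed act_add_left act_closed)
qed

text \<open>The scalars of \<open>Hom_space\<close> act through c 1; here they are matched with the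
  scalars of A.\<close>

lemma act_scalar:
  assumes "x \<in> carrier A"
  shows "(c \<odot>\<^bsub>R\<^esub> \<one>\<^bsub>R\<^esub>) \<odot>\<^bsub>AM\<^esub> x = c \<odot>\<^bsub>A\<^esub> x"
proof -
  have "c \<odot>\<^bsub>R\<^esub> \<one>\<^bsub>R\<^esub> = pure (c \<odot>\<^bsub>A\<^esub> \<one>\<^bsub>A\<^esub>) \<one>\<^bsub>A\<^esub>"
    by (rule R.coords_eqI) (auto simp: R_one pure_closed R.coords_smult coord_pure A.coords_smult)
  then show ?thesis using assms by (simp add: act_pure A.smult_mult_left)
qed

lemma AM_left_module: "left_module R AM"
proof -
  have "abelian_group AM"
  proof (rule abelian_groupI)
    show "\<exists>y\<in>carrier AM. y \<oplus>\<^bsub>AM\<^esub> x = \<zero>\<^bsub>AM\<^esub>" if "x \<in> carrier AM" for x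
      using that A.l_neg A.a_inv_closed by auto
  qed (auto simp: A.a_ac)
  then show ?thesis
    unfolding left_module_def
    by (auto simp: R.ring_axioms act_closed act_add_left act_add_right act_assoc R_one act_pure)
qed

end

section \<open>Comparison of resolutions\<close>

lemma left_moduleD:
  assumes "left_module R M"
  shows "ring R" "abelian_group M"
    "\<And>r x. r \<in> carrier R \<Longrightarrow> x \<in> carrier M \<Longrightarrow> r \<odot>\<^bsub>M\<^esub> x \<in> carrier M"
    "\<And>r s x. r \<in> carrier R \<Longrightarrow> s \<in> carrier R \<Longrightarrow> x \<in> carrier M \<Longrightarrow>
      (r \<oplus>\<^bsub>R\<^esub> s) \<odot>\<^bsub>M\<^esub> x = r \<odot>\<^bsub>M\<^esub> x \<oplus>\<^bsub>M\<^esub> s \<odot>\<^bsub>M\<^esub> x"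
    "\<And>r x y. r \<in> carrier R \<Longrightarrow> x \<in> carrier M \<Longrightarrow> y \<in> carrier M \<Longrightarrow>
      r \<odot>\<^bsub>M\<^esub> (x \<oplus>\<^bsub>M\<^esub> y) = r \<odot>\<^bsub>M\<^esub> x \<oplus>\<^bsub>M\<^esub> r \<odot>\<^bsub>M\<^esub> y"
    "\<And>r s x. r \<in> carrier R \<Longrightarrow> s \<in> carrier R \<Longrightarrow> x \<in> carrier M \<Longrightarrow>
      (r \<otimes>\<^bsub>R\<^esub> s) \<odot>\<^bsub>M\<^esub> x = r \<odot>\<^bsub>M\<^esub> (s \<odot>\<^bsub>M\<^esub> x)"
    "\<And>x. x \<in> carrier M \<Longrightarrow> \<one>\<^bsub>R\<^esub> \<odot>\<^bsub>M\<^esub> x = x"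
  using assms unfolding left_module_def by auto

locale lmod = R: ring R + M: abelian_group M
  for R :: "('r, 'b) ring_scheme" and M :: "('r, 'm) module" +
  assumes left_module: "left_module R M"
begin

lemmas smult_closed = left_moduleD(3)[OF left_module]
  and smult_add_left = left_moduleD(4)[OF left_module]
  and smult_add_right = left_moduleD(5)[OF left_module]
  and smult_smult = left_moduleD(6)[OF left_module]
  and smult_one = left_moduleD(7)[OF left_module]

lemma smult_zero_left: "x \<in> carrier M \<Longrightarrow> \<zero>\<^bsub>R\<^esub> \<odot>\<^bsub>M\<^esub> x = \<zero>\<^bsub>M\<^esub>"
  using smult_add_left[of "\<zero>\<^bsub>R\<^esub>" "\<zero>\<^bsub>R\<^esub>" x] smult_closed[of "\<zero>\<^bsub>R\<^esub>" x]
  by (simp add: M.add.l_cancel_one')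

lemma smult_zero_right: "r \<in> carrier R \<Longrightarrow> r \<odot>\<^bsub>M\<^esub> \<zero>\<^bsub>M\<^esub> = \<zero>\<^bsub>M\<^esub>"
  using smult_add_right[of r "\<zero>\<^bsub>M\<^esub>" "\<zero>\<^bsub>M\<^esub>"] smult_closed[of r "\<zero>\<^bsub>M\<^esub>"]
  by (simp add: M.add.l_cancel_one')

lemma smult_minus: "r \<in> carrier R \<Longrightarrow> x \<in> carrier M \<Longrightarrow> r \<odot>\<^bsub>M\<^esub> (\<ominus>\<^bsub>M\<^esub> x) = \<ominus>\<^bsub>M\<^esub> (r \<odot>\<^bsub>M\<^esub> x)"
  using smult_add_right[of r "\<ominus>\<^bsub>M\<^esub> x" x]
  by (intro M.minus_equality[symmetric]) (auto simp: M.l_neg smult_zero_right smult_closed)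

lemma minus_cancel: "x \<in> carrier M \<Longrightarrow> y \<in> carrier M \<Longrightarrow> (x \<ominus>\<^bsub>M\<^esub> y) \<oplus>\<^bsub>M\<^esub> y = x"
  by (simp add: M.minus_eq M.a_assoc M.l_neg)

end

lemma lmodI: "left_module R M \<Longrightarrow> lmod R M"
  by (simp add: lmod_def lmod_axioms_def left_moduleD)

lemma is_homD:
  assumes "is_hom R M N f"
  shows "\<And>x. x \<in> carrier M \<Longrightarrow> f x \<in> carrier N"
    "\<And>x y. x \<in> carrier M \<Longrightarrow> y \<in> carrier M \<Longrightarrow> f (x \<oplus>\<^bsub>M\<^esub> y) = f x \<oplus>\<^bsub>N\<^esub> f y"
    "\<And>r x. r \<in> carrier R \<Longrightarrow> x \<in> carrier M \<Longrightarrow> f (r \<odot>\<^bsub>M\<^esub> x) = r \<odot>\<^bsub>N\<^esub> f x"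
  using assms unfolding is_hom_def by auto

lemma is_homI:
  assumes "\<And>x. x \<in> carrier M \<Longrightarrow> f x \<in> carrier N"
    "\<And>x y. x \<in> carrier M \<Longrightarrow> y \<in> carrier M \<Longrightarrow> f (x \<oplus>\<^bsub>M\<^esub> y) = f x \<oplus>\<^bsub>N\<^esub> f y"
    "\<And>r x. r \<in> carrier R \<Longrightarrow> x \<in> carrier M \<Longrightarrow> f (r \<odot>\<^bsub>M\<^esub> x) = r \<odot>\<^bsub>N\<^esub> f x"
  shows "is_hom R M N f"
  using assms unfolding is_hom_def by auto

lemma is_hom_comp: "is_hom R M N f \<Longrightarrow> is_hom R N L g \<Longrightarrow> is_hom R M L (\<lambda>x. g (f x))"
  by (rule is_homI) (auto simp: is_homD)

lemma is_hom_zero: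
  assumes "is_hom R M N f" "lmod R M" "lmod R N"
  shows "f \<zero>\<^bsub>M\<^esub> = \<zero>\<^bsub>N\<^esub>"
proof -
  interpret M: lmod R M by fact
  interpret N: lmod R N by fact
  show ?thesis
    using is_homD(2)[OF assms(1), of "\<zero>\<^bsub>M\<^esub>" "\<zero>\<^bsub>M\<^esub>"] is_homD(1)[OF assms(1), of "\<zero>\<^bsub>M\<^esub>"]
    by (simp add: N.M.add.l_cancel_one')
qed

lemma is_hom_minus:
  assumes "is_hom R M N f" "lmod R M" "lmod R N" "x \<in> carrier M" "y \<in> carrier M"
  shows "f (x \<ominus>\<^bsub>M\<^esub> y) = f x \<ominus>\<^bsub>N\<^esub> f y"
proof -
  interpret M: lmod R M by fact
  interpret N: lmod R N by fact
  have "f (\<ominus>\<^bsub>M\<^esub> y) \<oplus>\<^bsub>N\<^esub> f y = \<zero>\<^bsub>N\<^esub>"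
    using is_homD(2)[OF assms(1), of "\<ominus>\<^bsub>M\<^esub> y" y] assms(5) is_hom_zero[OF assms(1-3)]
    by (simp add: M.M.l_neg)
  then have "f (\<ominus>\<^bsub>M\<^esub> y) = \<ominus>\<^bsub>N\<^esub> f y"
    using assms(5) is_homD(1)[OF assms(1)] by (intro N.M.minus_equality[symmetric]) auto
  then show ?thesis
    using assms by (simp add: M.M.minus_eq N.M.minus_eq is_homD(2)[OF assms(1)])
qed

lemma is_hom_sum:
  assumes f: "is_hom R M N f" and g: "is_hom R M N g" and N: "lmod R N"
  shows "is_hom R M N (\<lambda>x. f x \<oplus>\<^bsub>N\<^esub> g x)"
proof -
  interpret N: lmod R N by fact
  show ?thesis
    by (rule is_homI) (auto simp: is_homD[OF f] is_homD[OF g] N.smult_add_right N.M.a_ac)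
qed

lemma is_hom_diff:
  assumes f: "is_hom R M N f" and g: "is_hom R M N g" and N: "lmod R N"
  shows "is_hom R M N (\<lambda>x. f x \<ominus>\<^bsub>N\<^esub> g x)"
proof -
  interpret N: lmod R N by fact
  have "is_hom R M N (\<lambda>x. \<ominus>\<^bsub>N\<^esub> g x)"
    by (rule is_homI) (auto simp: is_homD[OF g] N.smult_minus N.M.minus_add)
  from is_hom_sum[OF f this N] show ?thesis by (simp add: N.M.minus_eq)
qed

section \<open>Free modules and lifting\<close>

lemma free_module_simps [simp]:
  "carrier (free_module R I) = {f. (\<forall>i\<in>I. f i \<in> carrier R) \<and> (\<forall>i. i \<notin> I \<longrightarrow> f i = \<zero>\<^bsub>R\<^esub>) \<and>
     finite {i. f i \<noteq> \<zero>\<^bsub>R\<^esub>}}"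
  "\<zero>\<^bsub>free_module R I\<^esub> = (\<lambda>_. \<zero>\<^bsub>R\<^esub>)" "f \<oplus>\<^bsub>free_module R I\<^esub> g = (\<lambda>i. f i \<oplus>\<^bsub>R\<^esub> g i)"
  "r \<odot>\<^bsub>free_module R I\<^esub> f = (\<lambda>i. r \<otimes>\<^bsub>R\<^esub> f i)"
  by (simp_all add: free_module_def)

definition unit_vec :: "('r, 'b) ring_scheme \<Rightarrow> 'i \<Rightarrow> 'i \<Rightarrow> 'r" where
  "unit_vec R i = (\<lambda>j. if j = i then \<one>\<^bsub>R\<^esub> else \<zero>\<^bsub>R\<^esub>)"

definition free_lift :: "('r, 'b) ring_scheme \<Rightarrow> ('r, 'm) module \<Rightarrow> ('i \<Rightarrow> 'm) \<Rightarrow> ('i \<Rightarrow> 'r) \<Rightarrow> 'm" where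
  "free_lift R M g f = (\<Oplus>\<^bsub>M\<^esub>i\<in>{i. f i \<noteq> \<zero>\<^bsub>R\<^esub>}. f i \<odot>\<^bsub>M\<^esub> g i)"

context ring
begin

lemma free_module_value: "f \<in> carrier (free_module R I) \<Longrightarrow> f i \<in> carrier R"
  by (cases "i \<in> I") auto

lemma free_module_lmod: "lmod R (free_module R I)"
proof (rule lmodI)
  have fin: "finite {i. f i \<oplus> g i \<noteq> \<zero>}" if "f \<in> carrier (free_module R I)" "g \<in> carrier (free_module R I)" for f g
    using that by (auto intro!: finite_subset[of _ "{i. f i \<noteq> \<zero>} \<union> {i. g i \<noteq> \<zero>}"])
  have fin': "finite {i. r \<otimes> f i \<noteq> \<zero>}" if "f \<in> carrier (free_module R I)" "r \<in> carrier R" for f r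
    using that by (auto intro!: finite_subset[of _ "{i. f i \<noteq> \<zero>}"])
  have "abelian_group (free_module R I)"
  proof (rule abelian_groupI)
    show "f \<oplus>\<^bsub>free_module R I\<^esub> g \<in> carrier (free_module R I)"
      if "f \<in> carrier (free_module R I)" "g \<in> carrier (free_module R I)" for f g
      using that fin[OF that] by simp
    show "\<exists>g\<in>carrier (free_module R I). g \<oplus>\<^bsub>free_module R I\<^esub> f = \<zero>\<^bsub>free_module R I\<^esub>"
      if f: "f \<in> carrier (free_module R I)" for f
    proof
      show "(\<lambda>i. \<ominus> f i) \<in> carrier (free_module R I)"
        using f by (auto intro!: finite_subset[of "{i. \<ominus> f i \<noteq> \<zero>}" "{i. f i \<noteq> \<zero>}"])
      show "(\<lambda>i. \<ominus> f i) \<oplus>\<^bsub>free_module R I\<^esub> f = \<zero>\<^bsub>free_module R I\<^esub>"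
        using free_module_value[OF f] by (simp add: l_neg)
    qed
  next
    fix f g h assume "f \<in> carrier (free_module R I)" "g \<in> carrier (free_module R I)"
      "h \<in> carrier (free_module R I)"
    note v = this[THEN free_module_value]
    show "f \<oplus>\<^bsub>free_module R I\<^esub> g \<oplus>\<^bsub>free_module R I\<^esub> h = f \<oplus>\<^bsub>free_module R I\<^esub> (g \<oplus>\<^bsub>free_module R I\<^esub> h)"
      using v by (simp add: a_assoc)
  next
    fix f g assume "f \<in> carrier (free_module R I)" "g \<in> carrier (free_module R I)"
    note v = this[THEN free_module_value]
    show "f \<oplus>\<^bsub>free_module R I\<^esub> g = g \<oplus>\<^bsub>free_module R I\<^esub> f"
      using v by (simp add: a_comm)
  next
    fix f assume "f \<in> carrier (free_module R I)"
    note v = this[THEN free_module_value]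
    show "\<zero>\<^bsub>free_module R I\<^esub> \<oplus>\<^bsub>free_module R I\<^esub> f = f" using v by simp
  qed simp
  then show "left_module R (free_module R I)"
    unfolding left_module_def
  proof (intro conjI ballI)
    show "r \<odot>\<^bsub>free_module R I\<^esub> f \<in> carrier (free_module R I)"
      if "r \<in> carrier R" "f \<in> carrier (free_module R I)" for r f
      using that fin'[OF that(2,1)] by simp
  qed (auto simp: l_distr r_distr m_assoc free_module_value ring_axioms simp del: free_module_simps(1))
qed

lemma unit_vec_closed: "i \<in> I \<Longrightarrow> unit_vec R i \<in> carrier (free_module R I)"
  by (auto simp: unit_vec_def)

lemma free_module_induct [consumes 1, case_names zero add]:
  assumes "f \<in> carrier (free_module R I)" "P (\<lambda>_. \<zero>)"
    and "\<And>f r i. f \<in> carrier (free_module R I) \<Longrightarrow> P f \<Longrightarrow> r \<in> carrier R \<Longrightarrow> i \<in> I \<Longrightarrow>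
      P (f \<oplus>\<^bsub>free_module R I\<^esub> r \<odot>\<^bsub>free_module R I\<^esub> unit_vec R i)"
  shows "P f"
proof -
  have "finite F \<Longrightarrow> F \<subseteq> I \<Longrightarrow> (\<And>i. f i \<in> carrier R) \<Longrightarrow> {i. f i \<noteq> \<zero>} \<subseteq> F \<Longrightarrow> P f" for F f
  proof (induction F arbitrary: f rule: finite_induct)
    case empty
    then have "f = (\<lambda>_. \<zero>)" by auto
    then show ?case using assms(2) by simp
  next
    case (insert i F)
    let ?g = "\<lambda>j. if j = i then \<zero> else f j"
    have g: "P ?g" using insert by (intro insert.IH) auto
    have "{i. ?g i \<noteq> \<zero>} \<subseteq> F" using insert by auto
    then have "?g \<in> carrier (free_module R I)"
      using insert finite_subset[of "{i. ?g i \<noteq> \<zero>}" F] by auto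
    from assms(3)[OF this g, of "f i" i] have "P (\<lambda>j. ?g j \<oplus> f i \<otimes> unit_vec R i j)"
      using insert by simp
    moreover have "(\<lambda>j. ?g j \<oplus> f i \<otimes> unit_vec R i j) = f"
      using insert by (auto simp: unit_vec_def)
    ultimately show ?case by simp
  qed
  from this[of "{i. f i \<noteq> \<zero>}" f] assms(1) free_module_value[OF assms(1)] show ?thesis by auto
qed

end

text \<open>Lets the supports of several elements be replaced by one common finite set, as
  additivity of \<open>free_lift\<close> requires.\<close>

lemma free_lift_eq:
  assumes M: "lmod R M" and g: "\<And>i. i \<in> I \<Longrightarrow> g i \<in> carrier M"
    and f: "f \<in> carrier (free_module R I)" and F: "finite F" "{i. f i \<noteq> \<zero>\<^bsub>R\<^esub>} \<subseteq> F" "F \<subseteq> I"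
  shows "free_lift R M g f = (\<Oplus>\<^bsub>M\<^esub>i\<in>F. f i \<odot>\<^bsub>M\<^esub> g i)"
proof -
  interpret M: lmod R M by fact
  have "(\<lambda>i. f i \<odot>\<^bsub>M\<^esub> g i) \<in> F \<rightarrow> carrier M"
    using F(3) g M.R.free_module_value[OF f] by (auto intro!: M.smult_closed)
  then show ?thesis
    unfolding free_lift_def using F g
    by (intro M.M.add.finprod_mono_neutral_cong_left) (auto simp: M.smult_zero_left subset_iff)
qed

lemma free_lift_hom:
  assumes M: "lmod R M" and g: "\<And>i. i \<in> I \<Longrightarrow> g i \<in> carrier M"
  shows "is_hom R (free_module R I) M (free_lift R M g)"
    and "\<And>i. i \<in> I \<Longrightarrow> free_lift R M g (unit_vec R i) = g i"
proof -
  interpret M: lmod R M by fact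
  interpret L: lmod R "free_module R I" by (rule M.R.free_module_lmod)
  have supp: "finite {i. f i \<noteq> \<zero>\<^bsub>R\<^esub>}" "{i. f i \<noteq> \<zero>\<^bsub>R\<^esub>} \<subseteq> I" if "f \<in> carrier (free_module R I)" for f
    using that by auto
  have c: "f i \<odot>\<^bsub>M\<^esub> g i \<in> carrier M" if "f \<in> carrier (free_module R I)" "i \<in> I" for f i
    using that g M.R.free_module_value[OF that(1)] by (auto intro!: M.smult_closed)
  show "is_hom R (free_module R I) M (free_lift R M g)"
  proof (rule is_homI)
    fix f assume f: "f \<in> carrier (free_module R I)"
    then show "free_lift R M g f \<in> carrier M"
      unfolding free_lift_def using supp[OF f] c[OF f] by (intro M.M.finsum_closed) auto
  next
    fix f h assume f: "f \<in> carrier (free_module R I)" and h: "h \<in> carrier (free_module R I)"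
    let ?F = "{i. f i \<noteq> \<zero>\<^bsub>R\<^esub>} \<union> {i. h i \<noteq> \<zero>\<^bsub>R\<^esub>}"
    have F: "finite ?F" "?F \<subseteq> I" using supp[OF f] supp[OF h] by auto
    have fh: "f \<oplus>\<^bsub>free_module R I\<^esub> h \<in> carrier (free_module R I)"
      using f h by (rule L.M.a_closed)
    have s: "{i. (f \<oplus>\<^bsub>free_module R I\<^esub> h) i \<noteq> \<zero>\<^bsub>R\<^esub>} \<subseteq> ?F" by auto
    have "free_lift R M g (f \<oplus>\<^bsub>free_module R I\<^esub> h) =
        (\<Oplus>\<^bsub>M\<^esub>i\<in>?F. (f \<oplus>\<^bsub>free_module R I\<^esub> h) i \<odot>\<^bsub>M\<^esub> g i)"
      by (rule free_lift_eq[OF M g fh F(1) s F(2)])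
    also have "\<dots> = (\<Oplus>\<^bsub>M\<^esub>i\<in>?F. f i \<odot>\<^bsub>M\<^esub> g i \<oplus>\<^bsub>M\<^esub> h i \<odot>\<^bsub>M\<^esub> g i)"
    proof (rule M.M.finsum_cong'[OF refl])
      show "(\<lambda>i. f i \<odot>\<^bsub>M\<^esub> g i \<oplus>\<^bsub>M\<^esub> h i \<odot>\<^bsub>M\<^esub> g i) \<in> ?F \<rightarrow> carrier M"
        using F(2) by (intro funcsetI M.M.a_closed c[OF f] c[OF h]) blast+
      fix i assume "i \<in> ?F"
      then have "g i \<in> carrier M" using F(2) g by blast
      then show "(f \<oplus>\<^bsub>free_module R I\<^esub> h) i \<odot>\<^bsub>M\<^esub> g i = f i \<odot>\<^bsub>M\<^esub> g i \<oplus>\<^bsub>M\<^esub> h i \<odot>\<^bsub>M\<^esub> g i"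
        using M.R.free_module_value[OF f, of i] M.R.free_module_value[OF h, of i]
        by (simp add: M.smult_add_left)
    qed
    also have "\<dots> = (\<Oplus>\<^bsub>M\<^esub>i\<in>?F. f i \<odot>\<^bsub>M\<^esub> g i) \<oplus>\<^bsub>M\<^esub> (\<Oplus>\<^bsub>M\<^esub>i\<in>?F. h i \<odot>\<^bsub>M\<^esub> g i)"
      using F(2) c[OF f] c[OF h] by (intro M.M.finsum_addf) blast+
    also have "\<dots> = free_lift R M g f \<oplus>\<^bsub>M\<^esub> free_lift R M g h"
      using free_lift_eq[OF M g f F(1) _ F(2)] free_lift_eq[OF M g h F(1) _ F(2)] by simp
    finally show "free_lift R M g (f \<oplus>\<^bsub>free_module R I\<^esub> h) = free_lift R M g f \<oplus>\<^bsub>M\<^esub> free_lift R M g h" .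
  next
    fix r f assume r: "r \<in> carrier R" and f: "f \<in> carrier (free_module R I)"
    let ?F = "{i. f i \<noteq> \<zero>\<^bsub>R\<^esub>}"
    have rf: "r \<odot>\<^bsub>free_module R I\<^esub> f \<in> carrier (free_module R I)"
      using r f by (rule L.smult_closed)
    have s: "{i. (r \<odot>\<^bsub>free_module R I\<^esub> f) i \<noteq> \<zero>\<^bsub>R\<^esub>} \<subseteq> ?F" using r by auto
    have "free_lift R M g (r \<odot>\<^bsub>free_module R I\<^esub> f) =
        (\<Oplus>\<^bsub>M\<^esub>i\<in>?F. (r \<odot>\<^bsub>free_module R I\<^esub> f) i \<odot>\<^bsub>M\<^esub> g i)"
      by (rule free_lift_eq[OF M g rf supp(1)[OF f] s supp(2)[OF f]])
    also have "\<dots> = (\<Oplus>\<^bsub>M\<^esub>i\<in>?F. r \<odot>\<^bsub>M\<^esub> (f i \<odot>\<^bsub>M\<^esub> g i))"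
    proof (rule M.M.finsum_cong'[OF refl])
      show "(\<lambda>i. r \<odot>\<^bsub>M\<^esub> (f i \<odot>\<^bsub>M\<^esub> g i)) \<in> ?F \<rightarrow> carrier M"
        using supp(2)[OF f] by (intro funcsetI M.smult_closed[OF r] c[OF f]) blast
      fix i assume "i \<in> ?F"
      then have "g i \<in> carrier M" using supp(2)[OF f] g by blast
      then show "(r \<odot>\<^bsub>free_module R I\<^esub> f) i \<odot>\<^bsub>M\<^esub> g i = r \<odot>\<^bsub>M\<^esub> (f i \<odot>\<^bsub>M\<^esub> g i)"
        using M.R.free_module_value[OF f, of i] r by (simp add: M.smult_smult)
    qed
    also have "\<dots> = r \<odot>\<^bsub>M\<^esub> (\<Oplus>\<^bsub>M\<^esub>i\<in>?F. f i \<odot>\<^bsub>M\<^esub> g i)"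
    proof -
      have "(\<Oplus>\<^bsub>M\<^esub>i\<in>S. r \<odot>\<^bsub>M\<^esub> (f i \<odot>\<^bsub>M\<^esub> g i)) = r \<odot>\<^bsub>M\<^esub> (\<Oplus>\<^bsub>M\<^esub>i\<in>S. f i \<odot>\<^bsub>M\<^esub> g i)"
        if "finite S" "S \<subseteq> I" for S
        using that
      proof (induction S rule: finite_induct)
        case (insert i S)
        have "(\<lambda>i. f i \<odot>\<^bsub>M\<^esub> g i) \<in> S \<rightarrow> carrier M" "(\<lambda>i. r \<odot>\<^bsub>M\<^esub> (f i \<odot>\<^bsub>M\<^esub> g i)) \<in> S \<rightarrow> carrier M"
          using insert.prems by (intro funcsetI M.smult_closed[OF r] c[OF f]; blast)+
        then show ?case
          using insert c[OF f, of i] r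
          by (simp add: M.M.finsum_insert M.smult_closed M.smult_add_right M.M.finsum_closed)
      qed (simp add: r M.smult_zero_right)
      then show ?thesis using supp[OF f] by blast
    qed
    finally show "free_lift R M g (r \<odot>\<^bsub>free_module R I\<^esub> f) = r \<odot>\<^bsub>M\<^esub> free_lift R M g f"
      unfolding free_lift_def .
  qed
  fix i assume i: "i \<in> I"
  have "free_lift R M g (unit_vec R i) = (\<Oplus>\<^bsub>M\<^esub>j\<in>{i}. unit_vec R i j \<odot>\<^bsub>M\<^esub> g j)"
    by (rule free_lift_eq[OF M g M.R.unit_vec_closed]) (use i in \<open>auto simp: unit_vec_def\<close>)
  also have "\<dots> = g i" using g[OF i] by (simp add: unit_vec_def M.smult_one)
  finally show "free_lift R M g (unit_vec R i) = g i" .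
qed

lemma free_module_hom_eq:
  assumes M: "lmod R M" and f: "is_hom R (free_module R I) M f" and g: "is_hom R (free_module R I) M g"
    and eq: "\<And>i. i \<in> I \<Longrightarrow> f (unit_vec R i) = g (unit_vec R i)"
    and x: "x \<in> carrier (free_module R I)"
  shows "f x = g x"
proof -
  interpret M: lmod R M by fact
  interpret L: lmod R "free_module R I" by (rule M.R.free_module_lmod)
  show ?thesis using x
  proof (induction x rule: M.R.free_module_induct)
    case zero
    show ?case
      using is_hom_zero[OF f L.lmod_axioms M] is_hom_zero[OF g L.lmod_axioms M] by simp
  next
    case (add x r i)
    have u: "unit_vec R i \<in> carrier (free_module R I)" using add(3) by (rule M.R.unit_vec_closed)
    have ru: "r \<odot>\<^bsub>free_module R I\<^esub> unit_vec R i \<in> carrier (free_module R I)"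
      using add(2) u by (rule L.smult_closed)
    show ?case
      unfolding is_homD(2)[OF f add(1) ru] is_homD(2)[OF g add(1) ru] is_homD(3)[OF f add(2) u]
        is_homD(3)[OF g add(2) u] add(4) eq[OF add(3)] ..
  qed
qed

text \<open>The splitting in \<open>projective_module\<close> with an index set of any type: the
  Koszul modules are free on exponent vectors, whose type is not that of their elements.\<close>

definition free_retract :: "('r, 'b) ring_scheme \<Rightarrow> ('r, 'p) module \<Rightarrow> 'i set \<Rightarrow> bool" where
  "free_retract R P I \<longleftrightarrow> (\<exists>s r. is_hom R P (free_module R I) s \<and> is_hom R (free_module R I) P r \<and>
     (\<forall>x\<in>carrier P. r (s x) = x))"

text \<open>Preimages are chosen for the images of the basis vectors, extended to the free module
  and restricted along the section. The inclusion of images replaces surjectivity of g, so that g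
  may be a differential, which reaches only cycles.\<close>

lemma free_retract_lift:
  assumes P: "free_retract R P I" and X: "lmod R X" and Y: "lmod R Y"
    and g: "is_hom R X Y g" and f: "is_hom R P Y f" and sub: "f ` carrier P \<subseteq> g ` carrier X"
  shows "\<exists>h. is_hom R P X h \<and> (\<forall>x\<in>carrier P. g (h x) = f x)"
proof -
  interpret X: lmod R X by fact
  obtain s r where s: "is_hom R P (free_module R I) s" and r: "is_hom R (free_module R I) P r"
    and rs: "\<And>x. x \<in> carrier P \<Longrightarrow> r (s x) = x"
    using P unfolding free_retract_def by blast
  have "\<exists>x\<in>carrier X. g x = f (r (unit_vec R i))" if "i \<in> I" for i
    using is_homD(1)[OF r X.R.unit_vec_closed[OF that]] sub by (metis imageE image_subset_iff)
  then obtain x where x: "\<And>i. i \<in> I \<Longrightarrow> x i \<in> carrier X" "\<And>i. i \<in> I \<Longrightarrow> g (x i) = f (r (unit_vec R i))"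
    by metis
  have L: "is_hom R (free_module R I) X (free_lift R X x)"
    "\<And>i. i \<in> I \<Longrightarrow> free_lift R X x (unit_vec R i) = x i"
    using free_lift_hom[OF X, of I x] x(1) by auto
  have "g (free_lift R X x v) = f (r v)" if "v \<in> carrier (free_module R I)" for v
    by (rule free_module_hom_eq[OF Y is_hom_comp[OF L(1) g] is_hom_comp[OF r f] _ that])
      (auto simp: L(2) x(2))
  then have "g (free_lift R X x (s v)) = f v" if "v \<in> carrier P" for v
    using is_homD(1)[OF s that] rs[OF that] by simp
  then show ?thesis using is_hom_comp[OF s L(1)] by blast
qed

section \<open>Chain maps and homotopies between resolutions\<close>

locale resolution =
  fixes R :: "('r, 'b) ring_scheme" and M :: "('r, 'm) module" and P :: "nat \<Rightarrow> ('r, 'p) module"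
    and d :: "nat \<Rightarrow> 'p \<Rightarrow> 'p" and e :: "'p \<Rightarrow> 'm" and I :: "nat \<Rightarrow> 'i set"
  assumes lmod_M: "lmod R M" and lmod_P: "\<And>n. lmod R (P n)"
    and retract: "\<And>n. free_retract R (P n) (I n)"
    and d_hom: "\<And>n. is_hom R (P (Suc n)) (P n) (d n)"
    and e_hom: "is_hom R (P 0) M e" and e_onto: "e ` carrier (P 0) = carrier M"
    and exact_0: "d 0 ` carrier (P (Suc 0)) = {x \<in> carrier (P 0). e x = \<zero>\<^bsub>M\<^esub>}"
    and exact_Suc: "\<And>n. d (Suc n) ` carrier (P (Suc (Suc n))) = {x \<in> carrier (P (Suc n)). d n x = \<zero>\<^bsub>P n\<^esub>}"
begin

lemma d_d: "x \<in> carrier (P (Suc (Suc n))) \<Longrightarrow> d n (d (Suc n) x) = \<zero>\<^bsub>P n\<^esub>"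
  using exact_Suc[of n] by blast

lemma e_d: "x \<in> carrier (P (Suc 0)) \<Longrightarrow> e (d 0 x) = \<zero>\<^bsub>M\<^esub>"
  using exact_0 by blast

lemma d_closed: "x \<in> carrier (P (Suc n)) \<Longrightarrow> d n x \<in> carrier (P n)"
  by (rule is_homD(1)[OF d_hom])

end

locale two_resolutions = P: resolution R M P dP eP I + Q: resolution R M Q dQ eQ J
  for R :: "('r, 'b) ring_scheme" and M :: "('r, 'm) module"
    and P :: "nat \<Rightarrow> ('r, 'p) module" and dP eP and I :: "nat \<Rightarrow> 'i set"
    and Q :: "nat \<Rightarrow> ('r, 'q) module" and dQ eQ and J :: "nat \<Rightarrow> 'j set"
begin

lemma chain_map_exists:
  "\<exists>f. (\<forall>n. is_hom R (P n) (Q n) (f n)) \<and> (\<forall>x\<in>carrier (P 0). eQ (f 0 x) = eP x) \<and>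
     (\<forall>n. \<forall>x\<in>carrier (P (Suc n)). dQ n (f (Suc n) x) = f n (dP n x))"
proof -
  \<comment> \<open>Besides linearity the invariant records that f carries boundaries into the image
    of the next differential of Q. Exactness of Q provides this, and the next lifting step consumes
    it.\<close>
  define S where "S n f \<longleftrightarrow> is_hom R (P n) (Q n) f \<and> (n = 0 \<longrightarrow> (\<forall>x\<in>carrier (P 0). eQ (f x) = eP x)) \<and>
     (\<forall>x\<in>carrier (P (Suc n)). f (dP n x) \<in> dQ n ` carrier (Q (Suc n)))" for n f
  have "\<exists>f. \<forall>n. S n (f n) \<and> (\<forall>x\<in>carrier (P (Suc n)). dQ n (f (Suc n) x) = f n (dP n x))"
  proof (rule dependent_nat_choice)
    have "eP ` carrier (P 0) \<subseteq> eQ ` carrier (Q 0)" by (simp add: P.e_onto Q.e_onto)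
    then obtain f where f: "is_hom R (P 0) (Q 0) f" "\<forall>x\<in>carrier (P 0). eQ (f x) = eP x"
      using free_retract_lift[OF P.retract Q.lmod_P Q.lmod_M Q.e_hom P.e_hom] by blast
    then have "f (dP 0 x) \<in> dQ 0 ` carrier (Q (Suc 0))" if "x \<in> carrier (P (Suc 0))" for x
      using that P.d_closed[OF that] P.e_d[OF that] is_homD(1)[OF f(1)] by (auto simp: Q.exact_0)
    then show "\<exists>f. S 0 f" using f unfolding S_def by blast
  next
    fix f n assume "S n f"
    then have f: "is_hom R (P n) (Q n) f"
      "\<And>x. x \<in> carrier (P (Suc n)) \<Longrightarrow> f (dP n x) \<in> dQ n ` carrier (Q (Suc n))"
      unfolding S_def by auto
    have "\<exists>h. is_hom R (P (Suc n)) (Q (Suc n)) h \<and> (\<forall>x\<in>carrier (P (Suc n)). dQ n (h x) = f (dP n x))"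
      using f(2) by (intro free_retract_lift[OF P.retract Q.lmod_P Q.lmod_P Q.d_hom
            is_hom_comp[OF P.d_hom f(1)]]) blast
    then obtain g where g: "is_hom R (P (Suc n)) (Q (Suc n)) g"
      "\<forall>x\<in>carrier (P (Suc n)). dQ n (g x) = f (dP n x)" by blast
    have "g (dP (Suc n) x) \<in> dQ (Suc n) ` carrier (Q (Suc (Suc n)))" if x: "x \<in> carrier (P (Suc (Suc n)))" for x
      using P.d_closed[OF x] P.d_d[OF x] g is_homD(1)[OF g(1)] is_hom_zero[OF f(1) P.lmod_P Q.lmod_P]
      by (auto simp: Q.exact_Suc)
    then show "\<exists>g. S (Suc n) g \<and> (\<forall>x\<in>carrier (P (Suc n)). dQ n (g x) = f (dP n x))"
      using g unfolding S_def by blast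
  qed
  then obtain f where f: "\<And>n. S n (f n)"
    "\<And>n x. x \<in> carrier (P (Suc n)) \<Longrightarrow> dQ n (f (Suc n) x) = f n (dP n x)" by blast
  show ?thesis
    using f(1)[of 0] f(1) f(2) by (intro exI[of _ f]) (simp add: S_def)
qed

lemma null_homotopy_exists:
  assumes g: "\<And>n. is_hom R (P n) (Q n) (g n)"
    and g0: "\<And>x. x \<in> carrier (P 0) \<Longrightarrow> eQ (g 0 x) = \<zero>\<^bsub>M\<^esub>"
    and gd: "\<And>n x. x \<in> carrier (P (Suc n)) \<Longrightarrow> dQ n (g (Suc n) x) = g n (dP n x)"
  shows "\<exists>h. (\<forall>n. is_hom R (P n) (Q (Suc n)) (h n)) \<and> (\<forall>x\<in>carrier (P 0). dQ 0 (h 0 x) = g 0 x) \<and>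
     (\<forall>n. \<forall>x\<in>carrier (P (Suc n)). dQ (Suc n) (h (Suc n) x) = g (Suc n) x \<ominus>\<^bsub>Q (Suc n)\<^esub> h n (dP n x))"
proof -
  \<comment> \<open>The last clause says that the defect left by h is a boundary of Q, so that the
    next component of the homotopy can be lifted along \<open>dQ\<close>.\<close>
  define S where "S n h \<longleftrightarrow> is_hom R (P n) (Q (Suc n)) h \<and> (n = 0 \<longrightarrow> (\<forall>x\<in>carrier (P 0). dQ 0 (h x) = g 0 x)) \<and>
     (\<forall>x\<in>carrier (P (Suc n)). g (Suc n) x \<ominus>\<^bsub>Q (Suc n)\<^esub> h (dP n x) \<in> dQ (Suc n) ` carrier (Q (Suc (Suc n))))" for n h
  have "\<exists>h. \<forall>n. S n (h n) \<and>
      (\<forall>x\<in>carrier (P (Suc n)). dQ (Suc n) (h (Suc n) x) = g (Suc n) x \<ominus>\<^bsub>Q (Suc n)\<^esub> h n (dP n x))"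
  proof (rule dependent_nat_choice)
    have "g 0 ` carrier (P 0) \<subseteq> dQ 0 ` carrier (Q (Suc 0))"
      using g0 is_homD(1)[OF g] by (auto simp: Q.exact_0)
    then obtain h where h: "is_hom R (P 0) (Q (Suc 0)) h" "\<forall>x\<in>carrier (P 0). dQ 0 (h x) = g 0 x"
      using free_retract_lift[OF P.retract Q.lmod_P Q.lmod_P Q.d_hom g] by blast
    interpret Q0: lmod R "Q 0" by (rule Q.lmod_P)
    interpret Q1: lmod R "Q (Suc 0)" by (rule Q.lmod_P)
    have "g (Suc 0) x \<ominus>\<^bsub>Q (Suc 0)\<^esub> h (dP 0 x) \<in> dQ (Suc 0) ` carrier (Q (Suc (Suc 0)))"
      if x: "x \<in> carrier (P (Suc 0))" for x
    proof -
      note dx = P.d_closed[OF x]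
      have c: "g (Suc 0) x \<in> carrier (Q (Suc 0))" "h (dP 0 x) \<in> carrier (Q (Suc 0))"
        "g 0 (dP 0 x) \<in> carrier (Q 0)"
        using is_homD(1)[OF g x] is_homD(1)[OF h(1) dx] is_homD(1)[OF g dx] by auto
      then show ?thesis
        using h(2) dx gd[OF x]
        by (auto simp: Q.exact_Suc is_hom_minus[OF Q.d_hom Q.lmod_P Q.lmod_P c(1,2)] Q0.M.minus_eq Q0.M.r_neg)
    qed
    then show "\<exists>h. S 0 h" using h unfolding S_def by blast
  next
    fix h n assume "S n h"
    then have h: "is_hom R (P n) (Q (Suc n)) h"
      "\<And>x. x \<in> carrier (P (Suc n)) \<Longrightarrow>
        g (Suc n) x \<ominus>\<^bsub>Q (Suc n)\<^esub> h (dP n x) \<in> dQ (Suc n) ` carrier (Q (Suc (Suc n)))"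
      unfolding S_def by auto
    interpret Q0: lmod R "Q n" by (rule Q.lmod_P)
    interpret Q1: lmod R "Q (Suc n)" by (rule Q.lmod_P)
    interpret Q2: lmod R "Q (Suc (Suc n))" by (rule Q.lmod_P)
    have "\<exists>h'. is_hom R (P (Suc n)) (Q (Suc (Suc n))) h' \<and> (\<forall>x\<in>carrier (P (Suc n)).
        dQ (Suc n) (h' x) = g (Suc n) x \<ominus>\<^bsub>Q (Suc n)\<^esub> h (dP n x))"
      using h(2) by (intro free_retract_lift[OF P.retract Q.lmod_P Q.lmod_P Q.d_hom
            is_hom_diff[OF g is_hom_comp[OF P.d_hom h(1)] Q.lmod_P]]) blast
    then obtain h' where h': "is_hom R (P (Suc n)) (Q (Suc (Suc n))) h'"
      "\<forall>x\<in>carrier (P (Suc n)). dQ (Suc n) (h' x) = g (Suc n) x \<ominus>\<^bsub>Q (Suc n)\<^esub> h (dP n x)" by blast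
    have "g (Suc (Suc n)) x \<ominus>\<^bsub>Q (Suc (Suc n))\<^esub> h' (dP (Suc n) x) \<in>
        dQ (Suc (Suc n)) ` carrier (Q (Suc (Suc (Suc n))))" if x: "x \<in> carrier (P (Suc (Suc n)))" for x
    proof -
      note dx = P.d_closed[OF x]
      have c: "g (Suc (Suc n)) x \<in> carrier (Q (Suc (Suc n)))" "h' (dP (Suc n) x) \<in> carrier (Q (Suc (Suc n)))"
        "g (Suc n) (dP (Suc n) x) \<in> carrier (Q (Suc n))"
        using is_homD(1)[OF g x] is_homD(1)[OF h'(1) dx] is_homD(1)[OF g dx] by auto
      have "dQ (Suc n) (h' (dP (Suc n) x)) = g (Suc n) (dP (Suc n) x)"
        using h'(2) dx P.d_d[OF x] is_hom_zero[OF h(1) P.lmod_P Q.lmod_P] c(3)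
        by (simp add: Q1.M.minus_eq)
      then show ?thesis
        using c gd[OF x]
        by (auto simp: Q.exact_Suc is_hom_minus[OF Q.d_hom Q.lmod_P Q.lmod_P c(1,2)] Q1.M.minus_eq Q1.M.r_neg)
    qed
    then show "\<exists>h'. S (Suc n) h' \<and> (\<forall>x\<in>carrier (P (Suc n)).
        dQ (Suc n) (h' x) = g (Suc n) x \<ominus>\<^bsub>Q (Suc n)\<^esub> h (dP n x))"
      using h' unfolding S_def by blast
  qed
  then obtain h where h: "\<And>n. S n (h n)"
    "\<And>n x. x \<in> carrier (P (Suc n)) \<Longrightarrow>
      dQ (Suc n) (h (Suc n) x) = g (Suc n) x \<ominus>\<^bsub>Q (Suc n)\<^esub> h n (dP n x)" by blast
  show ?thesis
    using h(1)[of 0] h(1) h(2) by (intro exI[of _ h]) (simp add: S_def)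
qed

end

text \<open>The chain map id - g covers the zero map of M, hence is null homotopic. The result is
  rearranged into a decomposition of x, to which a cocycle can be applied term by term.\<close>

lemma (in resolution) homotopic_to_identity:
  assumes g: "\<And>n. is_hom R (P n) (P n) (g n)"
    and g0: "\<And>x. x \<in> carrier (P 0) \<Longrightarrow> e (g 0 x) = e x"
    and gd: "\<And>n x. x \<in> carrier (P (Suc n)) \<Longrightarrow> d n (g (Suc n) x) = g n (d n x)"
  shows "\<exists>h. (\<forall>n. is_hom R (P n) (P (Suc n)) (h n)) \<and>
     (\<forall>x\<in>carrier (P 0). x = g 0 x \<oplus>\<^bsub>P 0\<^esub> d 0 (h 0 x)) \<and>
     (\<forall>n. \<forall>x\<in>carrier (P (Suc n)).
        x = g (Suc n) x \<oplus>\<^bsub>P (Suc n)\<^esub> (d (Suc n) (h (Suc n) x) \<oplus>\<^bsub>P (Suc n)\<^esub> h n (d n x)))"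
proof -
  interpret PP: two_resolutions R M P d e I P d e I ..
  interpret M: lmod R M by (rule lmod_M)
  have id: "is_hom R (P n) (P n) (\<lambda>x. x)" for n by (rule is_homI) auto
  have "\<exists>h. (\<forall>n. is_hom R (P n) (P (Suc n)) (h n)) \<and>
      (\<forall>x\<in>carrier (P 0). d 0 (h 0 x) = x \<ominus>\<^bsub>P 0\<^esub> g 0 x) \<and>
      (\<forall>n. \<forall>x\<in>carrier (P (Suc n)). d (Suc n) (h (Suc n) x) =
        (x \<ominus>\<^bsub>P (Suc n)\<^esub> g (Suc n) x) \<ominus>\<^bsub>P (Suc n)\<^esub> h n (d n x))"
  proof (rule PP.null_homotopy_exists)
    show "is_hom R (P n) (P n) (\<lambda>x. x \<ominus>\<^bsub>P n\<^esub> g n x)" for n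
      by (rule is_hom_diff[OF id g lmod_P])
    show "e (x \<ominus>\<^bsub>P 0\<^esub> g 0 x) = \<zero>\<^bsub>M\<^esub>" if x: "x \<in> carrier (P 0)" for x
      using is_hom_minus[OF e_hom lmod_P lmod_M x is_homD(1)[OF g x]] g0[OF x] is_homD(1)[OF e_hom x]
      by (simp add: M.M.minus_eq M.M.r_neg)
    show "d n (x \<ominus>\<^bsub>P (Suc n)\<^esub> g (Suc n) x) = d n x \<ominus>\<^bsub>P n\<^esub> g n (d n x)"
      if x: "x \<in> carrier (P (Suc n))" for n x
      using is_hom_minus[OF d_hom lmod_P lmod_P x is_homD(1)[OF g x]] gd[OF x] by simp
  qed
  then obtain h where h: "\<And>n. is_hom R (P n) (P (Suc n)) (h n)"
    "\<And>x. x \<in> carrier (P 0) \<Longrightarrow> d 0 (h 0 x) = x \<ominus>\<^bsub>P 0\<^esub> g 0 x"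
    "\<And>n x. x \<in> carrier (P (Suc n)) \<Longrightarrow> d (Suc n) (h (Suc n) x) =
        (x \<ominus>\<^bsub>P (Suc n)\<^esub> g (Suc n) x) \<ominus>\<^bsub>P (Suc n)\<^esub> h n (d n x)" by blast
  have "x = g 0 x \<oplus>\<^bsub>P 0\<^esub> d 0 (h 0 x)" if x: "x \<in> carrier (P 0)" for x
  proof -
    interpret L: lmod R "P 0" by (rule lmod_P)
    show ?thesis
      using L.minus_cancel[OF x is_homD(1)[OF g x]] is_homD(1)[OF g x] x by (simp add: h(2) L.M.a_comm)
  qed
  moreover have "x = g (Suc n) x \<oplus>\<^bsub>P (Suc n)\<^esub> (d (Suc n) (h (Suc n) x) \<oplus>\<^bsub>P (Suc n)\<^esub> h n (d n x))"
    if x: "x \<in> carrier (P (Suc n))" for n x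
  proof -
    interpret L: lmod R "P (Suc n)" by (rule lmod_P)
    have c: "g (Suc n) x \<in> carrier (P (Suc n))" "h n (d n x) \<in> carrier (P (Suc n))"
      using is_homD(1)[OF g x] is_homD(1)[OF h(1) d_closed[OF x]] by auto
    show ?thesis
      using L.minus_cancel[OF L.M.minus_closed[OF x c(1)] c(2)] L.minus_cancel[OF x c(1)] c x
      by (simp add: h(3) L.M.a_comm)
  qed
  ultimately show ?thesis using h(1) by blast
qed

section \<open>Cohomology of Hom complexes\<close>

definition is_cocycle where
  "is_cocycle R P d N m f \<longleftrightarrow> is_hom R (P m) N f \<and> (\<forall>x\<in>carrier (P (Suc m)). f (d m x) = \<zero>\<^bsub>N\<^esub>)"

text \<open>As with \<open>is_cocycle\<close>, a condition on plain functions, unrestricted outside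
  the carriers, so that composition with chain maps needs no \<open>restrict\<close>.
  \<open>Hom_cocycles_iff\<close> and \<open>Hom_coboundaries_iff\<close> translate to
  \<open>Hom_space\<close>.\<close>

definition is_coboundary where
  "is_coboundary R P d N m f \<longleftrightarrow> (case m of 0 \<Rightarrow> (\<forall>x\<in>carrier (P 0). f x = \<zero>\<^bsub>N\<^esub>)
     | Suc n \<Rightarrow> (\<exists>g. is_hom R (P n) N g \<and> (\<forall>x\<in>carrier (P (Suc n)). f x = g (d n x))))"

text \<open>Apply f to the decomposition of x: the term d h x dies because f is a cocycle, and f h d
  x is a coboundary with primitive f h. In degree 0 the latter term is absent.\<close>

lemma (in resolution) coboundary_of_homotopy:
  assumes N: "lmod R N" and f: "is_cocycle R P d N m f"
    and h: "\<And>n. is_hom R (P n) (P (Suc n)) (h n)"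
      "\<And>x. x \<in> carrier (P 0) \<Longrightarrow> x = g 0 x \<oplus>\<^bsub>P 0\<^esub> d 0 (h 0 x)"
      "\<And>n x. x \<in> carrier (P (Suc n)) \<Longrightarrow>
        x = g (Suc n) x \<oplus>\<^bsub>P (Suc n)\<^esub> (d (Suc n) (h (Suc n) x) \<oplus>\<^bsub>P (Suc n)\<^esub> h n (d n x))"
    and g: "\<And>n. is_hom R (P n) (P n) (g n)"
  shows "is_coboundary R P d N m (\<lambda>x. f x \<ominus>\<^bsub>N\<^esub> f (g m x))"
proof -
  interpret N: lmod R N by fact
  have f: "is_hom R (P m) N f" "\<And>x. x \<in> carrier (P (Suc m)) \<Longrightarrow> f (d m x) = \<zero>\<^bsub>N\<^esub>"
    using assms(2) unfolding is_cocycle_def by auto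
  show ?thesis
  proof (cases m)
    case 0
    have "f x \<ominus>\<^bsub>N\<^esub> f (g 0 x) = \<zero>\<^bsub>N\<^esub>" if x: "x \<in> carrier (P 0)" for x
    proof -
      have gx: "g 0 x \<in> carrier (P 0)" and hx: "h 0 x \<in> carrier (P (Suc 0))"
        using is_homD(1)[OF g x] is_homD(1)[OF h(1) x] .
      have "f x = f (g 0 x \<oplus>\<^bsub>P 0\<^esub> d 0 (h 0 x))" using h(2)[OF x] by simp
      also have "\<dots> = f (g 0 x)"
        using is_homD(2)[OF f(1), of "g 0 x" "d 0 (h 0 x)"] gx d_closed[OF hx] f(2)[of "h 0 x"] hx 0
          is_homD(1)[OF f(1), of "g 0 x"] by simp
      finally show ?thesis using is_homD(1)[OF f(1), of "g 0 x"] gx 0 by (simp add: N.M.minus_eq N.M.r_neg)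
    qed
    then show ?thesis using 0 by (simp add: is_coboundary_def)
  next
    case (Suc n)
    have "f x \<ominus>\<^bsub>N\<^esub> f (g m x) = f (h n (d n x))" if x: "x \<in> carrier (P (Suc n))" for x
    proof -
      have gx: "g m x \<in> carrier (P m)" and hx: "h m x \<in> carrier (P (Suc m))"
        and hdx: "h n (d n x) \<in> carrier (P m)"
        using is_homD(1)[OF g] is_homD(1)[OF h(1)] x d_closed[OF x] Suc by auto
      interpret L: lmod R "P m" by (rule lmod_P)
      have fc: "f (g m x) \<in> carrier N" "f (h n (d n x)) \<in> carrier N"
        using is_homD(1)[OF f(1)] gx hdx by auto
      have "f x = f (g m x \<oplus>\<^bsub>P m\<^esub> (d m (h m x) \<oplus>\<^bsub>P m\<^esub> h n (d n x)))" using h(3)[OF x] Suc by simp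
      also have "\<dots> = f (g m x) \<oplus>\<^bsub>N\<^esub> f (h n (d n x))"
        using is_homD(2)[OF f(1)] gx d_closed[OF hx] hdx f(2)[OF hx] fc by simp
      finally show ?thesis using fc by (simp add: N.M.minus_eq N.M.a_ac N.M.r_neg1 N.M.r_neg2)
    qed
    moreover have "is_hom R (P n) N (\<lambda>x. f (h n x))"
      using is_hom_comp[OF h(1) ] f(1) Suc by blast
    ultimately show ?thesis using Suc unfolding is_coboundary_def by auto
  qed
qed

text \<open>The comparison map is a homotopy equivalence, so composition with it induces an isomorphism on
  the cohomology of the Hom complexes.\<close>

lemma (in two_resolutions) comparison:
  fixes N :: "('r, 'n) module"
  assumes N: "lmod R N"
  shows "\<exists>f. (\<forall>n. is_hom R (P n) (Q n) (f n)) \<and>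
     (\<forall>n. \<forall>x\<in>carrier (P (Suc n)). dQ n (f (Suc n) x) = f n (dP n x)) \<and>
     (\<forall>m z. is_cocycle R Q dQ N m z \<longrightarrow> is_coboundary R P dP N m (\<lambda>x. z (f m x)) \<longrightarrow>
        is_coboundary R Q dQ N m z) \<and>
     (\<forall>m t. is_cocycle R P dP N m t \<longrightarrow> (\<exists>z. is_cocycle R Q dQ N m z \<and>
        is_coboundary R P dP N m (\<lambda>x. t x \<ominus>\<^bsub>N\<^esub> z (f m x))))"
proof -
  interpret QP: two_resolutions R M Q dQ eQ J P dP eP I ..
  interpret N: lmod R N by fact
  obtain f where f: "\<And>n. is_hom R (P n) (Q n) (f n)" "\<And>x. x \<in> carrier (P 0) \<Longrightarrow> eQ (f 0 x) = eP x"
    "\<And>n x. x \<in> carrier (P (Suc n)) \<Longrightarrow> dQ n (f (Suc n) x) = f n (dP n x)"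
    using chain_map_exists by blast
  obtain b where b: "\<And>n. is_hom R (Q n) (P n) (b n)" "\<And>x. x \<in> carrier (Q 0) \<Longrightarrow> eP (b 0 x) = eQ x"
    "\<And>n x. x \<in> carrier (Q (Suc n)) \<Longrightarrow> dP n (b (Suc n) x) = b n (dQ n x)"
    using QP.chain_map_exists by blast
  have "\<exists>h. (\<forall>n. is_hom R (P n) (P (Suc n)) (h n)) \<and>
     (\<forall>x\<in>carrier (P 0). x = b 0 (f 0 x) \<oplus>\<^bsub>P 0\<^esub> dP 0 (h 0 x)) \<and>
     (\<forall>n. \<forall>x\<in>carrier (P (Suc n)). x = b (Suc n) (f (Suc n) x) \<oplus>\<^bsub>P (Suc n)\<^esub>
        (dP (Suc n) (h (Suc n) x) \<oplus>\<^bsub>P (Suc n)\<^esub> h n (dP n x)))"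
    by (rule P.homotopic_to_identity[where g = "\<lambda>n x. b n (f n x)"])
      (simp_all add: f b is_homD(1)[OF f(1)] is_homD(1)[OF b(1)] is_hom_comp[OF f(1) b(1)])
  then obtain h where h: "\<And>n. is_hom R (P n) (P (Suc n)) (h n)"
     "\<And>x. x \<in> carrier (P 0) \<Longrightarrow> x = b 0 (f 0 x) \<oplus>\<^bsub>P 0\<^esub> dP 0 (h 0 x)"
     "\<And>n x. x \<in> carrier (P (Suc n)) \<Longrightarrow> x = b (Suc n) (f (Suc n) x) \<oplus>\<^bsub>P (Suc n)\<^esub>
        (dP (Suc n) (h (Suc n) x) \<oplus>\<^bsub>P (Suc n)\<^esub> h n (dP n x))" by blast
  have "\<exists>k. (\<forall>n. is_hom R (Q n) (Q (Suc n)) (k n)) \<and>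
     (\<forall>x\<in>carrier (Q 0). x = f 0 (b 0 x) \<oplus>\<^bsub>Q 0\<^esub> dQ 0 (k 0 x)) \<and>
     (\<forall>n. \<forall>x\<in>carrier (Q (Suc n)). x = f (Suc n) (b (Suc n) x) \<oplus>\<^bsub>Q (Suc n)\<^esub>
        (dQ (Suc n) (k (Suc n) x) \<oplus>\<^bsub>Q (Suc n)\<^esub> k n (dQ n x)))"
  proof (rule Q.homotopic_to_identity[where g = "\<lambda>n x. f n (b n x)"])
    show "is_hom R (Q n) (Q n) (\<lambda>x. f n (b n x))" for n by (rule is_hom_comp[OF b(1) f(1)])
    show "eQ (f 0 (b 0 x)) = eQ x" if "x \<in> carrier (Q 0)" for x
      using that f(2) b(2) is_homD(1)[OF b(1)] by simp
    show "dQ n (f (Suc n) (b (Suc n) x)) = f n (b n (dQ n x))" if "x \<in> carrier (Q (Suc n))" for n x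
      using that f(3) b(3) is_homD(1)[OF b(1)] by simp
  qed
  then obtain k where k: "\<And>n. is_hom R (Q n) (Q (Suc n)) (k n)"
     "\<And>x. x \<in> carrier (Q 0) \<Longrightarrow> x = f 0 (b 0 x) \<oplus>\<^bsub>Q 0\<^esub> dQ 0 (k 0 x)"
     "\<And>n x. x \<in> carrier (Q (Suc n)) \<Longrightarrow> x = f (Suc n) (b (Suc n) x) \<oplus>\<^bsub>Q (Suc n)\<^esub>
        (dQ (Suc n) (k (Suc n) x) \<oplus>\<^bsub>Q (Suc n)\<^esub> k n (dQ n x))" by blast
  \<comment> \<open>Write z as (z - z f b) + z f b. The first part is a coboundary by the homotopy k
    on Q, the second by composing the given primitive on P with b.\<close>
  have inj: "is_coboundary R Q dQ N m z"
    if z: "is_cocycle R Q dQ N m z" and zf: "is_coboundary R P dP N m (\<lambda>x. z (f m x))" for m z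
  proof -
    have zh: "is_hom R (Q m) N z" using z by (simp add: is_cocycle_def)
    have 1: "is_coboundary R Q dQ N m (\<lambda>x. z x \<ominus>\<^bsub>N\<^esub> z (f m (b m x)))"
      by (rule Q.coboundary_of_homotopy[where g = "\<lambda>n x. f n (b n x)" and h = k, OF N z k])
        (assumption | rule is_hom_comp[OF b(1) f(1)])+
    have c: "z x \<in> carrier N" "z (f m (b m x)) \<in> carrier N" if "x \<in> carrier (Q m)" for x
      using is_homD(1)[OF zh] is_homD(1)[OF f(1)] is_homD(1)[OF b(1)] that by auto
    have eq: "z x = (z x \<ominus>\<^bsub>N\<^esub> z (f m (b m x))) \<oplus>\<^bsub>N\<^esub> z (f m (b m x))" if "x \<in> carrier (Q m)" for x
      using N.minus_cancel[OF c[OF that]] by simp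
    show ?thesis
    proof (cases m)
      case 0
      have "z x = \<zero>\<^bsub>N\<^esub>" if x: "x \<in> carrier (Q 0)" for x
      proof -
        have "z (f m (b m x)) = \<zero>\<^bsub>N\<^esub>"
          using zf is_homD(1)[OF b(1) x] 0 by (simp add: is_coboundary_def)
        moreover have "z x \<ominus>\<^bsub>N\<^esub> z (f m (b m x)) = \<zero>\<^bsub>N\<^esub>"
          using 1 x 0 by (simp add: is_coboundary_def)
        ultimately show ?thesis using eq[of x] x 0 by (metis N.M.l_zero N.M.zero_closed)
      qed
      then show ?thesis using 0 by (simp add: is_coboundary_def)
    next
      case (Suc n)
      obtain u where u: "is_hom R (Q n) N u"
        "\<And>x. x \<in> carrier (Q m) \<Longrightarrow> z x \<ominus>\<^bsub>N\<^esub> z (f m (b m x)) = u (dQ n x)"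
        using 1 Suc by (auto simp: is_coboundary_def)
      obtain v where v: "is_hom R (P n) N v" "\<And>x. x \<in> carrier (P m) \<Longrightarrow> z (f m x) = v (dP n x)"
        using zf Suc by (auto simp: is_coboundary_def)
      have "z x = u (dQ n x) \<oplus>\<^bsub>N\<^esub> v (b n (dQ n x))" if x: "x \<in> carrier (Q (Suc n))" for x
      proof -
        have "b m x \<in> carrier (P m)" using is_homD(1)[OF b(1)] x Suc by simp
        then show ?thesis using eq[of x] u(2)[of x] v(2)[of "b m x"] b(3)[OF x] x Suc by simp
      qed
      moreover have "is_hom R (Q n) N (\<lambda>y. u y \<oplus>\<^bsub>N\<^esub> v (b n y))"
        by (rule is_hom_sum[OF u(1) is_hom_comp[OF b(1) v(1)] N])
      ultimately show ?thesis using Suc by (auto simp: is_coboundary_def)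
    qed
  qed
  \<comment> \<open>The preimage of t is t b; the homotopy h on P shows that t and t b f are
    cohomologous.\<close>
  have surj: "is_cocycle R Q dQ N m (\<lambda>x. t (b m x)) \<and>
      is_coboundary R P dP N m (\<lambda>x. t x \<ominus>\<^bsub>N\<^esub> t (b m (f m x)))" if t: "is_cocycle R P dP N m t" for m t
  proof
    show "is_cocycle R Q dQ N m (\<lambda>x. t (b m x))"
      using t is_hom_comp[OF b(1)] is_homD(1)[OF b(1)] b(3)[symmetric] unfolding is_cocycle_def by auto
    show "is_coboundary R P dP N m (\<lambda>x. t x \<ominus>\<^bsub>N\<^esub> t (b m (f m x)))"
      by (rule P.coboundary_of_homotopy[where g = "\<lambda>n x. b n (f n x)" and h = h, OF N t h])
        (assumption | rule is_hom_comp[OF f(1) b(1)])+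
  qed
  have surj': "\<forall>m t. is_cocycle R P dP N m t \<longrightarrow> (\<exists>z. is_cocycle R Q dQ N m z \<and>
      is_coboundary R P dP N m (\<lambda>x. t x \<ominus>\<^bsub>N\<^esub> z (f m x)))"
  proof (intro allI impI)
    fix m t assume "is_cocycle R P dP N m t"
    from surj[OF this] show "\<exists>z. is_cocycle R Q dQ N m z \<and>
        is_coboundary R P dP N m (\<lambda>x. t x \<ominus>\<^bsub>N\<^esub> z (f m x))"
      by (intro exI[of _ "\<lambda>x. t (b m x)"])
  qed
  show ?thesis
    by (rule exI[of _ f]) (use f inj surj' in blast)
qed

lemma Hom_space_simps [simp]:
  "f \<in> carrier (Hom_space R M N) \<longleftrightarrow> f \<in> extensional (carrier M) \<and> is_hom R M N f"
  "\<zero>\<^bsub>Hom_space R M N\<^esub> = (\<lambda>x\<in>carrier M. \<zero>\<^bsub>N\<^esub>)"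
  "f \<oplus>\<^bsub>Hom_space R M N\<^esub> g = (\<lambda>x\<in>carrier M. f x \<oplus>\<^bsub>N\<^esub> g x)"
  "c \<odot>\<^bsub>Hom_space R M N\<^esub> f = (\<lambda>x\<in>carrier M. (c \<odot>\<^bsub>R\<^esub> \<one>\<^bsub>R\<^esub>) \<odot>\<^bsub>N\<^esub> f x)"
  by (simp_all add: Hom_space_def)

lemma is_hom_restrict: "lmod R M \<Longrightarrow> is_hom R M N (restrict f (carrier M)) \<longleftrightarrow> is_hom R M N f"
proof -
  assume "lmod R M"
  then interpret M: lmod R M .
  show ?thesis
    unfolding is_hom_def using M.M.a_closed M.smult_closed by (auto simp: Pi_iff)
qed

lemma is_hom_zero_map:
  assumes "lmod R N"
  shows "is_hom R M N (\<lambda>_. \<zero>\<^bsub>N\<^esub>)"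
proof -
  interpret N: lmod R N by fact
  show ?thesis by (rule is_homI) (auto simp: N.smult_zero_right)
qed

text \<open>The element c 1 is central in R, which keeps the multiple c f linear over a
  noncommutative R.\<close>

lemma Hom_space_vsp:
  fixes R :: "('k::field, 'r) module" and M :: "('r, 'm) module" and N :: "('r, 'n) module"
  assumes R: "kalg R" and M: "lmod R M" and N: "lmod R N"
  shows "vsp (Hom_space R M N)"
    and "\<And>f g x. f \<in> carrier (Hom_space R M N) \<Longrightarrow> g \<in> carrier (Hom_space R M N) \<Longrightarrow> x \<in> carrier M \<Longrightarrow>
      (f \<ominus>\<^bsub>Hom_space R M N\<^esub> g) x = f x \<ominus>\<^bsub>N\<^esub> g x"
proof -
  interpret R: kalg R by fact
  interpret M: lmod R M by fact
  interpret N: lmod R N by fact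
  let ?H = "Hom_space R M N"
  have cent: "r \<otimes>\<^bsub>R\<^esub> (c \<odot>\<^bsub>R\<^esub> \<one>\<^bsub>R\<^esub>) = (c \<odot>\<^bsub>R\<^esub> \<one>\<^bsub>R\<^esub>) \<otimes>\<^bsub>R\<^esub> r" if "r \<in> carrier R" for r c
    using that by (simp add: R.smult_mult_left R.smult_mult_right)
  have sc: "is_hom R M N (\<lambda>x. (c \<odot>\<^bsub>R\<^esub> \<one>\<^bsub>R\<^esub>) \<odot>\<^bsub>N\<^esub> f x)" if f: "is_hom R M N f" for c f
  proof (rule is_homI)
    fix r x assume "r \<in> carrier R" "x \<in> carrier M"
    then show "(c \<odot>\<^bsub>R\<^esub> \<one>\<^bsub>R\<^esub>) \<odot>\<^bsub>N\<^esub> f (r \<odot>\<^bsub>M\<^esub> x) = r \<odot>\<^bsub>N\<^esub> ((c \<odot>\<^bsub>R\<^esub> \<one>\<^bsub>R\<^esub>) \<odot>\<^bsub>N\<^esub> f x)"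
      using is_homD[OF f] by (simp add: cent flip: N.smult_smult)
  qed (auto simp: is_homD[OF f] N.smult_closed N.smult_add_right)
  have neg: "is_hom R M N (\<lambda>x. \<ominus>\<^bsub>N\<^esub> f x)" if f: "is_hom R M N f" for f
    by (rule is_homI) (auto simp: is_homD[OF f] N.smult_minus N.M.minus_add)
  have ag: "abelian_group ?H"
  proof (rule abelian_groupI)
    fix f g assume fg: "f \<in> carrier ?H" "g \<in> carrier ?H"
    then show "f \<oplus>\<^bsub>?H\<^esub> g \<in> carrier ?H"
      by (simp add: is_hom_restrict[OF M] is_hom_sum[OF _ _ N])
    show "f \<oplus>\<^bsub>?H\<^esub> g = g \<oplus>\<^bsub>?H\<^esub> f"
      using fg by (auto simp: is_homD(1) N.M.a_comm intro!: restrict_ext)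
  next
    show "\<zero>\<^bsub>?H\<^esub> \<in> carrier ?H" by (simp add: is_hom_restrict[OF M] is_hom_zero_map[OF N])
  next
    fix f g h assume "f \<in> carrier ?H" "g \<in> carrier ?H" "h \<in> carrier ?H"
    then show "f \<oplus>\<^bsub>?H\<^esub> g \<oplus>\<^bsub>?H\<^esub> h = f \<oplus>\<^bsub>?H\<^esub> (g \<oplus>\<^bsub>?H\<^esub> h)"
      by (auto simp: is_homD(1) N.M.a_assoc intro!: restrict_ext)
  next
    fix f assume f: "f \<in> carrier ?H"
    then show "\<zero>\<^bsub>?H\<^esub> \<oplus>\<^bsub>?H\<^esub> f = f"
      by (intro extensionalityI[of _ "carrier M"]) (auto simp: is_homD(1))
    show "\<exists>g\<in>carrier ?H. g \<oplus>\<^bsub>?H\<^esub> f = \<zero>\<^bsub>?H\<^esub>"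
    proof
      show "(\<lambda>x\<in>carrier M. \<ominus>\<^bsub>N\<^esub> f x) \<in> carrier ?H" using f by (simp add: is_hom_restrict[OF M] neg)
      show "(\<lambda>x\<in>carrier M. \<ominus>\<^bsub>N\<^esub> f x) \<oplus>\<^bsub>?H\<^esub> f = \<zero>\<^bsub>?H\<^esub>"
        using f by (auto simp: is_homD(1) N.M.l_neg intro!: restrict_ext)
    qed
  qed
  show H: "vsp ?H"
  proof (rule vsp.intro[OF ag], rule vsp_axioms.intro)
    fix c d and f g assume f: "f \<in> carrier ?H"
    note fc = is_homD(1)[of R M N f]
    show "c \<odot>\<^bsub>?H\<^esub> f \<in> carrier ?H" using f by (simp add: is_hom_restrict[OF M] sc)
    show "(c + d) \<odot>\<^bsub>?H\<^esub> f = c \<odot>\<^bsub>?H\<^esub> f \<oplus>\<^bsub>?H\<^esub> d \<odot>\<^bsub>?H\<^esub> f"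
      using f fc by (auto simp: R.smult_add_left N.smult_add_left intro!: restrict_ext)
    show "(c * d) \<odot>\<^bsub>?H\<^esub> f = c \<odot>\<^bsub>?H\<^esub> (d \<odot>\<^bsub>?H\<^esub> f)"
    proof -
      have "(c * d) \<odot>\<^bsub>R\<^esub> \<one>\<^bsub>R\<^esub> = (c \<odot>\<^bsub>R\<^esub> \<one>\<^bsub>R\<^esub>) \<otimes>\<^bsub>R\<^esub> (d \<odot>\<^bsub>R\<^esub> \<one>\<^bsub>R\<^esub>)"
        by (simp add: R.smult_smult R.smult_mult_left)
      then show ?thesis using f fc by (auto simp: N.smult_smult intro!: restrict_ext)
    qed
    show "1 \<odot>\<^bsub>?H\<^esub> f = f"
      using f fc by (intro extensionalityI[of _ "carrier M"]) (auto simp: N.smult_one)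
    show "c \<odot>\<^bsub>?H\<^esub> (f \<oplus>\<^bsub>?H\<^esub> g) = c \<odot>\<^bsub>?H\<^esub> f \<oplus>\<^bsub>?H\<^esub> c \<odot>\<^bsub>?H\<^esub> g" if "g \<in> carrier ?H"
      using f that fc is_homD(1)[of R M N g] by (auto simp: N.smult_add_right intro!: restrict_ext)
  qed
  show "(f \<ominus>\<^bsub>?H\<^esub> g) x = f x \<ominus>\<^bsub>N\<^esub> g x"
    if f: "f \<in> carrier ?H" and g: "g \<in> carrier ?H" and x: "x \<in> carrier M" for f g x
  proof -
    interpret H: vsp ?H by (rule H)
    have h: "is_hom R M N f" "is_hom R M N g" "is_hom R M N (f \<ominus>\<^bsub>?H\<^esub> g)"
      using f g H.minus_closed[OF f g] by simp_all
    note c = h[THEN is_homD(1), OF x]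
    have "f x = ((f \<ominus>\<^bsub>?H\<^esub> g) \<oplus>\<^bsub>?H\<^esub> g) x" using H.minus_add_cancel[OF f g] by simp
    then have "f x = (f \<ominus>\<^bsub>?H\<^esub> g) x \<oplus>\<^bsub>N\<^esub> g x" using x by simp
    then show ?thesis using c by (simp add: N.M.minus_eq N.M.a_assoc N.M.r_neg)
  qed
qed

lemma Hom_cocycles_iff:
  assumes P: "\<And>n. lmod R (P n)"
  shows "f \<in> cocycles (\<lambda>n. Hom_space R (P n) N) (Hom_diff P d) m \<longleftrightarrow>
    f \<in> extensional (carrier (P m)) \<and> is_cocycle R P d N m f"
proof -
  have "Hom_diff P d m f = (\<lambda>x\<in>carrier (P (Suc m)). \<zero>\<^bsub>N\<^esub>) \<longleftrightarrow>
      (\<forall>x\<in>carrier (P (Suc m)). f (d m x) = \<zero>\<^bsub>N\<^esub>)"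
  proof
    assume "Hom_diff P d m f = (\<lambda>x\<in>carrier (P (Suc m)). \<zero>\<^bsub>N\<^esub>)"
    then have "Hom_diff P d m f x = (\<lambda>x\<in>carrier (P (Suc m)). \<zero>\<^bsub>N\<^esub>) x" for x by simp
    then show "\<forall>x\<in>carrier (P (Suc m)). f (d m x) = \<zero>\<^bsub>N\<^esub>"
      unfolding Hom_diff_def by (metis restrict_apply')
  next
    assume "\<forall>x\<in>carrier (P (Suc m)). f (d m x) = \<zero>\<^bsub>N\<^esub>"
    then show "Hom_diff P d m f = (\<lambda>x\<in>carrier (P (Suc m)). \<zero>\<^bsub>N\<^esub>)"
      unfolding Hom_diff_def by (intro restrict_ext) simp
  qed
  then show ?thesis by (auto simp: cocycles_def is_cocycle_def)
qed

lemma Hom_coboundaries_iff: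
  assumes P: "\<And>n. lmod R (P n)" and d: "\<And>n. is_hom R (P (Suc n)) (P n) (d n)"
    and f: "f \<in> extensional (carrier (P m))" "is_hom R (P m) N f"
  shows "f \<in> coboundaries (\<lambda>n. Hom_space R (P n) N) (Hom_diff P d) m \<longleftrightarrow> is_coboundary R P d N m f"
proof (cases m)
  case 0
  have "f = (\<lambda>x\<in>carrier (P 0). \<zero>\<^bsub>N\<^esub>) \<longleftrightarrow> (\<forall>x\<in>carrier (P 0). f x = \<zero>\<^bsub>N\<^esub>)"
    using f(1) unfolding 0 by (auto intro!: extensionalityI[of f "carrier (P 0)"])
  then show ?thesis using 0 by (simp add: coboundaries_def is_coboundary_def)
next
  case (Suc n)
  show ?thesis
  proof
    assume "f \<in> coboundaries (\<lambda>n. Hom_space R (P n) N) (Hom_diff P d) m"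
    then obtain g where "is_hom R (P n) N g" "f = Hom_diff P d n g"
      using Suc by (auto simp: coboundaries_def)
    then show "is_coboundary R P d N m f" using Suc by (auto simp: is_coboundary_def Hom_diff_def)
  next
    assume "is_coboundary R P d N m f"
    then obtain g where g: "is_hom R (P n) N g" "\<And>x. x \<in> carrier (P (Suc n)) \<Longrightarrow> f x = g (d n x)"
      using Suc by (auto simp: is_coboundary_def)
    have "f = Hom_diff P d n (restrict g (carrier (P n)))"
      unfolding Hom_diff_def using f(1) g(2) Suc is_homD(1)[OF d[of n]]
      by (intro extensionalityI[of f "carrier (P (Suc n))"]) auto
    moreover have "restrict g (carrier (P n)) \<in> carrier (Hom_space R (P n) N)"
      using g(1) by (simp add: is_hom_restrict[OF P])
    ultimately show "f \<in> coboundaries (\<lambda>n. Hom_space R (P n) N) (Hom_diff P d) m"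
      using Suc by (simp add: coboundaries_def)
  qed
qed

section \<open>A contraction of the untwisted Koszul complex\<close>

type_synonym exps2 = "(nat \<Rightarrow> nat) \<times> (nat \<Rightarrow> nat)"

definition bin :: "nat \<Rightarrow> (nat \<Rightarrow> nat) set" where
  "bin N = {\<beta> \<in> exponents N. \<forall>i. \<beta> i \<in> {0, 1}}"

text \<open>Only entries strictly before i are counted, so the sign does not depend on
  \<open>\<beta> i\<close>. For \<open>\<beta> i\<close> = 0 it agrees with the sign in
  \<open>koszul_diff_on_tensor\<close>, where the sum runs up to i.\<close>

definition sg :: "nat \<Rightarrow> (nat \<Rightarrow> nat) \<Rightarrow> 'k::field" where
  "sg i \<beta> = (-1) ^ (\<Sum>s\<in>{1..<i}. \<beta> s)"

lemma sg_sq [simp]: "sg i \<beta> * sg i \<beta> = (1 :: 'k::field)" "sg i \<beta> * (sg i \<beta> * x) = (x :: 'k::field)"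
  by (simp_all add: sg_def flip: power_add mult.assoc)

lemma sg_upd:
  assumes "\<beta> j = 0" "1 \<le> j"
  shows "sg i (\<beta>(j := 1)) = (if j < i then - sg i \<beta> else (sg i \<beta> :: 'k::field))"
proof (cases "j < i")
  case True
  then have j: "j \<in> {1..<i}" using assms by simp
  have "(\<Sum>s\<in>{1..<i} - {j}. (\<beta>(j := 1)) s) = (\<Sum>s\<in>{1..<i} - {j}. \<beta> s)"
    by (intro sum.cong) auto
  then have "(\<Sum>s\<in>{1..<i}. (\<beta>(j := 1)) s) = Suc (\<Sum>s\<in>{1..<i}. \<beta> s)"
    using j assms by (simp add: sum.remove[of "{1..<i}" j])
  then show ?thesis using True by (simp add: sg_def)
next
  case False
  then have "(\<Sum>s\<in>{1..<i}. (\<beta>(j := 1)) s) = (\<Sum>s\<in>{1..<i}. \<beta> s)"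
    by (intro sum.cong) auto
  then show ?thesis using False by (simp add: sg_def)
qed

text \<open>Raising the larger index first leaves the sign of the smaller one alone, while in the
  other order one sign flips. This is what makes the squares of the differentials vanish.\<close>

lemma sg_anticommute:
  assumes "i \<noteq> j" "\<beta> i = 0" "\<beta> j = 0" "1 \<le> i" "1 \<le> j"
  shows "sg i \<beta> * sg j (\<beta>(i := 1)) = - (sg j \<beta> * sg i (\<beta>(j := 1)) :: 'k::field)"
  using assms by (cases i j rule: linorder_cases) (simp_all add: sg_upd)

text \<open>A function on \<^typ>\<open>exps2\<close> lists the coefficients of \<open>x\<^sup>\<alpha> \<otimes> x\<^sup>\<gamma>\<close> in a tensor of commuting
  polynomials. On these, \<open>uu i\<close> is multiplication by \<open>x\<^sub>i \<otimes> 1 - 1 \<otimes> x\<^sub>i\<close>, and \<open>vv i\<close> is its left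
  inverse, which maps \<open>x\<^sup>a \<otimes> x\<^sup>c\<close> in the variable \<open>x\<^sub>i\<close> to the negative of the sum of
  \<open>x\<^sup>a\<^sup>+\<^sup>j \<otimes> x\<^sup>c\<^sup>-\<^sup>1\<^sup>-\<^sup>j\<close> over \<open>j < c\<close>.\<close>

definition uu :: "nat \<Rightarrow> (exps2 \<Rightarrow> 'k::field) \<Rightarrow> exps2 \<Rightarrow> 'k" where
  "uu i g = (\<lambda>(\<alpha>, \<gamma>). (if \<alpha> i = 0 then 0 else g (\<alpha>(i := \<alpha> i - 1), \<gamma>)) -
     (if \<gamma> i = 0 then 0 else g (\<alpha>, \<gamma>(i := \<gamma> i - 1))))"

definition vv :: "nat \<Rightarrow> (exps2 \<Rightarrow> 'k::field) \<Rightarrow> exps2 \<Rightarrow> 'k" where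
  "vv i g = (\<lambda>(\<alpha>, \<gamma>). - (\<Sum>j\<le>\<alpha> i. g (\<alpha>(i := \<alpha> i - j), \<gamma>(i := Suc (\<gamma> i + j)))))"

lemma uu_sum: "uu i (\<lambda>p. \<Sum>j\<in>S. c j * g j p) p = (\<Sum>j\<in>S. c j * uu i (g j) p)"
  by (cases p) (auto simp: uu_def sum_subtractf algebra_simps)

lemma uu_cmult: "uu i (\<lambda>p. c * g p) p = c * uu i g p"
  by (cases p) (auto simp: uu_def algebra_simps)

lemma vv_sum: "vv i (\<lambda>p. \<Sum>j\<in>S. c j * g j p) p = (\<Sum>j\<in>S. c j * vv i (g j) p)"
  by (cases p) (simp add: vv_def sum_distrib_left sum.swap[of _ S] flip: sum_negf)

lemma uu_diff: "uu i (\<lambda>p. f p - g p) p = uu i f p - uu i g p"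
  by (cases p) (simp add: uu_def)

lemma vv_zero: "vv i (\<lambda>p. 0) = (\<lambda>p. 0)"
  by (auto simp: vv_def)

lemma uu_zero: "uu i (\<lambda>p. 0) p = 0"
  by (cases p) (simp add: uu_def)

lemma uu_commute: "uu i (uu j g) p = uu j (uu i g) p"
proof (cases "i = j")
  case False
  then show ?thesis by (cases p) (auto simp: uu_def fun_upd_twist)
qed simp

lemma vv_uu_commute: "i \<noteq> j \<Longrightarrow> vv i (uu j g) p = uu j (vv i g) p"
  by (cases p) (auto simp: vv_def uu_def fun_upd_twist sum_subtractf)

text \<open>The sum in \<open>vv\<close> telescopes. The default 0 in \<open>a\<close> is the term
  past the end, where the exponent \<open>\<alpha> i\<close> is used up, and \<open>a 0\<close> is
  the value at p.\<close>

lemma vv_uu: "vv i (uu i g) p = g p"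
proof -
  obtain \<alpha> \<gamma> where p: "p = (\<alpha>, \<gamma>)" by (cases p)
  define a where "a j = (if \<alpha> i < j then 0 else g (\<alpha>(i := \<alpha> i - j), \<gamma>(i := \<gamma> i + j)))" for j
  have "uu i g (\<alpha>(i := \<alpha> i - j), \<gamma>(i := Suc (\<gamma> i + j))) = a (Suc j) - a j" if "j \<le> \<alpha> i" for j
    using that by (auto simp: uu_def a_def simp flip: Suc_eq_plus1)
  then have "vv i (uu i g) p = - (\<Sum>j\<le>\<alpha> i. a (Suc j) - a j)"
    by (simp add: vv_def p)
  also have "(\<Sum>j\<le>n. a (Suc j) - a j) = a (Suc n) - a 0" for n
    by (induction n) auto
  also have "- (a (Suc (\<alpha> i)) - a 0) = g p"
    by (simp add: a_def p)
  finally show ?thesis .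
qed

text \<open>The operator 1 - uu vv moves all of \<open>x\<^sub>i\<close> into the left tensor
  factor, sending \<open>x\<^sup>a \<otimes> x\<^sup>c\<close> to
  \<open>x\<^sup>a\<^sup>+\<^sup>c \<otimes> 1\<close>, so nothing of it remains where
  \<open>\<gamma> i\<close> is nonzero. In coefficients this is again a telescoping sum.\<close>

lemma uu_vv_vanish:
  assumes "\<gamma> i \<noteq> 0"
  shows "uu i (vv i g) (\<alpha>, \<gamma>) = g (\<alpha>, \<gamma>)"
proof -
  define a where "a j = g (\<alpha>(i := \<alpha> i - j), \<gamma>(i := \<gamma> i + j))" for j
  obtain c where c: "\<gamma> i = Suc c" using assms not0_implies_Suc by blast
  have "vv i g (\<alpha>, \<gamma>(i := \<gamma> i - 1)) = - (\<Sum>j\<le>\<alpha> i. a j)"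
    using c by (simp add: vv_def a_def)
  moreover have "(if \<alpha> i = 0 then 0 else vv i g (\<alpha>(i := \<alpha> i - 1), \<gamma>)) = - (\<Sum>j<\<alpha> i. a (Suc j))"
    by (cases "\<alpha> i") (simp_all add: vv_def a_def lessThan_Suc_atMost)
  ultimately have "uu i (vv i g) (\<alpha>, \<gamma>) = (\<Sum>j\<le>\<alpha> i. a j) - (\<Sum>j<\<alpha> i. a (Suc j))"
    using assms by (simp add: uu_def)
  also have "(\<Sum>j\<le>n. a j) - (\<Sum>j<n. a (Suc j)) = a 0" for n
    by (induction n) auto
  finally show ?thesis by (simp add: a_def)
qed

text \<open>\<open>uu i\<close> and \<open>vv i\<close> change exponents of the variable i only, so
  a variable j already removed from the right factor is not brought back.\<close>

lemma uu_vv_support: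
  assumes "j \<noteq> i" "g (\<alpha>, \<gamma>) - uu i (vv i g) (\<alpha>, \<gamma>) \<noteq> 0"
    and "\<And>\<alpha> \<gamma>. g (\<alpha>, \<gamma>) \<noteq> 0 \<Longrightarrow> \<gamma> j = 0"
  shows "\<gamma> j = 0"
proof (rule ccontr)
  assume "\<gamma> j \<noteq> 0"
  then have z: "g (\<alpha>', \<gamma>') = 0" if "\<gamma>' j = \<gamma> j" for \<alpha>' \<gamma>' using assms(3) that by metis
  have "vv i g (\<alpha>', \<gamma>') = 0" if "\<gamma>' j = \<gamma> j" for \<alpha>' \<gamma>'
    using assms(1) that by (simp add: vv_def z)
  then have "uu i (vv i g) (\<alpha>, \<gamma>) = 0" using assms(1) by (simp add: uu_def)
  then show False using assms(2) z by simp
qed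

section \<open>The Koszul differential and a homotopy in one variable\<close>

definition DD :: "nat \<Rightarrow> ((nat \<Rightarrow> nat) \<Rightarrow> exps2 \<Rightarrow> 'k::field) \<Rightarrow> (nat \<Rightarrow> nat) \<Rightarrow> exps2 \<Rightarrow> 'k" where
  "DD N F \<beta> p = (\<Sum>i | i \<in> {1..N} \<and> \<beta> i = 0. sg i \<beta> * uu i (F (\<beta>(i := 1))) p)"

text \<open>In a single variable the complex is multiplication by \<open>uu k\<close>, with left
  inverse \<open>vv k\<close>; \<open>hh k\<close> applies this inverse and raises \<beta> at k.
  Like \<open>DD\<close> it is written from the side of the target, hence reads F at \<beta> lowered
  at k.\<close>

definition hh :: "nat \<Rightarrow> ((nat \<Rightarrow> nat) \<Rightarrow> exps2 \<Rightarrow> 'k::field) \<Rightarrow> (nat \<Rightarrow> nat) \<Rightarrow> exps2 \<Rightarrow> 'k" where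
  "hh k F \<beta> p = (if \<beta> k = 1 then sg k \<beta> * vv k (F (\<beta>(k := 0))) p else 0)"

text \<open>Exchanging the two summations shows that the sum equals its own negative; characteristic
  0 then forces it to be 0.\<close>

lemma sum_antisymmetric:
  fixes f :: "'a \<Rightarrow> 'a \<Rightarrow> 'k::field_char_0"
  assumes "finite S" "\<And>i j. i \<in> S \<Longrightarrow> j \<in> S \<Longrightarrow> i \<noteq> j \<Longrightarrow> f i j = - f j i"
  shows "(\<Sum>i\<in>S. \<Sum>j\<in>S - {i}. f i j) = 0"
proof -
  let ?g = "\<lambda>i j. if i = j then 0 else f i j"
  have g: "(\<Sum>i\<in>S. \<Sum>j\<in>S - {i}. f i j) = (\<Sum>i\<in>S. \<Sum>j\<in>S. ?g i j)"
  proof (rule sum.cong[OF refl])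
    fix i assume "i \<in> S"
    show "(\<Sum>j\<in>S - {i}. f i j) = (\<Sum>j\<in>S. ?g i j)"
      using assms(1) by (rule sum.mono_neutral_cong_left) auto
  qed
  have "(\<Sum>i\<in>S. \<Sum>j\<in>S. ?g i j) = (\<Sum>i\<in>S. \<Sum>j\<in>S. - ?g j i)"
  proof (intro sum.cong refl)
    fix i j assume "i \<in> S" "j \<in> S"
    then show "?g i j = - ?g j i" using assms(2)[of i j] by (cases "i = j") simp_all
  qed
  also have "\<dots> = - (\<Sum>i\<in>S. \<Sum>j\<in>S. ?g i j)"
    by (subst sum.swap) (simp add: sum_negf)
  finally show ?thesis unfolding g by (simp only: eq_neg_iff_add_eq_0) simp
qed

lemma DD_DD:
  fixes F :: "(nat \<Rightarrow> nat) \<Rightarrow> exps2 \<Rightarrow> 'k::field_char_0"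
  shows "DD N (DD N F) \<beta> p = 0"
proof -
  let ?S = "{i. i \<in> {1..N} \<and> \<beta> i = 0}"
  have S: "{j. j \<in> {1..N} \<and> (\<beta>(i := 1)) j = 0} = ?S - {i}" for i by auto
  have "DD N (DD N F) \<beta> p =
      (\<Sum>i\<in>?S. \<Sum>j\<in>?S - {i}. sg i \<beta> * sg j (\<beta>(i := 1)) * uu i (uu j (F (\<beta>(i := 1, j := 1)))) p)"
    unfolding DD_def[of N "DD N F"] unfolding DD_def[abs_def] S
    by (simp only: uu_sum sum_distrib_left mult.assoc)
  also have "\<dots> = 0"
  proof (rule sum_antisymmetric)
    fix i j assume "i \<in> ?S" "j \<in> ?S" "i \<noteq> j"
    then have 1: "sg i \<beta> * sg j (\<beta>(i := 1)) = - (sg j \<beta> * sg i (\<beta>(j := 1)) :: 'k)"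
      and 2: "\<beta>(j := 1, i := 1) = \<beta>(i := 1, j := 1)"
      by (auto intro!: sg_anticommute simp: fun_upd_twist)
    show "sg i \<beta> * sg j (\<beta>(i := 1)) * uu i (uu j (F (\<beta>(i := 1, j := 1)))) p =
        - (sg j \<beta> * sg i (\<beta>(j := 1)) * uu j (uu i (F (\<beta>(j := 1, i := 1)))) p)"
      unfolding 1 2 uu_commute[of j i] by simp
  qed simp
  finally show ?thesis .
qed

text \<open>The homotopy formula for D h + h D, evaluated on a cycle, where h D drops out. If
  \<open>\<beta> k\<close> = 0, only the direction k contributes to D h.\<close>

lemma DD_hh:
  fixes F :: "(nat \<Rightarrow> nat) \<Rightarrow> exps2 \<Rightarrow> 'k::field_char_0"
  assumes k: "k \<in> {1..N}" and \<beta>: "\<beta> \<in> bin N" and cycle: "\<And>\<beta> p. \<beta> \<in> bin N \<Longrightarrow> DD N F \<beta> p = 0"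
  shows "F \<beta> p - DD N (hh k F) \<beta> p =
    (if \<beta> k = 0 then F \<beta> p - uu k (vv k (F \<beta>)) p else 0)"
proof (cases "\<beta> k = 0")
  case True
  let ?S = "{i. i \<in> {1..N} \<and> \<beta> i = 0}"
  have "sg i \<beta> * uu i (hh k F (\<beta>(i := 1))) p = (if i = k then uu k (vv k (F \<beta>)) p else 0)" if "i \<in> ?S" for i
  proof (cases "i = k")
    case True
    have "hh k F (\<beta>(k := 1)) = (\<lambda>p. sg k \<beta> * vv k (F \<beta>) p)"
      using \<open>\<beta> k = 0\<close> k sg_upd[of \<beta> k k] by (auto simp: hh_def fun_eq_iff fun_upd_idem)
    then show ?thesis using True by (simp add: uu_cmult)
  next
    case False
    then have "hh k F (\<beta>(i := 1)) = (\<lambda>p. 0)" using True by (auto simp: hh_def)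
    then show ?thesis using False by (simp add: uu_zero)
  qed
  then have "DD N (hh k F) \<beta> p = (\<Sum>i\<in>?S. if i = k then uu k (vv k (F \<beta>)) p else 0)"
    unfolding DD_def by (intro sum.cong refl) blast
  also have "\<dots> = uu k (vv k (F \<beta>)) p" using True k by simp
  finally show ?thesis using True by simp
next
  case False
  moreover have "\<beta> k \<in> {0, 1}" using \<beta> by (simp add: bin_def)
  ultimately have 1: "\<beta> k = 1" by simp
  let ?b = "\<beta>(k := 0)"
  let ?S = "{i. i \<in> {1..N} \<and> \<beta> i = 0}"
  have b: "?b \<in> bin N" using \<beta> by (auto simp: bin_def exponents_def)
  have \<beta>b: "\<beta> = ?b(k := 1)" using 1 by (auto simp: fun_eq_iff)
  have S: "{i. i \<in> {1..N} \<and> ?b i = 0} = insert k ?S" using k by auto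
  have kS: "k \<notin> ?S" using 1 by simp
  \<comment> \<open>The cycle condition is used at \<beta> lowered in direction k and divided by
    \<open>uu k\<close>: the term i = k returns F \<beta> by \<open>vv_uu\<close>, and the others
    form - D h F because \<open>vv k\<close> commutes with \<open>uu i\<close>.\<close>
  have "sg k \<beta> * vv k (DD N F ?b) p = 0"
    using cycle[OF b] by (cases p) (simp add: vv_def)
  also have "sg k \<beta> * vv k (DD N F ?b) p =
      sg k \<beta> * (\<Sum>i\<in>insert k ?S. sg i ?b * vv k (uu i (F (?b(i := 1)))) p)"
    unfolding DD_def[abs_def] S vv_sum ..
  also have "\<dots> = sg k \<beta> * (sg k ?b * F \<beta> p) + (\<Sum>i\<in>?S. sg k \<beta> * sg i ?b * uu i (vv k (F (?b(i := 1)))) p)"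
  proof -
    have "(\<Sum>i\<in>?S. sg i ?b * vv k (uu i (F (?b(i := 1)))) p) = (\<Sum>i\<in>?S. sg i ?b * uu i (vv k (F (?b(i := 1)))) p)"
    proof (rule sum.cong[OF refl])
      fix i assume "i \<in> ?S"
      then have "k \<noteq> i" using 1 by auto
      then show "sg i ?b * vv k (uu i (F (?b(i := 1)))) p = sg i ?b * uu i (vv k (F (?b(i := 1)))) p"
        using vv_uu_commute[of k i "F (?b(i := 1))" p] by simp
    qed
    then show ?thesis
      using kS \<beta>b[symmetric] by (simp add: vv_uu sum_distrib_left algebra_simps)
  qed
  also have "sg k \<beta> * (sg k ?b * F \<beta> p) = F \<beta> p"
  proof -
    have "sg k \<beta> = (sg k ?b :: 'k)" using sg_upd[of ?b k k] \<beta>b k by simp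
    then show ?thesis by simp
  qed
  also have "(\<Sum>i\<in>?S. sg k \<beta> * sg i ?b * uu i (vv k (F (?b(i := 1)))) p) = - DD N (hh k F) \<beta> p"
    unfolding DD_def sum_negf[symmetric]
  proof (intro sum.cong refl)
    fix i assume i: "i \<in> ?S"
    then have ik: "i \<noteq> k" using 1 by auto
    have "hh k F (\<beta>(i := 1)) = (\<lambda>p. sg k (\<beta>(i := 1)) * vv k (F (?b(i := 1))) p)"
      using 1 ik by (auto simp: hh_def fun_eq_iff fun_upd_twist)
    then have "sg i \<beta> * uu i (hh k F (\<beta>(i := 1))) p =
        sg i \<beta> * sg k (\<beta>(i := 1)) * uu i (vv k (F (?b(i := 1)))) p"
      by (simp add: uu_cmult)
    moreover have "sg i \<beta> * sg k (\<beta>(i := 1)) = - (sg k \<beta> * sg i ?b :: 'k)"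
    proof -
      have "\<beta> = ?b(k := 1)" by (rule \<beta>b)
      then have *: "sg i \<beta> = (if k < i then - sg i ?b else sg i ?b :: 'k)"
        using sg_upd[of ?b k i] k by auto
      have "sg k (\<beta>(i := 1)) = (if i < k then - sg k \<beta> else sg k \<beta> :: 'k)"
        using i by (intro sg_upd) auto
      then show ?thesis using * ik by (auto simp: algebra_simps)
    qed
    ultimately show "sg k \<beta> * sg i ?b * uu i (vv k (F (?b(i := 1)))) p =
        - (sg i \<beta> * uu i (hh k F (\<beta>(i := 1))) p)" by simp
  qed
  finally show ?thesis using False by simp
qed

lemma vv_finsupp:
  assumes g: "g \<in> finsupp (exponents N \<times> exponents N)" and i: "i \<in> {1..N}"
  shows "vv i g \<in> finsupp (exponents N \<times> exponents N)"
proof (rule finsuppI)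
  \<comment> \<open>A nonzero value of \<open>vv i g\<close> comes from a point of the support of g
    whose right exponent at i is larger by j + 1, so j stays below that exponent; \<open>?f\<close>
    leads back from that point.\<close>
  let ?f = "\<lambda>((\<alpha>, \<gamma>), j). (\<alpha>(i := \<alpha> i + j), \<gamma>(i := \<gamma> i - (j + 1)))"
  let ?X = "Sigma {p. g p \<noteq> 0} (\<lambda>p. {..<snd p i})"
  show "finite (?f ` ?X)"
    using finsuppD(1)[OF g] by (intro finite_imageI finite_SigmaI) auto
  have *: "\<exists>j. j \<le> \<alpha> i \<and> g (\<alpha>(i := \<alpha> i - j), \<gamma>(i := Suc (\<gamma> i + j))) \<noteq> 0" if "vv i g (\<alpha>, \<gamma>) \<noteq> 0" for \<alpha> \<gamma>
    using that unfolding vv_def by (auto intro: ccontr simp: sum.neutral)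
  show "{p. vv i g p \<noteq> 0} \<subseteq> ?f ` ?X"
  proof
    fix p assume "p \<in> {p. vv i g p \<noteq> 0}"
    moreover obtain \<alpha> \<gamma> where p: "p = (\<alpha>, \<gamma>)" by (cases p)
    ultimately obtain j where j: "j \<le> \<alpha> i" "g (\<alpha>(i := \<alpha> i - j), \<gamma>(i := Suc (\<gamma> i + j))) \<noteq> 0" using * by auto
    have "p = ?f ((\<alpha>(i := \<alpha> i - j), \<gamma>(i := Suc (\<gamma> i + j))), j)"
      using j(1) by (simp add: p fun_eq_iff)
    moreover have "((\<alpha>(i := \<alpha> i - j), \<gamma>(i := Suc (\<gamma> i + j))), j) \<in> ?X" using j by simp
    ultimately show "p \<in> ?f ` ?X" by blast
  qed
  show "{p. vv i g p \<noteq> 0} \<subseteq> exponents N \<times> exponents N"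
  proof clarify
    fix \<alpha> \<gamma> assume "vv i g (\<alpha>, \<gamma>) \<noteq> 0"
    then obtain j where "g (\<alpha>(i := \<alpha> i - j), \<gamma>(i := Suc (\<gamma> i + j))) \<noteq> 0" using * by auto
    from finsuppD(2)[OF g this] show "\<alpha> \<in> exponents N \<and> \<gamma> \<in> exponents N"
      using i by (auto simp: exponents_def split: if_splits)
  qed
qed

section \<open>The Koszul bimodule resolution\<close>

locale qsym =
  fixes N :: nat and q :: "nat \<Rightarrow> nat \<Rightarrow> 'k::field_char_0"
  assumes q: "quantum_params N q"
begin

lemma q_props: "i \<in> {1..N} \<Longrightarrow> q i i = 1" "i \<in> {1..N} \<Longrightarrow> j \<in> {1..N} \<Longrightarrow> q i j \<noteq> 0"
  "i \<in> {1..N} \<Longrightarrow> j \<in> {1..N} \<Longrightarrow> q i j * q j i = 1"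
proof -
  show "i \<in> {1..N} \<Longrightarrow> q i i = 1" "i \<in> {1..N} \<Longrightarrow> j \<in> {1..N} \<Longrightarrow> q i j \<noteq> 0"
    using q unfolding quantum_params_def by blast+
  then show "i \<in> {1..N} \<Longrightarrow> j \<in> {1..N} \<Longrightarrow> q i j * q j i = 1"
    using q unfolding quantum_params_def by (metis right_inverse)
qed

sublocale S: skew_params N q
  by unfold_locales (rule q_props)

sublocale L: skew_params N "\<lambda>i j. - inverse (q i j)"
proof
  fix i j assume "i \<in> {1..N}" "j \<in> {1..N}"
  then show "- inverse (q i j) * - inverse (q j i) = 1"
    using q_props(3)[of i j] by (simp flip: inverse_mult_distrib)
qed

abbreviation A :: "('k, (nat list \<Rightarrow> 'k) set) module" where "A \<equiv> S_alg N q"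
abbreviation \<phi> where "\<phi> \<equiv> S.coord"
abbreviation E :: "(nat \<Rightarrow> nat) set" where "E \<equiv> exponents N"
abbreviation gx where "gx \<equiv> S_gen N q"

lemma A_eq: "A = S.alg" "gx = S.gen"
  by (simp_all add: S_alg_def S.alg_def S_relators_def S.relators_def S_gen_def S.gen_def)

lemma S_exps: "S.exps = E"
  using q_props(1) by (auto simp: S.exps_def)

lemma A_kalg_coords: "kalg_coords A E \<phi>"
proof -
  have "kalg A" unfolding A_eq by (rule S.alg.kalg_axioms)
  moreover have "coords A E \<phi>" using S.alg_coords unfolding A_eq S_exps .
  ultimately show ?thesis by (simp add: kalg_coords_def)
qed

sublocale kalg_coords A E \<phi> by (rule A_kalg_coords)

lemma gx_closed: "i \<in> {1..N} \<Longrightarrow> gx i \<in> carrier A"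
  unfolding A_eq by (rule S.gen_closed)

lemmas coord_mult = S.coord_mult[folded A_eq]
lemmas coord_gx_mult = S.coord_gen_mult[folded A_eq]

section \<open>Coefficients of the twisted differential\<close>

definition Pc :: "nat \<Rightarrow> (nat \<Rightarrow> nat) \<Rightarrow> 'k" where "Pc i \<beta> = (\<Prod>s\<in>{1..i}. q s i ^ \<beta> s)"
definition Qc :: "nat \<Rightarrow> (nat \<Rightarrow> nat) \<Rightarrow> 'k" where "Qc i \<beta> = (\<Prod>s\<in>{i..N}. q i s ^ \<beta> s)"

text \<open>\<open>kap i s\<close> is inverse to \<open>q s i\<close> for s \<le> i and equal to 1
  beyond. So \<open>Pc i \<beta>\<close> cancels the scalar of sorting
  \<open>x\<^sub>i x\<^sup>\<beta>\<close>, which ties the constants of the differential to the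
  bicharacter; \<open>Qc\<close> does the same for \<open>x\<^sup>\<beta> x\<^sub>i\<close>.\<close>

lemma row_Pc: "i \<in> {1..N} \<Longrightarrow> S.row i \<beta> * Pc i \<beta> = 1"
proof -
  assume i: "i \<in> {1..N}"
  have "Pc i \<beta> = (\<Prod>s\<in>{1..N}. (if s \<le> i then q s i else 1) ^ \<beta> s)"
    unfolding Pc_def using i by (intro prod.mono_neutral_cong_left) auto
  moreover have "S.kap i s * (if s \<le> i then q s i else 1) = 1" if "s \<in> {1..N}" for s
    using i that q_props by (auto simp: S.kap_def)
  ultimately show ?thesis
    by (simp add: S.row_def prod.distrib[symmetric] power_mult_distrib[symmetric])
qed

lemma col_Qc: "i \<in> {1..N} \<Longrightarrow> S.col \<beta> i * Qc i \<beta> = 1"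
proof -
  assume i: "i \<in> {1..N}"
  have "Qc i \<beta> = (\<Prod>s\<in>{1..N}. (if i \<le> s then q i s else 1) ^ \<beta> s)"
    unfolding Qc_def using i by (intro prod.mono_neutral_cong_left) auto
  moreover have "S.kap s i * (if i \<le> s then q i s else 1) = 1" if "s \<in> {1..N}" for s
    using i that q_props by (auto simp: S.kap_def)
  ultimately show ?thesis
    by (simp add: S.col_def prod.distrib[symmetric] power_mult_distrib[symmetric])
qed

lemma row_nz: "i \<in> {1..N} \<Longrightarrow> S.row i \<beta> \<noteq> 0" and col_nz: "i \<in> {1..N} \<Longrightarrow> S.col \<beta> i \<noteq> 0"
  using row_Pc[of i \<beta>] col_Qc[of i \<beta>] by auto

lemma chi_nz: "S.chi \<alpha> \<gamma> \<noteq> 0"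
  unfolding S.chi_alt(1) using row_nz by simp

definition B :: "nat \<Rightarrow> (nat \<Rightarrow> nat) set" where "B n = binary_exponents N n"

lemma B_finite: "finite (B n)"
proof (rule finite_subset)
  show "B n \<subseteq> {\<beta>. \<forall>i. (i \<in> {1..N} \<longrightarrow> \<beta> i \<in> {0, 1}) \<and> (i \<notin> {1..N} \<longrightarrow> \<beta> i = 0)}"
    by (auto simp: B_def binary_exponents_def exponents_def)
  show "finite \<dots>" by (rule finite_set_of_finite_funs) auto
qed

lemma B_bin: "\<beta> \<in> B n \<Longrightarrow> \<beta> \<in> bin N"
  by (auto simp: B_def binary_exponents_def bin_def)

lemma bin_B: "\<beta> \<in> bin N \<longleftrightarrow> (\<exists>n. \<beta> \<in> B n)"
  by (auto simp: B_def binary_exponents_def bin_def)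

lemma sum_upd:
  assumes "i \<in> {1..N}" "\<beta> i = (0::nat)"
  shows "(\<Sum>s\<in>{1..N}. (\<beta>(i := 1)) s) = Suc (\<Sum>s\<in>{1..N}. \<beta> s)"
proof -
  have "(\<Sum>s\<in>{1..N} - {i}. (\<beta>(i := 1)) s) = (\<Sum>s\<in>{1..N} - {i}. \<beta> s)"
    by (intro sum.cong) auto
  then show ?thesis using assms by (simp add: sum.remove[of "{1..N}" i] del: atLeastAtMost_iff)
qed

lemma B_upd:
  assumes "\<beta> i = 0" "i \<in> {1..N}"
  shows "\<beta>(i := 1) \<in> B (Suc n) \<longleftrightarrow> \<beta> \<in> B n"
proof -
  have *: "(\<beta>(i := 1) \<in> exponents N \<and> (\<forall>j. (\<beta>(i := 1)) j \<in> {0, 1})) \<longleftrightarrow> (\<beta> \<in> exponents N \<and> (\<forall>j. \<beta> j \<in> {0, 1}))"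
  proof -
    have "(\<beta>(i := 1)) j \<in> {0, 1} \<longleftrightarrow> \<beta> j \<in> {0, 1}" for j
      using assms by (cases "j = i") simp_all
    moreover have "(j \<notin> {1..N} \<longrightarrow> (\<beta>(i := 1)) j = 0) \<longleftrightarrow> (j \<notin> {1..N} \<longrightarrow> \<beta> j = 0)" for j
      using assms by (cases "j = i") simp_all
    ultimately show ?thesis unfolding exponents_def by simp
  qed
  then show ?thesis
    unfolding B_def binary_exponents_def mem_Collect_eq conj_assoc[symmetric] *
    by (simp only: sum_upd[of i \<beta>, OF assms(2,1)] nat.inject)
qed

lemma B_zero: "\<beta> \<in> B 0 \<longleftrightarrow> \<beta> = (\<lambda>_. 0)"
  by (auto simp: B_def binary_exponents_def exponents_def fun_eq_iff)


section \<open>The twisted Koszul complex of bimodules\<close>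

abbreviation K :: "nat \<Rightarrow> ('k SW, (nat \<Rightarrow> nat) \<Rightarrow> 'k SW) module" where
  "K n \<equiv> free_module R (B n)"

text \<open>The element \<open>x\<^sub>i \<otimes> 1 - 1 \<otimes> x\<^sub>i\<close> with both terms
  twisted; acting on a, it gives up to sign the bracket of the cochain differential.\<close>

definition rel :: "nat \<Rightarrow> (nat \<Rightarrow> nat) \<Rightarrow> 'k SW" where
  "rel i \<beta> = (sg i \<beta> * Pc i \<beta>) \<odot>\<^bsub>R\<^esub> pure (gx i) \<one>\<^bsub>A\<^esub> \<oplus>\<^bsub>R\<^esub> (- (sg i \<beta> * Qc i \<beta>)) \<odot>\<^bsub>R\<^esub> pure \<one>\<^bsub>A\<^esub> (gx i)"

definition free_dirs :: "(nat \<Rightarrow> nat) \<Rightarrow> nat set" where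
  "free_dirs \<beta> = {i. i \<in> {1..N} \<and> \<beta> i = 0}"

lemma finite_free_dirs [simp]: "finite (free_dirs \<beta>)"
  by (simp add: free_dirs_def)

text \<open>Left linear maps between free modules multiply coefficients from the right: the basis
  vector at \<beta> + [i] contributes \<open>rel i \<beta>\<close> at \<beta>. The value 0 outside
  \<open>B n\<close> keeps the result in the free module.\<close>

definition dK :: "nat \<Rightarrow> ((nat \<Rightarrow> nat) \<Rightarrow> 'k SW) \<Rightarrow> (nat \<Rightarrow> nat) \<Rightarrow> 'k SW" where
  "dK n f = (\<lambda>\<beta>. if \<beta> \<in> B n then \<Oplus>\<^bsub>R\<^esub>i\<in>free_dirs \<beta>. f (\<beta>(i := 1)) \<otimes>\<^bsub>R\<^esub> rel i \<beta> else \<zero>\<^bsub>R\<^esub>)"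

text \<open>\<open>B 0\<close> contains only the zero vector, so this is the multiplication map from
  A \<otimes> A to A, obtained by acting on 1.\<close>

definition eK :: "((nat \<Rightarrow> nat) \<Rightarrow> 'k SW) \<Rightarrow> (nat list \<Rightarrow> 'k) set" where
  "eK f = f (\<lambda>_. 0) \<odot>\<^bsub>AM\<^esub> \<one>\<^bsub>A\<^esub>"

lemma K_carrier: "f \<in> carrier (K n) \<longleftrightarrow> (\<forall>\<beta>. f \<beta> \<in> carrier R) \<and> (\<forall>\<beta>. \<beta> \<notin> B n \<longrightarrow> f \<beta> = \<zero>\<^bsub>R\<^esub>)"
proof
  assume "f \<in> carrier (K n)"
  then show "(\<forall>\<beta>. f \<beta> \<in> carrier R) \<and> (\<forall>\<beta>. \<beta> \<notin> B n \<longrightarrow> f \<beta> = \<zero>\<^bsub>R\<^esub>)"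
    using R.free_module_value[of f "B n"] by auto
next
  assume "(\<forall>\<beta>. f \<beta> \<in> carrier R) \<and> (\<forall>\<beta>. \<beta> \<notin> B n \<longrightarrow> f \<beta> = \<zero>\<^bsub>R\<^esub>)"
  then show "f \<in> carrier (K n)"
    using finite_subset[OF _ B_finite[of n], of "{\<beta>. f \<beta> \<noteq> \<zero>\<^bsub>R\<^esub>}"] by auto
qed

lemma K_lmod: "lmod R (K n)"
  by (rule R.free_module_lmod)

lemma AM_lmod: "lmod R AM"
  by (rule lmodI[OF AM_left_module])

lemma rel_closed: "i \<in> {1..N} \<Longrightarrow> rel i \<beta> \<in> carrier R"
  by (simp add: rel_def pure_closed gx_closed)

lemma dK_summand_closed:
  "(\<And>\<beta>. f \<beta> \<in> carrier R) \<Longrightarrow> (\<lambda>i. f (\<beta>(i := 1)) \<otimes>\<^bsub>R\<^esub> rel i \<beta>) \<in> free_dirs \<beta> \<rightarrow> carrier R"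
  by (auto simp: free_dirs_def intro!: R.m_closed rel_closed)

lemma dK_hom: "is_hom R (K (Suc n)) (K n) (dK n)"
proof (rule is_homI)
  fix f assume f: "f \<in> carrier (K (Suc n))"
  then have v: "f \<beta> \<in> carrier R" for \<beta> unfolding K_carrier by simp
  show "dK n f \<in> carrier (K n)"
    unfolding K_carrier dK_def using R.finsum_closed[OF dK_summand_closed[of f, OF v]] by auto
next
  fix f g assume f: "f \<in> carrier (K (Suc n))" and g: "g \<in> carrier (K (Suc n))"
  have v: "f \<beta> \<in> carrier R" "g \<beta> \<in> carrier R" for \<beta> using f g unfolding K_carrier by simp_all
  have "(\<Oplus>\<^bsub>R\<^esub>i\<in>free_dirs \<beta>. (f (\<beta>(i := 1)) \<oplus>\<^bsub>R\<^esub> g (\<beta>(i := 1))) \<otimes>\<^bsub>R\<^esub> rel i \<beta>) =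
      (\<Oplus>\<^bsub>R\<^esub>i\<in>free_dirs \<beta>. f (\<beta>(i := 1)) \<otimes>\<^bsub>R\<^esub> rel i \<beta> \<oplus>\<^bsub>R\<^esub> g (\<beta>(i := 1)) \<otimes>\<^bsub>R\<^esub> rel i \<beta>)" for \<beta>
    using v rel_closed by (intro R.finsum_cong') (auto simp: R.l_distr free_dirs_def)
  then show "dK n (f \<oplus>\<^bsub>K (Suc n)\<^esub> g) = dK n f \<oplus>\<^bsub>K n\<^esub> dK n g"
    using R.finsum_addf[OF dK_summand_closed[of f, OF v(1)] dK_summand_closed[of g, OF v(2)]]
    by (auto simp: dK_def fun_eq_iff)
next
  fix r f assume r: "r \<in> carrier R" and f: "f \<in> carrier (K (Suc n))"
  have v: "f \<beta> \<in> carrier R" for \<beta> using f unfolding K_carrier by simp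
  have "(\<Oplus>\<^bsub>R\<^esub>i\<in>free_dirs \<beta>. (r \<otimes>\<^bsub>R\<^esub> f (\<beta>(i := 1))) \<otimes>\<^bsub>R\<^esub> rel i \<beta>) =
      (\<Oplus>\<^bsub>R\<^esub>i\<in>free_dirs \<beta>. r \<otimes>\<^bsub>R\<^esub> (f (\<beta>(i := 1)) \<otimes>\<^bsub>R\<^esub> rel i \<beta>))" for \<beta>
    using v rel_closed r by (intro R.finsum_cong') (auto simp: R.m_assoc free_dirs_def)
  then show "dK n (r \<odot>\<^bsub>K (Suc n)\<^esub> f) = r \<odot>\<^bsub>K n\<^esub> dK n f"
    using R.finsum_rdistr[OF finite_free_dirs r dK_summand_closed[of f, OF v]] r
    by (auto simp: dK_def fun_eq_iff)
qed

text \<open>Multiplication in the second factor of R is reversed, so both products insert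
  \<open>x\<^sub>i\<close> on the inner side of the tensor sign. Hence \<open>col\<close> appears
  for the left factor and \<open>row\<close> for the right one.\<close>

lemma coord_mult_pure:
  assumes r: "r \<in> carrier R" and i: "i \<in> {1..N}"
  shows "\<rho> (r \<otimes>\<^bsub>R\<^esub> pure (gx i) \<one>\<^bsub>A\<^esub>) (\<alpha>, \<gamma>) =
      (if \<alpha> i = 0 then 0 else S.col (\<alpha>(i := \<alpha> i - 1)) i * \<rho> r (\<alpha>(i := \<alpha> i - 1), \<gamma>))"
    and "\<rho> (r \<otimes>\<^bsub>R\<^esub> pure \<one>\<^bsub>A\<^esub> (gx i)) (\<alpha>, \<gamma>) =
      (if \<gamma> i = 0 then 0 else S.row i (\<gamma>(i := \<gamma> i - 1)) * \<rho> r (\<alpha>, \<gamma>(i := \<gamma> i - 1)))"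
proof (atomize (full))
  have p: "pure (gx i) \<one>\<^bsub>A\<^esub> \<in> carrier R" "pure \<one>\<^bsub>A\<^esub> (gx i) \<in> carrier R"
    using gx_closed[OF i] by (simp_all add: pure_closed)
  show "\<rho> (r \<otimes>\<^bsub>R\<^esub> pure (gx i) \<one>\<^bsub>A\<^esub>) (\<alpha>, \<gamma>) =
      (if \<alpha> i = 0 then 0 else S.col (\<alpha>(i := \<alpha> i - 1)) i * \<rho> r (\<alpha>(i := \<alpha> i - 1), \<gamma>)) \<and>
    \<rho> (r \<otimes>\<^bsub>R\<^esub> pure \<one>\<^bsub>A\<^esub> (gx i)) (\<alpha>, \<gamma>) =
      (if \<gamma> i = 0 then 0 else S.row i (\<gamma>(i := \<gamma> i - 1)) * \<rho> r (\<alpha>, \<gamma>(i := \<gamma> i - 1)))"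
    using r
  proof (induction r rule: R_induct)
    case zero
    show ?case using p by simp
  next
    case (add r a b)
    have *: "pure a b \<otimes>\<^bsub>R\<^esub> pure (gx i) \<one>\<^bsub>A\<^esub> = pure (a \<otimes>\<^bsub>A\<^esub> gx i) b"
      "pure a b \<otimes>\<^bsub>R\<^esub> pure \<one>\<^bsub>A\<^esub> (gx i) = pure a (gx i \<otimes>\<^bsub>A\<^esub> b)"
      using add gx_closed[OF i] by (simp_all add: pure_mult)
    show ?case
      using add p gx_closed[OF i]
      by (simp add: R.l_distr pure_closed R.coords_add * coord_pure coord_gx_mult[OF i] algebra_simps)
  qed
qed

lemma coord_mult_rel:
  assumes r: "r \<in> carrier R" and i: "i \<in> {1..N}"
  shows "\<rho> (r \<otimes>\<^bsub>R\<^esub> rel i \<beta>) (\<alpha>, \<gamma>) = sg i \<beta> *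
    ((if \<alpha> i = 0 then 0 else Pc i \<beta> * S.col (\<alpha>(i := \<alpha> i - 1)) i * \<rho> r (\<alpha>(i := \<alpha> i - 1), \<gamma>)) -
     (if \<gamma> i = 0 then 0 else Qc i \<beta> * S.row i (\<gamma>(i := \<gamma> i - 1)) * \<rho> r (\<alpha>, \<gamma>(i := \<gamma> i - 1))))"
proof -
  have p: "pure (gx i) \<one>\<^bsub>A\<^esub> \<in> carrier R" "pure \<one>\<^bsub>A\<^esub> (gx i) \<in> carrier R"
    using gx_closed[OF i] by (simp_all add: pure_closed)
  show ?thesis
    using r p by (simp add: rel_def R.r_distr R.smult_mult_right R.coords_add R.coords_smult
        coord_mult_pure[OF r i] algebra_simps)
qed

text \<open>The rescaled coordinates in which all the parameters \<open>q\<close> disappear from the differential: the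
  basis vector with exponents \<open>\<alpha>, \<beta>, \<gamma>\<close> is compared with the product of the three monomials
  \<open>x\<^sup>\<alpha> x\<^sup>\<beta> x\<^sup>\<gamma>\<close>.\<close>

definition gauge :: "(nat \<Rightarrow> nat) \<Rightarrow> (nat \<Rightarrow> nat) \<Rightarrow> (nat \<Rightarrow> nat) \<Rightarrow> 'k" where
  "gauge \<alpha> \<beta> \<gamma> = S.chi \<alpha> \<beta> * S.chi \<alpha> \<gamma> * S.chi \<beta> \<gamma>"

definition \<kappa> :: "((nat \<Rightarrow> nat) \<Rightarrow> 'k SW) \<Rightarrow> (nat \<Rightarrow> nat) \<Rightarrow> exps2 \<Rightarrow> 'k" where
  "\<kappa> f \<beta> = (\<lambda>(\<alpha>, \<gamma>). gauge \<alpha> \<beta> \<gamma> * \<rho> (f \<beta>) (\<alpha>, \<gamma>))"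

lemma gauge_nz: "gauge \<alpha> \<beta> \<gamma> \<noteq> 0"
  by (simp add: gauge_def chi_nz)

text \<open>With a = \<alpha> - [i], both sides belong to the product of \<open>x\<^sup>a\<close>,
  \<open>x\<^sub>i\<close>, \<open>x\<^sup>\<beta>\<close>, \<open>x\<^sup>\<gamma>\<close>, where
  \<open>x\<^sub>i\<close> is counted with \<alpha> on the left and with \<beta> on the right.
  \<open>Pc\<close> removes the crossing of \<open>x\<^sub>i\<close> with
  \<open>x\<^sup>\<beta>\<close>, and \<open>col\<close> adds the one with
  \<open>x\<^sup>a\<close>.\<close>

lemma gauge_left:
  assumes i: "i \<in> {1..N}" and "\<alpha> i \<noteq> 0" "\<beta> i = 0"
  shows "gauge \<alpha> \<beta> \<gamma> * Pc i \<beta> * S.col (\<alpha>(i := \<alpha> i - 1)) i = gauge (\<alpha>(i := \<alpha> i - 1)) (\<beta>(i := 1)) \<gamma>"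
proof -
  let ?a = "\<alpha>(i := \<alpha> i - 1)"
  have a: "\<alpha> = ?a(i := Suc (?a i))" using assms(2) by auto
  have b: "\<beta>(i := 1) = \<beta>(i := Suc (\<beta> i))" using assms(3) by (simp add: One_nat_def)
  have "gauge \<alpha> \<beta> \<gamma> = S.row i \<beta> * S.row i \<gamma> * (S.chi ?a \<beta> * S.chi ?a \<gamma> * S.chi \<beta> \<gamma>)"
    unfolding gauge_def by (subst (1 2) a) (simp only: S.chi_inc_left[OF i] mult_ac)
  moreover have "gauge ?a (\<beta>(i := 1)) \<gamma> = S.col ?a i * S.row i \<gamma> * (S.chi ?a \<beta> * S.chi ?a \<gamma> * S.chi \<beta> \<gamma>)"
    unfolding gauge_def b S.chi_inc_left[OF i] S.chi_inc_right[OF i] by (simp only: mult_ac)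
  moreover have "u * v = 1 \<Longrightarrow> u * w * z * v * c = c * w * z" for u v w z c :: 'k
    by (metis mult.left_commute mult.commute mult_1)
  ultimately show ?thesis using row_Pc[OF i, of \<beta>] by simp
qed

text \<open>Mirror image of \<open>gauge_left\<close>, with c = \<gamma> - [i]: \<open>Qc\<close>
  removes the crossing of \<open>x\<^sup>\<beta>\<close> with \<open>x\<^sub>i\<close>, and
  \<open>row\<close> adds the one of \<open>x\<^sub>i\<close> with \<open>x\<^sup>c\<close>.\<close>

lemma gauge_right:
  assumes i: "i \<in> {1..N}" and "\<gamma> i \<noteq> 0" "\<beta> i = 0"
  shows "gauge \<alpha> \<beta> \<gamma> * Qc i \<beta> * S.row i (\<gamma>(i := \<gamma> i - 1)) = gauge \<alpha> (\<beta>(i := 1)) (\<gamma>(i := \<gamma> i - 1))"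
proof -
  let ?c = "\<gamma>(i := \<gamma> i - 1)"
  have c: "\<gamma> = ?c(i := Suc (?c i))" using assms(2) by auto
  have b: "\<beta>(i := 1) = \<beta>(i := Suc (\<beta> i))" using assms(3) by (simp add: One_nat_def)
  have "gauge \<alpha> \<beta> \<gamma> = S.col \<beta> i * S.col \<alpha> i * (S.chi \<alpha> \<beta> * S.chi \<alpha> ?c * S.chi \<beta> ?c)"
    unfolding gauge_def by (subst (1 2) c) (simp only: S.chi_inc_right[OF i] mult_ac)
  moreover have "gauge \<alpha> (\<beta>(i := 1)) ?c = S.row i ?c * S.col \<alpha> i * (S.chi \<alpha> \<beta> * S.chi \<alpha> ?c * S.chi \<beta> ?c)"
    unfolding gauge_def b S.chi_inc_left[OF i] S.chi_inc_right[OF i] by (simp only: mult_ac)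
  moreover have "u * v = 1 \<Longrightarrow> u * w * z * v * c = c * w * z" for u v w z c :: 'k
    by (metis mult.left_commute mult.commute mult_1)
  ultimately show ?thesis using col_Qc[OF i, of \<beta>] by simp
qed

lemma \<kappa>_zero: "f \<beta> = \<zero>\<^bsub>R\<^esub> \<Longrightarrow> \<kappa> f \<beta> = (\<lambda>_. 0)"
  by (auto simp: \<kappa>_def)

lemma \<kappa>_dK:
  assumes f: "f \<in> carrier (K (Suc n))" and \<beta>: "\<beta> \<in> bin N"
  shows "\<kappa> (dK n f) \<beta> p = DD N (\<kappa> f) \<beta> p"
proof -
  have v: "f \<beta> \<in> carrier R" for \<beta> using f unfolding K_carrier by simp
  obtain \<alpha> \<gamma> where p: "p = (\<alpha>, \<gamma>)" by (cases p)
  show ?thesis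
  proof (cases "\<beta> \<in> B n")
    case False
    have "\<kappa> f (\<beta>(i := 1)) = (\<lambda>_. 0)" if "i \<in> {1..N}" "\<beta> i = 0" for i
      using f B_upd[of \<beta> i n] that False unfolding K_carrier by (intro \<kappa>_zero) blast
    then have "DD N (\<kappa> f) \<beta> p = 0" by (auto simp: DD_def uu_zero intro!: sum.neutral)
    then show ?thesis using False by (simp add: dK_def \<kappa>_zero)
  next
    case True
    have "\<rho> (dK n f \<beta>) (\<alpha>, \<gamma>) = (\<Sum>i\<in>free_dirs \<beta>. \<rho> (f (\<beta>(i := 1)) \<otimes>\<^bsub>R\<^esub> rel i \<beta>) (\<alpha>, \<gamma>))"
      using True R.coords_finsum[OF dK_summand_closed[of f \<beta>, OF v]] by (simp add: dK_def)
    then have "\<kappa> (dK n f) \<beta> p = (\<Sum>i\<in>free_dirs \<beta>. gauge \<alpha> \<beta> \<gamma> * \<rho> (f (\<beta>(i := 1)) \<otimes>\<^bsub>R\<^esub> rel i \<beta>) (\<alpha>, \<gamma>))"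
      by (simp add: \<kappa>_def p sum_distrib_left)
    also have "\<dots> = (\<Sum>i\<in>free_dirs \<beta>. sg i \<beta> * uu i (\<kappa> f (\<beta>(i := 1))) p)"
    proof (rule sum.cong[OF refl])
      fix i assume "i \<in> free_dirs \<beta>"
      then have i: "i \<in> {1..N}" "\<beta> i = 0" by (auto simp: free_dirs_def)
      \<comment> \<open>z stands for the coordinate at the shifted exponents. The case distinction
        stays in the equation because the gauge identities are available only where lowering the
        exponent does not truncate.\<close>
      have "(if \<alpha> i = 0 then 0 else gauge \<alpha> \<beta> \<gamma> * (Pc i \<beta> * S.col (\<alpha>(i := \<alpha> i - 1)) i * z)) =
          (if \<alpha> i = 0 then 0 else gauge (\<alpha>(i := \<alpha> i - 1)) (\<beta>(i := 1)) \<gamma> * z)" for z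
        using gauge_left[OF i(1), of \<alpha> \<beta> \<gamma>] i(2) by (simp flip: mult.assoc)
      moreover have "(if \<gamma> i = 0 then 0 else gauge \<alpha> \<beta> \<gamma> * (Qc i \<beta> * S.row i (\<gamma>(i := \<gamma> i - 1)) * z)) =
          (if \<gamma> i = 0 then 0 else gauge \<alpha> (\<beta>(i := 1)) (\<gamma>(i := \<gamma> i - 1)) * z)" for z
        using gauge_right[OF i(1), of \<gamma> \<beta> \<alpha>] i(2) by (simp flip: mult.assoc)
      ultimately show "gauge \<alpha> \<beta> \<gamma> * \<rho> (f (\<beta>(i := 1)) \<otimes>\<^bsub>R\<^esub> rel i \<beta>) (\<alpha>, \<gamma>) =
          sg i \<beta> * uu i (\<kappa> f (\<beta>(i := 1))) p"
        unfolding coord_mult_rel[OF v i(1)] uu_def \<kappa>_def p prod.case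
        by (simp only: mult.left_commute[of "gauge \<alpha> \<beta> \<gamma>"] right_diff_distrib
            if_distrib[of "\<lambda>z. gauge \<alpha> \<beta> \<gamma> * z"] mult_zero_right)
    qed
    finally show ?thesis by (simp add: DD_def free_dirs_def)
  qed
qed

lemma \<kappa>_finsupp: "f \<beta> \<in> carrier R \<Longrightarrow> \<kappa> f \<beta> \<in> finsupp (E \<times> E)"
proof -
  assume "f \<beta> \<in> carrier R"
  then have \<rho>: "\<rho> (f \<beta>) \<in> finsupp (E \<times> E)" by (rule R.coords_finsupp)
  have "{p. \<kappa> f \<beta> p \<noteq> 0} \<subseteq> {p. \<rho> (f \<beta>) p \<noteq> 0}" by (auto simp: \<kappa>_def)
  then show ?thesis using \<rho> by (intro finsuppI[OF finsuppD(1)[OF \<rho>]]) (auto simp: finsupp_def)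
qed

lemma \<kappa>_nonzeroD:
  assumes "f \<beta> \<in> carrier R" "\<kappa> f \<beta> (\<alpha>, \<gamma>) \<noteq> 0"
  shows "\<alpha> \<in> E" "\<gamma> \<in> E"
  using finsuppD(2)[OF \<kappa>_finsupp[of f \<beta>, OF assms(1)] assms(2)] by simp_all

lemma \<kappa>_inject:
  assumes "f \<in> carrier (K n)" "g \<in> carrier (K n)" "\<And>\<beta> p. \<beta> \<in> B n \<Longrightarrow> \<kappa> f \<beta> p = \<kappa> g \<beta> p"
  shows "f = g"
proof
  fix \<beta>
  show "f \<beta> = g \<beta>"
  proof (cases "\<beta> \<in> B n")
    case True
    show ?thesis
    proof (rule R.coords_eqI)
      fix p show "\<rho> (f \<beta>) p = \<rho> (g \<beta>) p"
        using assms(3)[OF True, of p] gauge_nz by (cases p) (auto simp: \<kappa>_def)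
    qed (use assms(1,2) in \<open>auto simp: K_carrier simp del: free_module_simps\<close>)
  qed (use assms(1,2) in \<open>auto simp: K_carrier simp del: free_module_simps\<close>)
qed

lemma \<kappa>_minus:
  assumes "f \<in> carrier (K n)" "g \<in> carrier (K n)"
  shows "\<kappa> (f \<ominus>\<^bsub>K n\<^esub> g) \<beta> p = \<kappa> f \<beta> p - \<kappa> g \<beta> p"
proof -
  interpret K: lmod R "K n" by (rule K_lmod)
  have c: "f \<ominus>\<^bsub>K n\<^esub> g \<in> carrier (K n)" using assms by (rule K.M.minus_closed)
  have v: "f \<beta> \<in> carrier R" "g \<beta> \<in> carrier R" "(f \<ominus>\<^bsub>K n\<^esub> g) \<beta> \<in> carrier R"
    using assms c unfolding K_carrier by auto
  have "f \<beta> = (f \<ominus>\<^bsub>K n\<^esub> g) \<beta> \<oplus>\<^bsub>R\<^esub> g \<beta>"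
    using K.minus_cancel[OF assms] by (metis free_module_simps(3))
  then have "\<rho> (f \<beta>) p = \<rho> ((f \<ominus>\<^bsub>K n\<^esub> g) \<beta> \<oplus>\<^bsub>R\<^esub> g \<beta>) p"
    by (rule arg_cong[where f = "\<lambda>r. \<rho> r p"])
  also have "\<dots> = \<rho> ((f \<ominus>\<^bsub>K n\<^esub> g) \<beta>) p + \<rho> (g \<beta>) p"
    by (simp only: R.coords_add[OF v(3,2)])
  finally have "\<rho> (f \<beta>) p = \<rho> ((f \<ominus>\<^bsub>K n\<^esub> g) \<beta>) p + \<rho> (g \<beta>) p" .
  then show ?thesis by (cases p) (simp add: \<kappa>_def algebra_simps)
qed

lemma dK_dK: "f \<in> carrier (K (Suc (Suc n))) \<Longrightarrow> dK n (dK (Suc n) f) = (\<lambda>_. \<zero>\<^bsub>R\<^esub>)"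
proof (rule \<kappa>_inject)
  assume f: "f \<in> carrier (K (Suc (Suc n)))"
  note df = is_homD(1)[OF dK_hom f]
  show "dK n (dK (Suc n) f) \<in> carrier (K n)" by (rule is_homD(1)[OF dK_hom df])
  show "(\<lambda>_. \<zero>\<^bsub>R\<^esub>) \<in> carrier (K n)" by simp
  fix \<beta> p assume "\<beta> \<in> B n"
  then have \<beta>: "\<beta> \<in> bin N" by (rule B_bin)
  have "\<kappa> (dK n (dK (Suc n) f)) \<beta> p = DD N (\<kappa> (dK (Suc n) f)) \<beta> p"
    by (rule \<kappa>_dK[OF df \<beta>])
  also have "\<dots> = DD N (DD N (\<kappa> f)) \<beta> p"
    unfolding DD_def[of N "\<kappa> (dK (Suc n) f)"] DD_def[of N "DD N (\<kappa> f)"]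
  proof (intro sum.cong refl)
    fix i assume "i \<in> {i. i \<in> {1..N} \<and> \<beta> i = 0}"
    then have "\<beta>(i := 1) \<in> bin N" using \<beta> by (auto simp: bin_def exponents_def)
    then have "\<kappa> (dK (Suc n) f) (\<beta>(i := 1)) = DD N (\<kappa> f) (\<beta>(i := 1))"
      using \<kappa>_dK[OF f] by blast
    then show "sg i \<beta> * uu i (\<kappa> (dK (Suc n) f) (\<beta>(i := 1))) p =
        sg i \<beta> * uu i (DD N (\<kappa> f) (\<beta>(i := 1))) p" by simp
  qed
  also have "\<dots> = 0" by (rule DD_DD)
  finally show "\<kappa> (dK n (dK (Suc n) f)) \<beta> p = \<kappa> (\<lambda>_. \<zero>\<^bsub>R\<^esub>) \<beta> p" by (simp add: \<kappa>_zero)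
qed

text \<open>\<open>hh\<close> is defined on coefficient functions. Dividing by the gauge turns its
  values back into elements of R, their supports being finite as for \<open>vv\<close>; outside
  \<open>B (Suc n)\<close> both sides vanish.\<close>

lemma hh_lift:
  assumes f: "f \<in> carrier (K n)" and k: "k \<in> {1..N}"
  shows "\<exists>g\<in>carrier (K (Suc n)). \<forall>\<beta>\<in>bin N. \<kappa> g \<beta> = hh k (\<kappa> f) \<beta>"
proof -
  define g where "g \<beta> = (if \<beta> \<in> B (Suc n) then R.vec (\<lambda>(\<alpha>, \<gamma>). hh k (\<kappa> f) \<beta> (\<alpha>, \<gamma>) / gauge \<alpha> \<beta> \<gamma>) else \<zero>\<^bsub>R\<^esub>)" for \<beta>
  have v: "f \<beta> \<in> carrier R" for \<beta> using f unfolding K_carrier by simp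
  have fs: "(\<lambda>(\<alpha>, \<gamma>). hh k (\<kappa> f) \<beta> (\<alpha>, \<gamma>) / gauge \<alpha> \<beta> \<gamma>) \<in> finsupp (E \<times> E)" for \<beta>
  proof -
    have vf: "vv k (\<kappa> f (\<beta>(k := 0))) \<in> finsupp (E \<times> E)"
      by (intro vv_finsupp \<kappa>_finsupp v k)
    have sub: "{p. (case p of (\<alpha>, \<gamma>) \<Rightarrow> hh k (\<kappa> f) \<beta> (\<alpha>, \<gamma>) / gauge \<alpha> \<beta> \<gamma>) \<noteq> 0}
        \<subseteq> {p. vv k (\<kappa> f (\<beta>(k := 0))) p \<noteq> 0}"
      by (auto simp: hh_def split: if_splits)
    have "{p. vv k (\<kappa> f (\<beta>(k := 0))) p \<noteq> 0} \<subseteq> E \<times> E"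
      using vf by (simp add: finsupp_def)
    from order_trans[OF sub this] show ?thesis by (rule finsuppI[OF finsuppD(1)[OF vf] sub])
  qed
  have "g \<in> carrier (K (Suc n))"
    unfolding K_carrier g_def using R.vec_closed[OF fs] by simp
  moreover have "\<kappa> g \<beta> = hh k (\<kappa> f) \<beta>" if \<beta>: "\<beta> \<in> bin N" for \<beta>
  proof (cases "\<beta> \<in> B (Suc n)")
    case True
    then show ?thesis
      using gauge_nz by (auto simp: \<kappa>_def g_def R.coords_vec[OF fs])
  next
    case False
    have "hh k (\<kappa> f) \<beta> p = 0" for p
    proof (cases "\<beta> k = 1")
      case True
      then have "\<beta> = (\<beta>(k := 0))(k := 1)" by auto
      then have "\<beta>(k := 0) \<notin> B n" using B_upd[of "\<beta>(k := 0)" k n] False k by auto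
      then have "\<kappa> f (\<beta>(k := 0)) = (\<lambda>_. 0)" using f unfolding K_carrier by (intro \<kappa>_zero) blast
      then show ?thesis by (cases p) (simp add: hh_def vv_def)
    qed (simp add: hh_def)
    then show ?thesis using False by (auto simp: g_def \<kappa>_zero)
  qed
  ultimately show ?thesis by blast
qed

section \<open>Exactness of the Koszul bimodule complex\<close>

lemma DD_cong:
  assumes "\<And>\<beta>. \<beta> \<in> bin N \<Longrightarrow> F \<beta> = G \<beta>" "\<beta> \<in> bin N"
  shows "DD N F \<beta> p = DD N G \<beta> p"
  unfolding DD_def
proof (intro sum.cong refl)
  fix i assume "i \<in> {i. i \<in> {1..N} \<and> \<beta> i = 0}"
  then have "\<beta>(i := 1) \<in> bin N" using assms(2) by (auto simp: bin_def exponents_def)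
  then show "sg i \<beta> * uu i (F (\<beta>(i := 1))) p = sg i \<beta> * uu i (G (\<beta>(i := 1))) p"
    using assms(1) by simp
qed

lemma DD_diff: "DD N (\<lambda>\<beta> p. F \<beta> p - G \<beta> p) \<beta> p = DD N F \<beta> p - DD N G \<beta> p"
  by (simp add: DD_def uu_diff right_diff_distrib sum_subtractf)

text \<open>Modulo boundaries a cycle is freed from the first k variables: neither \<beta> nor the
  right tensor factor involves them. The next variable is treated by \<open>DD_hh\<close>, applied
  to the corrected cycle, and \<open>uu_vv_support\<close> keeps the earlier ones away.\<close>

lemma partial_contraction:
  assumes f: "f \<in> carrier (K n)" and cycle: "\<And>\<beta> p. \<beta> \<in> bin N \<Longrightarrow> DD N (\<kappa> f) \<beta> p = 0"
  shows "k \<le> N \<Longrightarrow> \<exists>g\<in>carrier (K (Suc n)). \<forall>\<beta>\<in>bin N. \<forall>\<alpha> \<gamma>.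
    \<kappa> (f \<ominus>\<^bsub>K n\<^esub> dK n g) \<beta> (\<alpha>, \<gamma>) \<noteq> 0 \<longrightarrow> (\<forall>j\<in>{1..k}. \<beta> j = 0 \<and> \<gamma> j = 0)"
proof (induction k)
  case 0
  show ?case by (intro bexI[of _ "\<lambda>_. \<zero>\<^bsub>R\<^esub>"]) auto
next
  case (Suc k)
  interpret K0: lmod R "K n" by (rule K_lmod)
  interpret K1: lmod R "K (Suc n)" by (rule K_lmod)
  obtain g where g: "g \<in> carrier (K (Suc n))" and g0: "\<And>\<beta> \<alpha> \<gamma> j. \<beta> \<in> bin N \<Longrightarrow>
      \<kappa> (f \<ominus>\<^bsub>K n\<^esub> dK n g) \<beta> (\<alpha>, \<gamma>) \<noteq> 0 \<Longrightarrow> j \<in> {1..k} \<Longrightarrow> \<beta> j = 0 \<and> \<gamma> j = 0"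
    using Suc by fastforce
  let ?f = "f \<ominus>\<^bsub>K n\<^esub> dK n g"
  have dg: "dK n g \<in> carrier (K n)" by (rule is_homD(1)[OF dK_hom g])
  have f': "?f \<in> carrier (K n)" using f dg by (rule K0.M.minus_closed)
  have \<kappa>f: "\<kappa> ?f \<beta> = (\<lambda>p. \<kappa> f \<beta> p - DD N (\<kappa> g) \<beta> p)" if "\<beta> \<in> bin N" for \<beta>
    using \<kappa>_minus[OF f dg] \<kappa>_dK[OF g that] by auto
  have cyc: "DD N (\<kappa> ?f) \<beta> p = 0" if "\<beta> \<in> bin N" for \<beta> p
    using DD_cong[of "\<kappa> ?f" "\<lambda>\<beta> p. \<kappa> f \<beta> p - DD N (\<kappa> g) \<beta> p", OF \<kappa>f that]
    by (simp add: DD_diff cycle[OF that] DD_DD)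
  have k: "Suc k \<in> {1..N}" using Suc.prems by simp
  obtain h where h: "h \<in> carrier (K (Suc n))" "\<And>\<beta>. \<beta> \<in> bin N \<Longrightarrow> \<kappa> h \<beta> = hh (Suc k) (\<kappa> ?f) \<beta>"
    using hh_lift[OF f' k] by blast
  have dh: "dK n h \<in> carrier (K n)" by (rule is_homD(1)[OF dK_hom h(1)])
  have gh: "g \<oplus>\<^bsub>K (Suc n)\<^esub> h \<in> carrier (K (Suc n))" using g h(1) by (rule K1.M.a_closed)
  have eq: "f \<ominus>\<^bsub>K n\<^esub> dK n (g \<oplus>\<^bsub>K (Suc n)\<^esub> h) = ?f \<ominus>\<^bsub>K n\<^esub> dK n h"
    unfolding is_homD(2)[OF dK_hom g h(1)] K0.M.minus_eq K0.M.minus_add[OF dg dh]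
    using f dg dh by (intro K0.M.a_assoc[symmetric] K0.M.a_inv_closed)
  have \<kappa>': "\<kappa> (?f \<ominus>\<^bsub>K n\<^esub> dK n h) \<beta> p =
      (if \<beta> (Suc k) = 0 then \<kappa> ?f \<beta> p - uu (Suc k) (vv (Suc k) (\<kappa> ?f \<beta>)) p else 0)"
    if \<beta>: "\<beta> \<in> bin N" for \<beta> p
  proof -
    have "\<kappa> (?f \<ominus>\<^bsub>K n\<^esub> dK n h) \<beta> p = \<kappa> ?f \<beta> p - DD N (\<kappa> h) \<beta> p"
      unfolding \<kappa>_minus[OF f' dh] \<kappa>_dK[OF h(1) \<beta>] ..
    also have "DD N (\<kappa> h) \<beta> p = DD N (hh (Suc k) (\<kappa> ?f)) \<beta> p"
      by (rule DD_cong[OF h(2) \<beta>])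
    finally show ?thesis using DD_hh[OF k \<beta> cyc, of p] by simp
  qed
  have "\<beta> j = 0 \<and> \<gamma> j = 0"
    if \<beta>: "\<beta> \<in> bin N" and nz: "\<kappa> (?f \<ominus>\<^bsub>K n\<^esub> dK n h) \<beta> (\<alpha>, \<gamma>) \<noteq> 0" and j: "j \<in> {1..Suc k}" for \<beta> \<alpha> \<gamma> j
  proof -
    have b: "\<beta> (Suc k) = 0" and nz': "\<kappa> ?f \<beta> (\<alpha>, \<gamma>) - uu (Suc k) (vv (Suc k) (\<kappa> ?f \<beta>)) (\<alpha>, \<gamma>) \<noteq> 0"
      using nz \<kappa>'[OF \<beta>] by (auto split: if_splits)
    show ?thesis
    proof (cases "j = Suc k")
      case True
      then show ?thesis using b nz' uu_vv_vanish[of \<gamma> "Suc k" "\<kappa> ?f \<beta>" \<alpha>] by auto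
    next
      case False
      then have j: "j \<in> {1..k}" "j \<noteq> Suc k" using j by auto
      have "\<beta> j = 0"
      proof (rule ccontr)
        assume "\<beta> j \<noteq> 0"
        then have "\<kappa> ?f \<beta> = (\<lambda>_. 0)" using g0[OF \<beta> _ j(1)] by (auto simp: fun_eq_iff)
        then show False using nz' by (simp add: uu_zero vv_zero)
      qed
      moreover have "\<gamma> j = 0"
        by (rule uu_vv_support[OF j(2) nz']) (use g0[OF \<beta> _ j(1)] in blast)
      ultimately show ?thesis by simp
    qed
  qed
  then show ?case unfolding eq[symmetric] using gh by blast
qed

lemma coord_act_one:
  assumes "r \<in> carrier R" "\<delta> \<in> E"
  shows "\<phi> (r \<odot>\<^bsub>AM\<^esub> \<one>\<^bsub>A\<^esub>) \<delta> = (\<Sum>p\<in>splits \<delta>. S.chi (fst p) (snd p) * \<rho> r p)"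
  using assms(1)
proof (induction r rule: R_induct)
  case zero
  show ?case by (simp add: act_zero_left)
next
  case (add r a b)
  have "\<phi> (pure a b \<odot>\<^bsub>AM\<^esub> \<one>\<^bsub>A\<^esub>) \<delta> = (\<Sum>p\<in>splits \<delta>. S.chi (fst p) (snd p) * \<rho> (pure a b) p)"
  proof -
    have "\<rho> (pure a b) p = \<phi> a (fst p) * \<phi> b (snd p)" for p
      using add by (cases p) (simp add: coord_pure)
    then show ?thesis
      using add assms(2) by (simp add: act_pure coord_mult case_prod_unfold mult.assoc)
  qed
  then show ?case
    using add by (simp add: act_add_left pure_closed act_closed A.coords_add R.coords_add sum.distrib algebra_simps)
qed

lemma eK_hom: "is_hom R (K 0) AM eK"
proof (rule is_homI)
  fix f assume "f \<in> carrier (K 0)"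
  then show "eK f \<in> carrier AM" unfolding K_carrier by (simp add: eK_def act_closed)
next
  fix f g assume "f \<in> carrier (K 0)" "g \<in> carrier (K 0)"
  then show "eK (f \<oplus>\<^bsub>K 0\<^esub> g) = eK f \<oplus>\<^bsub>AM\<^esub> eK g"
    unfolding K_carrier by (simp add: eK_def act_add_left)
next
  fix r f assume "r \<in> carrier R" "f \<in> carrier (K 0)"
  then show "eK (r \<odot>\<^bsub>K 0\<^esub> f) = r \<odot>\<^bsub>AM\<^esub> eK f"
    unfolding K_carrier by (simp add: eK_def act_assoc)
qed

lemma act_smult:
  assumes "r \<in> carrier R" "a \<in> carrier A"
  shows "(c \<odot>\<^bsub>R\<^esub> r) \<odot>\<^bsub>AM\<^esub> a = c \<odot>\<^bsub>A\<^esub> (r \<odot>\<^bsub>AM\<^esub> a)"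
proof -
  have "c \<odot>\<^bsub>R\<^esub> r = (c \<odot>\<^bsub>R\<^esub> \<one>\<^bsub>R\<^esub>) \<otimes>\<^bsub>R\<^esub> r" using assms by (simp add: R.smult_mult_left)
  then show ?thesis using assms by (simp add: act_assoc act_scalar act_closed)
qed

text \<open>Evaluating a homomorphism on the image of a basis vector lets \<open>rel\<close> act on
  its values, so this bracket is the reason why homomorphisms from K to A carry the differential of
  the Koszul cochains.\<close>

lemma act_rel:
  assumes "i \<in> {1..N}" "a \<in> carrier A"
  shows "rel i \<beta> \<odot>\<^bsub>AM\<^esub> a =
    sg i \<beta> \<odot>\<^bsub>A\<^esub> (Pc i \<beta> \<odot>\<^bsub>A\<^esub> (gx i \<otimes>\<^bsub>A\<^esub> a) \<ominus>\<^bsub>A\<^esub> Qc i \<beta> \<odot>\<^bsub>A\<^esub> (a \<otimes>\<^bsub>A\<^esub> gx i))"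
proof (rule A.coords_eqI)
  note c = gx_closed[OF assms(1)] assms(2)
  show "\<phi> (rel i \<beta> \<odot>\<^bsub>AM\<^esub> a) p = \<phi> (sg i \<beta> \<odot>\<^bsub>A\<^esub> (Pc i \<beta> \<odot>\<^bsub>A\<^esub> (gx i \<otimes>\<^bsub>A\<^esub> a) \<ominus>\<^bsub>A\<^esub>
      Qc i \<beta> \<odot>\<^bsub>A\<^esub> (a \<otimes>\<^bsub>A\<^esub> gx i))) p" for p
    using c by (simp add: rel_def act_add_left act_smult pure_closed act_pure A.coords_add A.coords_smult
        A.coords_minus algebra_simps)
qed (use assms in \<open>auto intro!: act_closed rel_closed A.smult_closed A.minus_closed A.m_closed gx_closed\<close>)

text \<open>At \<beta> = 0 the twisting constants are 1, and \<open>x\<^sub>i\<close> commutes with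
  the unit.\<close>

lemma eK_dK: "f \<in> carrier (K (Suc 0)) \<Longrightarrow> eK (dK 0 f) = \<zero>\<^bsub>A\<^esub>"
proof -
  assume "f \<in> carrier (K (Suc 0))"
  then have v: "f \<beta> \<in> carrier R" for \<beta> unfolding K_carrier by simp
  define t where "t = (\<lambda>i. f ((\<lambda>_. 0)(i := 1)) \<otimes>\<^bsub>R\<^esub> rel i (\<lambda>_. 0))"
  have "rel i (\<lambda>_. 0) \<odot>\<^bsub>AM\<^esub> \<one>\<^bsub>A\<^esub> = \<zero>\<^bsub>A\<^esub>" if "i \<in> {1..N}" for i
    using gx_closed[OF that] that by (simp add: act_rel Pc_def Qc_def A.minus_eq A.r_neg)
  then have t: "t i \<in> carrier R \<and> t i \<odot>\<^bsub>AM\<^esub> \<one>\<^bsub>A\<^esub> = \<zero>\<^bsub>A\<^esub>" if "i \<in> {1..N}" for i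
    using that v rel_closed by (simp add: t_def act_assoc act_zero_right)
  have "finsum R t S \<odot>\<^bsub>AM\<^esub> \<one>\<^bsub>A\<^esub> = \<zero>\<^bsub>A\<^esub>" if "finite S" "S \<subseteq> {1..N}" for S
    using that
  proof (induction S rule: finite_induct)
    case (insert i S)
    then have "t \<in> S \<rightarrow> carrier R" using t by blast
    then show ?case using insert t[of i] by (simp add: R.finsum_insert act_add_left)
  qed (simp add: act_zero_left)
  from this[of "free_dirs (\<lambda>_. 0)"] have "finsum R t (free_dirs (\<lambda>_. 0)) \<odot>\<^bsub>AM\<^esub> \<one>\<^bsub>A\<^esub> = \<zero>\<^bsub>A\<^esub>"
    by (simp add: free_dirs_def subset_iff)
  then show ?thesis by (simp add: eK_def dK_def B_zero t_def)
qed

text \<open>Once all N variables are contracted, what is left of a cycle lives at \<beta> = 0 and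
  \<gamma> = 0, hence only in degree 0. There it is a combination of the
  \<open>x\<^sup>\<alpha> \<otimes> 1\<close>, on which the augmentation is injective.\<close>

lemma exact_cycle:
  assumes f: "f \<in> carrier (K n)" and cycle: "\<And>\<beta> p. \<beta> \<in> bin N \<Longrightarrow> DD N (\<kappa> f) \<beta> p = 0"
    and aug: "n = 0 \<Longrightarrow> eK f = \<zero>\<^bsub>A\<^esub>"
  shows "f \<in> dK n ` carrier (K (Suc n))"
proof -
  interpret K0: lmod R "K n" by (rule K_lmod)
  obtain g where g: "g \<in> carrier (K (Suc n))" and g0: "\<And>\<beta> \<alpha> \<gamma> j. \<beta> \<in> bin N \<Longrightarrow>
      \<kappa> (f \<ominus>\<^bsub>K n\<^esub> dK n g) \<beta> (\<alpha>, \<gamma>) \<noteq> 0 \<Longrightarrow> j \<in> {1..N} \<Longrightarrow> \<beta> j = 0 \<and> \<gamma> j = 0"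
    using partial_contraction[OF f cycle order_refl] by fastforce
  define f' where "f' = f \<ominus>\<^bsub>K n\<^esub> dK n g"
  note g0 = g0[folded f'_def]
  have dg: "dK n g \<in> carrier (K n)" by (rule is_homD(1)[OF dK_hom g])
  have f': "f' \<in> carrier (K n)" unfolding f'_def using f dg by (rule K0.M.minus_closed)
  have "\<kappa> f' \<beta> (\<alpha>, \<gamma>) = 0" if \<beta>: "\<beta> \<in> B n" for \<beta> \<alpha> \<gamma>
  proof (rule ccontr)
    assume nz: "\<kappa> f' \<beta> (\<alpha>, \<gamma>) \<noteq> 0"
    have z: "\<beta> j = 0 \<and> \<gamma> j = 0" if "j \<in> {1..N}" for j
      by (rule g0[OF B_bin[OF \<beta>] nz that])
    have fv: "f' \<beta> \<in> carrier R" using f' unfolding K_carrier by simp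
    have \<beta>0: "\<beta> = (\<lambda>_. 0)" using \<beta> z by (auto simp: B_def binary_exponents_def exponents_def fun_eq_iff)
    then have n0: "n = 0" using \<beta> by (simp add: B_def binary_exponents_def)
    note \<alpha> = \<kappa>_nonzeroD(1)[of f' \<beta>, OF fv nz]
    have \<gamma>0: "\<gamma> = (\<lambda>_. 0)"
      using \<kappa>_nonzeroD(2)[of f' \<beta>, OF fv nz] z by (auto simp: exponents_def fun_eq_iff)
    have "eK f' = eK f \<ominus>\<^bsub>AM\<^esub> eK (dK n g)"
      unfolding f'_def by (rule is_hom_minus[OF eK_hom[folded n0] K_lmod AM_lmod f dg])
    also have "\<dots> = \<zero>\<^bsub>A\<^esub>"
    proof -
      interpret AM: lmod R AM by (rule AM_lmod)
      show ?thesis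
        using aug n0 eK_dK[of g] g AM.M.r_neg[of "\<zero>\<^bsub>AM\<^esub>"] by (simp add: AM.M.minus_eq)
    qed
    finally have "0 = (\<Sum>p\<in>splits \<alpha>. S.chi (fst p) (snd p) * \<rho> (f' \<beta>) p)"
      using coord_act_one[OF fv \<alpha>] \<beta>0 by (simp add: eK_def)
    \<comment> \<open>All remaining terms have trivial right exponent, so among the factorizations
      of \<open>x\<^sup>\<alpha>\<close> only (\<alpha>, 0) counts; at \<beta> = 0 the gauge reduces
      to \<open>chi\<close>.\<close>
    also have "\<dots> = (\<Sum>p\<in>splits \<alpha>. if p = (\<alpha>, \<gamma>) then \<kappa> f' \<beta> (\<alpha>, \<gamma>) else 0)"
    proof (rule sum.cong[OF refl])
      fix p assume p: "p \<in> splits \<alpha>"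
      have "S.chi (fst p) (snd p) * \<rho> (f' \<beta>) p = \<kappa> f' \<beta> p"
        by (cases p) (simp add: \<kappa>_def gauge_def \<beta>0)
      moreover have "p = (\<alpha>, \<gamma>)" if "\<kappa> f' \<beta> p \<noteq> 0"
      proof -
        have "snd p j = 0" for j
        proof (cases "j \<in> {1..N}")
          case True
          then show ?thesis using g0[OF B_bin[OF \<beta>], of "fst p" "snd p" j] that by simp
        next
          case False
          have "snd p \<in> E" using \<kappa>_nonzeroD(2)[of f' \<beta> "fst p" "snd p", OF fv] that by simp
          then show ?thesis using False by (simp add: exponentsD)
        qed
        then show ?thesis using p \<gamma>0 by (cases p) (auto simp: splits_def fun_eq_iff)
      qed
      ultimately show "S.chi (fst p) (snd p) * \<rho> (f' \<beta>) p = (if p = (\<alpha>, \<gamma>) then \<kappa> f' \<beta> (\<alpha>, \<gamma>) else 0)"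
        by auto
    qed
    also have "\<dots> = \<kappa> f' \<beta> (\<alpha>, \<gamma>)"
      using finite_splits[OF \<alpha>] \<gamma>0 by (auto simp: splits_def)
    finally show False using nz by simp
  qed
  then have "\<kappa> f \<beta> p = \<kappa> (dK n g) \<beta> p" if "\<beta> \<in> B n" for \<beta> p
    using \<kappa>_minus[OF f dg, of \<beta> p] that by (cases p) (simp add: f'_def[symmetric])
  then have "f = dK n g" by (rule \<kappa>_inject[OF f dg])
  then show ?thesis using g by blast
qed

lemma koszul_resolution: "resolution R AM K dK eK B"
proof (rule resolution.intro)
  show "lmod R AM" by (rule AM_lmod)
  show "lmod R (K n)" for n by (rule K_lmod)
  show "free_retract R (K n) (B n)" for n
    unfolding free_retract_def by (intro exI[of _ "\<lambda>f. f"]) (auto intro!: is_homI simp del: free_module_simps)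
  show "is_hom R (K (Suc n)) (K n) (dK n)" for n by (rule dK_hom)
  show "is_hom R (K 0) AM eK" by (rule eK_hom)
  show "eK ` carrier (K 0) = carrier AM"
  proof
    show "eK ` carrier (K 0) \<subseteq> carrier AM" using is_homD(1)[OF eK_hom] by blast
    show "carrier AM \<subseteq> eK ` carrier (K 0)"
    proof
      fix a assume "a \<in> carrier AM"
      then have a: "a \<in> carrier A" by simp
      let ?f = "\<lambda>\<beta>. if \<beta> \<in> B 0 then pure a \<one>\<^bsub>A\<^esub> else \<zero>\<^bsub>R\<^esub>"
      have "?f \<in> carrier (K 0)" unfolding K_carrier using a by (simp add: pure_closed)
      moreover have "eK ?f = a" using a by (simp add: eK_def B_zero act_pure)
      ultimately show "a \<in> eK ` carrier (K 0)" using image_eqI[of a eK ?f] by simp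
    qed
  qed
  have dd: "DD N (\<kappa> f) \<beta> p = 0" if "f \<in> carrier (K (Suc n))" "dK n f = (\<lambda>_. \<zero>\<^bsub>R\<^esub>)" "\<beta> \<in> bin N" for n f \<beta> p
    using \<kappa>_dK[OF that(1,3), of p] that(2) by (simp add: \<kappa>_zero)
  show "dK 0 ` carrier (K (Suc 0)) = {f \<in> carrier (K 0). eK f = \<zero>\<^bsub>AM\<^esub>}"
  proof
    show "dK 0 ` carrier (K (Suc 0)) \<subseteq> {f \<in> carrier (K 0). eK f = \<zero>\<^bsub>AM\<^esub>}"
      using is_homD(1)[OF dK_hom] eK_dK by auto
    show "{f \<in> carrier (K 0). eK f = \<zero>\<^bsub>AM\<^esub>} \<subseteq> dK 0 ` carrier (K (Suc 0))"
    proof clarify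
      fix f assume f: "f \<in> carrier (K 0)" "eK f = \<zero>\<^bsub>AM\<^esub>"
      have "DD N (\<kappa> f) \<beta> p = 0" for \<beta> p
        unfolding DD_def
      proof (rule sum.neutral, rule ballI)
        fix i assume "i \<in> {i. i \<in> {1..N} \<and> \<beta> i = 0}"
        have "(\<beta>(i := 1)) \<notin> B 0" by (auto simp: B_zero fun_eq_iff)
        then have "\<kappa> f (\<beta>(i := 1)) = (\<lambda>_. 0)" using f(1) unfolding K_carrier by (intro \<kappa>_zero) blast
        then show "sg i \<beta> * uu i (\<kappa> f (\<beta>(i := 1))) p = 0" by (simp add: uu_zero)
      qed
      then show "f \<in> dK 0 ` carrier (K (Suc 0))" using f by (intro exact_cycle) auto
    qed
  qed
  show "dK (Suc n) ` carrier (K (Suc (Suc n))) = {f \<in> carrier (K (Suc n)). dK n f = \<zero>\<^bsub>K n\<^esub>}" for n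
  proof
    show "dK (Suc n) ` carrier (K (Suc (Suc n))) \<subseteq> {f \<in> carrier (K (Suc n)). dK n f = \<zero>\<^bsub>K n\<^esub>}"
      using is_homD(1)[OF dK_hom] dK_dK by (auto simp del: free_module_simps(1))
    show "{f \<in> carrier (K (Suc n)). dK n f = \<zero>\<^bsub>K n\<^esub>} \<subseteq> dK (Suc n) ` carrier (K (Suc (Suc n)))"
      using dd by (auto intro!: exact_cycle simp del: free_module_simps(1))
  qed
qed

end

section \<open>Cohomology of the Koszul cochain complex\<close>

text \<open>Multiply the hypothesis by y z, which moves a sign from one side to the other.\<close>

lemma sign_exchange:
  fixes a y z w :: "'k::field"
  assumes "a * y = - (z * w)" "y * y = 1" "z * z = 1"
  shows "a * z = - (y * w)"
proof -
  have "a * z = (a * y) * (y * z)" using assms(2) by (simp add: mult.assoc)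
  also have "\<dots> = - (y * w * (z * z))" unfolding assms(1) by (simp add: mult_ac)
  finally show ?thesis by (simp add: assms(3))
qed

context qsym
begin

abbreviation Wd :: "('k, (nat list \<Rightarrow> 'k) set) module" where "Wd \<equiv> wedge_alg N q"
abbreviation T :: "('k, 'k SW) module" where "T \<equiv> S_wedge N q"
abbreviation \<tau> :: "'k SW \<Rightarrow> exps2 \<Rightarrow> 'k" where "\<tau> \<equiv> tensor_coord \<phi> L.coord"
abbreviation dd :: "'k SW \<Rightarrow> 'k SW" where "dd \<equiv> koszul_diff N q"

lemma wedge_eq: "Wd = L.alg" "wedge_gen N q = L.gen"
  by (simp_all add: wedge_alg_def L.alg_def wedge_relators_def L.relators_def wedge_gen_def L.gen_def)

text \<open>The diagonal parameter of the exterior algebra is -1, which differs from 1 in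
  characteristic 0; hence all squares vanish.\<close>

lemma L_exps: "L.exps = bin N"
proof -
  have "- inverse (q i i) \<noteq> 1" if "i \<in> {1..N}" for i
    using q_props(1)[OF that] one_neq_neg_one[where 'a = 'k] by auto
  then have "L.exps = {\<alpha> \<in> E. \<forall>i\<in>{1..N}. \<alpha> i \<le> 1}" by (auto simp: L.exps_def)
  also have "\<dots> = bin N"
  proof -
    have "(\<forall>i\<in>{1..N}. \<alpha> i \<le> 1) \<longleftrightarrow> (\<forall>i. \<alpha> i \<in> {0, 1})" if "\<alpha> \<in> E" for \<alpha> :: "nat \<Rightarrow> nat"
    proof -
      have "\<alpha> i \<le> 1 \<longleftrightarrow> \<alpha> i \<in> {0, 1}" for i by auto
      moreover have "\<alpha> i \<in> {0, 1}" if "i \<notin> {1..N}" for i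
        using exponentsD[OF \<open>\<alpha> \<in> E\<close> that] by simp
      ultimately show ?thesis by blast
    qed
    then show ?thesis by (auto simp: bin_def)
  qed
  finally show ?thesis .
qed

lemma Wd_coords: "coords Wd (bin N) L.coord"
  using L.alg_coords unfolding wedge_eq L_exps .

lemma SW_tensor_coords: "tensor_coords A E \<phi> Wd (bin N) L.coord"
  using A_kalg_coords Wd_coords by (simp add: tensor_coords_def kalg_coords_def)

interpretation TC: tensor_coords A E \<phi> Wd "bin N" L.coord
  by (rule SW_tensor_coords)

interpretation T: coords T "E \<times> bin N" \<tau>
  unfolding S_wedge_def by (rule TC.tensor_coords)

lemma sw_closed: "a \<in> carrier A \<Longrightarrow> sw N q a \<beta> \<in> carrier T"
  unfolding sw_def S_wedge_def wedge_monomial_def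
  by (intro TC.pure_closed) (simp_all add: wedge_eq L.monomial_closed)

lemma coord_sw: "a \<in> carrier A \<Longrightarrow> \<beta> \<in> bin N \<Longrightarrow> \<tau> (sw N q a \<beta>) (\<alpha>, \<beta>') = \<phi> a \<alpha> * single \<beta> \<beta>'"
  unfolding sw_def wedge_monomial_def wedge_eq(2)
  using TC.coord_pure[of a "ordered_monomial L.alg L.gen N \<beta>" \<alpha> \<beta>'] L.monomial_closed[of \<beta>]
    L.coord_monomial[of \<beta>] by (simp add: wedge_eq L_exps)

lemma S_monomial_props:
  "S_monomial N q \<alpha> \<in> carrier A" "\<alpha> \<in> E \<Longrightarrow> \<phi> (S_monomial N q \<alpha>) = single \<alpha>"
  unfolding S_monomial_def using S.monomial_closed S.coord_monomial[of \<alpha>] by (simp_all add: A_eq S_exps)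

definition supported :: "exps2 set \<Rightarrow> 'k SW set" where
  "supported J = {v \<in> carrier T. \<forall>p. p \<notin> J \<longrightarrow> \<tau> v p = 0}"

lemma koszul_simps [simp]:
  "\<zero>\<^bsub>koszul N q m\<^esub> = \<zero>\<^bsub>T\<^esub>" "v \<oplus>\<^bsub>koszul N q m\<^esub> w = v \<oplus>\<^bsub>T\<^esub> w" "c \<odot>\<^bsub>koszul N q m\<^esub> v = c \<odot>\<^bsub>T\<^esub> v"
  by (simp_all add: koszul_def)

lemma koszul_carrier: "carrier (koszul N q m) = supported (E \<times> B m)"
proof -
  have "lin_span T {sw N q a \<beta> | a \<beta>. a \<in> carrier A \<and> \<beta> \<in> B m} = supported (E \<times> B m)"
    unfolding supported_def
  proof (rule T.lin_span_eq_supported)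
    show "{sw N q a \<beta> | a \<beta>. a \<in> carrier A \<and> \<beta> \<in> B m} \<subseteq> carrier T" using sw_closed by auto
    show "E \<times> B m \<subseteq> E \<times> bin N" using B_bin by auto
    fix v p assume "v \<in> {sw N q a \<beta> | a \<beta>. a \<in> carrier A \<and> \<beta> \<in> B m}" and p: "p \<notin> E \<times> B m"
    then obtain a \<beta> where v: "v = sw N q a \<beta>" "a \<in> carrier A" "\<beta> \<in> B m" by auto
    show "\<tau> v p = 0"
      using p v A.coords_outside[of a] by (cases p) (auto simp: coord_sw B_bin single_def)
  next
    fix p assume "p \<in> E \<times> B m"
    then obtain \<alpha> \<beta> where p: "p = (\<alpha>, \<beta>)" "\<alpha> \<in> E" "\<beta> \<in> B m" by auto
    have "\<tau> (sw N q (S_monomial N q \<alpha>) \<beta>) = single p"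
      using p by (auto simp: fun_eq_iff coord_sw S_monomial_props B_bin single_Pair)
    then show "\<exists>v\<in>{sw N q a \<beta> | a \<beta>. a \<in> carrier A \<and> \<beta> \<in> B m}. \<tau> v = single p"
      using S_monomial_props(1) p by blast
  qed
  then show ?thesis by (simp add: koszul_def B_def)
qed

lemma koszul_vsp: "vsp (koszul N q m)"
proof -
  have "submodule (carrier (koszul N q m)) (scalars :: 'k ring) T"
    unfolding koszul_carrier supported_def by (rule T.supported_submodule)
  from T.restrict_vsp[OF this] show ?thesis by (simp add: koszul_def)
qed

lemma koszul_minus: "v \<in> carrier (koszul N q m) \<Longrightarrow> w \<in> carrier (koszul N q m) \<Longrightarrow>
    v \<ominus>\<^bsub>koszul N q m\<^esub> w = v \<ominus>\<^bsub>T\<^esub> w"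
proof -
  assume v: "v \<in> carrier (koszul N q m)" and w: "w \<in> carrier (koszul N q m)"
  interpret C: vsp "koszul N q m" by (rule koszul_vsp)
  have "w \<in> carrier T" using w by (simp add: koszul_carrier supported_def)
  then show ?thesis using w
    by (simp add: C.minus_eq T.minus_eq flip: C.smult_minus_one T.smult_minus_one)
qed

lemma HH_index_subset: "HH_index N q m \<subseteq> E \<times> B m"
  by (auto simp: HH_index_def B_def)

lemma HH_monomial_props:
  assumes "p \<in> HH_index N q m"
  shows "HH_monomial N q p \<in> carrier T" "\<tau> (HH_monomial N q p) = single p"
proof -
  obtain \<alpha> \<beta> where p: "p = (\<alpha>, \<beta>)" "\<alpha> \<in> E" "\<beta> \<in> B m"
    using assms HH_index_subset[of m] by (cases p) blast
  show "HH_monomial N q p \<in> carrier T" "\<tau> (HH_monomial N q p) = single p"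
    using p by (auto simp: fun_eq_iff HH_monomial_def sw_closed coord_sw S_monomial_props B_bin single_Pair)
qed

lemma HH_independent: "lin_indep_family T (HH_index N q m) (HH_monomial N q)"
  using HH_monomial_props by (intro T.lin_indep_familyI) auto

lemma HH_span_carrier: "carrier (HH_span N q m) = supported (HH_index N q m)"
proof -
  have "lin_span T (HH_monomial N q ` HH_index N q m) = supported (HH_index N q m)"
    unfolding supported_def
  proof (rule T.lin_span_eq_supported)
    show "HH_index N q m \<subseteq> E \<times> bin N" using HH_index_subset[of m] B_bin by blast
  qed (auto simp: HH_monomial_props single_def)
  then show ?thesis by (simp add: HH_span_def)
qed

lemma HH_span_simps [simp]:
  "\<zero>\<^bsub>HH_span N q m\<^esub> = \<zero>\<^bsub>T\<^esub>" "v \<oplus>\<^bsub>HH_span N q m\<^esub> w = v \<oplus>\<^bsub>T\<^esub> w" "c \<odot>\<^bsub>HH_span N q m\<^esub> v = c \<odot>\<^bsub>T\<^esub> v"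
  by (simp_all add: HH_span_def)

lemma HH_span_vsp: "vsp (HH_span N q m)"
proof -
  have "submodule (carrier (HH_span N q m)) (scalars :: 'k ring) T"
    unfolding HH_span_carrier supported_def by (rule T.supported_submodule)
  from T.restrict_vsp[OF this] show ?thesis by (simp add: HH_span_def)
qed

subsection \<open>The differential in coordinates\<close>

definition mm :: "nat \<Rightarrow> (nat \<Rightarrow> nat) \<Rightarrow> (nat \<Rightarrow> nat) \<Rightarrow> 'k" where
  "mm i \<alpha> \<beta> = Pc i \<beta> * S.row i \<alpha> - Qc i \<beta> * S.col \<alpha> i"

lemma mm_alt: "i \<in> {1..N} \<Longrightarrow> mm i \<alpha> \<beta> = S.row i \<alpha> / S.row i \<beta> - S.col \<alpha> i / S.col \<beta> i"
  using inverse_unique[OF row_Pc, of i \<beta>] inverse_unique[OF col_Qc, of i \<beta>]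
  by (simp add: mm_def divide_inverse mult.commute)

lemma kap_nz: "i \<in> {1..N} \<Longrightarrow> j \<in> {1..N} \<Longrightarrow> S.kap i j \<noteq> 0"
  using q_props by (auto simp: S.kap_def)

text \<open>By \<open>mm_alt\<close> both terms are ratios of an \<alpha>-part and a \<beta>-part,
  in which the new \<open>kap\<close> factors cancel. So \<open>mm\<close> depends only on \<alpha>
  - \<beta>.\<close>

lemma mm_shift:
  assumes "i \<in> {1..N}" "j \<in> {1..N}"
  shows "mm i (\<alpha>(j := Suc (\<alpha> j))) (\<beta>(j := Suc (\<beta> j))) = mm i \<alpha> \<beta>"
  using assms kap_nz[of i j] kap_nz[of j i] by (simp add: mm_alt S.row_inc S.col_inc)

text \<open>Each parameter is a quotient, \<open>q i s\<close> = \<open>kap i s\<close> /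
  \<open>kap s i\<close>, so the product in the definition of C is the ratio of the two terms in
  \<open>mm_alt\<close>.\<close>

lemma mm_eq_0_iff:
  assumes i: "i \<in> {1..N}"
  shows "mm i \<alpha> \<beta> = 0 \<longleftrightarrow> (\<Prod>s\<in>{1..N}. q i s powi (int (\<alpha> s) - int (\<beta> s))) = 1"
proof -
  let ?\<gamma> = "\<lambda>s. int (\<alpha> s) - int (\<beta> s)"
  have r: "S.row i \<alpha> / S.row i \<beta> = (\<Prod>s\<in>{1..N}. S.kap i s powi ?\<gamma> s)"
    using kap_nz[OF i] by (simp add: S.row_def power_int_diff flip: prod_dividef)
  have c: "S.col \<alpha> i / S.col \<beta> i = (\<Prod>s\<in>{1..N}. S.kap s i powi ?\<gamma> s)"
    using kap_nz[OF _ i] by (simp add: S.col_def power_int_diff flip: prod_dividef)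
  have "q i s powi ?\<gamma> s = S.kap i s powi ?\<gamma> s / S.kap s i powi ?\<gamma> s" if s: "s \<in> {1..N}" for s
  proof -
    have "q i s = S.kap i s / S.kap s i"
      using q_props(1)[OF i] q_props(2)[OF s i] q_props(3)[OF i s] by (auto simp: S.kap_def field_simps)
    then show ?thesis by (simp add: power_int_divide_distrib)
  qed
  then have "(\<Prod>s\<in>{1..N}. q i s powi ?\<gamma> s) = (S.row i \<alpha> / S.row i \<beta>) / (S.col \<alpha> i / S.col \<beta> i)"
    unfolding r c by (simp flip: prod_dividef)
  then show ?thesis
    using row_nz[OF i] col_nz[OF i] by (simp add: mm_alt[OF i] frac_eq_eq mult.commute)
qed

definition dirs :: "(nat \<Rightarrow> nat) \<Rightarrow> nat set" where
  "dirs \<beta> = {i. i \<in> {1..N} \<and> \<beta> i = 1}"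

lemma finite_dirs [simp]: "finite (dirs \<beta>)"
  by (simp add: dirs_def)

text \<open>Written at the target: the contribution to (\<alpha>, \<beta>) comes from the point
  where both are lowered at i. If \<open>\<alpha> i\<close> = 0 there is no such point, and
  subtraction would truncate, hence the default 0.\<close>

definition dterm :: "nat \<Rightarrow> (exps2 \<Rightarrow> 'k) \<Rightarrow> (nat \<Rightarrow> nat) \<Rightarrow> (nat \<Rightarrow> nat) \<Rightarrow> 'k" where
  "dterm i F \<alpha> \<beta> = (if \<alpha> i = 0 then 0 else sg i (\<beta>(i := 0)) * mm i (\<alpha>(i := \<alpha> i - 1)) (\<beta>(i := 0)) *
     F (\<alpha>(i := \<alpha> i - 1), \<beta>(i := 0)))"

definition dhat :: "(exps2 \<Rightarrow> 'k) \<Rightarrow> exps2 \<Rightarrow> 'k" where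
  "dhat F = (\<lambda>(\<alpha>, \<beta>). \<Sum>i\<in>dirs \<beta>. dterm i F \<alpha> \<beta>)"

lemma dhat_nonzeroD:
  assumes "dhat F (\<alpha>, \<beta>) \<noteq> 0"
  obtains i where "i \<in> {1..N}" "\<beta> i = 1" "\<alpha> i \<noteq> 0" "F (\<alpha>(i := \<alpha> i - 1), \<beta>(i := 0)) \<noteq> 0"
proof -
  have "\<exists>i\<in>dirs \<beta>. dterm i F \<alpha> \<beta> \<noteq> 0"
    using assms unfolding dhat_def by (auto intro: ccontr simp: sum.neutral)
  then show ?thesis using that by (auto simp: dirs_def dterm_def split: if_splits)
qed

lemma bin_upd: "i \<in> {1..N} \<Longrightarrow> \<beta>(i := 0) \<in> bin N \<Longrightarrow> \<beta> i = 1 \<Longrightarrow> \<beta> \<in> bin N"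
  "\<beta> \<in> bin N \<Longrightarrow> \<beta>(i := 0) \<in> bin N" "i \<in> {1..N} \<Longrightarrow> \<beta> \<in> bin N \<Longrightarrow> \<beta>(i := 1) \<in> bin N"
proof -
  assume i: "i \<in> {1..N}" and b: "\<beta>(i := 0) \<in> bin N" and 1: "\<beta> i = 1"
  have "\<beta> j \<in> {0, 1} \<and> (j \<notin> {1..N} \<longrightarrow> \<beta> j = 0)" for j
  proof (cases "j = i")
    case False
    have "(\<beta>(i := 0)) j \<in> {0, 1} \<and> (j \<notin> {1..N} \<longrightarrow> (\<beta>(i := 0)) j = 0)"
      using b by (simp add: bin_def exponents_def)
    then show ?thesis using False by simp
  qed (use i 1 in simp)
  then show "\<beta> \<in> bin N" by (simp add: bin_def exponents_def)
qed (auto simp: bin_def exponents_def)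

lemma exponents_upd: "i \<in> {1..N} \<Longrightarrow> \<alpha>(i := n) \<in> E \<longleftrightarrow> \<alpha> \<in> E"
proof -
  assume i: "i \<in> {1..N}"
  have "(j \<notin> {1..N} \<longrightarrow> (\<alpha>(i := n)) j = 0) \<longleftrightarrow> (j \<notin> {1..N} \<longrightarrow> \<alpha> j = 0)" for j
    using i by (cases "j = i") simp_all
  then show ?thesis unfolding exponents_def by simp
qed

lemma dhat_finsupp:
  assumes F: "F \<in> finsupp (E \<times> bin N)"
  shows "dhat F \<in> finsupp (E \<times> bin N)"
proof (rule finsuppI)
  let ?f = "\<lambda>((\<alpha>, \<beta>), i). (\<alpha>(i := \<alpha> i + 1), \<beta>(i := 1))"
  show "finite (?f ` ({p. F p \<noteq> 0} \<times> {1..N}))" using finsuppD(1)[OF F] by simp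
  show "{p. dhat F p \<noteq> 0} \<subseteq> ?f ` ({p. F p \<noteq> 0} \<times> {1..N})"
  proof clarify
    fix \<alpha> \<beta> assume "dhat F (\<alpha>, \<beta>) \<noteq> 0"
    then obtain i where i: "i \<in> {1..N}" "\<beta> i = 1" "\<alpha> i \<noteq> 0" "F (\<alpha>(i := \<alpha> i - 1), \<beta>(i := 0)) \<noteq> 0"
      by (rule dhat_nonzeroD)
    then have "(\<alpha>, \<beta>) = ?f ((\<alpha>(i := \<alpha> i - 1), \<beta>(i := 0)), i)" by (auto simp: fun_eq_iff)
    then show "(\<alpha>, \<beta>) \<in> ?f ` ({p. F p \<noteq> 0} \<times> {1..N})" using i by blast
  qed
  show "{p. dhat F p \<noteq> 0} \<subseteq> E \<times> bin N"
  proof clarify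
    fix \<alpha> \<beta> assume "dhat F (\<alpha>, \<beta>) \<noteq> 0"
    then obtain i where i: "i \<in> {1..N}" "\<beta> i = 1" "\<alpha> i \<noteq> 0" "F (\<alpha>(i := \<alpha> i - 1), \<beta>(i := 0)) \<noteq> 0"
      by (rule dhat_nonzeroD)
    from finsuppD(2)[OF F i(4)] show "\<alpha> \<in> E \<and> \<beta> \<in> bin N"
      using i bin_upd(1) exponents_upd by auto
  qed
qed

lemma dhat_zero: "dhat (\<lambda>_. 0) = (\<lambda>_. 0)"
  by (auto simp: dhat_def dterm_def fun_eq_iff intro!: sum.neutral)

lemma dhat_add: "dhat (\<lambda>p. F p + G p) = (\<lambda>p. dhat F p + dhat G p)"
  by (auto simp: dhat_def dterm_def fun_eq_iff algebra_simps simp flip: sum.distrib intro!: sum.cong)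

lemma dhat_smult: "dhat (\<lambda>p. c * F p) = (\<lambda>p. c * dhat F p)"
  by (auto simp: dhat_def dterm_def fun_eq_iff sum_distrib_left algebra_simps intro!: sum.cong)

text \<open>Passes from a sum over directions at the source \<beta>, the form of
  \<open>koszul_diff_on_tensor\<close>, to one over directions at the target \<beta>', the form of
  \<open>dhat\<close>.\<close>

lemma sum_free_dirs_dirs:
  assumes "\<beta> \<in> bin N"
  shows "(\<Sum>i\<in>free_dirs \<beta>. g i * single (\<beta>(i := \<beta> i + 1)) \<beta>') =
    (\<Sum>i\<in>dirs \<beta>'. if \<beta>'(i := 0) = \<beta> then g i else (0 :: 'k))"
proof -
  have iff: "(\<beta> i = 0 \<and> \<beta>' = \<beta>(i := \<beta> i + 1)) \<longleftrightarrow> (\<beta>' i = 1 \<and> \<beta>'(i := 0) = \<beta>)" for i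
    by (auto simp: fun_eq_iff)
  have "(\<Sum>i\<in>free_dirs \<beta>. g i * single (\<beta>(i := \<beta> i + 1)) \<beta>') =
      (\<Sum>i\<in>{1..N}. if \<beta> i = 0 \<and> \<beta>' = \<beta>(i := \<beta> i + 1) then g i else 0)"
    by (intro sum.mono_neutral_cong_left) (auto simp: free_dirs_def single_def)
  also have "\<dots> = (\<Sum>i\<in>dirs \<beta>'. if \<beta>'(i := 0) = \<beta> then g i else 0)"
    unfolding iff by (intro sum.mono_neutral_cong_right) (auto simp: dirs_def)
  finally show ?thesis .
qed

lemma sg_eq: "\<beta> i = 0 \<Longrightarrow> 1 \<le> i \<Longrightarrow> (-1) ^ (\<Sum>s\<in>{1..i}. \<beta> s) = (sg i \<beta> :: 'k)"
proof -
  assume "\<beta> i = 0" "1 \<le> i"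
  moreover from this have "{1..i} = insert i {1..<i}" by auto
  ultimately show ?thesis by (simp add: sg_def)
qed

definition xcomm :: "nat \<Rightarrow> (nat \<Rightarrow> nat) \<Rightarrow> (nat list \<Rightarrow> 'k) set \<Rightarrow> (nat list \<Rightarrow> 'k) set" where
  "xcomm i \<beta> a = Pc i \<beta> \<odot>\<^bsub>A\<^esub> (gx i \<otimes>\<^bsub>A\<^esub> a) \<ominus>\<^bsub>A\<^esub> Qc i \<beta> \<odot>\<^bsub>A\<^esub> (a \<otimes>\<^bsub>A\<^esub> gx i)"

lemma xcomm_closed: "i \<in> {1..N} \<Longrightarrow> a \<in> carrier A \<Longrightarrow> xcomm i \<beta> a \<in> carrier A"
  unfolding xcomm_def by (intro A.minus_closed A.smult_closed A.m_closed gx_closed)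

lemma coord_xcomm:
  assumes "i \<in> {1..N}" "a \<in> carrier A"
  shows "\<phi> (xcomm i \<beta> a) \<alpha> =
    (if \<alpha> i = 0 then 0 else mm i (\<alpha>(i := \<alpha> i - 1)) \<beta> * \<phi> a (\<alpha>(i := \<alpha> i - 1)))"
proof -
  have "gx i \<otimes>\<^bsub>A\<^esub> a \<in> carrier A" "a \<otimes>\<^bsub>A\<^esub> gx i \<in> carrier A"
    using gx_closed[OF assms(1)] assms(2) by simp_all
  then show ?thesis
    by (simp add: xcomm_def A.coords_minus A.coords_smult coord_gx_mult[OF assms] mm_def algebra_simps)
qed

lemma koszul_diff_on_tensor_alt:
  assumes "a \<in> carrier A"
  shows "koszul_diff_on_tensor N q a \<beta> = (\<Oplus>\<^bsub>T\<^esub>i\<in>free_dirs \<beta>. sg i \<beta> \<odot>\<^bsub>T\<^esub> sw N q (xcomm i \<beta> a) (\<beta>(i := \<beta> i + 1)))"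
proof -
  have "koszul_diff_on_tensor N q a \<beta> = (\<Oplus>\<^bsub>T\<^esub>i\<in>free_dirs \<beta>. ((-1) ^ (\<Sum>s\<in>{1..i}. \<beta> s)) \<odot>\<^bsub>T\<^esub>
      sw N q (xcomm i \<beta> a) (\<beta>(i := \<beta> i + 1)))"
    by (simp only: koszul_diff_on_tensor_def Let_def free_dirs_def xcomm_def Pc_def Qc_def Collect_conj_eq
        Collect_mem_eq)
  also have "\<dots> = (\<Oplus>\<^bsub>T\<^esub>i\<in>free_dirs \<beta>. sg i \<beta> \<odot>\<^bsub>T\<^esub> sw N q (xcomm i \<beta> a) (\<beta>(i := \<beta> i + 1)))"
    using assms by (intro T.finsum_cong') (auto simp: free_dirs_def sg_eq intro!: T.smult_closed sw_closed xcomm_closed)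
  finally show ?thesis .
qed

lemma coord_koszul_diff_on_tensor:
  assumes a: "a \<in> carrier A" and \<beta>: "\<beta> \<in> bin N"
  shows "koszul_diff_on_tensor N q a \<beta> \<in> carrier T"
    and "\<tau> (koszul_diff_on_tensor N q a \<beta>) = dhat (\<tau> (sw N q a \<beta>))"
proof -
  have c: "(\<lambda>i. sg i \<beta> \<odot>\<^bsub>T\<^esub> sw N q (xcomm i \<beta> a) (\<beta>(i := \<beta> i + 1))) \<in> free_dirs \<beta> \<rightarrow> carrier T"
    using a by (auto simp: free_dirs_def intro!: T.smult_closed sw_closed xcomm_closed)
  then show "koszul_diff_on_tensor N q a \<beta> \<in> carrier T"
    unfolding koszul_diff_on_tensor_alt[OF a] by (rule T.finsum_closed)
  show "\<tau> (koszul_diff_on_tensor N q a \<beta>) = dhat (\<tau> (sw N q a \<beta>))"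
  proof
    fix p :: exps2
    obtain \<alpha> \<beta>' where p: "p = (\<alpha>, \<beta>')" by (cases p)
    have "\<tau> (koszul_diff_on_tensor N q a \<beta>) p =
        (\<Sum>i\<in>free_dirs \<beta>. \<tau> (sg i \<beta> \<odot>\<^bsub>T\<^esub> sw N q (xcomm i \<beta> a) (\<beta>(i := \<beta> i + 1))) p)"
      unfolding koszul_diff_on_tensor_alt[OF a] T.coords_finsum[OF c] ..
    also have "\<dots> = (\<Sum>i\<in>free_dirs \<beta>. sg i \<beta> * \<phi> (xcomm i \<beta> a) \<alpha> * single (\<beta>(i := \<beta> i + 1)) \<beta>')"
    proof (rule sum.cong[OF refl])
      fix i assume "i \<in> free_dirs \<beta>"
      then have i: "i \<in> {1..N}" "\<beta> i = 0" by (auto simp: free_dirs_def)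
      then have "\<beta>(i := \<beta> i + 1) \<in> bin N" using bin_upd(3)[OF i(1) \<beta>] by simp
      then show "\<tau> (sg i \<beta> \<odot>\<^bsub>T\<^esub> sw N q (xcomm i \<beta> a) (\<beta>(i := \<beta> i + 1))) p =
          sg i \<beta> * \<phi> (xcomm i \<beta> a) \<alpha> * single (\<beta>(i := \<beta> i + 1)) \<beta>'"
        using i a by (simp add: T.coords_smult sw_closed xcomm_closed coord_sw p)
    qed
    also have "\<dots> = (\<Sum>i\<in>dirs \<beta>'. if \<beta>'(i := 0) = \<beta> then sg i \<beta> * \<phi> (xcomm i \<beta> a) \<alpha> else 0)"
      by (rule sum_free_dirs_dirs[OF \<beta>])
    also have "\<dots> = dhat (\<tau> (sw N q a \<beta>)) p"
      unfolding dhat_def p prod.case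
    proof (rule sum.cong[OF refl])
      fix i assume "i \<in> dirs \<beta>'"
      then have i: "i \<in> {1..N}" by (simp add: dirs_def)
      show "(if \<beta>'(i := 0) = \<beta> then sg i \<beta> * \<phi> (xcomm i \<beta> a) \<alpha> else 0) = dterm i (\<tau> (sw N q a \<beta>)) \<alpha> \<beta>'"
        by (auto simp: dterm_def coord_xcomm[OF i a] coord_sw[OF a \<beta>] single_def)
    qed
    finally show "\<tau> (koszul_diff_on_tensor N q a \<beta>) p = dhat (\<tau> (sw N q a \<beta>)) p" .
  qed
qed

text \<open>Resolves the definite description: \<open>dhat\<close> supplies a linear map with the
  prescribed values, and any other such map agrees with it on the tensors of monomials, which are
  the basis vectors.\<close>

lemma koszul_diff_eq: "dd = (\<lambda>v\<in>carrier T. T.vec (dhat (\<tau> v)))"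
proof -
  let ?d = "\<lambda>v\<in>carrier T. T.vec (dhat (\<tau> v))"
  let ?P = "\<lambda>d. d \<in> extensional (carrier T) \<and> is_hom scalars T T d \<and>
     (\<forall>a\<in>carrier A. \<forall>m. \<forall>\<beta>\<in>binary_exponents N m. d (sw N q a \<beta>) = koszul_diff_on_tensor N q a \<beta>)"
  have fs: "dhat (\<tau> v) \<in> finsupp (E \<times> bin N)" if "v \<in> carrier T" for v
    by (rule dhat_finsupp[OF T.coords_finsupp[OF that]])
  have "is_hom scalars T T ?d"
  proof (rule is_homI)
    fix v w assume v: "v \<in> carrier T" and w: "w \<in> carrier T"
    have "T.vec (dhat (\<tau> (v \<oplus>\<^bsub>T\<^esub> w))) = T.vec (dhat (\<tau> v)) \<oplus>\<^bsub>T\<^esub> T.vec (dhat (\<tau> w))"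
      using v w fs by (intro T.coords_eqI) (simp_all add: T.vec_closed T.coords_vec T.coords_add dhat_add finsupp_add)
    then show "?d (v \<oplus>\<^bsub>T\<^esub> w) = ?d v \<oplus>\<^bsub>T\<^esub> ?d w" using v w by simp
  next
    fix c v assume v: "v \<in> carrier T"
    have "T.vec (dhat (\<tau> (c \<odot>\<^bsub>T\<^esub> v))) = c \<odot>\<^bsub>T\<^esub> T.vec (dhat (\<tau> v))"
      using v fs by (intro T.coords_eqI) (simp_all add: T.vec_closed T.coords_vec T.coords_smult dhat_smult finsupp_smult)
    then show "?d (c \<odot>\<^bsub>T\<^esub> v) = c \<odot>\<^bsub>T\<^esub> ?d v" using v by simp
  qed (simp add: fs T.vec_closed)
  moreover have "?d (sw N q a \<beta>) = koszul_diff_on_tensor N q a \<beta>"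
    if a: "a \<in> carrier A" and "\<beta> \<in> binary_exponents N m" for a \<beta> m
  proof -
    have \<beta>: "\<beta> \<in> bin N" using that(2) B_bin[of \<beta> m] by (simp add: B_def)
    show ?thesis
      using coord_koszul_diff_on_tensor[OF a \<beta>] sw_closed[OF a] fs[OF sw_closed[OF a]]
      by (intro T.coords_eqI) (simp_all add: T.vec_closed T.coords_vec)
  qed
  ultimately have P: "?P ?d" by simp
  have "d = ?d" if d: "?P d" for d
  proof
    fix v
    show "d v = ?d v"
    proof (cases "v \<in> carrier T")
      case True
      note dh = is_hom_scalarsD[OF conjunct1[OF conjunct2[OF d]]]
        and h = is_hom_scalarsD[OF conjunct1[OF conjunct2[OF P]]]
      show ?thesis using True
      proof (induction v rule: T.carrier_induct)
        case zero
        show ?case using dh(3)[of "\<zero>\<^bsub>T\<^esub>" 0] h(3)[of "\<zero>\<^bsub>T\<^esub>" 0] dh(1)[of "\<zero>\<^bsub>T\<^esub>"] h(1)[of "\<zero>\<^bsub>T\<^esub>"] by simp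
      next
        case (add v c p)
        obtain \<alpha> \<beta> where p: "p = (\<alpha>, \<beta>)" "\<alpha> \<in> E" "\<beta> \<in> bin N" using add by auto
        let ?s = "sw N q (S_monomial N q \<alpha>) \<beta>"
        have s: "T.vec (single p) = ?s"
          using p by (intro T.coords_eqI)
            (auto simp: T.vec_closed T.coords_vec sw_closed S_monomial_props coord_sw single_Pair)
        obtain m where m: "\<beta> \<in> binary_exponents N m" using p(3) bin_B by (auto simp: B_def)
        have "d ?s = koszul_diff_on_tensor N q (S_monomial N q \<alpha>) \<beta>"
          using conjunct2[OF conjunct2[OF d]] S_monomial_props(1) m by blast
        moreover have "?d ?s = koszul_diff_on_tensor N q (S_monomial N q \<alpha>) \<beta>"
          using conjunct2[OF conjunct2[OF P]] S_monomial_props(1) m by blast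
        ultimately have ds: "d ?s = ?d ?s" by (rule trans[OF _ sym])
        have sc: "?s \<in> carrier T" by (rule sw_closed[OF S_monomial_props(1)])
        have "d (v \<oplus>\<^bsub>T\<^esub> c \<odot>\<^bsub>T\<^esub> ?s) = d v \<oplus>\<^bsub>T\<^esub> c \<odot>\<^bsub>T\<^esub> d ?s"
          unfolding dh(2)[OF add(1) T.smult_closed[OF sc]] dh(3)[OF sc] ..
        also have "\<dots> = ?d v \<oplus>\<^bsub>T\<^esub> c \<odot>\<^bsub>T\<^esub> ?d ?s" unfolding add(3) ds ..
        also have "\<dots> = ?d (v \<oplus>\<^bsub>T\<^esub> c \<odot>\<^bsub>T\<^esub> ?s)"
          unfolding h(2)[OF add(1) T.smult_closed[OF sc]] h(3)[OF sc] ..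
        finally show ?case unfolding s .
      qed
    next
      case False
      then show ?thesis using d by (auto simp: extensional_def)
    qed
  qed
  with P show ?thesis unfolding koszul_diff_def by (rule the_equality)
qed

lemma
  assumes v: "v \<in> carrier T"
  shows dd_closed: "dd v \<in> carrier T" and coord_dd: "\<tau> (dd v) = dhat (\<tau> v)"
  using v dhat_finsupp[OF T.coords_finsupp[OF v]] by (simp_all add: koszul_diff_eq T.vec_closed T.coords_vec)

lemma dd_zero_iff: "v \<in> carrier T \<Longrightarrow> dd v = \<zero>\<^bsub>T\<^esub> \<longleftrightarrow> dhat (\<tau> v) = (\<lambda>_. 0)"
proof
  assume v: "v \<in> carrier T"
  show "dhat (\<tau> v) = (\<lambda>_. 0)" if "dd v = \<zero>\<^bsub>T\<^esub>"
    using coord_dd[OF v] that by simp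
  show "dd v = \<zero>\<^bsub>T\<^esub>" if "dhat (\<tau> v) = (\<lambda>_. 0)"
    using coord_dd[OF v] dd_closed[OF v] that by (intro T.coords_eqI) simp_all
qed

lemma dd_hom: "is_hom scalars T T dd"
proof (rule is_homI)
  fix v w assume "v \<in> carrier T" "w \<in> carrier T"
  then show "dd (v \<oplus>\<^bsub>T\<^esub> w) = dd v \<oplus>\<^bsub>T\<^esub> dd w"
    by (intro T.coords_eqI) (simp_all add: dd_closed coord_dd T.coords_add dhat_add)
next
  fix c v assume "v \<in> carrier T"
  then show "dd (c \<odot>\<^bsub>T\<^esub> v) = c \<odot>\<^bsub>T\<^esub> dd v"
    by (intro T.coords_eqI) (simp_all add: dd_closed coord_dd T.coords_smult dhat_smult)
qed (rule dd_closed)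

lemma B_down: "i \<in> {1..N} \<Longrightarrow> \<beta> i = 1 \<Longrightarrow> \<beta>(i := 0) \<in> B n \<longleftrightarrow> \<beta> \<in> B (Suc n)"
proof -
  assume "i \<in> {1..N}" "\<beta> i = 1"
  moreover from this have "(\<beta>(i := 0))(i := 1) = \<beta>" by auto
  ultimately show ?thesis using B_upd[of "\<beta>(i := 0)" i n] by simp
qed

lemma dd_koszul: "v \<in> carrier (koszul N q m) \<Longrightarrow> dd v \<in> carrier (koszul N q (Suc m))"
  unfolding koszul_carrier supported_def
proof (clarify, intro conjI allI impI)
  assume v: "v \<in> carrier T" and z: "\<forall>p. p \<notin> E \<times> B m \<longrightarrow> \<tau> v p = 0"
  show "dd v \<in> carrier T" using v by (rule dd_closed)
  fix p :: exps2 assume p: "p \<notin> E \<times> B (Suc m)"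
  obtain \<alpha> \<beta> where ab: "p = (\<alpha>, \<beta>)" by (cases p)
  show "\<tau> (dd v) p = 0"
  proof (rule ccontr)
    assume "\<tau> (dd v) p \<noteq> 0"
    then have "dhat (\<tau> v) (\<alpha>, \<beta>) \<noteq> 0" by (simp add: coord_dd[OF v] ab)
    then obtain i where i: "i \<in> {1..N}" "\<beta> i = 1" "\<tau> v (\<alpha>(i := \<alpha> i - 1), \<beta>(i := 0)) \<noteq> 0"
      by (rule dhat_nonzeroD)
    then have "(\<alpha>(i := \<alpha> i - 1), \<beta>(i := 0)) \<in> E \<times> B m" using z by blast
    then show False using p ab exponents_upd[OF i(1)] B_down[of i \<beta>, OF i(1,2)] by simp
  qed
qed

subsection \<open>The contraction outside of \<open>C\<close>\<close>

text \<open>The directions along which the contraction can divide. The excluded case is \<gamma>_i =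
  -1 for \<gamma> = \<alpha> - \<beta>: there the i-th entries can be neither raised nor lowered
  together.\<close>

definition bad :: "(nat \<Rightarrow> nat) \<Rightarrow> (nat \<Rightarrow> nat) \<Rightarrow> nat \<Rightarrow> bool" where
  "bad \<alpha> \<beta> i \<longleftrightarrow> i \<in> {1..N} \<and> mm i \<alpha> \<beta> \<noteq> 0 \<and> \<not> (\<alpha> i = 0 \<and> \<beta> i = 1)"

text \<open>The direction of contraction must stay the same along the differential, or the cross
  terms in \<open>dhat_eta\<close> would not cancel; so it is chosen from \<open>bad\<close>, which
  both ends of an edge share.\<close>

definition pivot :: "(nat \<Rightarrow> nat) \<Rightarrow> (nat \<Rightarrow> nat) \<Rightarrow> nat" where
  "pivot \<alpha> \<beta> = (LEAST i. bad \<alpha> \<beta> i)"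

text \<open>For binary \<beta> the difference is -1 exactly when \<open>\<alpha> i\<close> = 0 and
  \<open>\<beta> i\<close> = 1, and the product condition of C is the vanishing of
  \<open>mm\<close>.\<close>

lemma HH_index_iff: "(\<alpha>, \<beta>) \<in> HH_index N q m \<longleftrightarrow> \<alpha> \<in> E \<and> \<beta> \<in> B m \<and> (\<forall>i. \<not> bad \<alpha> \<beta> i)"
proof (cases "\<alpha> \<in> E \<and> \<beta> \<in> B m")
  case True
  have out: "int (\<alpha> i) - int (\<beta> i) = 0" if "i \<notin> {1..N}" for i
    using True that exponentsD[of \<alpha> N i] exponentsD[of \<beta> N i] by (simp add: B_def binary_exponents_def)
  have b: "\<beta> i \<in> {0, 1}" for i using True by (simp add: B_def binary_exponents_def)
  have ge: "int (\<alpha> i) - int (\<beta> i) \<ge> -1" for i using b[of i] by auto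
  have eq: "int (\<alpha> i) - int (\<beta> i) = -1 \<longleftrightarrow> \<alpha> i = 0 \<and> \<beta> i = 1" for i using b[of i] by auto
  show ?thesis
    using True out ge by (auto simp: HH_index_def C_set_def B_def bad_def eq mm_eq_0_iff)
next
  case False
  then show ?thesis by (auto simp: HH_index_def B_def)
qed

text \<open>Raising both entries at j alters neither \<open>mm\<close> nor the exceptional case, as
  \<open>\<beta> j\<close> = 0 before and \<open>\<alpha> j\<close> > 0 afterwards.\<close>

lemma bad_up: "j \<in> {1..N} \<Longrightarrow> \<beta> j = 0 \<Longrightarrow> bad (\<alpha>(j := \<alpha> j + 1)) (\<beta>(j := 1)) = bad \<alpha> \<beta>"
proof
  fix i assume j: "j \<in> {1..N}" "\<beta> j = 0"
  have "mm i (\<alpha>(j := \<alpha> j + 1)) (\<beta>(j := 1)) = mm i \<alpha> \<beta>" if "i \<in> {1..N}"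
    using mm_shift[OF that j(1), of \<alpha> \<beta>] j(2) by (simp add: One_nat_def)
  then show "bad (\<alpha>(j := \<alpha> j + 1)) (\<beta>(j := 1)) i = bad \<alpha> \<beta> i"
    using j(2) by (auto simp: bad_def)
qed

lemma bad_down: "j \<in> {1..N} \<Longrightarrow> \<beta> j = 1 \<Longrightarrow> \<alpha> j \<noteq> 0 \<Longrightarrow> bad (\<alpha>(j := \<alpha> j - 1)) (\<beta>(j := 0)) = bad \<alpha> \<beta>"
proof -
  assume j: "j \<in> {1..N}" "\<beta> j = 1" "\<alpha> j \<noteq> 0"
  have "\<beta> = (\<beta>(j := 0))(j := 1)" "\<alpha> = (\<alpha>(j := \<alpha> j - 1))(j := (\<alpha>(j := \<alpha> j - 1)) j + 1)"
    using j by auto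
  then show ?thesis using bad_up[OF j(1), of "\<beta>(j := 0)" "\<alpha>(j := \<alpha> j - 1)"] by simp
qed

lemma mm_down:
  assumes "i \<in> {1..N}" "j \<in> {1..N}" "\<beta> j = 1" "\<alpha> j \<noteq> 0"
  shows "mm i (\<alpha>(j := \<alpha> j - 1)) (\<beta>(j := 0)) = mm i \<alpha> \<beta>"
proof -
  have "\<beta> = (\<beta>(j := 0))(j := Suc ((\<beta>(j := 0)) j))" "\<alpha> = (\<alpha>(j := \<alpha> j - 1))(j := Suc ((\<alpha>(j := \<alpha> j - 1)) j))"
    using assms by (auto simp: One_nat_def)
  then show ?thesis using mm_shift[OF assms(1,2), of "\<alpha>(j := \<alpha> j - 1)" "\<beta>(j := 0)"] by simp
qed

lemma pivot_bad: "bad \<alpha> \<beta> i \<Longrightarrow> bad \<alpha> \<beta> (pivot \<alpha> \<beta>)"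
  unfolding pivot_def by (rule LeastI)

text \<open>Inverts the edge in the pivot direction: the value at its upper end is carried to the
  lower end and divided by the edge scalar. It is 0 at upper ends of pivot edges and where no
  direction is bad.\<close>

definition eta :: "(exps2 \<Rightarrow> 'k) \<Rightarrow> exps2 \<Rightarrow> 'k" where
  "eta F = (\<lambda>(\<alpha>, \<beta>). if (\<exists>i. bad \<alpha> \<beta> i) \<and> \<beta> (pivot \<alpha> \<beta>) = 0
     then sg (pivot \<alpha> \<beta>) \<beta> / mm (pivot \<alpha> \<beta>) \<alpha> \<beta> *
       F (\<alpha>(pivot \<alpha> \<beta> := \<alpha> (pivot \<alpha> \<beta>) + 1), \<beta>(pivot \<alpha> \<beta> := 1)) else 0)"

text \<open>Every edge that ends at such a point has \<open>\<alpha> i\<close> > 0, so not being bad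
  leaves only the zero scalar. Thus coboundaries have no component over C.\<close>

lemma dhat_good:
  assumes "\<And>i. \<not> bad \<alpha> \<beta> i"
  shows "dhat F (\<alpha>, \<beta>) = 0"
  unfolding dhat_def prod.case
proof (rule sum.neutral, rule ballI)
  fix i assume "i \<in> dirs \<beta>"
  then have i: "i \<in> {1..N}" "\<beta> i = 1" by (auto simp: dirs_def)
  show "dterm i F \<alpha> \<beta> = 0"
  proof (cases "\<alpha> i = 0")
    case False
    then have "mm i \<alpha> \<beta> = 0" using assms[of i] i by (auto simp: bad_def)
    then show ?thesis using mm_down[of i i \<beta> \<alpha>] i False by (simp add: dterm_def)
  qed (simp add: dterm_def)
qed

text \<open>An edge in direction i starts where \<open>\<beta> i\<close> = 0, which is never the
  exceptional case, so a nonzero contribution would make i bad. Thus everything supported over C is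
  a cocycle.\<close>

lemma dhat_supported_good:
  assumes "\<And>\<alpha> \<beta> i. F (\<alpha>, \<beta>) \<noteq> 0 \<Longrightarrow> \<not> bad \<alpha> \<beta> i"
  shows "dhat F = (\<lambda>_. 0)"
proof
  fix p :: exps2
  obtain \<alpha> \<beta> where p: "p = (\<alpha>, \<beta>)" by (cases p)
  have "dterm i F \<alpha> \<beta> = 0" if "i \<in> dirs \<beta>" for i
  proof (rule ccontr)
    assume nz: "dterm i F \<alpha> \<beta> \<noteq> 0"
    then have "F (\<alpha>(i := \<alpha> i - 1), \<beta>(i := 0)) \<noteq> 0" by (auto simp: dterm_def split: if_splits)
    then have "\<not> bad (\<alpha>(i := \<alpha> i - 1)) (\<beta>(i := 0)) i" by (rule assms)
    moreover have "bad (\<alpha>(i := \<alpha> i - 1)) (\<beta>(i := 0)) i"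
      using nz that by (auto simp: bad_def dirs_def dterm_def split: if_splits)
    ultimately show False by blast
  qed
  then show "dhat F p = 0" by (simp add: dhat_def p)
qed

text \<open>All points involved share the pivot k. In direction k the contraction inverts the
  differential, and with its parts in the other directions it anticommutes.\<close>

lemma dhat_eta:
  assumes \<beta>: "\<beta> \<in> bin N" and ex: "\<exists>i. bad \<alpha> \<beta> i"
  shows "dhat (eta F) (\<alpha>, \<beta>) + eta (dhat F) (\<alpha>, \<beta>) = F (\<alpha>, \<beta>)"
proof -
  define k where "k = pivot \<alpha> \<beta>"
  have k: "bad \<alpha> \<beta> k" using ex pivot_bad k_def by blast
  then have kN: "k \<in> {1..N}" and mk: "mm k \<alpha> \<beta> \<noteq> 0" by (auto simp: bad_def)
  have down: "(\<exists>j. bad (\<alpha>(i := \<alpha> i - 1)) (\<beta>(i := 0)) j) \<and> pivot (\<alpha>(i := \<alpha> i - 1)) (\<beta>(i := 0)) = k"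
    if "i \<in> {1..N}" "\<beta> i = 1" "\<alpha> i \<noteq> 0" for i
    unfolding pivot_def bad_down[of i \<beta> \<alpha>, OF that] using ex k_def by (simp add: pivot_def)
  have eta_down: "eta F (\<alpha>(i := \<alpha> i - 1), \<beta>(i := 0)) = (if (\<beta>(i := 0)) k = 0 then
      sg k (\<beta>(i := 0)) / mm k \<alpha> \<beta> * F (\<alpha>(i := \<alpha> i - 1, k := (\<alpha>(i := \<alpha> i - 1)) k + 1), \<beta>(i := 0, k := 1)) else 0)"
    if i: "i \<in> {1..N}" "\<beta> i = 1" "\<alpha> i \<noteq> 0" for i
    unfolding eta_def prod.case using down[OF i] mm_down[of k i \<beta> \<alpha>, OF kN i] by auto
  show ?thesis
  proof (cases "\<beta> k = 1")
    case True
    then have ak: "\<alpha> k \<noteq> 0" using k by (simp add: bad_def)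
    \<comment> \<open>At the upper end of the pivot edge only the term i = k of the other summand
      survives: lowering in any other direction leaves \<open>eta\<close> evaluated at an upper
      end.\<close>
    have "eta (dhat F) (\<alpha>, \<beta>) = 0" using True by (simp add: eta_def k_def[symmetric])
    moreover have "dhat (eta F) (\<alpha>, \<beta>) = (\<Sum>i\<in>dirs \<beta>. if i = k then F (\<alpha>, \<beta>) else 0)"
      unfolding dhat_def prod.case
    proof (rule sum.cong[OF refl])
      fix i assume "i \<in> dirs \<beta>"
      then have i: "i \<in> {1..N}" "\<beta> i = 1" by (auto simp: dirs_def)
      show "dterm i (eta F) \<alpha> \<beta> = (if i = k then F (\<alpha>, \<beta>) else 0)"
      proof (cases "i = k")
        case True
        have "\<alpha>(k := \<alpha> k - 1, k := (\<alpha>(k := \<alpha> k - 1)) k + 1) = \<alpha>" "\<beta>(k := 0, k := 1) = \<beta>"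
          using ak \<open>\<beta> k = 1\<close> by auto
        then have "eta F (\<alpha>(k := \<alpha> k - 1), \<beta>(k := 0)) = sg k (\<beta>(k := 0)) / mm k \<alpha> \<beta> * F (\<alpha>, \<beta>)"
          using eta_down[of k, OF kN \<open>\<beta> k = 1\<close> ak] by simp
        then show ?thesis
          using True ak mk mm_down[of k k \<beta> \<alpha>, OF kN kN \<open>\<beta> k = 1\<close> ak] by (simp add: dterm_def)
      next
        case False
        then have "(\<beta>(i := 0)) k \<noteq> 0" using \<open>\<beta> k = 1\<close> by simp
        then show ?thesis using False eta_down[OF i] by (simp add: dterm_def)
      qed
    qed
    moreover have "k \<in> dirs \<beta>" using kN True by (simp add: dirs_def)
    ultimately show ?thesis by simp
  next
    case False
    moreover have "\<beta> k \<in> {0, 1}" using \<beta> by (simp add: bin_def)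
    ultimately have bk: "\<beta> k = 0" by simp
    \<comment> \<open>At the lower end the raised point (?a, ?b) has the additional direction k,
      whose term returns F; the remaining directions occur in both summands with opposite
      signs.\<close>
    let ?a = "\<alpha>(k := \<alpha> k + 1)" and ?b = "\<beta>(k := 1)"
    have kd: "k \<notin> dirs \<beta>" using bk by (simp add: dirs_def)
    have "dirs ?b = insert k (dirs \<beta>)" using kN by (auto simp: dirs_def)
    moreover have "eta (dhat F) (\<alpha>, \<beta>) = sg k \<beta> / mm k \<alpha> \<beta> * dhat F (?a, ?b)"
      using ex bk by (simp add: eta_def k_def[symmetric])
    ultimately have "eta (dhat F) (\<alpha>, \<beta>) = sg k \<beta> / mm k \<alpha> \<beta> * dterm k F ?a ?b +
        (\<Sum>i\<in>dirs \<beta>. sg k \<beta> / mm k \<alpha> \<beta> * dterm i F ?a ?b)"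
      using kd by (simp add: dhat_def distrib_left sum_distrib_left)
    moreover have "sg k \<beta> / mm k \<alpha> \<beta> * dterm k F ?a ?b = F (\<alpha>, \<beta>)"
    proof -
      have "?a(k := ?a k - 1) = \<alpha>" "?b(k := 0) = \<beta>" using bk by auto
      then show ?thesis using mk by (simp add: dterm_def)
    qed
    moreover have "dhat (eta F) (\<alpha>, \<beta>) = (\<Sum>i\<in>dirs \<beta>. - (sg k \<beta> / mm k \<alpha> \<beta> * dterm i F ?a ?b))"
      unfolding dhat_def prod.case
    proof (rule sum.cong[OF refl])
      fix i assume "i \<in> dirs \<beta>"
      then have i: "i \<in> {1..N}" "\<beta> i = 1" by (auto simp: dirs_def)
      then have ik: "i \<noteq> k" using bk by auto
      show "dterm i (eta F) \<alpha> \<beta> = - (sg k \<beta> / mm k \<alpha> \<beta> * dterm i F ?a ?b)"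
      proof (cases "\<alpha> i = 0")
        case True
        then show ?thesis using ik by (simp add: dterm_def)
      next
        case False
        let ?c = "\<beta>(i := 0)"
        have c: "?c k = 0" "?c i = 0" "?c(i := 1) = \<beta>" "?b(i := 0) = ?c(k := 1)"
          using bk i ik by (auto simp: fun_upd_twist)
        have a: "?a(i := ?a i - 1) = \<alpha>(i := \<alpha> i - 1, k := (\<alpha>(i := \<alpha> i - 1)) k + 1)"
          using ik by (auto simp: fun_upd_twist)
        have m: "mm i (?a(i := ?a i - 1)) (?b(i := 0)) = mm i (\<alpha>(i := \<alpha> i - 1)) ?c"
          unfolding a c(4) using mm_shift[OF i(1) kN, of "\<alpha>(i := \<alpha> i - 1)" ?c] c(1) by (simp add: One_nat_def)
        have sgs: "sg i ?c * sg k ?c = - (sg k \<beta> * sg i (?c(k := 1)) :: 'k)"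
        proof -
          have "sg i ?c * sg k (?c(i := 1)) = - (sg k ?c * sg i (?c(k := 1)) :: 'k)"
            using ik c i kN by (intro sg_anticommute) auto
          then show ?thesis unfolding c(3) by (rule sign_exchange) simp_all
        qed
        let ?F = "F (?a(i := ?a i - 1), ?b(i := 0))"
        have "dterm i (eta F) \<alpha> \<beta> = (sg i ?c * sg k ?c) * (mm i (\<alpha>(i := \<alpha> i - 1)) ?c / mm k \<alpha> \<beta> * ?F)"
          unfolding a c(4) using False c(1) eta_down[OF i False] by (simp add: dterm_def)
        also have "\<dots> = - (sg k \<beta> / mm k \<alpha> \<beta> * dterm i F ?a ?b)"
        proof -
          have "mm i (\<alpha>(k := \<alpha> k + 1, i := \<alpha> i - 1)) (?c(k := 1)) = mm i (\<alpha>(i := \<alpha> i - 1)) ?c"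
            using m ik unfolding c(4) by simp
          then show ?thesis unfolding sgs using False ik by (simp add: dterm_def c(4))
        qed
        finally show ?thesis .
      qed
    qed
    ultimately show ?thesis by (simp add: sum_negf)
  qed
qed

lemma eta_nonzeroD:
  assumes "eta F (\<alpha>, \<beta>) \<noteq> 0"
  obtains i where "i \<in> {1..N}" "\<beta> i = 0" "F (\<alpha>(i := \<alpha> i + 1), \<beta>(i := 1)) \<noteq> 0"
proof -
  have "\<exists>i. bad \<alpha> \<beta> i" "\<beta> (pivot \<alpha> \<beta>) = 0"
    "F (\<alpha>(pivot \<alpha> \<beta> := \<alpha> (pivot \<alpha> \<beta>) + 1), \<beta>(pivot \<alpha> \<beta> := 1)) \<noteq> 0"
    using assms by (auto simp: eta_def split: if_splits)
  moreover from this(1) have "pivot \<alpha> \<beta> \<in> {1..N}" using pivot_bad bad_def by blast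
  ultimately show ?thesis using that by blast
qed

lemma eta_finsupp:
  assumes F: "F \<in> finsupp (E \<times> B (Suc n))"
  shows "eta F \<in> finsupp (E \<times> B n)"
proof (rule finsuppI)
  let ?f = "\<lambda>((\<alpha>, \<beta>), i). (\<alpha>(i := \<alpha> i - 1), \<beta>(i := 0))"
  show "finite (?f ` ({p. F p \<noteq> 0} \<times> {1..N}))" using finsuppD(1)[OF F] by simp
  show "{p. eta F p \<noteq> 0} \<subseteq> ?f ` ({p. F p \<noteq> 0} \<times> {1..N})"
  proof clarify
    fix \<alpha> \<beta> assume "eta F (\<alpha>, \<beta>) \<noteq> 0"
    then obtain i where i: "i \<in> {1..N}" "\<beta> i = 0" "F (\<alpha>(i := \<alpha> i + 1), \<beta>(i := 1)) \<noteq> 0"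
      by (rule eta_nonzeroD)
    then have "(\<alpha>, \<beta>) = ?f ((\<alpha>(i := \<alpha> i + 1), \<beta>(i := 1)), i)" by (auto simp: fun_eq_iff)
    then show "(\<alpha>, \<beta>) \<in> ?f ` ({p. F p \<noteq> 0} \<times> {1..N})" using i by blast
  qed
  show "{p. eta F p \<noteq> 0} \<subseteq> E \<times> B n"
  proof clarify
    fix \<alpha> \<beta> assume "eta F (\<alpha>, \<beta>) \<noteq> 0"
    then obtain i where i: "i \<in> {1..N}" "\<beta> i = 0" "F (\<alpha>(i := \<alpha> i + 1), \<beta>(i := 1)) \<noteq> 0"
      by (rule eta_nonzeroD)
    from finsuppD(2)[OF F i(3)] show "\<alpha> \<in> E \<and> \<beta> \<in> B n"
      using exponents_upd[OF i(1)] B_upd[of \<beta> i, OF i(2,1)] by simp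
  qed
qed

section \<open>Cocycles and coboundaries of the Koszul cochains\<close>

abbreviation kcoc :: "nat \<Rightarrow> 'k SW set" where "kcoc \<equiv> cocycles (koszul N q) (\<lambda>_. dd)"
abbreviation kcob :: "nat \<Rightarrow> 'k SW set" where "kcob \<equiv> coboundaries (koszul N q) (\<lambda>_. dd)"

lemma kcoc_iff: "v \<in> kcoc m \<longleftrightarrow> v \<in> carrier (koszul N q m) \<and> dhat (\<tau> v) = (\<lambda>_. 0)"
  using dd_zero_iff[of v] by (auto simp: cocycles_def koszul_carrier supported_def)

lemma HH_span_kcoc: "carrier (HH_span N q m) \<subseteq> kcoc m"
proof
  fix v assume "v \<in> carrier (HH_span N q m)"
  then have v: "v \<in> carrier T" "\<And>p. \<tau> v p \<noteq> 0 \<Longrightarrow> p \<in> HH_index N q m"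
    by (auto simp: HH_span_carrier supported_def)
  have "dhat (\<tau> v) = (\<lambda>_. 0)"
    using v(2) HH_index_iff by (intro dhat_supported_good) blast
  moreover have "v \<in> carrier (koszul N q m)"
    using v HH_index_subset[of m] by (auto simp: koszul_carrier supported_def)
  ultimately show "v \<in> kcoc m" by (simp add: kcoc_iff)
qed

text \<open>A coboundary has no coordinates over C by \<open>dhat_good\<close>, and an element of
  the span has no others.\<close>

lemma HH_span_kcob:
  assumes v: "v \<in> carrier (HH_span N q m)" and "v \<in> kcob m"
  shows "v = \<zero>\<^bsub>T\<^esub>"
proof (cases m)
  case 0
  then show ?thesis using assms(2) by (simp add: coboundaries_def)
next
  case (Suc n)
  then obtain w where w: "w \<in> carrier T" "v = dd w"
    using assms(2) by (auto simp: coboundaries_def koszul_carrier supported_def)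
  show ?thesis
  proof (rule T.coords_eqI)
    fix p :: exps2
    obtain \<alpha> \<beta> where p: "p = (\<alpha>, \<beta>)" by (cases p)
    show "\<tau> v p = \<tau> \<zero>\<^bsub>T\<^esub> p"
    proof (cases "p \<in> HH_index N q m")
      case True
      then have "dhat (\<tau> w) p = 0" unfolding p by (intro dhat_good) (simp add: HH_index_iff)
      then show ?thesis by (simp add: w coord_dd)
    next
      case False
      then show ?thesis using v by (simp add: HH_span_carrier supported_def p)
    qed
  qed (use v in \<open>auto simp: HH_span_carrier supported_def\<close>)
qed

lemma kcoc_HH_span:
  assumes z: "z \<in> kcoc m"
  shows "\<exists>v\<in>carrier (HH_span N q m). z \<ominus>\<^bsub>T\<^esub> v \<in> kcob m"
proof -
  have zc: "z \<in> carrier T" and z0: "\<And>p. p \<notin> E \<times> B m \<Longrightarrow> \<tau> z p = 0"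
    and dz: "dhat (\<tau> z) = (\<lambda>_. 0)"
    using z by (auto simp: kcoc_iff koszul_carrier supported_def)
  have fz: "\<tau> z \<in> finsupp (E \<times> B m)"
    using T.coords_finsupp[OF zc] z0 by (auto simp: finsupp_def)
  \<comment> \<open>The representative in the span consists of the coordinates of z over C; the rest
    of z is to be the differential of \<open>eta (\<tau> z)\<close>.\<close>
  define g where "g p = (if p \<in> HH_index N q m then \<tau> z p else 0)" for p
  have g: "g \<in> finsupp (E \<times> bin N)"
    using T.coords_finsupp[OF zc] by (intro finsuppI[OF finsuppD(1)[OF T.coords_finsupp[OF zc]]])
      (auto simp: g_def finsupp_def)
  define v where "v = T.vec g"
  have vc: "v \<in> carrier T" and \<tau>v: "\<tau> v = g" using g by (simp_all add: v_def T.vec_closed T.coords_vec)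
  have vH: "v \<in> carrier (HH_span N q m)" using vc by (simp add: HH_span_carrier supported_def \<tau>v g_def)
  have eq: "\<tau> z p - g p = dhat (eta (\<tau> z)) p" for p
  proof -
    obtain \<alpha> \<beta> where p: "p = (\<alpha>, \<beta>)" by (cases p)
    show ?thesis
    proof (cases "\<exists>i. bad \<alpha> \<beta> i")
      case False
      have "\<tau> z p - g p = 0"
        using False z0[of p] by (auto simp: g_def p HH_index_iff)
      then show ?thesis using False dhat_good[of \<alpha> \<beta>] p by simp
    next
      case True
      have "p \<notin> HH_index N q m" using True by (simp add: p HH_index_iff)
      then have g0: "g p = 0" by (simp add: g_def)
      show ?thesis
      proof (cases "\<beta> \<in> bin N")
        case \<beta>: True
        have "eta (dhat (\<tau> z)) p = 0" by (simp add: dz eta_def p)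
        then show ?thesis using dhat_eta[OF \<beta> True, of "\<tau> z"] g0 p by simp
      next
        \<comment> \<open>\<open>dhat_eta\<close> needs a binary \<beta>. Elsewhere both sides
          vanish: whatever \<open>eta\<close> and \<open>dhat\<close> produce from the support of z
          has binary \<beta>.\<close>
        case False
        then have "\<tau> z p = 0" using z0[of p] B_bin p by auto
        moreover have "dhat (eta (\<tau> z)) p = 0"
        proof (rule ccontr)
          assume "dhat (eta (\<tau> z)) p \<noteq> 0"
          then obtain i where i: "i \<in> {1..N}" "\<beta> i = 1" "eta (\<tau> z) (\<alpha>(i := \<alpha> i - 1), \<beta>(i := 0)) \<noteq> 0"
            unfolding p by (rule dhat_nonzeroD)
          obtain j where j: "j \<in> {1..N}" "(\<beta>(i := 0)) j = 0"
            "\<tau> z ((\<alpha>(i := \<alpha> i - 1))(j := (\<alpha>(i := \<alpha> i - 1)) j + 1), (\<beta>(i := 0))(j := 1)) \<noteq> 0"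
            using i(3) by (rule eta_nonzeroD)
          then have "(\<beta>(i := 0))(j := 1) \<in> B m" using z0 by blast
          then have "(\<beta>(i := 0))(j := 1) \<in> bin N" by (rule B_bin)
          then have "((\<beta>(i := 0))(j := 1))(j := 0) \<in> bin N" by (rule bin_upd(2))
          moreover have "((\<beta>(i := 0))(j := 1))(j := 0) = \<beta>(i := 0)"
            unfolding fun_upd_upd using j(2) by (rule fun_upd_idem)
          ultimately have "\<beta> \<in> bin N" using bin_upd(1)[of i \<beta>] i by simp
          then show False using False by blast
        qed
        ultimately show ?thesis using g0 by simp
      qed
    qed
  qed
  have "z \<ominus>\<^bsub>T\<^esub> v \<in> kcob m"
  proof (cases m)
    case 0
    \<comment> \<open>In degree 0 there is nothing to contract: \<open>eta\<close> reads values at a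
      \<beta> with an entry 1, and none occurs in \<open>B 0\<close>.\<close>
    have "eta (\<tau> z) (\<alpha>, \<beta>) = 0" for \<alpha> \<beta>
    proof (rule ccontr)
      assume "eta (\<tau> z) (\<alpha>, \<beta>) \<noteq> 0"
      then obtain i where i: "i \<in> {1..N}" "\<beta> i = 0" "\<tau> z (\<alpha>(i := \<alpha> i + 1), \<beta>(i := 1)) \<noteq> 0"
        by (rule eta_nonzeroD)
      then have "\<beta>(i := 1) \<in> B 0" using z0 0 by blast
      then have "\<beta>(i := 1) = (\<lambda>_. 0)" by (simp only: B_zero)
      from fun_cong[OF this, of i] show False by simp
    qed
    then have "eta (\<tau> z) = (\<lambda>_. 0)" by auto
    then have "\<tau> z p - g p = 0" for p using eq[of p] by (simp add: dhat_zero)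
    then have "z \<ominus>\<^bsub>T\<^esub> v = \<zero>\<^bsub>T\<^esub>" using zc vc by (intro T.coords_eqI) (simp_all add: T.coords_minus \<tau>v)
    then show ?thesis using 0 by (simp add: coboundaries_def)
  next
    case (Suc n)
    have "eta (\<tau> z) \<in> finsupp (E \<times> B n)" using fz Suc by (intro eta_finsupp) simp
    moreover from this have "eta (\<tau> z) \<in> finsupp (E \<times> bin N)"
      by (rule finsupp_mono) (use B_bin in blast)
    ultimately have y: "T.vec (eta (\<tau> z)) \<in> carrier (koszul N q n)" "\<tau> (T.vec (eta (\<tau> z))) = eta (\<tau> z)"
      by (auto simp: koszul_carrier supported_def T.vec_closed T.coords_vec finsuppD(3))
    have yc: "T.vec (eta (\<tau> z)) \<in> carrier T" using y by (simp add: koszul_carrier supported_def)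
    have "z \<ominus>\<^bsub>T\<^esub> v = dd (T.vec (eta (\<tau> z)))"
      using zc vc yc by (intro T.coords_eqI) (simp_all add: T.coords_minus \<tau>v dd_closed coord_dd y eq)
    then show ?thesis using Suc y(1) by (simp add: coboundaries_def)
  qed
  then show ?thesis using vH by blast
qed

text \<open>Lowering in one direction leaves the scalars of the others unchanged, so the
  contributions of i, j and of j, i agree up to the sign, which \<open>sg_anticommute\<close> makes
  opposite.\<close>

lemma dhat_dhat: "dhat (dhat F) (\<alpha>, \<beta>) = 0"
proof -
  define f where "f i j = (if \<alpha> i = 0 \<or> \<alpha> j = 0 then 0 else
    (sg i (\<beta>(i := 0)) * sg j (\<beta>(i := 0, j := 0))) * (mm i \<alpha> \<beta> * mm j \<alpha> \<beta> *
      F (\<alpha>(i := \<alpha> i - 1, j := \<alpha> j - 1), \<beta>(i := 0, j := 0))))" for i j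
  have dirs: "dirs (\<beta>(i := 0)) = dirs \<beta> - {i}" for i by (auto simp: dirs_def)
  have "dhat (dhat F) (\<alpha>, \<beta>) = (\<Sum>i\<in>dirs \<beta>. \<Sum>j\<in>dirs \<beta> - {i}. f i j)"
    unfolding dhat_def[of "dhat F"] prod.case
  proof (rule sum.cong[OF refl])
    fix i assume "i \<in> dirs \<beta>"
    then have i: "i \<in> {1..N}" "\<beta> i = 1" by (auto simp: dirs_def)
    show "dterm i (dhat F) \<alpha> \<beta> = (\<Sum>j\<in>dirs \<beta> - {i}. f i j)"
    proof (cases "\<alpha> i = 0")
      case True
      then show ?thesis by (simp add: dterm_def f_def)
    next
      case False
      have "sg i (\<beta>(i := 0)) * mm i \<alpha> \<beta> * dterm j F (\<alpha>(i := \<alpha> i - 1)) (\<beta>(i := 0)) = f i j"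
        if "j \<in> dirs \<beta> - {i}" for j
      proof -
        have j: "j \<in> {1..N}" "\<beta> j = 1" "j \<noteq> i" using that by (auto simp: dirs_def)
        have "mm j ((\<alpha>(i := \<alpha> i - 1))(j := \<alpha> j - 1)) (\<beta>(i := 0, j := 0)) = mm j \<alpha> \<beta>" if "\<alpha> j \<noteq> 0"
          using mm_down[of j j "\<beta>(i := 0)" "\<alpha>(i := \<alpha> i - 1)", OF j(1,1)] mm_down[of j i \<beta> \<alpha>, OF j(1) i False] j that by simp
        then show ?thesis using j False by (simp add: dterm_def f_def)
      qed
      then show ?thesis
        using False mm_down[of i i \<beta> \<alpha>, OF i(1) i False]
        by (simp add: dterm_def[of i] dhat_def dirs sum_distrib_left)
    qed
  qed
  also have "\<dots> = 0"
  proof (rule sum_antisymmetric[OF finite_dirs])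
    fix i j assume ij: "i \<in> dirs \<beta>" "j \<in> dirs \<beta>" "i \<noteq> j"
    let ?b = "\<beta>(i := 0, j := 0)"
    have e: "\<beta>(i := 0) = ?b(j := 1)" "\<beta>(j := 0) = ?b(i := 1)" "\<beta>(j := 0, i := 0) = ?b"
      using ij by (auto simp: dirs_def fun_eq_iff)
    have "\<alpha>(j := \<alpha> j - 1, i := \<alpha> i - 1) = \<alpha>(i := \<alpha> i - 1, j := \<alpha> j - 1)"
      using ij by (intro fun_upd_twist) simp
    then have Feq: "F (\<alpha>(j := \<alpha> j - 1, i := \<alpha> i - 1), ?b) = F (\<alpha>(i := \<alpha> i - 1, j := \<alpha> j - 1), ?b)"
      by (rule arg_cong[where f = "\<lambda>a. F (a, ?b)"])
    have "sg j ?b * sg i (?b(j := 1)) = - (sg i ?b * sg j (?b(i := 1)) :: 'k)"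
      using ij by (intro sg_anticommute) (auto simp: dirs_def)
    then have s: "sg i (\<beta>(i := 0)) * sg j ?b = - (sg j (\<beta>(j := 0)) * sg i ?b :: 'k)"
      by (simp only: e(1,2)[symmetric] mult.commute)
    show "f i j = - f j i"
      unfolding f_def Feq e(3) s by (auto simp: mult_ac)
  qed
  finally show ?thesis .
qed

lemma dd_kcoc: "v \<in> carrier (koszul N q m) \<Longrightarrow> dd v \<in> kcoc (Suc m)"
proof -
  assume v: "v \<in> carrier (koszul N q m)"
  then have "v \<in> carrier T" by (simp add: koszul_carrier supported_def)
  then show ?thesis using dd_koszul[OF v] dhat_dhat[of "\<tau> v"]
    by (auto simp: kcoc_iff coord_dd)
qed

lemma kcob_subset: "kcob m \<subseteq> kcoc m"
proof (cases m)
  case 0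
  have "\<zero>\<^bsub>T\<^esub> \<in> kcoc 0" by (auto simp: kcoc_iff koszul_carrier supported_def dhat_zero)
  then show ?thesis using 0 by (simp add: coboundaries_def)
next
  case (Suc n)
  then show ?thesis using dd_kcoc[of _ n] by (auto simp: coboundaries_def)
qed

lemma dd_koszul_hom: "is_hom scalars (koszul N q m) (koszul N q (Suc m)) dd"
proof (rule is_homI)
  show "dd v \<in> carrier (koszul N q (Suc m))" if "v \<in> carrier (koszul N q m)" for v
    using that by (rule dd_koszul)
qed (use is_hom_scalarsD[OF dd_hom] in \<open>auto simp: koszul_carrier supported_def\<close>)

lemma kcoc_submodule: "submodule (kcoc m) (scalars :: 'k ring) (koszul N q m)"
  unfolding cocycles_def by (rule kernel_submodule[OF koszul_vsp koszul_vsp dd_koszul_hom])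

lemma kcob_submodule: "submodule (kcob m) (scalars :: 'k ring) (koszul N q m)"
proof (cases m)
  case 0
  show ?thesis unfolding 0 coboundaries_def using koszul_vsp[of 0]
    by (auto simp: vsp.submodule_iff koszul_carrier supported_def)
next
  case (Suc n)
  show ?thesis unfolding Suc coboundaries_def
    using image_submodule[OF koszul_vsp koszul_vsp dd_koszul_hom[of n]] by simp
qed

theorem koszul_cohomology:
  "lin_iso (HH_span N q m) (cohomology (koszul N q) (\<lambda>_. dd) m) (coh_class (koszul N q) (\<lambda>_. dd) m)"
proof -
  have "lin_iso (HH_span N q m) (quotient ((koszul N q m)\<lparr>carrier := kcoc m\<rparr>) (kcob m))
      (\<lambda>v. kcob m +>\<^bsub>koszul N q m\<^esub> v)"
  proof (rule lin_iso_quotient[OF HH_span_vsp koszul_vsp kcoc_submodule kcob_submodule kcob_subset])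
    have HC: "carrier (HH_span N q m) \<subseteq> carrier (koszul N q m)"
      using HH_span_kcoc[of m] by (auto simp: kcoc_iff)
    then show "is_hom scalars (HH_span N q m) (koszul N q m) (\<lambda>v. v)" by (intro is_homI) auto
    show "v \<in> kcoc m" if "v \<in> carrier (HH_span N q m)" for v using that HH_span_kcoc by blast
    show "v = \<zero>\<^bsub>HH_span N q m\<^esub>" if "v \<in> carrier (HH_span N q m)" "v \<in> kcob m" for v
      using HH_span_kcob[OF that] by simp
    show "\<exists>v\<in>carrier (HH_span N q m). z \<ominus>\<^bsub>koszul N q m\<^esub> v \<in> kcob m" if z: "z \<in> kcoc m" for z
    proof -
      obtain v where v: "v \<in> carrier (HH_span N q m)" "z \<ominus>\<^bsub>T\<^esub> v \<in> kcob m"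
        using kcoc_HH_span[OF z] by blast
      then have "z \<ominus>\<^bsub>koszul N q m\<^esub> v = z \<ominus>\<^bsub>T\<^esub> v" using z HC by (intro koszul_minus) (auto simp: kcoc_iff)
      then show ?thesis by (intro bexI[OF _ v(1)]) (simp add: v(2))
    qed
  qed
  then show ?thesis unfolding cohomology_def coh_class_def[abs_def] .
qed

subsection \<open>Comparison with an arbitrary projective resolution\<close>

text \<open>The element of A that stands before the exterior monomial with exponents \<beta> in
  z.\<close>

definition comp :: "'k SW \<Rightarrow> (nat \<Rightarrow> nat) \<Rightarrow> (nat list \<Rightarrow> 'k) set" where
  "comp z \<beta> = A.vec (\<lambda>\<alpha>. \<tau> z (\<alpha>, \<beta>))"

lemma comp_finsupp: "z \<in> carrier T \<Longrightarrow> (\<lambda>\<alpha>. \<tau> z (\<alpha>, \<beta>)) \<in> finsupp E"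
proof (rule finsuppI[of "fst ` {p. \<tau> z p \<noteq> 0}"])
  assume z: "z \<in> carrier T"
  note fz = T.coords_finsupp[OF z]
  show "finite (fst ` {p. \<tau> z p \<noteq> 0})" using finsuppD(1)[OF fz] by simp
  show "{\<alpha>. \<tau> z (\<alpha>, \<beta>) \<noteq> 0} \<subseteq> fst ` {p. \<tau> z p \<noteq> 0}" by force
  show "{\<alpha>. \<tau> z (\<alpha>, \<beta>) \<noteq> 0} \<subseteq> E" using finsuppD(2)[OF fz] by blast
qed

lemma comp_closed: "z \<in> carrier T \<Longrightarrow> comp z \<beta> \<in> carrier A"
  and coord_comp: "z \<in> carrier T \<Longrightarrow> \<phi> (comp z \<beta>) \<alpha> = \<tau> z (\<alpha>, \<beta>)"
  using comp_finsupp[of z \<beta>] by (simp_all add: comp_def A.vec_closed A.coords_vec)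

text \<open>The identification of cochains with homomorphisms from the free module on
  \<open>B m\<close> to A: the basis vector at \<beta> goes to the \<beta>-component of z.\<close>

definition zeta :: "'k SW \<Rightarrow> ((nat \<Rightarrow> nat) \<Rightarrow> 'k SW) \<Rightarrow> (nat list \<Rightarrow> 'k) set" where
  "zeta z = free_lift R AM (comp z)"

lemma zeta_hom: "z \<in> carrier T \<Longrightarrow> is_hom R (K m) AM (zeta z)"
  and zeta_unit: "z \<in> carrier T \<Longrightarrow> \<beta> \<in> B m \<Longrightarrow> zeta z (unit_vec R \<beta>) = comp z \<beta>"
  using free_lift_hom[OF AM_lmod, of "B m" "comp z"] comp_closed[of z] by (simp_all add: zeta_def)

lemma coord_zeta:
  assumes z: "z \<in> carrier T" and f: "f \<in> carrier (K m)"
  shows "\<phi> (zeta z f) \<alpha> = (\<Sum>\<beta>\<in>B m. \<phi> (f \<beta> \<odot>\<^bsub>AM\<^esub> comp z \<beta>) \<alpha>)"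
proof -
  have v: "f \<beta> \<in> carrier R" for \<beta> using f unfolding K_carrier by simp
  have "{i. f i \<noteq> \<zero>\<^bsub>R\<^esub>} \<subseteq> B m" using f unfolding K_carrier by auto
  then have eq: "zeta z f = (\<Oplus>\<^bsub>AM\<^esub>\<beta>\<in>B m. f \<beta> \<odot>\<^bsub>AM\<^esub> comp z \<beta>)"
    unfolding zeta_def using comp_closed[OF z]
    by (intro free_lift_eq[OF AM_lmod _ f B_finite]) auto
  have "(\<lambda>\<beta>. f \<beta> \<odot>\<^bsub>AM\<^esub> comp z \<beta>) \<in> B m \<rightarrow> carrier A"
    by (intro funcsetI act_closed v comp_closed z)
  then show ?thesis unfolding eq finsum_regular_bimodule by (simp only: A.coords_finsum)
qed

lemma act_finsum:
  assumes "finite S" "t \<in> S \<rightarrow> carrier R" "a \<in> carrier A"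
  shows "\<phi> (finsum R t S \<odot>\<^bsub>AM\<^esub> a) \<alpha> = (\<Sum>i\<in>S. \<phi> (t i \<odot>\<^bsub>AM\<^esub> a) \<alpha>)"
  using assms(1,2)
proof (induction S rule: finite_induct)
  case empty
  show ?case using assms(3) by (simp add: act_zero_left)
next
  case (insert i S)
  then show ?case
    using assms(3) by (simp add: R.finsum_insert act_add_left act_closed A.coords_add)
qed

lemma coord_act_rel:
  assumes "i \<in> {1..N}" "a \<in> carrier A"
  shows "\<phi> (rel i \<beta> \<odot>\<^bsub>AM\<^esub> a) \<alpha> = sg i \<beta> *
    (if \<alpha> i = 0 then 0 else mm i (\<alpha>(i := \<alpha> i - 1)) \<beta> * \<phi> a (\<alpha>(i := \<alpha> i - 1)))"
  using coord_xcomm[OF assms] xcomm_closed[OF assms]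
  by (simp add: act_rel[OF assms] A.coords_smult xcomm_def[symmetric])

text \<open>Both sides are linear over R, so basis vectors suffice. The one at \<beta>' is mapped to
  the places where \<beta>' is lowered in one direction, and there \<open>rel\<close> acts on the
  components of z by the bracket of the cochain differential.\<close>

lemma zeta_dd:
  assumes z: "z \<in> carrier (koszul N q m)" and f: "f \<in> carrier (K (Suc m))"
  shows "zeta (dd z) f = zeta z (dK m f)"
proof -
  have zT: "z \<in> carrier T" using z by (simp add: koszul_carrier supported_def)
  note dz = dd_closed[OF zT]
  show ?thesis
  proof (rule free_module_hom_eq[OF AM_lmod zeta_hom[OF dz] is_hom_comp[OF dK_hom zeta_hom[OF zT]] _ f])
    fix \<beta>' assume \<beta>': "\<beta>' \<in> B (Suc m)"
    have u: "unit_vec R \<beta>' \<in> carrier (K (Suc m))" using \<beta>' by (rule R.unit_vec_closed)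
    have du: "dK m (unit_vec R \<beta>') \<in> carrier (K m)" by (rule is_homD(1)[OF dK_hom u])
    show "zeta (dd z) (unit_vec R \<beta>') = zeta z (dK m (unit_vec R \<beta>'))"
    proof (rule A.coords_eqI)
      show "zeta (dd z) (unit_vec R \<beta>') \<in> carrier A"
        using zeta_unit[OF dz \<beta>'] comp_closed[OF dz] by simp
      show "zeta z (dK m (unit_vec R \<beta>')) \<in> carrier A"
        using is_homD(1)[OF zeta_hom[OF zT] du] by simp
      fix \<alpha>
      let ?g = "\<lambda>i \<beta>. \<phi> (rel i \<beta> \<odot>\<^bsub>AM\<^esub> comp z \<beta>) \<alpha>"
      have t: "\<phi> ((unit_vec R \<beta>' (\<beta>(i := 1)) \<otimes>\<^bsub>R\<^esub> rel i \<beta>) \<odot>\<^bsub>AM\<^esub> comp z \<beta>) \<alpha> =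
          (if \<beta>' = \<beta>(i := 1) then ?g i \<beta> else 0)" if "i \<in> {1..N}" for i \<beta>
        using that rel_closed comp_closed[OF zT] by (auto simp: unit_vec_def act_zero_left)
      have "\<phi> (zeta z (dK m (unit_vec R \<beta>'))) \<alpha> =
          (\<Sum>\<beta>\<in>B m. \<phi> (dK m (unit_vec R \<beta>') \<beta> \<odot>\<^bsub>AM\<^esub> comp z \<beta>) \<alpha>)"
        by (rule coord_zeta[OF zT du])
      also have "\<dots> = (\<Sum>\<beta>\<in>B m. \<Sum>i\<in>free_dirs \<beta>. if \<beta>' = \<beta>(i := 1) then ?g i \<beta> else 0)"
      proof (rule sum.cong[OF refl])
        fix \<beta> assume \<beta>: "\<beta> \<in> B m"
        have "unit_vec R \<beta>' \<beta> \<in> carrier R" for \<beta> by (simp add: unit_vec_def)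
        then have "\<phi> (dK m (unit_vec R \<beta>') \<beta> \<odot>\<^bsub>AM\<^esub> comp z \<beta>) \<alpha> =
            (\<Sum>i\<in>free_dirs \<beta>. \<phi> ((unit_vec R \<beta>' (\<beta>(i := 1)) \<otimes>\<^bsub>R\<^esub> rel i \<beta>) \<odot>\<^bsub>AM\<^esub> comp z \<beta>) \<alpha>)"
          using \<beta> act_finsum[OF finite_free_dirs dK_summand_closed comp_closed[OF zT]] by (simp add: dK_def)
        also have "\<dots> = (\<Sum>i\<in>free_dirs \<beta>. if \<beta>' = \<beta>(i := 1) then ?g i \<beta> else 0)"
          by (intro sum.cong refl t) (simp add: free_dirs_def)
        finally show "\<phi> (dK m (unit_vec R \<beta>') \<beta> \<odot>\<^bsub>AM\<^esub> comp z \<beta>) \<alpha> =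
          (\<Sum>i\<in>free_dirs \<beta>. if \<beta>' = \<beta>(i := 1) then ?g i \<beta> else 0)" .
      qed
      also have "\<dots> = (\<Sum>\<beta>\<in>B m. \<Sum>i\<in>dirs \<beta>'. if \<beta>'(i := 0) = \<beta> then ?g i \<beta> else 0)"
      proof (rule sum.cong[OF refl])
        fix \<beta> assume \<beta>: "\<beta> \<in> B m"
        have "(\<Sum>i\<in>free_dirs \<beta>. if \<beta>' = \<beta>(i := 1) then ?g i \<beta> else 0) =
            (\<Sum>i\<in>free_dirs \<beta>. ?g i \<beta> * single (\<beta>(i := \<beta> i + 1)) \<beta>')"
          by (intro sum.cong refl) (auto simp: free_dirs_def single_def)
        then show "(\<Sum>i\<in>free_dirs \<beta>. if \<beta>' = \<beta>(i := 1) then ?g i \<beta> else 0) =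
            (\<Sum>i\<in>dirs \<beta>'. if \<beta>'(i := 0) = \<beta> then ?g i \<beta> else 0)"
          using sum_free_dirs_dirs[OF B_bin[OF \<beta>], of "\<lambda>i. ?g i \<beta>" \<beta>'] by simp
      qed
      \<comment> \<open>For given i the only source is \<beta>' lowered at i, so after the exchange
        the inner sum collapses.\<close>
      also have "\<dots> = (\<Sum>i\<in>dirs \<beta>'. \<Sum>\<beta>\<in>B m. if \<beta> = \<beta>'(i := 0) then ?g i \<beta> else 0)"
        by (subst sum.swap) (simp only: eq_commute)
      also have "\<dots> = (\<Sum>i\<in>dirs \<beta>'. ?g i (\<beta>'(i := 0)))"
      proof (rule sum.cong[OF refl])
        fix i assume "i \<in> dirs \<beta>'"
        then have "\<beta>'(i := 0) \<in> B m" using B_down[of i \<beta>' m] \<beta>' by (simp add: dirs_def)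
        then show "(\<Sum>\<beta>\<in>B m. if \<beta> = \<beta>'(i := 0) then ?g i \<beta> else 0) = ?g i (\<beta>'(i := 0))"
          using B_finite by simp
      qed
      also have "\<dots> = dhat (\<tau> z) (\<alpha>, \<beta>')"
        unfolding dhat_def prod.case
        by (intro sum.cong refl)
          (auto simp: dirs_def coord_act_rel comp_closed[OF zT] coord_comp[OF zT] dterm_def)
      also have "\<dots> = \<phi> (zeta (dd z) (unit_vec R \<beta>')) \<alpha>"
        by (simp add: zeta_unit[OF dz \<beta>'] coord_comp[OF dz] coord_dd[OF zT])
      finally show "\<phi> (zeta (dd z) (unit_vec R \<beta>')) \<alpha> = \<phi> (zeta z (dK m (unit_vec R \<beta>'))) \<alpha>" ..
    qed
  qed
qed

lemma zeta_inject:
  assumes z: "z \<in> carrier (koszul N q m)" and w: "w \<in> carrier (koszul N q m)"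
    and eq: "\<And>f. f \<in> carrier (K m) \<Longrightarrow> zeta z f = zeta w f"
  shows "z = w"
proof -
  have c: "z \<in> carrier T" "w \<in> carrier T" using z w by (simp_all add: koszul_carrier supported_def)
  show ?thesis
  proof (rule T.coords_eqI[OF c])
    fix p :: exps2
    obtain \<alpha> \<beta> where p: "p = (\<alpha>, \<beta>)" by (cases p)
    show "\<tau> z p = \<tau> w p"
    proof (cases "\<beta> \<in> B m")
      case True
      have "comp z \<beta> = comp w \<beta>"
        using eq[OF R.unit_vec_closed[OF True]] zeta_unit[OF c(1) True] zeta_unit[OF c(2) True] by simp
      then show ?thesis using coord_comp[OF c(1)] coord_comp[OF c(2)] p by metis
    next
      case False
      then show ?thesis using z w by (simp add: koszul_carrier supported_def p)
    qed
  qed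
qed

lemma zeta_surject:
  assumes t: "is_hom R (K m) AM t"
  shows "\<exists>z\<in>carrier (koszul N q m). \<forall>f\<in>carrier (K m). t f = zeta z f"
proof -
  \<comment> \<open>The coordinates of the wanted cochain are those of the values of t on the basis
    vectors; finiteness of \<open>B m\<close> bounds their support.\<close>
  define F where "F p = (if snd p \<in> B m then \<phi> (t (unit_vec R (snd p))) (fst p) else 0)" for p :: exps2
  have tc: "t (unit_vec R \<beta>) \<in> carrier A" if "\<beta> \<in> B m" for \<beta>
    using is_homD(1)[OF t R.unit_vec_closed[OF that]] by simp
  have F: "F \<in> finsupp (E \<times> bin N)"
  proof (rule finsuppI)
    show "finite (\<Union>\<beta>\<in>B m. {\<alpha>. \<phi> (t (unit_vec R \<beta>)) \<alpha> \<noteq> 0} \<times> {\<beta>})"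
      using finsuppD(1)[OF A.coords_finsupp[OF tc]] by (intro finite_UN_I B_finite) simp
    show "{p. F p \<noteq> 0} \<subseteq> (\<Union>\<beta>\<in>B m. {\<alpha>. \<phi> (t (unit_vec R \<beta>)) \<alpha> \<noteq> 0} \<times> {\<beta>})"
      by (auto simp: F_def split: if_splits)
    show "{p. F p \<noteq> 0} \<subseteq> E \<times> bin N"
      using finsuppD(2)[OF A.coords_finsupp[OF tc]] B_bin by (auto simp: F_def split: if_splits)
  qed
  define z where "z = T.vec F"
  have zT: "z \<in> carrier T" and \<tau>z: "\<tau> z = F" using F by (simp_all add: z_def T.vec_closed T.coords_vec)
  have FB: "F p = 0" if "p \<notin> E \<times> B m" for p
    using that finsuppD(3)[OF F, of p] by (cases p) (auto simp: F_def intro: finsuppD(3)[OF A.coords_finsupp[OF tc]])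
  have "z \<in> carrier (koszul N q m)" using zT FB by (simp add: koszul_carrier supported_def \<tau>z)
  moreover have "t f = zeta z f" if "f \<in> carrier (K m)" for f
  proof (rule free_module_hom_eq[OF AM_lmod t zeta_hom[OF zT] _ that])
    fix \<beta> assume \<beta>: "\<beta> \<in> B m"
    show "t (unit_vec R \<beta>) = zeta z (unit_vec R \<beta>)"
      unfolding zeta_unit[OF zT \<beta>] using \<beta>
      by (intro A.coords_eqI tc comp_closed[OF zT]) (simp_all add: coord_comp[OF zT] \<tau>z F_def)
  qed
  ultimately show ?thesis by blast
qed

lemma zeta_add:
  assumes "z \<in> carrier T" "w \<in> carrier T" "f \<in> carrier (K m)"
  shows "zeta (z \<oplus>\<^bsub>T\<^esub> w) f = zeta z f \<oplus>\<^bsub>A\<^esub> zeta w f"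
proof -
  have zw: "z \<oplus>\<^bsub>T\<^esub> w \<in> carrier T" using assms by simp
  have c: "comp (z \<oplus>\<^bsub>T\<^esub> w) \<beta> = comp z \<beta> \<oplus>\<^bsub>A\<^esub> comp w \<beta>" for \<beta>
    using assms zw by (intro A.coords_eqI) (simp_all add: comp_closed coord_comp T.coords_add A.coords_add)
  have "zeta (z \<oplus>\<^bsub>T\<^esub> w) f = zeta z f \<oplus>\<^bsub>AM\<^esub> zeta w f"
  proof (rule free_module_hom_eq[OF AM_lmod zeta_hom[OF zw] _ _ assms(3)])
    show "is_hom R (K m) AM (\<lambda>f. zeta z f \<oplus>\<^bsub>AM\<^esub> zeta w f)"
      using assms by (intro is_hom_sum zeta_hom AM_lmod)
  qed (use assms zw c in \<open>simp add: zeta_unit[of _ _ m]\<close>)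
  then show ?thesis by simp
qed

text \<open>The element c 1 is central, so it can be moved past the coefficients of f.\<close>

lemma zeta_smult:
  assumes "z \<in> carrier T" "f \<in> carrier (K m)"
  shows "zeta (c \<odot>\<^bsub>T\<^esub> z) f = (c \<odot>\<^bsub>R\<^esub> \<one>\<^bsub>R\<^esub>) \<odot>\<^bsub>AM\<^esub> zeta z f"
proof -
  have cz: "c \<odot>\<^bsub>T\<^esub> z \<in> carrier T" using assms by simp
  have v: "f \<beta> \<in> carrier R" for \<beta> using assms(2) unfolding K_carrier by simp
  have zc: "zeta z f \<in> carrier A" "zeta (c \<odot>\<^bsub>T\<^esub> z) f \<in> carrier A"
    using is_homD(1)[OF zeta_hom[OF assms(1)] assms(2)] is_homD(1)[OF zeta_hom[OF cz] assms(2)] by simp_all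
  have comp: "comp (c \<odot>\<^bsub>T\<^esub> z) \<beta> = (c \<odot>\<^bsub>R\<^esub> \<one>\<^bsub>R\<^esub>) \<odot>\<^bsub>AM\<^esub> comp z \<beta>" for \<beta>
    unfolding act_scalar[OF comp_closed[OF assms(1)]] using assms(1) cz
    by (intro A.coords_eqI) (simp_all add: comp_closed coord_comp T.coords_smult A.coords_smult)
  have cent: "r \<odot>\<^bsub>AM\<^esub> ((c \<odot>\<^bsub>R\<^esub> \<one>\<^bsub>R\<^esub>) \<odot>\<^bsub>AM\<^esub> a) = c \<odot>\<^bsub>A\<^esub> (r \<odot>\<^bsub>AM\<^esub> a)"
    if "r \<in> carrier R" "a \<in> carrier A" for r a
  proof -
    have "r \<otimes>\<^bsub>R\<^esub> (c \<odot>\<^bsub>R\<^esub> \<one>\<^bsub>R\<^esub>) = c \<odot>\<^bsub>R\<^esub> r" using that by (simp add: R.smult_mult_right)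
    then show ?thesis using that act_smult[of r a c] by (simp flip: act_assoc)
  qed
  show ?thesis
    unfolding act_scalar[OF zc(1)]
  proof (rule A.coords_eqI)
    fix \<alpha>
    show "\<phi> (zeta (c \<odot>\<^bsub>T\<^esub> z) f) \<alpha> = \<phi> (c \<odot>\<^bsub>A\<^esub> zeta z f) \<alpha>"
      using v zc assms(1) by (simp add: coord_zeta[OF cz assms(2)] coord_zeta[OF assms] A.coords_smult comp
          cent comp_closed act_closed sum_distrib_left)
  qed (use zc in simp_all)
qed

lemma zeta_cocycle_iff:
  assumes "z \<in> carrier (koszul N q m)"
  shows "is_cocycle R K dK AM m (zeta z) \<longleftrightarrow> z \<in> kcoc m"
proof -
  have zT: "z \<in> carrier T" using assms by (simp add: koszul_carrier supported_def)
  have z0: "zeta \<zero>\<^bsub>T\<^esub> f = \<zero>\<^bsub>A\<^esub>" if "f \<in> carrier (K n)" for f n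
    using zeta_smult[OF T.zero_closed that, of 0] is_homD(1)[OF zeta_hom[OF T.zero_closed] that]
    by (simp add: act_zero_left)
  have zc: "\<zero>\<^bsub>T\<^esub> \<in> carrier (koszul N q (Suc m))" by (simp add: koszul_carrier supported_def)
  have "is_cocycle R K dK AM m (zeta z) \<longleftrightarrow> (\<forall>f\<in>carrier (K (Suc m)). zeta (dd z) f = \<zero>\<^bsub>A\<^esub>)"
    using zeta_hom[OF zT] zeta_dd[OF assms] by (simp add: is_cocycle_def del: free_module_simps)
  also have "\<dots> \<longleftrightarrow> dd z = \<zero>\<^bsub>T\<^esub>"
    using zeta_inject[OF dd_koszul[OF assms] zc] z0 by metis
  finally show ?thesis using assms by (simp add: cocycles_def)
qed

text \<open>A primitive of \<open>zeta z\<close> is itself of the form \<open>zeta y\<close> by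
  surjectivity, and \<open>zeta_dd\<close> with injectivity turns the equation into z = d y. In
  degree 0 both notions of coboundary mean 0.\<close>

lemma zeta_coboundary:
  assumes z: "z \<in> carrier (koszul N q m)" and "is_coboundary R K dK AM m (zeta z)"
  shows "z \<in> kcob m"
proof (cases m)
  case 0
  have "\<zero>\<^bsub>T\<^esub> \<in> carrier (koszul N q 0)" by (simp add: koszul_carrier supported_def)
  moreover have "zeta \<zero>\<^bsub>T\<^esub> f = \<zero>\<^bsub>A\<^esub>" if "f \<in> carrier (K 0)" for f
    using zeta_smult[OF T.zero_closed that, of 0] is_homD(1)[OF zeta_hom[OF T.zero_closed] that]
    by (simp add: act_zero_left)
  ultimately have "z = \<zero>\<^bsub>T\<^esub>"
    using assms 0 by (intro zeta_inject[of z 0]) (simp_all add: is_coboundary_def del: free_module_simps)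
  then show ?thesis using 0 by (simp add: coboundaries_def)
next
  case (Suc n)
  obtain g where g: "is_hom R (K n) AM g" "\<And>f. f \<in> carrier (K (Suc n)) \<Longrightarrow> zeta z f = g (dK n f)"
    using assms(2) Suc by (auto simp: is_coboundary_def simp del: free_module_simps)
  obtain y where y: "y \<in> carrier (koszul N q n)" "\<And>f. f \<in> carrier (K n) \<Longrightarrow> g f = zeta y f"
    using zeta_surject[OF g(1)] by blast
  have "z = dd y"
  proof (rule zeta_inject[of _ m])
    fix f assume "f \<in> carrier (K m)"
    then have f: "f \<in> carrier (K (Suc n))" using Suc by simp
    show "zeta z f = zeta (dd y) f"
      unfolding g(2)[OF f] y(2)[OF is_homD(1)[OF dK_hom f]] zeta_dd[OF y(1) f] ..
  qed (use z dd_koszul[OF y(1)] Suc in auto)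
  then show ?thesis using y(1) Suc by (auto simp: coboundaries_def)
qed

lemma zeta_cong_cocycle:
  assumes "is_cocycle R K dK AM m t" "\<And>f. f \<in> carrier (K m) \<Longrightarrow> t f = zeta y f" "y \<in> carrier T"
  shows "is_cocycle R K dK AM m (zeta y)"
  using assms zeta_hom[OF assms(3)] is_homD(1)[OF dK_hom[of m]]
  by (simp add: is_cocycle_def del: free_module_simps)

lemma projective_resolution_resolution:
  fixes P :: "nat \<Rightarrow> ('k SW, 'p) module"
  assumes "bimodule_resolution A P dP \<epsilon>"
  shows "\<exists>I :: nat \<Rightarrow> 'p set. resolution R AM P dP \<epsilon> I"
proof -
  have P: "projective_resolution R AM P dP \<epsilon>" using assms by (simp add: bimodule_resolution_def)
  then have "\<exists>I :: 'p set. free_retract R (P n) I" for n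
    by (simp add: projective_resolution_def projective_module_def free_retract_def)
  then obtain I :: "nat \<Rightarrow> 'p set" where I: "\<And>n. free_retract R (P n) (I n)" by metis
  have L: "lmod R (P n)" for n
    using P by (intro lmodI) (simp add: projective_resolution_def projective_module_def)
  have "resolution R AM P dP \<epsilon> I"
    using P by (intro resolution.intro AM_lmod L I)
      (auto simp: projective_resolution_def One_nat_def)
  then show ?thesis by blast
qed

text \<open>Injectivity and surjectivity modulo coboundaries are checked directly on the span, so
  that \<open>lin_iso_quotient\<close> applies to the Hom complex of P without composing two
  isomorphisms of cohomology.\<close>

theorem hochschild_comparison:
  fixes P :: "nat \<Rightarrow> ('k SW, 'p) module"
  assumes "bimodule_resolution A P dP \<epsilon>"
  shows "\<exists>\<Theta>. cochain_map (koszul N q) (\<lambda>_. dd) (HH_complex A P) (Hom_diff P dP) \<Theta> \<and>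
    (\<forall>m. lin_iso (HH_span N q m) (HH A P dP m)
      (\<lambda>z. coh_class (HH_complex A P) (Hom_diff P dP) m (\<Theta> m z)))"
proof -
  obtain I :: "nat \<Rightarrow> 'p set" where res: "resolution R AM P dP \<epsilon> I"
    using projective_resolution_resolution[OF assms] by blast
  interpret PK: two_resolutions R AM P dP \<epsilon> I K dK eK B
    using res koszul_resolution by (rule two_resolutions.intro)
  obtain f where f: "\<And>n. is_hom R (P n) (K n) (f n)"
    and fd: "\<And>n x. x \<in> carrier (P (Suc n)) \<Longrightarrow> dK n (f (Suc n) x) = f n (dP n x)"
    and f_inj: "\<And>m z. is_cocycle R K dK AM m z \<Longrightarrow> is_coboundary R P dP AM m (\<lambda>x. z (f m x)) \<Longrightarrow>
        is_coboundary R K dK AM m z"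
    and f_surj: "\<And>m t. is_cocycle R P dP AM m t \<Longrightarrow> \<exists>z. is_cocycle R K dK AM m z \<and>
        is_coboundary R P dP AM m (\<lambda>x. t x \<ominus>\<^bsub>AM\<^esub> z (f m x))"
    using PK.comparison[OF AM_lmod] by blast
  note fc = is_homD(1)[OF f]
  let ?H = "\<lambda>n. Hom_space R (P n) AM"
  let ?d = "Hom_diff P dP"
  have HH: "HH_complex A P = ?H" by (simp add: HH_complex_def fun_eq_iff)
  \<comment> \<open>A cochain becomes a homomorphism on K by \<open>zeta\<close> and is pulled back
    to P along the comparison map f; \<open>restrict\<close> makes it an element of
    \<open>Hom_space\<close>.\<close>
  define \<Theta> where "\<Theta> m z = (\<lambda>x\<in>carrier (P m). zeta z (f m x))" for m z
  have kT: "carrier (koszul N q n) \<subseteq> carrier T" for n by (auto simp: koszul_carrier supported_def)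
  note Hv = Hom_space_vsp[OF R.kalg_axioms PK.P.lmod_P AM_lmod]
  have \<Theta>_closed: "\<Theta> m z \<in> carrier (?H m)" if "z \<in> carrier T" for m z
    using is_hom_comp[OF f zeta_hom[OF that]] by (simp add: \<Theta>_def is_hom_restrict[OF PK.P.lmod_P])
  have \<Theta>_hom: "is_hom scalars (koszul N q m) (?H m) (\<Theta> m)" for m
  proof (rule is_homI)
    fix z assume "z \<in> carrier (koszul N q m)"
    then show "\<Theta> m z \<in> carrier (?H m)" using kT by (intro \<Theta>_closed) blast
  next
    fix z w assume "z \<in> carrier (koszul N q m)" "w \<in> carrier (koszul N q m)"
    then have "z \<in> carrier T" "w \<in> carrier T" using kT by auto
    then show "\<Theta> m (z \<oplus>\<^bsub>koszul N q m\<^esub> w) = \<Theta> m z \<oplus>\<^bsub>?H m\<^esub> \<Theta> m w"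
      using zeta_add[OF _ _ fc] by (auto simp: \<Theta>_def simp del: free_module_simps intro!: restrict_ext)
  next
    fix c z assume "z \<in> carrier (koszul N q m)"
    then have "z \<in> carrier T" using kT by auto
    then show "\<Theta> m (c \<odot>\<^bsub>koszul N q m\<^esub> z) = c \<odot>\<^bsub>?H m\<^esub> \<Theta> m z"
      using zeta_smult[OF _ fc] by (auto simp: \<Theta>_def simp del: free_module_simps intro!: restrict_ext)
  qed
  have \<Theta>_d: "\<Theta> (Suc m) (dd z) = ?d m (\<Theta> m z)" if z: "z \<in> carrier (koszul N q m)" for m z
    using zeta_dd[OF z fc] fd PK.P.d_closed
    by (auto simp: \<Theta>_def Hom_diff_def simp del: free_module_simps intro!: restrict_ext)
  have d_hom: "is_hom scalars (?H n) (?H (Suc n)) (?d n)" for n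
  proof (rule is_homI)
    fix t assume "t \<in> carrier (?H n)"
    then have "is_hom R (P (Suc n)) AM (\<lambda>x. t (dP n x))" by (intro is_hom_comp[OF PK.P.d_hom]) simp
    then show "?d n t \<in> carrier (?H (Suc n))" by (simp add: Hom_diff_def is_hom_restrict[OF PK.P.lmod_P])
  qed (auto simp: Hom_diff_def PK.P.d_closed intro!: restrict_ext)
  let ?Z = "cocycles ?H ?d" and ?W = "coboundaries ?H ?d"
  have Z: "submodule (?Z m) (scalars :: 'k ring) (?H m)" for m
    unfolding cocycles_def by (rule kernel_submodule[OF Hv(1) Hv(1) d_hom])
  have W: "submodule (?W m) (scalars :: 'k ring) (?H m)" for m
  proof (cases m)
    case 0
    interpret H: vsp "?H 0" by (rule Hv(1))
    show ?thesis unfolding 0 coboundaries_def H.submodule_iff by (simp del: Hom_space_simps)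
  next
    case (Suc n)
    show ?thesis unfolding Suc coboundaries_def using image_submodule[OF Hv(1) Hv(1) d_hom[of n]] by simp
  qed
  have W_iff: "t \<in> ?W m \<longleftrightarrow> is_coboundary R P dP AM m t" if "t \<in> carrier (?H m)" for t m
    using that by (intro Hom_coboundaries_iff[where P = P, OF PK.P.lmod_P PK.P.d_hom]) simp_all
  have WZ: "?W m \<subseteq> ?Z m" for m
  proof (cases m)
    case 0
    interpret H: vsp "?H 0" by (rule Hv(1))
    show ?thesis using vsp.submodule_zero[OF Hv(1) Z[of 0]] 0 by (simp add: coboundaries_def)
  next
    case (Suc n)
    have "?d (Suc n) (?d n t) = \<zero>\<^bsub>?H (Suc (Suc n))\<^esub>" if t: "t \<in> carrier (?H n)" for t
      using is_hom_zero[OF _ PK.P.lmod_P AM_lmod, of n t] t PK.P.d_d PK.P.d_closed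
      by (auto simp: Hom_diff_def intro!: restrict_ext)
    then show ?thesis using Suc is_homD(1)[OF d_hom]
      by (auto simp: coboundaries_def cocycles_def simp del: Hom_space_simps)
  qed
  \<comment> \<open>\<open>is_coboundary\<close> sees values on the carrier only, so
    \<open>restrict\<close> may be dropped.\<close>
  have cob_cong: "is_coboundary R P dP AM m t \<longleftrightarrow> is_coboundary R P dP AM m u"
    if "\<And>x. x \<in> carrier (P m) \<Longrightarrow> t x = u x" for m t u
    using that by (cases m) (simp_all add: is_coboundary_def)
  have iso: "lin_iso (HH_span N q m) (quotient ((?H m)\<lparr>carrier := ?Z m\<rparr>) (?W m)) (\<lambda>z. ?W m +>\<^bsub>?H m\<^esub> \<Theta> m z)" for m
  proof (rule lin_iso_quotient[OF HH_span_vsp Hv(1) Z W WZ])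
    interpret H: vsp "?H m" by (rule Hv(1))
    have HC: "carrier (HH_span N q m) \<subseteq> carrier (koszul N q m)"
      using HH_span_kcoc[of m] by (auto simp: kcoc_iff)
    note h = is_hom_scalarsD[OF \<Theta>_hom[of m]]
    show "is_hom scalars (HH_span N q m) (?H m) (\<Theta> m)"
      using HC h by (intro is_homI) (simp_all add: subset_iff del: Hom_space_simps)
    have kZ: "\<Theta> m z \<in> ?Z m" if "z \<in> kcoc m" for z
    proof -
      have z: "z \<in> carrier (koszul N q m)" "dd z = \<zero>\<^bsub>T\<^esub>" using that by (auto simp: cocycles_def)
      have "?d m (\<Theta> m z) = \<Theta> (Suc m) \<zero>\<^bsub>T\<^esub>" using \<Theta>_d[OF z(1)] z(2) by simp
      also have "\<dots> = \<zero>\<^bsub>?H (Suc m)\<^esub>"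
      proof -
        interpret H': vsp "?H (Suc m)" by (rule Hv(1))
        have "\<zero>\<^bsub>T\<^esub> \<in> carrier (koszul N q (Suc m))" by (simp add: koszul_carrier supported_def)
        then show ?thesis
          using is_hom_scalarsD(1,3)[OF \<Theta>_hom[of "Suc m"], of "\<zero>\<^bsub>T\<^esub>"]
          by (metis H'.smult_zero_left T.smult_zero_right koszul_simps(3))
      qed
      finally show ?thesis using h(1)[OF z(1)] by (simp add: cocycles_def del: Hom_space_simps)
    qed
    then show "\<Theta> m z \<in> ?Z m" if "z \<in> carrier (HH_span N q m)" for z using that HH_span_kcoc by blast
    show "z = \<zero>\<^bsub>HH_span N q m\<^esub>" if z: "z \<in> carrier (HH_span N q m)" and "\<Theta> m z \<in> ?W m" for z
    proof -
      have zk: "z \<in> kcoc m" "z \<in> carrier (koszul N q m)" using z HH_span_kcoc HC by auto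
      have "is_coboundary R P dP AM m (\<Theta> m z)" using that(2) W_iff[OF h(1)[OF zk(2)]] by blast
      then have "is_coboundary R P dP AM m (\<lambda>x. zeta z (f m x))"
        by (subst cob_cong[of m _ "\<Theta> m z"]) (simp_all add: \<Theta>_def)
      then have "is_coboundary R K dK AM m (zeta z)"
        using zeta_cocycle_iff[OF zk(2)] zk(1) by (intro f_inj) blast+
      then have "z \<in> kcob m" by (rule zeta_coboundary[OF zk(2)])
      then show ?thesis using HH_span_kcob[OF z] by simp
    qed
    \<comment> \<open>Surjectivity: t is cohomologous to the pullback of a Koszul cocycle y, and y
      to an element v of the span; the two differences add up to t - \<Theta> v.\<close>
    fix t assume t: "t \<in> ?Z m"
    then have tH: "t \<in> carrier (?H m)" and "is_cocycle R P dP AM m t"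
      using Hom_cocycles_iff[where P = P, OF PK.P.lmod_P, of t AM dP m] by (auto simp: cocycles_def)
    then obtain u where u: "is_cocycle R K dK AM m u"
      "is_coboundary R P dP AM m (\<lambda>x. t x \<ominus>\<^bsub>AM\<^esub> u (f m x))" using f_surj by blast
    obtain y where y: "y \<in> carrier (koszul N q m)" "\<And>g. g \<in> carrier (K m) \<Longrightarrow> u g = zeta y g"
      using zeta_surject[of m u] u(1) unfolding is_cocycle_def by blast
    have yT: "y \<in> carrier T" using y(1) kT by blast
    have yk: "y \<in> kcoc m"
      using zeta_cong_cocycle[OF u(1) y(2) yT] zeta_cocycle_iff[OF y(1)] by blast
    obtain v where v: "v \<in> carrier (HH_span N q m)" "y \<ominus>\<^bsub>T\<^esub> v \<in> kcob m"
      using kcoc_HH_span[OF yk] by blast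
    have vk: "v \<in> carrier (koszul N q m)" using v(1) HC by blast
    note c = tH h(1)[OF y(1)] h(1)[OF vk]
    have "t \<ominus>\<^bsub>?H m\<^esub> \<Theta> m y \<in> ?W m"
    proof -
      have "(t \<ominus>\<^bsub>?H m\<^esub> \<Theta> m y) x = t x \<ominus>\<^bsub>AM\<^esub> u (f m x)" if "x \<in> carrier (P m)" for x
        using Hv(2)[OF c(1,2) that] y(2)[OF fc[OF that]] that by (simp add: \<Theta>_def)
      then show ?thesis
        unfolding W_iff[OF H.minus_closed[OF c(1,2)]] using u(2) by (subst cob_cong)
    qed
    moreover have "\<Theta> m y \<ominus>\<^bsub>?H m\<^esub> \<Theta> m v \<in> ?W m"
    proof -
      interpret C: vsp "koszul N q m" by (rule koszul_vsp)
      have "\<Theta> m y \<ominus>\<^bsub>?H m\<^esub> \<Theta> m v = \<Theta> m (y \<ominus>\<^bsub>koszul N q m\<^esub> v)"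
        unfolding C.minus_eq H.minus_eq C.smult_minus_one[OF vk, symmetric] H.smult_minus_one[OF c(3), symmetric]
          h(2)[OF y(1) C.smult_closed[OF vk]] h(3)[OF vk] ..
      also have "y \<ominus>\<^bsub>koszul N q m\<^esub> v = y \<ominus>\<^bsub>T\<^esub> v" by (rule koszul_minus[OF y(1) vk])
      finally have eq: "\<Theta> m y \<ominus>\<^bsub>?H m\<^esub> \<Theta> m v = \<Theta> m (y \<ominus>\<^bsub>T\<^esub> v)" .
      show ?thesis
      proof (cases m)
        case 0
        have "y \<ominus>\<^bsub>T\<^esub> v = \<zero>\<^bsub>T\<^esub>" using v(2) 0 by (simp add: coboundaries_def)
        moreover have "\<Theta> m \<zero>\<^bsub>T\<^esub> = \<zero>\<^bsub>?H m\<^esub>"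
          using h(3)[OF C.zero_closed, of 0] h(1)[OF C.zero_closed] by (simp del: Hom_space_simps)
        ultimately show ?thesis using eq 0 by (simp add: coboundaries_def del: Hom_space_simps)
      next
        case (Suc n)
        then obtain w where w: "w \<in> carrier (koszul N q n)" "y \<ominus>\<^bsub>T\<^esub> v = dd w"
          using v(2) by (auto simp: coboundaries_def)
        have "\<Theta> m (y \<ominus>\<^bsub>T\<^esub> v) = ?d n (\<Theta> n w)" using \<Theta>_d[OF w(1)] w(2) Suc by simp
        then show ?thesis
          using eq is_homD(1)[OF \<Theta>_hom w(1)] Suc by (simp add: coboundaries_def del: Hom_space_simps)
      qed
    qed
    ultimately have "t \<ominus>\<^bsub>?H m\<^esub> \<Theta> m v \<in> ?W m"
      using H.submodule_add[OF W] H.minus_chain[OF c] by metis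
    then show "\<exists>v\<in>carrier (HH_span N q m). t \<ominus>\<^bsub>?H m\<^esub> \<Theta> m v \<in> ?W m" using v(1) by blast
  qed
  show ?thesis
  proof (intro exI[of _ \<Theta>] conjI allI)
    show "cochain_map (koszul N q) (\<lambda>_. dd) (HH_complex A P) ?d \<Theta>"
      unfolding HH cochain_map_def using \<Theta>_hom \<Theta>_d by blast
    show "lin_iso (HH_span N q m) (HH A P dP m) (\<lambda>z. coh_class (HH_complex A P) ?d m (\<Theta> m z))" for m
      using iso[of m] unfolding HH HH_def Ext_def cohomology_def coh_class_def .
  qed
qed

end

text \<open>Independence expresses that the sum of the lines is direct. The second part fixes which
  classes the monomials denote, and the third carries them into \<open>HH\<close> by a map of
  complexes, which says more than an abstract isomorphism.\<close>

theorem corollary4p3: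
  fixes N :: nat
    and q :: "nat \<Rightarrow> nat \<Rightarrow> 'k::field_char_0"
    and P :: "nat \<Rightarrow> (((nat list \<Rightarrow> 'k) set \<times> (nat list \<Rightarrow> 'k) set \<Rightarrow> 'k) set, 'p) module"
    and dP :: "nat \<Rightarrow> 'p \<Rightarrow> 'p"
    and \<epsilon> :: "'p \<Rightarrow> (nat list \<Rightarrow> 'k) set"
  assumes "N \<ge> 1"
    and "quantum_params N q"
    and "bimodule_resolution (S_alg N q) P dP \<epsilon>"
  shows
    "(\<forall>m. lin_indep_family (S_wedge N q) (HH_index N q m) (HH_monomial N q)) \<and>
     (\<forall>m. lin_iso (HH_span N q m) (cohomology (koszul N q) (\<lambda>_. koszul_diff N q) m)
            (coh_class (koszul N q) (\<lambda>_. koszul_diff N q) m)) \<and>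
     (\<exists>\<Theta>. cochain_map (koszul N q) (\<lambda>_. koszul_diff N q)
              (HH_complex (S_alg N q) P) (Hom_diff P dP) \<Theta> \<and>
          (\<forall>m. lin_iso (HH_span N q m) (HH (S_alg N q) P dP m)
                 (\<lambda>z. coh_class (HH_complex (S_alg N q) P) (Hom_diff P dP) m (\<Theta> m z))))"
proof -
  interpret qsym N q by unfold_locales fact
  show ?thesis
    using HH_independent koszul_cohomology hochschild_comparison[OF assms(3)] by blast
qed

end
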